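(* Let $\Omega=\mathbb R^2\times(0,1)$ and let $n\ge3$ be an integer. There is a constant $C>0$ such that for every sufficiently smooth vector field $\mathbf w=(w_1,w_2,w_3)$ on $\Omega$ (with $\mathbf w\in H^{2n}(\Omega)$), with $\mathbf W:=\nabla\times\mathbf w$ and Helmholtz decomposition $\mathbf W=\mathcal P\mathbf W+\nabla\phi$, and for $\nabla_h$ denoting either $\partial_1$ or $\partial_2$, the following hold for any $\sigma>0$: $$\|\nabla_h\phi\|_{0,2n-1}^2\le C\Big(\|\partial_3\phi\|_{0,2n-1}^2+\sigma\|\mathbf W\|_{0,2n-1}^2+\|\mathbf w\|_0\|\mathbf w\|_1\Big),$$ and, more generally, for all integers $0\le k\le2n-1$ and $0\le\lambda\le2n-k-1$, $$\|\nabla_h\phi\|_{k,\lambda}^2\le C\Big(\|\partial_3\phi\|_{k,\lambda}^2+\sigma\|\mathbf W\|_{0,k+\lambda}^2+\|\mathbf w\|_0\|\mathbf w\|_1\Big).$$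
   Context: $\|\cdot\|_k$ is the norm of $H^k(\Omega)=W^{k,2}(\Omega)$, and $\|f\|_{k,l}^2:=\sum_{\alpha_1+\alpha_2\le l}\|\partial_1^{\alpha_1}\partial_2^{\alpha_2}f\|_k^2$. $\mathcal P$ is the Helmholtz projection, i.e. the orthogonal projection of $L^2(\Omega;\mathbb R^3)$ onto $\{\mathbf v\in L^2:\operatorname{div}\mathbf v=0\text{ in }\Omega,\ \mathbf v\cdot\mathbf n=0\text{ on }\partial\Omega\}$. In the decomposition $\mathbf W=\mathcal P\mathbf W+\nabla\phi$ both parts lie in $L^2(\Omega)$, and $\phi$ solves $\Delta\phi=0$ in $\Omega$, $\partial_3\phi=\partial_1w_2-\partial_2w_1$ on $x_3=0$ and $x_3=1$. *)

theory Defs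
  imports "HOL-Analysis.Analysis"
begin

definition slab :: "(real^3) set" where
  "slab = {x. 0 < x $ 3 \<and> x $ 3 < 1}"

subsection \<open>Test functions\<close>

definition pderiv_dir :: "3 \<Rightarrow> (real^3 \<Rightarrow> real) \<Rightarrow> real^3 \<Rightarrow> real" where
  "pderiv_dir i f = (\<lambda>x. frechet_derivative f (at x) (axis i 1))"

definition smooth_fun :: "(real^3 \<Rightarrow> real) \<Rightarrow> bool" where
  "smooth_fun f \<longleftrightarrow> (\<forall>is. foldr pderiv_dir is f differentiable_on UNIV)"

definition test_fun :: "(real^3) set \<Rightarrow> (real^3 \<Rightarrow> real) set" where
  "test_fun S = {\<psi>. smooth_fun \<psi> \<and> compact (closure {x. \<psi> x \<noteq> 0}) \<and> closure {x. \<psi> x \<noteq> 0} \<subseteq> S}"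

definition grad :: "(real^3 \<Rightarrow> real) \<Rightarrow> real^3 \<Rightarrow> real^3" where
  "grad \<psi> x = (\<chi> i. pderiv_dir i \<psi> x)"

subsection \<open>Weak derivatives and Sobolev norms on the slab\<close>

type_synonym multi_index = "nat^3"

definition mi_order :: "multi_index \<Rightarrow> nat" where
  "mi_order \<alpha> = (\<Sum>i\<in>UNIV. \<alpha> $ i)"

definition mpderiv :: "multi_index \<Rightarrow> (real^3 \<Rightarrow> real) \<Rightarrow> real^3 \<Rightarrow> real" where
  "mpderiv \<alpha> = (pderiv_dir 1 ^^ (\<alpha> $ 1)) \<circ> (pderiv_dir 2 ^^ (\<alpha> $ 2)) \<circ> (pderiv_dir 3 ^^ (\<alpha> $ 3))"

definition loc_integrable :: "(real^3 \<Rightarrow> 'b::euclidean_space) \<Rightarrow> bool" where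
  "loc_integrable f \<longleftrightarrow> (\<forall>K. compact K \<longrightarrow> K \<subseteq> slab \<longrightarrow> integrable (lebesgue_on K) f)"

definition has_weak_pderiv ::
    "multi_index \<Rightarrow> (real^3 \<Rightarrow> 'b::euclidean_space) \<Rightarrow> (real^3 \<Rightarrow> 'b) \<Rightarrow> bool" where
  "has_weak_pderiv \<alpha> f g \<longleftrightarrow> loc_integrable f \<and> loc_integrable g \<and>
     (\<forall>\<psi>\<in>test_fun slab.
        (LINT x|lebesgue_on slab. mpderiv \<alpha> \<psi> x *\<^sub>R f x) =
        (-1) ^ mi_order \<alpha> *\<^sub>R (LINT x|lebesgue_on slab. \<psi> x *\<^sub>R g x))"

(* A representative of the weak derivative, which is unique up to null sets of the slab;
   arbitrary if the weak derivative does not exist. *)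
definition weak_pderiv ::
    "multi_index \<Rightarrow> (real^3 \<Rightarrow> 'b::euclidean_space) \<Rightarrow> real^3 \<Rightarrow> 'b" where
  "weak_pderiv \<alpha> f = (SOME g. has_weak_pderiv \<alpha> f g)"

abbreviation weak_partial ::
    "3 \<Rightarrow> (real^3 \<Rightarrow> 'b::euclidean_space) \<Rightarrow> real^3 \<Rightarrow> 'b" where
  "weak_partial i \<equiv> weak_pderiv (axis i 1)"

definition L2_slab :: "(real^3 \<Rightarrow> 'b::euclidean_space) set" where
  "L2_slab = {f. f \<in> borel_measurable (lebesgue_on slab) \<and>
                 integrable (lebesgue_on slab) (\<lambda>x. (norm (f x))\<^sup>2)}"

definition Sobolev_space :: "nat \<Rightarrow> (real^3 \<Rightarrow> 'b::euclidean_space) set" where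
  "Sobolev_space k = {f. f \<in> L2_slab \<and>
     (\<forall>\<alpha>. mi_order \<alpha> \<le> k \<longrightarrow> (\<exists>g\<in>L2_slab. has_weak_pderiv \<alpha> f g))}"

(* Norms are extended by the value \<infinity> to functions outside the corresponding space, so an
   estimate between norms also carries the finiteness information. *)
definition Sobolev_norm :: "nat \<Rightarrow> (real^3 \<Rightarrow> 'b::euclidean_space) \<Rightarrow> ennreal" where
  "Sobolev_norm k f =
     (if f \<in> Sobolev_space k
      then ennreal (sqrt (\<Sum>\<alpha> | mi_order \<alpha> \<le> k. LINT x|lebesgue_on slab. (norm (weak_pderiv \<alpha> f x))\<^sup>2))
      else \<infinity>)"

definition horizontal_indices :: "nat \<Rightarrow> multi_index set" where
  "horizontal_indices l = {\<alpha>. \<alpha> $ 3 = 0 \<and> \<alpha> $ 1 + \<alpha> $ 2 \<le> l}"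

definition aniso_norm_sq :: "nat \<Rightarrow> nat \<Rightarrow> (real^3 \<Rightarrow> 'b::euclidean_space) \<Rightarrow> ennreal" where
  "aniso_norm_sq k l f =
     (if \<forall>\<alpha>\<in>horizontal_indices l. \<exists>g. has_weak_pderiv \<alpha> f g
      then \<Sum>\<alpha>\<in>horizontal_indices l. (Sobolev_norm k (weak_pderiv \<alpha> f))\<^sup>2
      else \<infinity>)"

subsection \<open>Curl and Helmholtz decomposition\<close>

definition weak_curl :: "(real^3 \<Rightarrow> real^3) \<Rightarrow> real^3 \<Rightarrow> real^3" where
  "weak_curl w x = vector
     [weak_partial 2 (\<lambda>y. w y $ 3) x - weak_partial 3 (\<lambda>y. w y $ 2) x,
      weak_partial 3 (\<lambda>y. w y $ 1) x - weak_partial 1 (\<lambda>y. w y $ 3) x,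
      weak_partial 1 (\<lambda>y. w y $ 2) x - weak_partial 2 (\<lambda>y. w y $ 1) x]"

definition weakly_div_free :: "(real^3 \<Rightarrow> real^3) \<Rightarrow> bool" where
  "weakly_div_free v \<longleftrightarrow>
     (\<forall>\<psi>\<in>test_fun slab. (LINT x|lebesgue_on slab. v x \<bullet> grad \<psi> x) = 0)"

(* For div-free v in L2 the normal trace is defined through Green's formula by its action
   \<psi> \<mapsto> \<integral> v \<bullet> \<nabla>\<psi> on boundary values of functions \<psi>; here \<psi> need not vanish at the boundary. *)
definition zero_normal_trace :: "(real^3 \<Rightarrow> real^3) \<Rightarrow> bool" where
  "zero_normal_trace v \<longleftrightarrow>
     (\<forall>\<psi>\<in>test_fun UNIV. (LINT x|lebesgue_on slab. v x \<bullet> grad \<psi> x) = 0)"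

definition solenoidal :: "(real^3 \<Rightarrow> real^3) set" where
  "solenoidal = {v \<in> L2_slab. weakly_div_free v \<and> zero_normal_trace v}"

text \<open>\<open>v\<close> is (a representative of) the orthogonal projection of \<open>W\<close> onto the closed subspace
  \<^const>\<open>solenoidal\<close> of \<open>L\<^sup>2\<close>.\<close>

definition is_Helmholtz_projection :: "(real^3 \<Rightarrow> real^3) \<Rightarrow> (real^3 \<Rightarrow> real^3) \<Rightarrow> bool" where
  "is_Helmholtz_projection W v \<longleftrightarrow> W \<in> L2_slab \<and> v \<in> solenoidal \<and>
     (\<forall>u\<in>solenoidal. (LINT x|lebesgue_on slab. (W x - v x) \<bullet> u x) = 0)"

definition Helmholtz_decomposition ::
    "(real^3 \<Rightarrow> real^3) \<Rightarrow> (real^3 \<Rightarrow> real^3) \<Rightarrow> (real^3 \<Rightarrow> real) \<Rightarrow> bool" where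
  "Helmholtz_decomposition W v \<phi> \<longleftrightarrow> is_Helmholtz_projection W v \<and>
     (\<forall>i. has_weak_pderiv (axis i 1) \<phi> (\<lambda>x. (W x - v x) $ i))"

end

theory Submission
  imports Defs
begin

text \<open>The gradient \<open>\<nabla>\<phi> = W - PW\<close> is orthogonal to gradients of test functions, so \<open>\<phi>\<close> is harmonic by Weyl's
  lemma. On the slab, Hardy's inequality with the weight \<open>x\<^sub>3(1 - x\<^sub>3)\<close> followed by Caccioppoli's inequality
  for harmonic functions bounds \<open>\<partial>\<^sub>i\<partial>\<^sub>h\<phi>\<close> by \<open>\<partial>\<^sub>h\<phi>\<close> and \<open>\<partial>\<^sub>i\<partial>\<^sub>3\<phi>\<close>, without any boundary terms. By induction only
  \<open>\<partial>\<^sub>h\<phi>\<close> itself is left. It differs from its trace on the plane \<open>x\<^sub>3 = 1/2\<close> by a quantity bounded by \<open>\<partial>\<^sub>3\<phi>\<close>, again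
  by Hardy and Caccioppoli. The trace is tested with gradients of functions \<open>\<zeta>\<close> of the horizontal
  variables: since \<open>PW\<close> has no normal trace, \<open>\<integral>\<nabla>\<phi> \<bullet> \<nabla>\<zeta> = \<integral>W \<bullet> \<nabla>\<zeta>\<close>. As \<open>W\<close> is a curl, the contribution of
  the part of the slab at distance more than \<open>\<delta>\<close> from the boundary is of size \<open>\<delta>\<^sup>-\<^sup>1\<^sup>/\<^sup>2 \<parallel>w\<parallel>\<^sub>0\<close>, that of the rest is of
  size \<open>\<delta>\<^sup>1\<^sup>/\<^sup>2 \<parallel>w\<parallel>\<^sub>1\<close>, and the optimal \<open>\<delta>\<close> produces \<open>\<parallel>w\<parallel>\<^sub>0 \<parallel>w\<parallel>\<^sub>1\<close> after squaring.\<close>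

section \<open>Smooth functions\<close>

text \<open>Near the boundary only the square integrability of \<nabla>\<phi> is known, and the
  norms of its derivatives may be infinite. Hence the estimates for \<phi> are inequalities in
  \<open>ennreal\<close>, and the weighted ones are proved on boxes inside the slab, with polynomial
  multipliers adapted to the faces, and passed to the slab by Fatou's lemma. Hardy's inequality
  turns two weighted square integrals into an unweighted one, Caccioppoli's turns a weighted
  derivative into the function itself; composed, they lose nothing. One application of both costs 72
  * 3 + 8 * 3 = 240, the base of the final constant. The undifferentiated
  \<open>\<partial>\<^sub>h\<phi>\<close> is out of reach of this: a harmonic function that
  resembles \<open>x $ 1\<close> over a large region has \<open>\<partial>\<^sub>3\<phi>\<close>
  close to 0. There the curl structure has to enter. The trace potential has a square integrable
  gradient but need not be square integrable itself, so a constant depending on the size of the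
  cut-off is subtracted; the Poincare constant grows like n^2 and cancels against the square of the
  cut-off's gradient, of size n^(-2). What remains is a multiple of the trace energy, absorbed by
  Young's inequality with small weights.\<close>

abbreviation pd :: "3 \<Rightarrow> (real^3 \<Rightarrow> real) \<Rightarrow> real^3 \<Rightarrow> real" where "pd \<equiv> pderiv_dir"
abbreviation pds :: "3 list \<Rightarrow> (real^3 \<Rightarrow> real) \<Rightarrow> real^3 \<Rightarrow> real" where "pds \<equiv> foldr pderiv_dir"

text \<open>Words of partial derivatives instead of multi-indices make closure under
  \<open>pd\<close> immediate; that the order of letters is irrelevant is proved later, in
  \<open>pds_perm\<close>. Differentiability is required at the points of \<open>U\<close>, not
  within \<open>U\<close>, so the notion is local on open sets.\<close>

definition smooth_on :: "(real^3) set \<Rightarrow> (real^3 \<Rightarrow> real) \<Rightarrow> bool" where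
  "smooth_on U f \<longleftrightarrow> (\<forall>is. \<forall>x\<in>U. pds is f differentiable at x)"

lemma smooth_fun_iff: "smooth_fun f \<longleftrightarrow> smooth_on UNIV f"
  by (auto simp: smooth_fun_def smooth_on_def differentiable_on_def)

lemma smooth_on_differentiable: "smooth_on U f \<Longrightarrow> x \<in> U \<Longrightarrow> f differentiable at x"
  unfolding smooth_on_def by (drule spec[of _ "[]"]) simp

lemma smooth_on_pds: "smooth_on U f \<Longrightarrow> smooth_on U (pds is f)"
  unfolding smooth_on_def by (metis foldr_append comp_apply)

lemma smooth_on_pd: "smooth_on U f \<Longrightarrow> smooth_on U (pd i f)"
  using smooth_on_pds[of U f "[i]"] by simp

lemma smooth_on_subset: "smooth_on U f \<Longrightarrow> V \<subseteq> U \<Longrightarrow> smooth_on V f"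
  unfolding smooth_on_def by blast

lemma smooth_on_continuous: "smooth_on U f \<Longrightarrow> continuous_on U f"
  by (meson continuous_at_imp_continuous_on differentiable_imp_continuous_within smooth_on_differentiable)

lemma pd_eqI: "(f has_derivative f') (at x) \<Longrightarrow> pd i f x = f' (axis i 1)"
  unfolding pderiv_dir_def using frechet_derivative_at by metis

lemma pd_cong_open:
  assumes "open U" "x \<in> U" "\<And>y. y \<in> U \<Longrightarrow> f y = g y"
  shows "pd i f x = pd i g x"
proof -
  have "(f has_derivative f') (at x) \<longleftrightarrow> (g has_derivative f') (at x)" for f'
    using assms has_derivative_transform_within_open[of f f' x UNIV U g]
      has_derivative_transform_within_open[of g f' x UNIV U f] by auto
  then show ?thesis by (simp add: pderiv_dir_def frechet_derivative_def)
qed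

lemma differentiable_cong_open:
  assumes "open U" "x \<in> U" "\<And>y. y \<in> U \<Longrightarrow> f y = g y"
  shows "f differentiable at x \<longleftrightarrow> g differentiable at x"
proof -
  have "(f has_derivative f') (at x) \<longleftrightarrow> (g has_derivative f') (at x)" for f'
    using assms has_derivative_transform_within_open[of f f' x UNIV U g]
      has_derivative_transform_within_open[of g f' x UNIV U f] by auto
  then show ?thesis by (simp add: differentiable_def)
qed

lemma pds_cong_open:
  assumes "open U" "x \<in> U" "\<And>y. y \<in> U \<Longrightarrow> f y = g y"
  shows "pds is f x = pds is g x"
  using assms(2)
proof (induction "is" arbitrary: x)
  case (Cons i js)
  then show ?case using pd_cong_open[OF assms(1) Cons.prems, of "pds js f" "pds js g"] by simp
qed (use assms in auto)

lemma smooth_on_cong: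
  assumes "open U" "\<And>y. y \<in> U \<Longrightarrow> f y = g y"
  shows "smooth_on U f \<longleftrightarrow> smooth_on U g"
proof -
  have "pds is f differentiable at x \<longleftrightarrow> pds is g differentiable at x" if "x \<in> U" for x "is"
    by (rule differentiable_cong_open[OF assms(1) that]) (rule pds_cong_open[OF assms(1) _ assms(2)])
  then show ?thesis by (auto simp: smooth_on_def)
qed

lemma smooth_on_local:
  assumes "\<And>x. x \<in> U \<Longrightarrow> \<exists>V. open V \<and> x \<in> V \<and> smooth_on V f"
  shows "smooth_on U f"
  using assms unfolding smooth_on_def by blast

text \<open>By induction on the word, \<open>pds is f\<close> agrees on \<open>U\<close> with a
  member of \<open>X\<close>; openness of \<open>U\<close> carries differentiability and the next
  derivative across this agreement. For a whole family of functions only one derivative of a typical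
  member has to be computed.\<close>

lemma smooth_on_coinduct:
  assumes "open U" "X f"
    and step: "\<And>f. X f \<Longrightarrow> (\<forall>x\<in>U. f differentiable at x) \<and> (\<forall>i. \<exists>g. X g \<and> (\<forall>x\<in>U. pd i f x = g x))"
  shows "smooth_on U f"
proof -
  have "\<exists>g. X g \<and> (\<forall>x\<in>U. pds is f x = g x)" for "is"
  proof (induction "is")
    case (Cons i js)
    then obtain g where g: "X g" "\<forall>x\<in>U. pds js f x = g x" by blast
    then obtain g' where "X g'" "\<forall>x\<in>U. pd i g x = g' x" using step by meson
    then show ?case using pd_cong_open[OF assms(1), of _ "pds js f" g] g(2) by (auto intro!: exI[of _ g'])
  qed (use assms in auto)
  note g = this
  show ?thesis unfolding smooth_on_def
  proof (intro allI ballI)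
    fix "is" x assume x: "x \<in> U"
    obtain g where g: "X g" "\<forall>x\<in>U. pds is f x = g x" using g by blast
    then have "g differentiable at x" using step x by blast
    then show "pds is f differentiable at x"
      using differentiable_cong_open[OF assms(1) x, of "pds is f" g] g by auto
  qed
qed

lemma has_derivative_frechet: "f differentiable at x \<Longrightarrow> (f has_derivative frechet_derivative f (at x)) (at x)"
  using frechet_derivative_works by blast

lemma frechet_eq_sum_pd:
  assumes "f differentiable at x"
  shows "frechet_derivative f (at x) h = (\<Sum>i\<in>UNIV. h $ i * pd i f x)"
proof -
  interpret linear "frechet_derivative f (at x)" using assms by (rule linear_frechet_derivative)
  have "h = (\<Sum>i\<in>UNIV. h $ i *\<^sub>R axis i 1)" by (simp add: vec_eq_iff axis_def if_distrib cong: if_cong)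
  then have "frechet_derivative f (at x) h = frechet_derivative f (at x) (\<Sum>i\<in>UNIV. h $ i *\<^sub>R axis i 1)" by simp
  also have "\<dots> = (\<Sum>i\<in>UNIV. h $ i * pd i f x)" by (simp add: sum scale pderiv_dir_def)
  finally show ?thesis .
qed

lemma has_derivative_pd:
  assumes "f differentiable at x"
  shows "(f has_derivative (\<lambda>h. \<Sum>i\<in>UNIV. h $ i * pd i f x)) (at x)"
  using has_derivative_frechet[OF assms] unfolding frechet_eq_sum_pd[OF assms, abs_def] .

lemma pd_add: "f differentiable at x \<Longrightarrow> g differentiable at x \<Longrightarrow> pd i (\<lambda>x. f x + g x) x = pd i f x + pd i g x"
  by (rule pd_eqI[OF has_derivative_add[OF has_derivative_frechet has_derivative_frechet], THEN trans])
    (auto simp: pderiv_dir_def)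

lemma pd_diff: "f differentiable at x \<Longrightarrow> g differentiable at x \<Longrightarrow> pd i (\<lambda>x. f x - g x) x = pd i f x - pd i g x"
  by (rule pd_eqI[OF has_derivative_diff[OF has_derivative_frechet has_derivative_frechet], THEN trans])
    (auto simp: pderiv_dir_def)

lemma pd_mult: "f differentiable at x \<Longrightarrow> g differentiable at x \<Longrightarrow>
   pd i (\<lambda>x. f x * g x) x = f x * pd i g x + pd i f x * g x"
  by (rule pd_eqI[OF has_derivative_mult[OF has_derivative_frechet has_derivative_frechet], THEN trans])
    (auto simp: pderiv_dir_def)

lemma pd_const [simp]: "pd i (\<lambda>x. c) x = 0"
  by (rule pd_eqI[OF has_derivative_const, THEN trans]) simp

lemma pd_comp_real:
  assumes "(g has_real_derivative g') (at (f x))" "f differentiable at x"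
  shows "((\<lambda>x. g (f x)) has_derivative (\<lambda>h. frechet_derivative f (at x) h * g')) (at x)"
    and "pd i (\<lambda>x. g (f x)) x = g' * pd i f x"
proof -
  show 1: "((\<lambda>x. g (f x)) has_derivative (\<lambda>h. frechet_derivative f (at x) h * g')) (at x)"
    using DERIV_compose_FDERIV[OF assms(1) has_derivative_frechet[OF assms(2)]] .
  show "pd i (\<lambda>x. g (f x)) x = g' * pd i f x"
    using pd_eqI[OF 1] by (simp add: pderiv_dir_def)
qed

lemma pd_coord [simp]: "pd i (\<lambda>x. x $ j) x = (if i = j then 1 else 0)"
  by (rule pd_eqI[OF bounded_linear_imp_has_derivative[OF bounded_linear_vec_nth], THEN trans])
    (auto simp: axis_def)

lemma differentiable_coord [simp]: "(\<lambda>x::real^3. x $ j) differentiable at x"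
  using bounded_linear_imp_has_derivative[OF bounded_linear_vec_nth] differentiable_def by blast

section \<open>A function flat at the origin and closure properties of smooth functions\<close>

definition flat_exp :: "nat \<Rightarrow> real \<Rightarrow> real" where
  "flat_exp k t = (if t > 0 then exp (- 1 / t) / t ^ k else 0)"

lemma power_div_fact_le_exp: "x \<ge> 0 \<Longrightarrow> x ^ n / fact n \<le> exp (x::real)"
proof -
  assume "x \<ge> 0"
  then have "sum (\<lambda>n. x ^ n /\<^sub>R fact n) {n} \<le> (\<Sum>n. x ^ n /\<^sub>R fact n)"
    by (intro sum_le_suminf summable_exp_generic) auto
  then show ?thesis by (simp add: exp_def divide_inverse mult.commute)
qed

text \<open>One term of the exponential series at 1/t bounds exp(-1/t) by (k+2)! t^(k+2). Two powers
  more than \<open>k\<close> are kept so that the difference quotient at the origin tends to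
  0.\<close>

lemma flat_exp_le:
  assumes "t > 0" shows "flat_exp k t \<le> fact (k + 2) * t\<^sup>2"
proof -
  have "(1/t)^(k+2) / fact (k+2) \<le> exp (1/t)" using assms by (intro power_div_fact_le_exp) simp
  then have "1 \<le> exp (1/t) * (fact (k+2) * t^(k+2))" using assms
    by (simp add: field_simps power_divide del: fact_Suc)
  then have "exp (- (1/t)) * 1 \<le> exp (- (1/t)) * (exp (1/t) * (fact (k+2) * t^(k+2)))"
    by (intro mult_left_mono) auto
  also have "\<dots> = fact (k+2) * t^(k+2)" by (simp add: mult.assoc[symmetric] exp_minus del: fact_Suc)
  finally show ?thesis using assms by (simp add: flat_exp_def divide_le_eq power_add mult_ac power2_eq_square del: fact_Suc)
qed

lemma flat_exp_deriv: "(flat_exp k has_real_derivative flat_exp (k + 2) t - k * flat_exp (k + 1) t) (at t)"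
proof (cases t "0::real" rule: linorder_cases)
  case less
  have "((\<lambda>t. 0) has_real_derivative 0) (at t)" by simp
  then have "(flat_exp k has_real_derivative 0) (at t)"
    by (rule has_field_derivative_transform_within_open[where S="{..<0}"]) (use less in \<open>auto simp: flat_exp_def\<close>)
  then show ?thesis using less by (simp add: flat_exp_def)
next
  case greater
  \<comment> \<open>For k = 0 the exponent k - 1 is truncated to 0, but the factor k
    vanishes.\<close>
  have *: "real k * inverse t ^ (k - 1) * (inverse t)\<^sup>2 = k * inverse t ^ (k + 1)"
    by (cases k) (auto simp: power2_eq_square)
  have "((\<lambda>t. exp (- inverse t) * inverse t ^ k) has_real_derivative
     exp (- inverse t) * (inverse t)\<^sup>2 * inverse t ^ k - exp (- inverse t) * (real k * inverse t ^ (k - 1) * (inverse t)\<^sup>2)) (at t)"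
    using greater by (auto intro!: derivative_eq_intros simp: power2_eq_square algebra_simps)
  then have "((\<lambda>t. exp (- 1 / t) / t ^ k) has_real_derivative flat_exp (k + 2) t - k * flat_exp (k + 1) t) (at t)"
    unfolding * using greater by (simp add: flat_exp_def divide_inverse power_inverse power_add power2_eq_square mult_ac)
  then show ?thesis
    by (rule has_field_derivative_transform_within_open[where S="{0<..}"]) (use greater in \<open>auto simp: flat_exp_def\<close>)
next
  case equal
  have "((\<lambda>h. flat_exp k h / h) \<longlongrightarrow> 0) (at 0)"
  proof (rule Lim_null_comparison)
    have "\<bar>flat_exp k h / h\<bar> \<le> fact (k+2) * \<bar>h\<bar>" for h
    proof (cases "h > 0")
      case True
      then have "flat_exp k h \<ge> 0" by (simp add: flat_exp_def)
      then show ?thesis using flat_exp_le[OF True, of k] True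
        by (simp add: divide_le_eq power2_eq_square mult_ac del: fact_Suc)
    qed (use mult_nonneg_nonneg[OF fact_ge_zero abs_ge_zero, of "k+2" h] in \<open>simp add: flat_exp_def del: fact_Suc\<close>)
    then show "\<forall>\<^sub>F h in at 0. norm (flat_exp k h / h) \<le> fact (k+2) * \<bar>h\<bar>" by simp
    show "((\<lambda>h::real. fact (k+2) * \<bar>h\<bar>) \<longlongrightarrow> 0) (at 0)" by (auto intro!: tendsto_eq_intros)
  qed
  then show ?thesis using equal by (simp add: DERIV_def flat_exp_def)
qed

text \<open>The partial derivatives of such terms are again such terms, so their smoothness follows by coinduction.
  The family \<open>flat_exp\<close> is indexed by \<open>k\<close> to be closed under differentiation.\<close>

inductive smooth_term :: "(real^3) set \<Rightarrow> (real^3 \<Rightarrow> real) \<Rightarrow> bool" for U where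
  base: "smooth_on U f \<Longrightarrow> smooth_term U f"
| const: "smooth_term U (\<lambda>x. c)"
| coord: "smooth_term U (\<lambda>x. x $ j)"
| add: "smooth_term U f \<Longrightarrow> smooth_term U g \<Longrightarrow> smooth_term U (\<lambda>x. f x + g x)"
| mult: "smooth_term U f \<Longrightarrow> smooth_term U g \<Longrightarrow> smooth_term U (\<lambda>x. f x * g x)"
| flat: "smooth_term U f \<Longrightarrow> smooth_term U (\<lambda>x. flat_exp k (f x))"
| powr: "smooth_term U f \<Longrightarrow> (\<And>x. x \<in> U \<Longrightarrow> f x > 0) \<Longrightarrow> smooth_term U (\<lambda>x. f x powr a)"

lemma smooth_term_step:
  "smooth_term U f \<Longrightarrow> (\<forall>x\<in>U. f differentiable at x) \<and> (\<forall>i. \<exists>g. smooth_term U g \<and> (\<forall>x\<in>U. pd i f x = g x))"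
proof (induction rule: smooth_term.induct)
  case (base f)
  then show ?case using smooth_on_differentiable smooth_on_pd smooth_term.base by blast
next
  case (const c)
  then show ?case using smooth_term.const by fastforce
next
  case (coord j)
  then show ?case using smooth_term.const[of U 0] smooth_term.const[of U 1] by fastforce
next
  case (add f g)
  have "\<exists>h. smooth_term U h \<and> (\<forall>x\<in>U. pd i (\<lambda>x. f x + g x) x = h x)" for i
  proof -
    obtain f' g' where "smooth_term U f'" "\<forall>x\<in>U. pd i f x = f' x" "smooth_term U g'" "\<forall>x\<in>U. pd i g x = g' x"
      using add.IH by meson
    then show ?thesis using add.IH smooth_term.add[of U f' g'] pd_add[of f _ g i] by auto
  qed
  then show ?case using add.IH by auto
next
  case (mult f g)
  have "\<exists>h. smooth_term U h \<and> (\<forall>x\<in>U. pd i (\<lambda>x. f x * g x) x = h x)" for i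
  proof -
    obtain f' g' where fg: "smooth_term U f'" "\<forall>x\<in>U. pd i f x = f' x" "smooth_term U g'" "\<forall>x\<in>U. pd i g x = g' x"
      using mult.IH by meson
    have "smooth_term U (\<lambda>x. f x * g' x + f' x * g x)"
      using fg mult.hyps by (intro smooth_term.intros(2-))
    then show ?thesis using mult.IH fg pd_mult[of f _ g i] by (intro exI[of _ "\<lambda>x. f x * g' x + f' x * g x"]) auto
  qed
  then show ?case using mult.IH by auto
next
  case (flat f k)
  have "\<exists>h. smooth_term U h \<and> (\<forall>x\<in>U. pd i (\<lambda>x. flat_exp k (f x)) x = h x)" for i
  proof -
    obtain f' where fg: "smooth_term U f'" "\<forall>x\<in>U. pd i f x = f' x"
      using flat.IH by meson
    have "smooth_term U (\<lambda>x. (flat_exp (k + 2) (f x) + (- real k) * flat_exp (k + 1) (f x)) * f' x)"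
      using fg flat.hyps by (intro smooth_term.intros(2-))
    then show ?thesis using flat.IH fg pd_comp_real(2)[OF flat_exp_deriv]
      by (intro exI[of _ "\<lambda>x. (flat_exp (k + 2) (f x) + (- real k) * flat_exp (k + 1) (f x)) * f' x"]) auto
  qed
  then show ?case using flat.IH pd_comp_real(1)[OF flat_exp_deriv] differentiable_def by blast
next
  case (powr f a)
  have d: "((\<lambda>t. t powr a) has_real_derivative a * f x powr (a - 1)) (at (f x))" if "x \<in> U" for x
    using powr.hyps(2)[OF that] by (auto intro!: has_real_derivative_powr)
  have "\<exists>h. smooth_term U h \<and> (\<forall>x\<in>U. pd i (\<lambda>x. f x powr a) x = h x)" for i
  proof -
    obtain f' where fg: "smooth_term U f'" "\<forall>x\<in>U. pd i f x = f' x"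
      using powr.IH by meson
    have "smooth_term U (\<lambda>x. (a * f x powr (a - 1)) * f' x)"
      using fg powr.hyps by (intro smooth_term.intros(2-)) auto
    then show ?thesis using powr.IH fg pd_comp_real(2)[where g="\<lambda>t. t powr a" and f=f, OF d]
      by (intro exI[of _ "\<lambda>x. (a * f x powr (a - 1)) * f' x"]) auto
  qed
  moreover have "(\<lambda>x. f x powr a) differentiable at x" if "x \<in> U" for x
    using pd_comp_real(1)[where g="\<lambda>t. t powr a" and f=f, OF d[OF that]] powr.IH that differentiable_def by blast
  ultimately show ?case by blast
qed

text \<open>The constructor \<open>base\<close> puts every smooth function into the inductive class,
  and coinduction shows that nothing else lies in it. Each further constructor thereby becomes a
  closure rule for smooth functions.\<close>

lemma smooth_on_iff_term: "open U \<Longrightarrow> smooth_on U f \<longleftrightarrow> smooth_term U f"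
  using smooth_on_coinduct[of U "smooth_term U" f] smooth_term_step smooth_term.base by blast

context
  fixes U :: "(real^3) set"
  assumes U: "open U"
begin

lemma smooth_on_const: "smooth_on U (\<lambda>x. c)"
  using U smooth_on_iff_term smooth_term.const by blast

lemma smooth_on_coord: "smooth_on U (\<lambda>x. x $ j)"
  using U smooth_on_iff_term smooth_term.coord by blast

lemma smooth_on_add: "smooth_on U f \<Longrightarrow> smooth_on U g \<Longrightarrow> smooth_on U (\<lambda>x. f x + g x)"
  using U smooth_on_iff_term smooth_term.add by blast

lemma smooth_on_mult: "smooth_on U f \<Longrightarrow> smooth_on U g \<Longrightarrow> smooth_on U (\<lambda>x. f x * g x)"
  using U smooth_on_iff_term smooth_term.mult by blast

lemma smooth_on_diff: "smooth_on U f \<Longrightarrow> smooth_on U g \<Longrightarrow> smooth_on U (\<lambda>x. f x - g x)"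
  using smooth_on_add[of f "\<lambda>x. (-1) * g x"] smooth_on_mult[of "\<lambda>x. -1" g] smooth_on_const[of "-1"] by simp

lemma smooth_on_sum: "(\<And>i. i \<in> I \<Longrightarrow> smooth_on U (f i)) \<Longrightarrow> smooth_on U (\<lambda>x. \<Sum>i\<in>I. f i x)"
  by (induction I rule: infinite_finite_induct) (auto intro: smooth_on_const smooth_on_add)

lemma smooth_on_power: "smooth_on U f \<Longrightarrow> smooth_on U (\<lambda>x. f x ^ n)"
  by (induction n) (auto intro: smooth_on_const smooth_on_mult)

lemma smooth_on_flat_exp: "smooth_on U f \<Longrightarrow> smooth_on U (\<lambda>x. flat_exp k (f x))"
  using U smooth_on_iff_term smooth_term.flat by blast

lemma smooth_on_powr: "smooth_on U f \<Longrightarrow> (\<And>x. x \<in> U \<Longrightarrow> f x > 0) \<Longrightarrow> smooth_on U (\<lambda>x. f x powr a)"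
  using U smooth_on_iff_term smooth_term.powr by blast

end

lemmas smooth_on_intros = smooth_on_const smooth_on_coord smooth_on_add smooth_on_mult smooth_on_diff
  smooth_on_sum smooth_on_power smooth_on_flat_exp

lemma open_slab [simp]: "open slab"
  unfolding slab_def by (intro open_Collect_conj open_Collect_less continuous_intros)

section \<open>Smooth transition functions and affine substitutions\<close>

definition step_fun :: "real \<Rightarrow> real" where
  "step_fun t = flat_exp 0 t / (flat_exp 0 t + flat_exp 0 (1 - t))"

text \<open>At least one of t and 1 - t is positive, so this classical transition from 0 to 1 over
  the unit interval has no singularity.\<close>

lemma step_fun_den: "flat_exp 0 t + flat_exp 0 (1 - t) > 0"
  by (cases "t > 0") (auto simp: flat_exp_def add_pos_nonneg)

lemma step_fun_bounds: "0 \<le> step_fun t" "step_fun t \<le> 1"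
proof -
  have "flat_exp 0 t \<ge> 0" "flat_exp 0 (1 - t) \<ge> 0" by (simp_all add: flat_exp_def)
  then show "0 \<le> step_fun t" "step_fun t \<le> 1"
    using step_fun_den[of t] by (simp_all add: step_fun_def divide_le_eq)
qed

lemma step_fun_0: "t \<le> 0 \<Longrightarrow> step_fun t = 0"
  by (simp add: step_fun_def flat_exp_def)

lemma step_fun_1: "t \<ge> 1 \<Longrightarrow> step_fun t = 1"
  by (simp add: step_fun_def flat_exp_def)

lemma smooth_on_step_fun:
  assumes "open U" "smooth_on U f" shows "smooth_on U (\<lambda>x. step_fun (f x))"
proof -
  \<comment> \<open>Division enters the calculus of smooth terms as the power -1, admissible because
    the denominator is positive.\<close>
  have "smooth_on U (\<lambda>x. flat_exp 0 (f x) * (flat_exp 0 (f x) + flat_exp 0 (1 - f x)) powr (-1))"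
    using assms step_fun_den by (intro smooth_on_intros smooth_on_powr) auto
  moreover have "flat_exp 0 t * (flat_exp 0 t + flat_exp 0 (1 - t)) powr (-1) = step_fun t" for t
    using step_fun_den[of t] by (simp add: step_fun_def powr_minus_divide)
  ultimately show ?thesis by simp
qed

text \<open>\<open>smooth_on\<close> concerns functions on \<open>real^3\<close>. The cut-offs are
  functions of single coordinates, and bounding their derivatives needs a continuous derivative on
  the line, so the quotient rule is applied directly.\<close>

lemma step_fun_deriv: "\<exists>D. continuous_on UNIV D \<and> (\<forall>t. (step_fun has_real_derivative D t) (at t))"
proof -
  define D where "D k t = flat_exp (k + 2) t - k * flat_exp (k + 1) t" for k t
  have "continuous_on UNIV (flat_exp k)" for k
    using flat_exp_deriv by (intro DERIV_continuous_on) blast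
  then have c: "continuous_on UNIV (\<lambda>x. flat_exp k (f x))" if "continuous_on UNIV f" for k and f :: "real \<Rightarrow> real"
    by (rule continuous_on_compose2[of UNIV "flat_exp k" UNIV f]) (use that in auto)
  have "(step_fun has_real_derivative
     (D 0 t * (flat_exp 0 t + flat_exp 0 (1 - t)) - flat_exp 0 t * (D 0 t + D 0 (1 - t) * (- 1))) /
      ((flat_exp 0 t + flat_exp 0 (1 - t)) * (flat_exp 0 t + flat_exp 0 (1 - t)))) (at t)" for t
  proof -
    have 0: "(flat_exp 0 has_real_derivative D 0 t) (at t)" for t
      using flat_exp_deriv[of 0 t] by (simp add: D_def)
    have 1: "((\<lambda>t. flat_exp 0 (1 - t)) has_real_derivative D 0 (1 - t) * (- 1)) (at t)"
      by (rule DERIV_chain2[OF 0]) (auto intro!: derivative_eq_intros)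
    show ?thesis
      using DERIV_divide[OF 0 DERIV_add[OF 0 1]] step_fun_den[of t] by (simp add: step_fun_def[abs_def])
  qed
  moreover have "continuous_on UNIV (\<lambda>t. (D 0 t * (flat_exp 0 t + flat_exp 0 (1 - t)) - flat_exp 0 t * (D 0 t + D 0 (1 - t) * (- 1))) /
      ((flat_exp 0 t + flat_exp 0 (1 - t)) * (flat_exp 0 t + flat_exp 0 (1 - t))))"
    unfolding D_def by (intro continuous_intros c ballI mult_pos_pos[OF step_fun_den step_fun_den, THEN less_imp_neq, THEN not_sym])
  ultimately show ?thesis by blast
qed

text \<open>Diagonal affine maps cover the substitutions used later: dilations, the reflections y ->
  x - y, translations, and, with some entries of \<open>a\<close> equal to 0, projections onto
  coordinate planes and lines. The multiples k * g(A x) form a family closed under differentiation,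
  each derivative contributing a factor \<open>a $ i\<close>.\<close>

lemma smooth_on_affine:
  assumes "open V" "smooth_on U f" "\<And>x. x \<in> V \<Longrightarrow> (\<chi> i. a $ i * x $ i + c $ i) \<in> U"
  shows "smooth_on V (\<lambda>x. f (\<chi> i. a $ i * x $ i + c $ i))"
    and "x \<in> V \<Longrightarrow> pd i (\<lambda>x. f (\<chi> i. a $ i * x $ i + c $ i)) x = a $ i * pd i f (\<chi> i. a $ i * x $ i + c $ i)"
proof -
  define A where "A x = (\<chi> i. a $ i * x $ i + c $ i)" for x :: "real^3"
  have A: "(A has_derivative (\<lambda>h. \<chi> i. a $ i * h $ i)) (at x)" for x
    unfolding A_def by (subst has_derivative_componentwise_within)
      (auto simp: Basis_vec_def inner_axis intro!: derivative_eq_intros bounded_linear_imp_has_derivative bounded_linear_intros)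
  have B: "((\<lambda>x. f (A x)) has_derivative (\<lambda>h. frechet_derivative f (at (A x)) (\<chi> i. a $ i * h $ i))) (at x)"
    if "smooth_on U f" "x \<in> V" for x f
    using has_derivative_compose[OF A has_derivative_frechet[OF smooth_on_differentiable[OF that(1)]]]
      assms(3) that by (auto simp: A_def)
  have C: "pd i (\<lambda>x. f (A x)) x = a $ i * pd i f (A x)" if "smooth_on U f" "x \<in> V" for x f i
  proof -
    have "f differentiable at (A x)" using that assms(3) smooth_on_differentiable by (auto simp: A_def)
    then have "pd i (\<lambda>x. f (A x)) x = (\<Sum>j\<in>UNIV. (\<chi> k. a $ k * axis i 1 $ k) $ j * pd j f (A x))"
      unfolding pd_eqI[OF B[OF that]] by (subst frechet_eq_sum_pd) auto
    also have "\<dots> = (\<Sum>j\<in>UNIV. if j = i then a $ i * pd i f (A x) else 0)"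
      by (intro sum.cong) (auto simp: axis_def)
    finally show ?thesis by simp
  qed
  show "x \<in> V \<Longrightarrow> pd i (\<lambda>x. f (\<chi> i. a $ i * x $ i + c $ i)) x = a $ i * pd i f (\<chi> i. a $ i * x $ i + c $ i)"
    using C[OF assms(2)] by (simp add: A_def)
  \<comment> \<open>The factor 1 exhibits the function as a member of the coinductive family of
    multiples.\<close>
  have "smooth_on V (\<lambda>x. 1 * f (A x))"
  proof (rule smooth_on_coinduct[where X="\<lambda>h. \<exists>g k. smooth_on U g \<and> h = (\<lambda>x. k * g (A x))"])
    fix h assume "\<exists>g k. smooth_on U g \<and> h = (\<lambda>x. k * g (A x))"
    then obtain g k where g: "smooth_on U g" "h = (\<lambda>x. k * g (A x))" by blast
    have d: "(\<lambda>x. g (A x)) differentiable at x" if "x \<in> V" for x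
      using B[OF g(1) that] differentiable_def by blast
    have "pd i h x = (k * a $ i) * pd i g (A x)" if "x \<in> V" for x i
      using pd_mult[OF _ d[OF that], of "\<lambda>x. k" i] C[OF g(1) that] g(2) by simp
    moreover have "h differentiable at x" if "x \<in> V" for x
      unfolding g(2) using d[OF that] by (intro differentiable_mult differentiable_const)
    ultimately show "(\<forall>x\<in>V. h differentiable at x) \<and> (\<forall>i. \<exists>g. (\<exists>g' k. smooth_on U g' \<and> g = (\<lambda>x. k * g' (A x))) \<and>
       (\<forall>x\<in>V. pd i h x = g x))"
      using smooth_on_pd[OF g(1)] by blast
  next
    show "\<exists>g k. smooth_on U g \<and> (\<lambda>x. 1 * f (A x)) = (\<lambda>x. k * g (A x))" using assms(2) by blast
  qed (use assms in auto)
  then show "smooth_on V (\<lambda>x. f (\<chi> i. a $ i * x $ i + c $ i))" by (simp add: A_def)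
qed

section \<open>Symmetry of higher partial derivatives\<close>

lemma has_real_derivative_line:
  assumes "f differentiable at (x + t *\<^sub>R axis i 1)"
  shows "((\<lambda>t. f (x + t *\<^sub>R axis i 1)) has_real_derivative pd i f (x + t *\<^sub>R axis i 1)) (at t)"
proof -
  have "((\<lambda>t. x + t *\<^sub>R axis i 1) has_derivative (\<lambda>h. h *\<^sub>R axis i 1)) (at t)"
    by (auto intro!: derivative_eq_intros)
  from has_derivative_compose[OF this has_derivative_frechet[OF assms]]
  have "((\<lambda>t. f (x + t *\<^sub>R axis i 1)) has_derivative
      (\<lambda>h. frechet_derivative f (at (x + t *\<^sub>R axis i 1)) (h *\<^sub>R axis i 1))) (at t)" .
  moreover have "frechet_derivative f (at (x + t *\<^sub>R axis i 1)) (h *\<^sub>R axis i 1) = pd i f (x + t *\<^sub>R axis i 1) * h" for h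
    using linear_cmul[OF linear_frechet_derivative[OF assms], of h "axis i 1"] by (simp add: pderiv_dir_def mult.commute)
  ultimately show ?thesis by (simp add: has_field_derivative_def)
qed

text \<open>The second difference over a parallelogram is, by two applications of the mean value theorem,
  a value of either mixed derivative.\<close>

lemma second_difference_mvt:
  assumes "smooth_on (ball x (2 * r)) f" "0 < h" "h < r"
  shows "\<exists>y\<in>ball x (2 * r). dist x y < 2 * h \<and>
    f (x + h *\<^sub>R axis i 1 + h *\<^sub>R axis j 1) - f (x + h *\<^sub>R axis i 1) - f (x + h *\<^sub>R axis j 1) + f x = h\<^sup>2 * pd j (pd i f) y"
proof -
  have n: "norm (s *\<^sub>R axis i 1 + t *\<^sub>R axis j 1 :: real^3) \<le> \<bar>s\<bar> + \<bar>t\<bar>" for s t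
    using norm_triangle_ineq[of "s *\<^sub>R axis i 1 :: real^3" "t *\<^sub>R axis j 1"] by (simp add: norm_axis_1)
  have n2: "dist x (x + s *\<^sub>R axis i 1 + t *\<^sub>R axis j 1) \<le> \<bar>s\<bar> + \<bar>t\<bar>" for s t
    using n[of s t] norm_minus_commute by (metis add.assoc add_diff_cancel_left' dist_norm)
  have b: "x + s *\<^sub>R axis i 1 + t *\<^sub>R axis j 1 \<in> ball x (2 * r)" if "\<bar>s\<bar> \<le> h" "\<bar>t\<bar> \<le> h" for s t
    using n2[of s t] that assms by (auto simp: mem_ball)
  have b1: "x + s *\<^sub>R axis i 1 \<in> ball x (2 * r)" if "\<bar>s\<bar> \<le> h" for s using b[of s 0] that assms by auto
  define g where "g s = f (x + s *\<^sub>R axis i 1 + h *\<^sub>R axis j 1) - f (x + s *\<^sub>R axis i 1)" for s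
  have "\<exists>s. 0 < s \<and> s < h \<and> g h - g 0 = (h - 0) * (pd i f (x + s *\<^sub>R axis i 1 + h *\<^sub>R axis j 1) - pd i f (x + s *\<^sub>R axis i 1))"
  proof (rule MVT2)
    fix s assume s: "0 \<le> s" "s \<le> h"
    have 1: "((\<lambda>s. f ((x + h *\<^sub>R axis j 1) + s *\<^sub>R axis i 1)) has_real_derivative pd i f ((x + h *\<^sub>R axis j 1) + s *\<^sub>R axis i 1)) (at s)"
      using b[of s h] s assms by (intro has_real_derivative_line smooth_on_differentiable[OF assms(1)]) (simp add: algebra_simps)
    have 2: "((\<lambda>s. f (x + s *\<^sub>R axis i 1)) has_real_derivative pd i f (x + s *\<^sub>R axis i 1)) (at s)"
      using b1[of s] s by (intro has_real_derivative_line smooth_on_differentiable[OF assms(1)]) auto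
    show "(g has_real_derivative pd i f (x + s *\<^sub>R axis i 1 + h *\<^sub>R axis j 1) - pd i f (x + s *\<^sub>R axis i 1)) (at s)"
      using DERIV_diff[OF 1 2] unfolding g_def by (simp add: add.commute add.left_commute)
  qed fact
  then obtain s where s: "0 < s" "s < h" "g h - g 0 = h * (pd i f (x + s *\<^sub>R axis i 1 + h *\<^sub>R axis j 1) - pd i f (x + s *\<^sub>R axis i 1))"
    by auto
  have "\<exists>t. 0 < t \<and> t < h \<and> pd i f (x + s *\<^sub>R axis i 1 + h *\<^sub>R axis j 1) - pd i f (x + s *\<^sub>R axis i 1 + 0 *\<^sub>R axis j 1) =
      (h - 0) * pd j (pd i f) (x + s *\<^sub>R axis i 1 + t *\<^sub>R axis j 1)"
    using b s(1,2) by (intro MVT2 assms has_real_derivative_line smooth_on_differentiable[OF smooth_on_pd[OF assms(1)]]) auto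
  then obtain t where t: "0 < t" "t < h" "pd i f (x + s *\<^sub>R axis i 1 + h *\<^sub>R axis j 1) - pd i f (x + s *\<^sub>R axis i 1) =
      h * pd j (pd i f) (x + s *\<^sub>R axis i 1 + t *\<^sub>R axis j 1)" by auto
  show ?thesis
    using s t b[of s t] n2[of s t]
    by (intro bexI[of _ "x + s *\<^sub>R axis i 1 + t *\<^sub>R axis j 1"]) (auto simp: g_def power2_eq_square)
qed

text \<open>The second difference is symmetric in the two directions, so the two mixed derivatives
  take a common value at points within 2h of \<open>x\<close>. Both are continuous at
  \<open>x\<close>, and h is arbitrarily small.\<close>

lemma pd_commute:
  assumes "open U" "smooth_on U f" "x \<in> U"
  shows "pd i (pd j f) x = pd j (pd i f) x"
proof -
  obtain r0 where r0: "r0 > 0" "ball x r0 \<subseteq> U" using assms openE by blast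
  define r where "r = r0 / 2"
  have r: "r > 0" "smooth_on (ball x (2 * r)) f" using r0 assms smooth_on_subset by (auto simp: r_def)
  have c: "continuous (at x) (pd i (pd j f))" for i j
    by (intro differentiable_imp_continuous_within smooth_on_differentiable[OF smooth_on_pd[OF smooth_on_pd[OF assms(2)]]] assms)
  have "\<bar>pd i (pd j f) x - pd j (pd i f) x\<bar> \<le> e" if e: "e > 0" for e
  proof -
    obtain d1 where d1: "d1 > 0" "\<And>y. dist y x < d1 \<Longrightarrow> dist (pd i (pd j f) y) (pd i (pd j f) x) < e/2"
      using c[of i j, unfolded continuous_at_eps_delta] half_gt_zero[OF e] by blast
    obtain d2 where d2: "d2 > 0" "\<And>y. dist y x < d2 \<Longrightarrow> dist (pd j (pd i f) y) (pd j (pd i f) x) < e/2"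
      using c[of j i, unfolded continuous_at_eps_delta] half_gt_zero[OF e] by blast
    define h where "h = min (r/2) (min (d1/2) (d2/2))"
    have h: "0 < h" "h < r" "2 * h \<le> d1" "2 * h \<le> d2" using r d1 d2 by (auto simp: h_def)
    obtain y1 where y1: "dist x y1 < 2 * h" "f (x + h *\<^sub>R axis i 1 + h *\<^sub>R axis j 1) - f (x + h *\<^sub>R axis i 1) - f (x + h *\<^sub>R axis j 1) + f x = h\<^sup>2 * pd j (pd i f) y1"
      using second_difference_mvt[OF r(2) h(1,2)] by blast
    obtain y2 where y2: "dist x y2 < 2 * h" "f (x + h *\<^sub>R axis j 1 + h *\<^sub>R axis i 1) - f (x + h *\<^sub>R axis j 1) - f (x + h *\<^sub>R axis i 1) + f x = h\<^sup>2 * pd i (pd j f) y2"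
      using second_difference_mvt[OF r(2) h(1,2)] by blast
    have "x + h *\<^sub>R axis j 1 + h *\<^sub>R axis i 1 = x + h *\<^sub>R axis i 1 + h *\<^sub>R axis j 1" by simp
    then have "h\<^sup>2 * pd j (pd i f) y1 = h\<^sup>2 * pd i (pd j f) y2" using y1(2) y2(2) by (simp only:)
    then have "pd j (pd i f) y1 = pd i (pd j f) y2" using h by simp
    moreover have "dist (pd i (pd j f) y2) (pd i (pd j f) x) < e/2" "dist (pd j (pd i f) y1) (pd j (pd i f) x) < e/2"
      using d1(2)[of y2] d2(2)[of y1] y1(1) y2(1) h by (auto simp: dist_commute)
    ultimately show ?thesis unfolding dist_real_def by linarith
  qed
  then show ?thesis using field_le_epsilon[of "\<bar>pd i (pd j f) x - pd j (pd i f) x\<bar>" 0] by auto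
qed

text \<open>A letter travels through a word by adjacent transpositions. Each transposition is an
  equality on \<open>U\<close> only; as \<open>U\<close> is open it survives the derivatives applied
  outside it.\<close>

lemma pds_perm:
  assumes "open U" "smooth_on U f" "x \<in> U" "mset is = mset js"
  shows "pds is f x = pds js f x"
proof -
  have move: "pds (i # ks @ ls) f x = pds (ks @ i # ls) f x" if "x \<in> U" for i ks ls x
    using that
  proof (induction ks arbitrary: x)
    case (Cons k ks)
    have "pd i (pd k (pds (ks @ ls) f)) x = pd k (pd i (pds (ks @ ls) f)) x"
      using assms(1) smooth_on_pds[OF assms(2)] Cons.prems by (rule pd_commute)
    also have "\<dots> = pd k (pds (ks @ i # ls) f) x"
      using Cons.IH by (intro pd_cong_open[OF assms(1) Cons.prems]) simp
    finally show ?case by simp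
  qed simp
  show ?thesis using assms(3,4)
  proof (induction "is" arbitrary: js x)
    case (Cons i "is")
    then obtain ks ls where js: "js = ks @ i # ls"
      by (metis list.set_intros(1) mset_eq_setD split_list)
    have "pds (i # is) f x = pds (i # ks @ ls) f x"
      using Cons.IH[of _ "ks @ ls"] Cons.prems js by (auto intro!: pd_cong_open[OF assms(1) Cons.prems(1)])
    then show ?case using move[OF Cons.prems(1)] js by simp
  qed simp
qed

subsection \<open>Test functions\<close>

lemma closure_support_subset: "closed K \<Longrightarrow> (\<And>x. x \<notin> K \<Longrightarrow> \<psi> x = 0) \<Longrightarrow> closure {x. \<psi> x \<noteq> 0} \<subseteq> K"
  by (rule closure_minimal) auto

lemma test_funI:
  assumes "smooth_on UNIV \<psi>" "compact K" "K \<subseteq> S" "\<And>x. x \<notin> K \<Longrightarrow> \<psi> x = 0"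
  shows "\<psi> \<in> test_fun S"
proof -
  have "closure {x. \<psi> x \<noteq> 0} \<subseteq> K" using assms compact_imp_closed by (intro closure_support_subset) auto
  moreover from this have "compact (closure {x. \<psi> x \<noteq> 0})"
    using compact_Int_closed[OF assms(2) closed_closure, of "{x. \<psi> x \<noteq> 0}"] by (simp add: Int_absorb1)
  ultimately show ?thesis using assms by (auto simp: test_fun_def smooth_fun_iff)
qed

lemma test_funE:
  assumes "\<psi> \<in> test_fun S"
  obtains K where "smooth_on UNIV \<psi>" "compact K" "K \<subseteq> S" "\<And>x. x \<notin> K \<Longrightarrow> \<psi> x = 0"
proof
  show "smooth_on UNIV \<psi>" "compact (closure {x. \<psi> x \<noteq> 0})" "closure {x. \<psi> x \<noteq> 0} \<subseteq> S"
    using assms by (auto simp: test_fun_def smooth_fun_iff)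
  show "\<psi> x = 0" if "x \<notin> closure {x. \<psi> x \<noteq> 0}" for x
    using that subsetD[OF closure_subset[of "{x. \<psi> x \<noteq> 0}"], of x] by blast
qed

lemma pd_zero_outside:
  assumes "closed K" "\<And>x. x \<notin> K \<Longrightarrow> \<psi> x = 0" "x \<notin> K" shows "pd i \<psi> x = 0"
  using pd_cong_open[of "- K" x \<psi> "\<lambda>x. 0" i] assms by auto

lemma test_fun_pd:
  assumes "\<psi> \<in> test_fun S" shows "pd i \<psi> \<in> test_fun S"
  using assms
proof (rule test_funE)
  fix K assume "smooth_on UNIV \<psi>" and K: "compact K" "K \<subseteq> S" "\<And>x. x \<notin> K \<Longrightarrow> \<psi> x = 0"
  then show ?thesis
    using pd_zero_outside[OF compact_imp_closed[OF K(1)] K(3)] by (intro test_funI[of _ K] smooth_on_pd) auto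
qed

lemma test_fun_pds: "\<psi> \<in> test_fun S \<Longrightarrow> pds is \<psi> \<in> test_fun S"
  by (induction "is") (auto intro: test_fun_pd)

lemma test_fun_mono: "S \<subseteq> T \<Longrightarrow> \<psi> \<in> test_fun S \<Longrightarrow> \<psi> \<in> test_fun T"
  unfolding test_fun_def by auto

text \<open>Outside \<open>S\<close> nothing is known about \<open>f\<close>, but there \<psi>
  vanishes: the product is smooth on \<open>S\<close> and identically 0 on the complement of the
  support, and these two open sets cover the space.\<close>

lemma test_fun_mult:
  assumes "open S" "smooth_on S f" "\<psi> \<in> test_fun S" shows "(\<lambda>x. f x * \<psi> x) \<in> test_fun S"
  using assms(3)
proof (rule test_funE)
  fix K assume sm: "smooth_on UNIV \<psi>" and K: "compact K" "K \<subseteq> S" "\<And>x. x \<notin> K \<Longrightarrow> \<psi> x = 0"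
  have "smooth_on S (\<lambda>x. f x * \<psi> x)"
    using assms sm by (intro smooth_on_mult smooth_on_subset[OF sm]) auto
  moreover have "smooth_on (- K) (\<lambda>x. f x * \<psi> x)"
    using K smooth_on_const[of "- K" 0] compact_imp_closed[of K]
    by (subst smooth_on_cong[where g="\<lambda>x. 0"]) (auto simp: open_Compl)
  ultimately have "smooth_on UNIV (\<lambda>x. f x * \<psi> x)"
    using K(2) assms(1) open_Compl[OF compact_imp_closed[OF K(1)]]
    by (intro smooth_on_local) blast
  then show ?thesis using K by (intro test_funI[of _ K]) auto
qed

lemma test_fun_continuous: "\<psi> \<in> test_fun S \<Longrightarrow> continuous_on A \<psi>"
  by (rule continuous_on_subset[OF smooth_on_continuous subset_UNIV]) (auto simp: test_fun_def smooth_fun_iff)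

lemma test_fun_bounded:
  assumes "\<psi> \<in> test_fun S" obtains B where "B \<ge> 0" "\<And>x. \<bar>\<psi> x\<bar> \<le> B"
  using assms
proof (rule test_funE)
  fix K assume K: "compact K" "\<And>x. x \<notin> K \<Longrightarrow> \<psi> x = 0"
  have "bounded (\<psi> ` K)" using K assms by (intro compact_imp_bounded compact_continuous_image test_fun_continuous)
  then obtain B where "\<And>x. x \<in> K \<Longrightarrow> \<bar>\<psi> x\<bar> \<le> B" by (auto simp: bounded_iff)
  then have "\<bar>\<psi> x\<bar> \<le> \<bar>B\<bar>" for x using K(2)[of x] by (cases "x \<in> K") force+
  then show ?thesis using that[of "\<bar>B\<bar>"] by auto
qed

section \<open>Integration\<close>

text \<open>Both sides below are rewritten by translations only: first \<open>t\<close> by \<open>y $ i\<close>, then \<open>y\<close> by a multiple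
  of the \<open>i\<close>th axis. The indicator normalises the superfluous \<open>i\<close>th coordinate of \<open>y\<close>.\<close>

lemma nn_integral_slice:
  fixes F :: "real^3 \<Rightarrow> ennreal"
  assumes [measurable]: "F \<in> borel_measurable borel"
  shows "(\<integral>\<^sup>+x. F x \<partial>lborel) =
    (\<integral>\<^sup>+y. indicator {0<..<1} (y $ i) * (\<integral>\<^sup>+t. F (y + (t - y $ i) *\<^sub>R axis i 1) \<partial>lborel) \<partial>lborel)" (is "?L = ?R")
    and "(\<integral>\<^sup>+x. F x \<partial>lborel) = (\<integral>\<^sup>+t. \<integral>\<^sup>+y. indicator {0<..<1} (y $ i) * F (y + (t - y $ i) *\<^sub>R axis i 1) \<partial>lborel \<partial>lborel)"
proof -
  have [measurable]: "(\<lambda>y::real^3. y $ i) \<in> borel_measurable borel"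
    by (intro borel_measurable_continuous_onI continuous_intros)
  have "?R = (\<integral>\<^sup>+y. indicator {0<..<1} (y $ i) * (\<integral>\<^sup>+t. F (y + t *\<^sub>R axis i 1) \<partial>lborel) \<partial>lborel)"
  proof (intro nn_integral_cong)
    fix y :: "real^3"
    show "indicator {0<..<1} (y $ i) * (\<integral>\<^sup>+t. F (y + (t - y $ i) *\<^sub>R axis i 1) \<partial>lborel) =
      indicator {0<..<1} (y $ i) * (\<integral>\<^sup>+t. F (y + t *\<^sub>R axis i 1) \<partial>lborel)"
      by (subst nn_integral_real_affine[where c=1 and t="y $ i"]) auto
  qed
  also have "\<dots> = (\<integral>\<^sup>+y. \<integral>\<^sup>+t. indicator {0<..<1} (y $ i) * F (y + t *\<^sub>R axis i 1) \<partial>lborel \<partial>lborel)"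
    by (intro nn_integral_cong nn_integral_cmult[symmetric]) measurable
  also have "\<dots> = (\<integral>\<^sup>+t. \<integral>\<^sup>+y. indicator {0<..<1} (y $ i) * F (y + t *\<^sub>R axis i 1) \<partial>lborel \<partial>lborel)"
    by (rule lborel_pair.Fubini') measurable
  also have "\<dots> = (\<integral>\<^sup>+t. \<integral>\<^sup>+y. indicator {0<..<1} (y $ i - t) * F y \<partial>lborel \<partial>lborel)"
  proof (rule nn_integral_cong)
    fix t :: real
    have "(\<integral>\<^sup>+y. indicator {0<..<1} (y $ i - t) * F y \<partial>lborel) =
        (\<integral>\<^sup>+y. indicator {0<..<1} (y $ i - t) * F y \<partial>distr lborel borel ((+) (t *\<^sub>R axis i 1)))"
      by (simp add: lborel_distr_plus)
    also have "\<dots> = (\<integral>\<^sup>+y. indicator {0<..<1} (y $ i) * F (y + t *\<^sub>R axis i 1) \<partial>lborel)"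
      by (subst nn_integral_distr) (auto simp: axis_def add.commute)
    finally show "(\<integral>\<^sup>+y. indicator {0<..<1} (y $ i) * F (y + t *\<^sub>R axis i 1) \<partial>lborel) =
      (\<integral>\<^sup>+y. indicator {0<..<1} (y $ i - t) * F y \<partial>lborel)" ..
  qed
  also have "\<dots> = (\<integral>\<^sup>+y. \<integral>\<^sup>+t. indicator {0<..<1} (y $ i - t) * F y \<partial>lborel \<partial>lborel)"
    by (rule lborel_pair.Fubini'[symmetric]) measurable
  also have "\<dots> = (\<integral>\<^sup>+y. F y \<partial>lborel)"
  proof (intro nn_integral_cong)
    fix y :: "real^3"
    have "(\<integral>\<^sup>+t. indicator {0<..<1} (y $ i - t) * F y \<partial>lborel) = (\<integral>\<^sup>+t. indicator {y $ i - 1<..<y $ i} t * F y \<partial>lborel)"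
      by (intro nn_integral_cong) (auto split: split_indicator)
    then show "(\<integral>\<^sup>+t. indicator {0<..<1} (y $ i - t) * F y \<partial>lborel) = F y"
      by (simp add: nn_integral_multc)
  qed
  finally show *: "?L = ?R" ..
  have "?R = (\<integral>\<^sup>+y. \<integral>\<^sup>+t. indicator {0<..<1} (y $ i) * F (y + (t - y $ i) *\<^sub>R axis i 1) \<partial>lborel \<partial>lborel)"
    by (intro nn_integral_cong nn_integral_cmult[symmetric]) measurable
  also have "\<dots> = (\<integral>\<^sup>+t. \<integral>\<^sup>+y. indicator {0<..<1} (y $ i) * F (y + (t - y $ i) *\<^sub>R axis i 1) \<partial>lborel \<partial>lborel)"
    by (rule lborel_pair.Fubini') measurable
  finally show "?L = (\<integral>\<^sup>+t. \<integral>\<^sup>+y. indicator {0<..<1} (y $ i) * F (y + (t - y $ i) *\<^sub>R axis i 1) \<partial>lborel \<partial>lborel)" using * by simp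
qed

text \<open>The sign of an integral is recorded as a comparison of the positive and the negative
  part. In this form it can be assembled from slices by Tonelli's theorem, with no question about
  the integrability of slice integrals.\<close>

lemma nn_integral_pos_le_neg:
  assumes int: "integrable M h" and le: "integral\<^sup>L M h \<le> (0::real)"
  shows "(\<integral>\<^sup>+x. ennreal (h x) \<partial>M) \<le> (\<integral>\<^sup>+x. ennreal (- h x) \<partial>M)" (is "?A \<le> ?B")
proof -
  have fin: "?A < top" "?B < top" using int integrable_minus[OF int] by (auto simp: real_integrable_def less_top)
  have "enn2real ?A \<le> enn2real ?B" using le unfolding real_lebesgue_integral_def[OF int] by simp
  then have "ennreal (enn2real ?A) \<le> ennreal (enn2real ?B)" by (rule ennreal_leI)
  then show ?thesis using fin by (simp add: ennreal_enn2real)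
qed

lemma integral_le_0_of_pos_le_neg:
  assumes int: "integrable M h" and le: "(\<integral>\<^sup>+x. ennreal (h x) \<partial>M) \<le> (\<integral>\<^sup>+x. ennreal (- h x) \<partial>M)"
  shows "integral\<^sup>L M h \<le> (0::real)"
proof -
  have "(\<integral>\<^sup>+x. ennreal (- h x) \<partial>M) < top" using integrable_minus[OF int] by (auto simp: real_integrable_def less_top)
  from enn2real_mono[OF le this] show ?thesis unfolding real_lebesgue_integral_def[OF int] by simp
qed

lemma mem_cbox_axis:
  fixes a b y :: "real^3"
  shows "y + (t - y $ i) *\<^sub>R axis i 1 \<in> cbox a b \<longleftrightarrow> a $ i \<le> t \<and> t \<le> b $ i \<and> (\<forall>j. j \<noteq> i \<longrightarrow> a $ j \<le> y $ j \<and> y $ j \<le> b $ j)"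
  by (auto simp: mem_box_cart axis_def)

text \<open>The fundamental theorem of calculus on a line parallel to the i-th axis gives the value
  on the upper face minus the value on the lower one; lines that miss the box contribute 0. An
  inequality, rather than vanishing boundary values, admits fields with a sign on the faces, as is
  needed for the flux of the Newtonian potential.\<close>

lemma cbox_pd_integral_le_0:
  fixes a b :: "real^3"
  assumes diff: "\<And>x. x \<in> cbox a b \<Longrightarrow> F differentiable at x" and cont: "continuous_on (cbox a b) (pd i F)"
    and faces: "\<And>x. x \<in> cbox a b \<Longrightarrow> F (x + (b $ i - x $ i) *\<^sub>R axis i 1) \<le> F (x + (a $ i - x $ i) *\<^sub>R axis i 1)"
  shows "integrable lborel (\<lambda>x. indicator (cbox a b) x * pd i F x)"
    and "(\<integral>x. indicator (cbox a b) x * pd i F x \<partial>lborel) \<le> 0"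
proof -
  define H where "H x = indicator (cbox a b) x * pd i F x" for x
  show int: "integrable lborel (\<lambda>x. indicator (cbox a b) x * pd i F x)"
    using borel_integrable_compact[OF compact_cbox cont] by simp
  then have [measurable]: "H \<in> borel_measurable borel" by (simp add: H_def[abs_def])
  have 1: "(\<integral>\<^sup>+t. ennreal (H (y + (t - y $ i) *\<^sub>R axis i 1)) \<partial>lborel) \<le> (\<integral>\<^sup>+t. ennreal (- H (y + (t - y $ i) *\<^sub>R axis i 1)) \<partial>lborel)" for y
  proof (cases "a $ i \<le> b $ i \<and> (\<forall>j. j \<noteq> i \<longrightarrow> a $ j \<le> y $ j \<and> y $ j \<le> b $ j)")
    case False
    then have "H (y + (t - y $ i) *\<^sub>R axis i 1) = 0" for t
      using mem_cbox_axis[of y t i a b] by (auto simp: H_def split: split_indicator)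
    then show ?thesis by simp
  next
    case True
    define z where "z = y - y $ i *\<^sub>R axis i 1"
    have z: "y + (t - y $ i) *\<^sub>R axis i 1 = z + t *\<^sub>R axis i 1" for t by (simp add: z_def algebra_simps)
    have zin: "z + t *\<^sub>R axis i 1 \<in> cbox a b \<longleftrightarrow> t \<in> {a $ i..b $ i}" for t
      using mem_cbox_axis[of y t i a b] True unfolding z by auto
    have H: "H (z + t *\<^sub>R axis i 1) = pd i F (z + t *\<^sub>R axis i 1) * indicator {a $ i..b $ i} t" for t
      using zin[of t] by (auto simp: H_def split: split_indicator)
    have FTC: "has_bochner_integral lborel (\<lambda>t. indicator {a $ i..b $ i} t *\<^sub>R pd i F (z + t *\<^sub>R axis i 1))
        (F (z + b $ i *\<^sub>R axis i 1) - F (z + a $ i *\<^sub>R axis i 1))"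
    proof (rule has_bochner_integral_FTC_Icc)
      fix t assume t: "a $ i \<le> t" "t \<le> b $ i"
      then have 1: "z + t *\<^sub>R axis i 1 \<in> cbox a b" using zin by auto
      show "((\<lambda>t. F (z + t *\<^sub>R axis i 1)) has_vector_derivative pd i F (z + t *\<^sub>R axis i 1)) (at t within {a $ i..b $ i})"
        using has_field_derivative_at_within[OF has_real_derivative_line[OF diff[OF 1]]]
        by (simp only: has_real_derivative_iff_has_vector_derivative)
    next
      show "continuous_on {a $ i..b $ i} (\<lambda>t. pd i F (z + t *\<^sub>R axis i 1))"
        by (rule continuous_on_compose2[OF cont]) (auto intro!: continuous_intros simp: zin)
    qed (use True in auto)
    let ?h = "\<lambda>t. H (z + t *\<^sub>R axis i 1)"
    have ih: "integrable lborel ?h" using FTC by (auto simp: H mult.commute has_bochner_integral_iff)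
    have "(z + a $ i *\<^sub>R axis i 1) $ i = a $ i" by (simp add: z_def axis_def)
    then have "integral\<^sup>L lborel ?h \<le> 0"
      using faces[of "z + a $ i *\<^sub>R axis i 1"] zin[of "a $ i"] True has_bochner_integral_integral_eq[OF FTC]
      by (simp add: H mult.commute scaleR_diff_left)
    from nn_integral_pos_le_neg[OF ih this] have "(\<integral>\<^sup>+t. ennreal (?h t) \<partial>lborel) \<le> (\<integral>\<^sup>+t. ennreal (- ?h t) \<partial>lborel)" .
    then show ?thesis unfolding z .
  qed
  have m: "(\<lambda>x. ennreal (H x)) \<in> borel_measurable borel" "(\<lambda>x. ennreal (- H x)) \<in> borel_measurable borel"
    by measurable
  note nn_integral_slice(1)[OF m(1), of i]
  also have "(\<integral>\<^sup>+y. indicator {0<..<1} (y $ i) * (\<integral>\<^sup>+t. ennreal (H (y + (t - y $ i) *\<^sub>R axis i 1)) \<partial>lborel) \<partial>lborel) \<le>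
    (\<integral>\<^sup>+y. indicator {0<..<1} (y $ i) * (\<integral>\<^sup>+t. ennreal (- H (y + (t - y $ i) *\<^sub>R axis i 1)) \<partial>lborel) \<partial>lborel)"
    by (intro nn_integral_mono mult_left_mono 1) simp
  also note nn_integral_slice(1)[OF m(2), of i, symmetric]
  finally have "(\<integral>\<^sup>+x. ennreal (H x) \<partial>lborel) \<le> (\<integral>\<^sup>+x. ennreal (- H x) \<partial>lborel)" .
  then show "(\<integral>x. indicator (cbox a b) x * pd i F x \<partial>lborel) \<le> 0"
    unfolding H_def by (rule integral_le_0_of_pos_le_neg[OF int])
qed

text \<open>The divergence of \<open>F\<close> has nonpositive integral by the condition on the
  faces. A weighted integral inequality is thereby reduced to the choice of a field \<open>F\<close>
  and a pointwise inequality between polynomials in the function and its derivatives.\<close>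

lemma cbox_ineq:
  fixes a b :: "real^3"
  assumes U: "open U" "cbox a b \<subseteq> U" and F: "\<And>i. smooth_on U (F i)"
    and faces: "\<And>i x. x \<in> cbox a b \<Longrightarrow> F i (x + (b $ i - x $ i) *\<^sub>R axis i 1) \<le> F i (x + (a $ i - x $ i) *\<^sub>R axis i 1)"
    and AB: "continuous_on U A" "continuous_on U B"
    and nonneg: "\<And>x. x \<in> cbox a b \<Longrightarrow> 0 \<le> A x" "\<And>x. x \<in> cbox a b \<Longrightarrow> 0 \<le> B x"
    and le: "\<And>x. x \<in> cbox a b \<Longrightarrow> A x \<le> B x + (\<Sum>i\<in>UNIV. pd i (F i) x)"
  shows "(\<integral>\<^sup>+x. indicator (cbox a b) x * ennreal (A x) \<partial>lborel) \<le> (\<integral>\<^sup>+x. indicator (cbox a b) x * ennreal (B x) \<partial>lborel)"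
proof -
  let ?I = "indicator (cbox a b) :: real^3 \<Rightarrow> real"
  have F1: "integrable lborel (\<lambda>x. ?I x * pd i (F i) x)" "(\<integral>x. ?I x * pd i (F i) x \<partial>lborel) \<le> 0" for i
    using cbox_pd_integral_le_0[of a b "F i" i] U faces smooth_on_differentiable[OF F] 
      continuous_on_subset[OF smooth_on_continuous[OF smooth_on_pd[OF F]]] by blast+
  have int: "integrable lborel (\<lambda>x. ?I x * A x)" "integrable lborel (\<lambda>x. ?I x * B x)"
    using borel_integrable_compact[OF compact_cbox continuous_on_subset[OF AB(1) U(2)]]
      borel_integrable_compact[OF compact_cbox continuous_on_subset[OF AB(2) U(2)]] by simp_all
  have "(\<integral>x. ?I x * A x \<partial>lborel) \<le> (\<integral>x. ?I x * B x + (\<Sum>i\<in>UNIV. ?I x * pd i (F i) x) \<partial>lborel)"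
    using le by (intro integral_mono int F1 Bochner_Integration.integrable_add Bochner_Integration.integrable_sum) 
      (auto split: split_indicator)
  also have "\<dots> = (\<integral>x. ?I x * B x \<partial>lborel) + (\<Sum>i\<in>UNIV. \<integral>x. ?I x * pd i (F i) x \<partial>lborel)"
    unfolding Bochner_Integration.integral_add[OF int(2) Bochner_Integration.integrable_sum[OF F1(1)]]
      Bochner_Integration.integral_sum[OF F1(1)] ..
  also have "\<dots> \<le> (\<integral>x. ?I x * B x \<partial>lborel)"
    using sum_nonpos[of UNIV "\<lambda>i. \<integral>x. ?I x * pd i (F i) x \<partial>lborel"] F1(2) by simp
  finally have "ennreal (\<integral>x. ?I x * A x \<partial>lborel) \<le> ennreal (\<integral>x. ?I x * B x \<partial>lborel)" by (rule ennreal_leI)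
  moreover have "(\<integral>\<^sup>+x. indicator (cbox a b) x * ennreal (A x) \<partial>lborel) = ennreal (\<integral>x. ?I x * A x \<partial>lborel)"
    using nonneg by (subst nn_integral_eq_integral[symmetric, OF int(1)])
      (auto intro!: AE_I2 nn_integral_cong split: split_indicator)
  moreover have "(\<integral>\<^sup>+x. indicator (cbox a b) x * ennreal (B x) \<partial>lborel) = ennreal (\<integral>x. ?I x * B x \<partial>lborel)"
    using nonneg by (subst nn_integral_eq_integral[symmetric, OF int(2)])
      (auto intro!: AE_I2 nn_integral_cong split: split_indicator)
  ultimately show ?thesis by simp
qed

section \<open>Exhaustion of the slab by the boxes [-n, n] x [-n, n] x [1/n, 1 - 1/n]\<close>

definition low :: "nat \<Rightarrow> real^3" where "low n = (\<chi> i. if i = 3 then 1 / real n else - real n)"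
definition high :: "nat \<Rightarrow> real^3" where "high n = (\<chi> i. if i = 3 then 1 - 1 / real n else real n)"

lemma low_high_nth [simp]:
  "low n $ 3 = 1 / real n" "high n $ 3 = 1 - 1 / real n"
  "low n $ 1 = - real n" "high n $ 1 = real n" "low n $ 2 = - real n" "high n $ 2 = real n"
  by (auto simp: low_def high_def)

lemma mem_slab_box: "x \<in> cbox (low n) (high n) \<longleftrightarrow> \<bar>x $ 1\<bar> \<le> n \<and> \<bar>x $ 2\<bar> \<le> n \<and> 1 / n \<le> x $ 3 \<and> x $ 3 \<le> 1 - 1 / n"
  by (auto simp: mem_box_cart forall_3)

lemma slab_box_subset: "n \<ge> 1 \<Longrightarrow> cbox (low n) (high n) \<subseteq> slab"
proof
  fix x :: "real^3" assume n: "n \<ge> 1" "x \<in> cbox (low n) (high n)"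
  have "0 < 1 / real n" using n by simp
  then have "0 < x $ 3 \<and> x $ 3 < 1" using n(2) unfolding mem_slab_box by linarith
  then show "x \<in> slab" by (simp add: slab_def)
qed

lemma eventually_mem_slab_box:
  assumes "x \<in> slab" shows "\<forall>\<^sub>F n in sequentially. x \<in> cbox (low n) (high n)"
proof -
  have "\<forall>\<^sub>F n in sequentially. c \<le> real n" for c
    using filterlim_real_sequentially unfolding filterlim_at_top by blast
  then have "\<forall>\<^sub>F n in sequentially. \<bar>x $ 1\<bar> \<le> n \<and> \<bar>x $ 2\<bar> \<le> n \<and> 1 / x $ 3 \<le> n \<and> 1 / (1 - x $ 3) \<le> n"
    by (intro eventually_conj)
  then show ?thesis
  proof eventually_elim
    case (elim n)
    have x: "0 < x $ 3" "0 < 1 - x $ 3" using assms by (auto simp: slab_def)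
    then have "real n > 0" using elim by (smt (verit) divide_pos_pos)
    then show ?case using elim x by (simp add: mem_slab_box field_simps)
  qed
qed

text \<open>Used for squares and other nonnegative integrands. With values in \<open>ennreal\<close>
  an estimate can be stated before its terms are known to be finite.\<close>

definition slab_nn :: "(real^3 \<Rightarrow> real) \<Rightarrow> ennreal" where
  "slab_nn f = (\<integral>\<^sup>+x. indicator slab x * ennreal (f x) \<partial>lborel)"

lemma slab_measurable [measurable]: "slab \<in> sets borel" by (simp add: borel_open)

lemma borel_measurable_slab:
  "continuous_on slab f \<Longrightarrow> (\<lambda>x. indicator slab x * ennreal (f x)) \<in> borel_measurable borel"
proof -
  assume "continuous_on slab f"
  then have "(\<lambda>x. indicator slab x *\<^sub>R f x) \<in> borel_measurable borel"
    by (rule borel_measurable_continuous_on_indicator[OF slab_measurable])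
  then have "(\<lambda>x. ennreal (indicator slab x *\<^sub>R f x)) \<in> borel_measurable borel" by measurable
  moreover have "(\<lambda>x. ennreal (indicator slab x *\<^sub>R f x)) = (\<lambda>x. indicator slab x * ennreal (f x))"
    by (auto split: split_indicator)
  ultimately show ?thesis by simp
qed

lemma slab_nn_mono: "(\<And>x. x \<in> slab \<Longrightarrow> f x \<le> g x) \<Longrightarrow> slab_nn f \<le> slab_nn g"
  unfolding slab_nn_def by (intro nn_integral_mono) (auto split: split_indicator intro: ennreal_leI)

lemma slab_nn_cong: "(\<And>x. x \<in> slab \<Longrightarrow> f x = g x) \<Longrightarrow> slab_nn f = slab_nn g"
  unfolding slab_nn_def by (intro nn_integral_cong) (auto split: split_indicator)

lemma slab_nn_cmult:
  assumes "continuous_on slab f" "c \<ge> 0" shows "slab_nn (\<lambda>x. c * f x) = ennreal c * slab_nn f"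
proof -
  have "slab_nn (\<lambda>x. c * f x) = (\<integral>\<^sup>+x. ennreal c * (indicator slab x * ennreal (f x)) \<partial>lborel)"
    unfolding slab_nn_def using assms(2) by (intro nn_integral_cong) (auto split: split_indicator simp: ennreal_mult')
  also have "\<dots> = ennreal c * slab_nn f"
    unfolding slab_nn_def using borel_measurable_slab[OF assms(1)] by (intro nn_integral_cmult) simp
  finally show ?thesis .
qed

lemma slab_nn_add:
  assumes "continuous_on slab f" "continuous_on slab g" "\<And>x. x \<in> slab \<Longrightarrow> 0 \<le> f x" "\<And>x. x \<in> slab \<Longrightarrow> 0 \<le> g x"
  shows "slab_nn (\<lambda>x. f x + g x) = slab_nn f + slab_nn g"
proof -
  have "slab_nn (\<lambda>x. f x + g x) = (\<integral>\<^sup>+x. indicator slab x * ennreal (f x) + indicator slab x * ennreal (g x) \<partial>lborel)"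
    unfolding slab_nn_def using assms(3,4) by (intro nn_integral_cong) (auto split: split_indicator)
  then show ?thesis using assms(1,2) by (simp add: nn_integral_add borel_measurable_slab slab_nn_def)
qed

text \<open>Each point of the slab eventually lies in the boxes, so the truncated integrands
  converge pointwise on the slab and vanish off it. A bound uniform in n then survives the limit
  without any dominating function.\<close>

lemma slab_nn_Fatou:
  assumes cont: "\<And>n. n \<ge> 2 \<Longrightarrow> continuous_on slab (A n)" "continuous_on slab A'"
    and lim: "\<And>x. x \<in> slab \<Longrightarrow> (\<lambda>n. A n x) \<longlonglongrightarrow> A' x"
    and le: "\<And>n. n \<ge> 2 \<Longrightarrow> (\<integral>\<^sup>+x. indicator (cbox (low n) (high n)) x * ennreal (A n x) \<partial>lborel) \<le> c"
  shows "slab_nn A' \<le> c"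
proof -
  \<comment> \<open>The shift by 2 skips the degenerate boxes, for which no bound is
    assumed.\<close>
  define G where "G n x = indicator (cbox (low (n+2)) (high (n+2))) x * ennreal (A (n+2) x)" for n and x :: "real^3"
  have G[measurable]: "G n \<in> borel_measurable borel" for n
  proof -
    have "continuous_on (cbox (low (n+2)) (high (n+2))) (A (n+2))"
      by (rule continuous_on_subset[OF cont(1) slab_box_subset]) auto
    then have "(\<lambda>x. indicator (cbox (low (n+2)) (high (n+2))) x *\<^sub>R A (n+2) x) \<in> borel_measurable borel"
      by (intro borel_measurable_continuous_on_indicator) auto
    then have "(\<lambda>x. ennreal (indicator (cbox (low (n+2)) (high (n+2))) x *\<^sub>R A (n+2) x)) \<in> borel_measurable borel" by measurable
    moreover have "(\<lambda>x. ennreal (indicator (cbox (low (n+2)) (high (n+2))) x *\<^sub>R A (n+2) x)) = G n"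
      by (auto simp: G_def split: split_indicator)
    ultimately show ?thesis by simp
  qed
  have "liminf (\<lambda>n. G n x) = indicator slab x * ennreal (A' x)" for x
  proof (cases "x \<in> slab")
    case True
    have "(\<lambda>n. ennreal (A (n+2) x)) \<longlonglongrightarrow> ennreal (A' x)"
      using LIMSEQ_ignore_initial_segment[OF lim[OF True], of 2] by (rule tendsto_ennrealI)
    moreover have "\<forall>\<^sub>F n in sequentially. ennreal (A (n+2) x) = G n x"
      using eventually_mem_slab_box[OF True, THEN sequentially_offset, of 2]
      by eventually_elim (simp add: G_def)
    ultimately have "(\<lambda>n. G n x) \<longlonglongrightarrow> ennreal (A' x)" by (simp add: tendsto_cong)
    then show ?thesis using True lim_imp_Liminf[OF sequentially_bot] by simp
  next
    case False
    then have "G n x = 0" for n using slab_box_subset[of "n+2"] by (auto simp: G_def split: split_indicator)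
    then show ?thesis using False by (simp add: Liminf_const)
  qed
  then have "slab_nn A' = (\<integral>\<^sup>+x. liminf (\<lambda>n. G n x) \<partial>lborel)" by (simp add: slab_nn_def)
  also have "\<dots> \<le> liminf (\<lambda>n. \<integral>\<^sup>+x. G n x \<partial>lborel)" by (rule nn_integral_liminf) simp
  also have "\<dots> \<le> liminf (\<lambda>n. c)" using le by (intro Liminf_mono) (auto simp: G_def)
  also have "\<dots> = c" by (simp add: Liminf_const)
  finally show ?thesis .
qed

lemma cbox_nn_le_slab_nn:
  assumes "n \<ge> 1" "\<And>x. x \<in> slab \<Longrightarrow> 0 \<le> f x"
  shows "(\<integral>\<^sup>+x. indicator (cbox (low n) (high n)) x * ennreal (f x) \<partial>lborel) \<le> slab_nn f"
  unfolding slab_nn_def using slab_box_subset[OF assms(1)]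
  by (intro nn_integral_mono) (auto split: split_indicator)

section \<open>Weighted estimates on the slab\<close>

text \<open>Comparable to the distance from the boundary of the slab, but polynomial and hence
  smooth across the middle plane as well.\<close>

definition wt :: "real^3 \<Rightarrow> real" where "wt x = x $ 3 * (1 - x $ 3)"

lemma smooth_on_wt: "open U \<Longrightarrow> smooth_on U wt"
  unfolding wt_def[abs_def] by (intro smooth_on_intros)

lemma pd_comp_coord:
  assumes "(g has_real_derivative g') (at (x $ j))"
  shows "pd i (\<lambda>x. g (x $ j)) x = (if i = j then g' else 0)"
    and "(\<lambda>x. g (x $ j)) differentiable at (x::real^3)"
  using pd_comp_real(2)[where f="\<lambda>x. x $ j" and x=x, OF assms differentiable_coord, of i]
    pd_comp_real(1)[where f="\<lambda>x. x $ j" and x=x, OF assms differentiable_coord]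
  by (auto simp: differentiable_def)

lemma pd_prod_coords:
  assumes "\<And>t. (p1 has_real_derivative p1' t) (at t)" "\<And>t. (p2 has_real_derivative p2' t) (at t)"
    "\<And>t. (p3 has_real_derivative p3' t) (at t)"
  shows "pd 1 (\<lambda>x. p1 (x $ 1) * p2 (x $ 2) * p3 (x $ 3)) = (\<lambda>x. p1' (x $ 1) * p2 (x $ 2) * p3 (x $ 3))"
    and "pd 2 (\<lambda>x. p1 (x $ 1) * p2 (x $ 2) * p3 (x $ 3)) = (\<lambda>x. p1 (x $ 1) * p2' (x $ 2) * p3 (x $ 3))"
    and "pd 3 (\<lambda>x. p1 (x $ 1) * p2 (x $ 2) * p3 (x $ 3)) = (\<lambda>x. p1 (x $ 1) * p2 (x $ 2) * p3' (x $ 3))"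
proof -
  note d = pd_comp_coord(2)[OF assms(1)] pd_comp_coord(2)[OF assms(2)] pd_comp_coord(2)[OF assms(3)]
  note e = pd_comp_coord(1)[OF assms(1)] pd_comp_coord(1)[OF assms(2)] pd_comp_coord(1)[OF assms(3)]
  show "pd 1 (\<lambda>x. p1 (x $ 1) * p2 (x $ 2) * p3 (x $ 3)) = (\<lambda>x. p1' (x $ 1) * p2 (x $ 2) * p3 (x $ 3))"
    by (rule ext) (simp add: pd_mult differentiable_mult d e)
  show "pd 2 (\<lambda>x. p1 (x $ 1) * p2 (x $ 2) * p3 (x $ 3)) = (\<lambda>x. p1 (x $ 1) * p2' (x $ 2) * p3 (x $ 3))"
    by (rule ext) (simp add: pd_mult differentiable_mult d e)
  show "pd 3 (\<lambda>x. p1 (x $ 1) * p2 (x $ 2) * p3 (x $ 3)) = (\<lambda>x. p1 (x $ 1) * p2 (x $ 2) * p3' (x $ 3))"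
    by (rule ext) (simp add: pd_mult differentiable_mult d e)
qed

definition lap :: "(real^3 \<Rightarrow> real) \<Rightarrow> real^3 \<Rightarrow> real" where
  "lap f x = (\<Sum>i\<in>UNIV. pd i (pd i f) x)"

text \<open>Polynomials suffice as cut-offs because they are only used on a box. Being squares,
  \<open>horiz_cut\<close> and \<open>vert_cut\<close> vanish together with their first derivatives
  on the faces, where |t| = N, respectively z = e or z = 1 - e. For N tending to infinity and e to 0
  they converge to 1 and to the square of the weight.\<close>

definition horiz_cut :: "real \<Rightarrow> real \<Rightarrow> real" where "horiz_cut N t = (1 - (t / N)\<^sup>2)\<^sup>2"
definition horiz_cut' :: "real \<Rightarrow> real \<Rightarrow> real" where "horiz_cut' N t = - 4 * t / N\<^sup>2 * (1 - (t / N)\<^sup>2)"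
definition horiz_cut'' :: "real \<Rightarrow> real \<Rightarrow> real" where "horiz_cut'' N t = - 4 / N\<^sup>2 + 12 * t\<^sup>2 / N ^ 4"
definition vert_cut :: "real \<Rightarrow> real \<Rightarrow> real" where "vert_cut e z = ((z - e) * (1 - e - z))\<^sup>2"
definition vert_cut' :: "real \<Rightarrow> real \<Rightarrow> real" where "vert_cut' e z = 2 * ((z - e) * (1 - e - z)) * (1 - 2 * z)"
definition vert_cut'' :: "real \<Rightarrow> real \<Rightarrow> real" where "vert_cut'' e z = 2 * (1 - 2 * z)\<^sup>2 - 4 * ((z - e) * (1 - e - z))"

lemma cut_derivs:
  "N \<noteq> 0 \<Longrightarrow> (horiz_cut N has_real_derivative horiz_cut' N t) (at t)"
  "N \<noteq> 0 \<Longrightarrow> (horiz_cut' N has_real_derivative horiz_cut'' N t) (at t)"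
  "(vert_cut e has_real_derivative vert_cut' e t) (at t)"
  "(vert_cut' e has_real_derivative vert_cut'' e t) (at t)"
  unfolding horiz_cut_def[abs_def] horiz_cut'_def[abs_def] horiz_cut''_def vert_cut_def[abs_def] vert_cut'_def[abs_def] vert_cut''_def
  by (auto intro!: derivative_eq_intros simp: field_simps power2_eq_square power4_eq_xxxx)

text \<open>The bound 2 on second derivatives is what is used: three of them make the Laplacian of
  the product at most 6. In the horizontal directions it comes from 8 / N^2 and N at least
  2.\<close>

lemma cut_bounds:
  assumes "N \<ge> 2" "\<bar>t\<bar> \<le> N" "0 \<le> e" "e \<le> z" "z \<le> 1 - e"
  shows "0 \<le> horiz_cut N t" "horiz_cut N t \<le> 1" "horiz_cut'' N t \<le> 2"
    "0 \<le> vert_cut e z" "vert_cut e z \<le> 1" "vert_cut'' e z \<le> 2"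
proof -
  have t: "t\<^sup>2 \<le> N\<^sup>2" using assms by (metis abs_le_square_iff abs_of_nonneg order_trans zero_le_numeral)
  have N: "4 \<le> N\<^sup>2" using power_mono[OF assms(1), of 2] by simp
  have "(t/N)\<^sup>2 \<le> 1" using t N assms by (simp add: power_divide divide_le_eq_1)
  then show "0 \<le> horiz_cut N t" "horiz_cut N t \<le> 1" unfolding horiz_cut_def by (auto intro: power_le_one)
  have "12 * t\<^sup>2 / N ^ 4 \<le> 12 / N\<^sup>2" using t N assms
    by (simp add: divide_le_eq power4_eq_xxxx power2_eq_square)
  then have "horiz_cut'' N t \<le> 8 / N\<^sup>2" by (simp add: horiz_cut''_def)
  also have "\<dots> \<le> 2" using N by (simp add: divide_le_eq)
  finally show "horiz_cut'' N t \<le> 2" .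
  have P: "0 \<le> (z - e) * (1 - e - z)" "(z - e) * (1 - e - z) \<le> 1"
    using assms mult_mono[of "z - e" 1 "1 - e - z" 1] by auto
  then show "0 \<le> vert_cut e z" "vert_cut e z \<le> 1" unfolding vert_cut_def by (auto intro: power_le_one)
  have "(1 - 2 * z)\<^sup>2 \<le> 1" using assms by (intro power2_le_iff_abs_le[THEN iffD2, of 1, simplified]) auto
  then show "vert_cut'' e z \<le> 2" using P by (simp add: vert_cut''_def)
qed

text \<open>Green's second identity for u^2 and a cut-off \<Theta>: the field \<Theta> \<nabla>(u^2)
  - u^2 \<nabla>\<Theta> has divergence 2 \<Theta> |\<nabla>u|^2 - u^2 \<Delta>\<Theta> because
  \<open>u\<close> is harmonic. With \<Delta>\<Theta> at most 6, half of 6 is the constant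
  3.\<close>

lemma Caccioppoli:
  assumes u: "smooth_on slab u" and harm: "\<And>x. x \<in> slab \<Longrightarrow> lap u x = 0"
  shows "slab_nn (\<lambda>x. (wt x)\<^sup>2 * (\<Sum>i\<in>UNIV. (pd i u x)\<^sup>2)) \<le> ennreal 3 * slab_nn (\<lambda>x. (u x)\<^sup>2)"
proof -
  define \<Theta> where "\<Theta> n x = horiz_cut n (x $ 1) * horiz_cut n (x $ 2) * vert_cut (1 / n) (x $ 3)" for n :: real and x :: "real^3"
  define v where "v x = u x * u x" for x
  define G where "G x = (\<Sum>i\<in>UNIV. (pd i u x)\<^sup>2)" for x
  have sm\<Theta>: "smooth_on UNIV (\<Theta> n)" for n
    unfolding \<Theta>_def[abs_def] horiz_cut_def vert_cut_def divide_inverse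
    by (intro smooth_on_intros open_UNIV)
  have smv: "smooth_on slab v" unfolding v_def[abs_def] by (intro smooth_on_intros open_slab u)
  have smG: "continuous_on slab G" unfolding G_def[abs_def]
    by (intro continuous_intros smooth_on_continuous smooth_on_pd u)
  have contu: "continuous_on slab u" by (rule smooth_on_continuous[OF u])
  have contw: "continuous_on slab wt" by (rule smooth_on_continuous[OF smooth_on_wt[OF open_slab]])
  have cont\<Theta>: "continuous_on slab (\<Theta> n)" for n
    by (rule smooth_on_continuous[OF smooth_on_subset[OF sm\<Theta>]]) auto
  have main: "(\<integral>\<^sup>+x. indicator (cbox (low n) (high n)) x * ennreal (\<Theta> n x * (2 * G x)) \<partial>lborel)
     \<le> ennreal 6 * slab_nn (\<lambda>x. (u x)\<^sup>2)" if n: "n \<ge> 2" for n :: nat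
  proof -
    define F where "F i x = \<Theta> n x * pd i v x - v x * pd i (\<Theta> n) x" for i x
    have N: "real n \<noteq> 0" "real n \<ge> 2" using n by auto
    have Q: "cbox (low n) (high n) \<subseteq> slab" using n by (intro slab_box_subset) auto
    have D1: "pd 1 (\<Theta> n) = (\<lambda>x. horiz_cut' n (x $ 1) * horiz_cut n (x $ 2) * vert_cut (1 / n) (x $ 3))"
      "pd 2 (\<Theta> n) = (\<lambda>x. horiz_cut n (x $ 1) * horiz_cut' n (x $ 2) * vert_cut (1 / n) (x $ 3))"
      "pd 3 (\<Theta> n) = (\<lambda>x. horiz_cut n (x $ 1) * horiz_cut n (x $ 2) * vert_cut' (1 / n) (x $ 3))"
      unfolding \<Theta>_def[abs_def] by (rule pd_prod_coords cut_derivs N)+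
    have D2: "pd 1 (pd 1 (\<Theta> n)) = (\<lambda>x. horiz_cut'' n (x $ 1) * horiz_cut n (x $ 2) * vert_cut (1 / n) (x $ 3))"
      "pd 2 (pd 2 (\<Theta> n)) = (\<lambda>x. horiz_cut n (x $ 1) * horiz_cut'' n (x $ 2) * vert_cut (1 / n) (x $ 3))"
      "pd 3 (pd 3 (\<Theta> n)) = (\<lambda>x. horiz_cut n (x $ 1) * horiz_cut n (x $ 2) * vert_cut'' (1 / n) (x $ 3))"
      unfolding D1 by (rule pd_prod_coords cut_derivs N)+
    have pdv: "pd i v x = 2 * (u x * pd i u x)" if "x \<in> slab" for i x
      using smooth_on_differentiable[OF u that] by (simp add: v_def[abs_def] pd_mult)
    have pd2v: "pd i (pd i v) x = 2 * ((pd i u x)\<^sup>2 + u x * pd i (pd i u) x)" if "x \<in> slab" for i x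
    proof -
      note d = smooth_on_differentiable[OF u that] smooth_on_differentiable[OF smooth_on_pd[OF u] that]
      have "pd i (pd i v) x = pd i (\<lambda>x. 2 * (u x * pd i u x)) x"
        by (rule pd_cong_open[OF open_slab that]) (rule pdv)
      then show ?thesis using d by (simp add: pd_mult differentiable_mult power2_eq_square algebra_simps)
    qed
    have pdF: "pd i (F i) x = \<Theta> n x * pd i (pd i v) x - v x * pd i (pd i (\<Theta> n)) x" if "x \<in> slab" for i x
    proof -
      note d = smooth_on_differentiable[OF smooth_on_pd[OF smv] that] smooth_on_differentiable[OF smv that]
        smooth_on_differentiable[OF sm\<Theta>] smooth_on_differentiable[OF smooth_on_pd[OF sm\<Theta>]]
      show ?thesis unfolding F_def[abs_def] by (simp add: pd_diff pd_mult differentiable_mult d)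
    qed
    have le: "\<Theta> n x * (2 * G x) \<le> 6 * (u x)\<^sup>2 + (\<Sum>i\<in>UNIV. pd i (F i) x)" if x: "x \<in> cbox (low n) (high n)" for x
    proof -
      have xs: "x \<in> slab" using x Q by auto
      have L: "lap (\<Theta> n) x \<le> 6"
      proof -
        have c: "0 \<le> horiz_cut n (x $ 1)" "horiz_cut n (x $ 1) \<le> 1" "0 \<le> horiz_cut n (x $ 2)" "horiz_cut n (x $ 2) \<le> 1"
          "0 \<le> vert_cut (1 / n) (x $ 3)" "vert_cut (1 / n) (x $ 3) \<le> 1"
          "horiz_cut'' n (x $ 1) \<le> 2" "horiz_cut'' n (x $ 2) \<le> 2" "vert_cut'' (1 / n) (x $ 3) \<le> 2"
          using x N by (auto simp: mem_slab_box intro!: cut_bounds[where e="1 / real n" and N=n])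
        have *: "a * (b * c) \<le> 2" if "a \<le> 2" "0 \<le> b" "b \<le> 1" "0 \<le> c" "c \<le> 1" for a b c :: real
          using that mult_le_one[of b c] mult_right_mono[of a 2 "b * c"] mult_nonneg_nonneg[of b c] by linarith
        show ?thesis unfolding lap_def sum_3 D2
          using *[OF c(7,3,4,5,6)] *[OF c(8,1,2,5,6)] *[OF c(9,1,2,3,4)] by (simp add: mult_ac)
      qed
      have "(\<Sum>i\<in>UNIV. pd i (F i) x) = \<Theta> n x * (2 * G x) + 2 * \<Theta> n x * u x * lap u x - v x * lap (\<Theta> n) x"
        by (simp add: pdF[OF xs] pd2v[OF xs] sum_subtractf sum_distrib_left sum.distrib G_def lap_def algebra_simps)
      moreover have "v x * lap (\<Theta> n) x \<le> v x * 6" using L by (intro mult_left_mono) (auto simp: v_def)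
      ultimately show ?thesis using harm[OF xs] by (simp add: v_def power2_eq_square)
    qed
    have "(\<integral>\<^sup>+x. indicator (cbox (low n) (high n)) x * ennreal (\<Theta> n x * (2 * G x)) \<partial>lborel)
      \<le> (\<integral>\<^sup>+x. indicator (cbox (low n) (high n)) x * ennreal (6 * (u x)\<^sup>2) \<partial>lborel)"
    proof (rule cbox_ineq[OF open_slab Q, where F=F])
      show "smooth_on slab (F i)" for i unfolding F_def[abs_def]
        by (intro smooth_on_intros open_slab smooth_on_pd smv smooth_on_subset[OF sm\<Theta>] smooth_on_subset[OF smooth_on_pd[OF sm\<Theta>]]) auto
      fix i :: 3 and x :: "real^3"
      assume x: "x \<in> cbox (low n) (high n)"
      \<comment> \<open>On a face orthogonal to the i-th axis the i-th factor has a double zero, so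
        the flux through that face vanishes whatever \<open>u\<close> is.\<close>
      have "\<Theta> n y = 0 \<and> pd i (\<Theta> n) y = 0" if "y $ i = low n $ i \<or> y $ i = high n $ i" for y
        using that N exhaust_3[of i] by (auto simp: D1 \<Theta>_def horiz_cut_def horiz_cut'_def vert_cut_def vert_cut'_def)
      then have "F i y = 0" if "y $ i = low n $ i \<or> y $ i = high n $ i" for y using that by (simp add: F_def)
      then show "F i (x + (high n $ i - x $ i) *\<^sub>R axis i 1) \<le> F i (x + (low n $ i - x $ i) *\<^sub>R axis i 1)"
        by (simp add: axis_def)
      show "0 \<le> \<Theta> n x * (2 * G x)"
        unfolding \<Theta>_def G_def horiz_cut_def vert_cut_def by (simp add: sum_nonneg)
    qed (use le in \<open>auto intro!: continuous_intros smG cont\<Theta> contu\<close>)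
    also have "\<dots> \<le> slab_nn (\<lambda>x. 6 * (u x)\<^sup>2)" using n by (intro cbox_nn_le_slab_nn) auto
    also have "\<dots> = ennreal 6 * slab_nn (\<lambda>x. (u x)\<^sup>2)"
      by (intro slab_nn_cmult continuous_intros contu) auto
    finally show ?thesis .
  qed
  have lim: "(\<lambda>n. \<Theta> (real n) x * (2 * G x)) \<longlonglongrightarrow> (wt x)\<^sup>2 * (2 * G x)" for x
  proof -
    have "(\<lambda>n. \<Theta> (real n) x * (2 * G x)) \<longlonglongrightarrow> (1 - 0\<^sup>2)\<^sup>2 * (1 - 0\<^sup>2)\<^sup>2 * ((x $ 3 - 0) * (1 - 0 - x $ 3))\<^sup>2 * (2 * G x)"
      unfolding \<Theta>_def horiz_cut_def vert_cut_def by (intro tendsto_intros lim_const_over_n lim_1_over_n)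
    then show ?thesis by (simp add: wt_def)
  qed
  have "slab_nn (\<lambda>x. (wt x)\<^sup>2 * (2 * G x)) \<le> ennreal 6 * slab_nn (\<lambda>x. (u x)\<^sup>2)"
  proof (rule slab_nn_Fatou[where A="\<lambda>n x. \<Theta> (real n) x * (2 * G x)"])
  qed (rule main lim | assumption | intro continuous_intros smG cont\<Theta> contw)+
  moreover have "slab_nn (\<lambda>x. (wt x)\<^sup>2 * (2 * G x)) = ennreal 2 * slab_nn (\<lambda>x. (wt x)\<^sup>2 * G x)"
    by (subst slab_nn_cmult[symmetric]) (auto intro!: continuous_intros smG contw slab_nn_cong)
  ultimately have "ennreal 2 * slab_nn (\<lambda>x. (wt x)\<^sup>2 * G x) \<le> ennreal 2 * (ennreal 3 * slab_nn (\<lambda>x. (u x)\<^sup>2))"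
    by (simp add: mult.assoc[symmetric] ennreal_mult[symmetric])
  then show ?thesis unfolding G_def by (subst (asm) ennreal_mult_le_mult_iff) auto
qed

text \<open>The multiplier p(z) = (z - e)(1 - e - z)(1 - 2z) is half the derivative of the squared
  cut-off weight. It vanishes on the horizontal faces and satisfies |p| \<le> \<open>wt\<close>,
  whereas p' is at least 1 - 6 \<open>wt\<close>, thus near 1 at the boundary. The divergence of p
  f^2 in the vertical direction therefore yields f^2 near the boundary, and the deficit in the
  interior is paid by the weighted term in f.\<close>

lemma Hardy:
  assumes f: "smooth_on slab f"
  shows "slab_nn (\<lambda>x. (f x)\<^sup>2) \<le> ennreal 72 * slab_nn (\<lambda>x. (wt x)\<^sup>2 * (f x)\<^sup>2) + ennreal 8 * slab_nn (\<lambda>x. (wt x)\<^sup>2 * (pd 3 f x)\<^sup>2)"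
proof -
  note cont = smooth_on_continuous[OF f] smooth_on_continuous[OF smooth_on_pd[OF f]]
    smooth_on_continuous[OF smooth_on_wt[OF open_slab]]
  define B where "B x = 36 * ((wt x)\<^sup>2 * (f x)\<^sup>2) + 4 * ((wt x)\<^sup>2 * (pd 3 f x)\<^sup>2)" for x
  have B: "continuous_on slab B" unfolding B_def[abs_def] by (intro continuous_intros cont)
  have B0: "0 \<le> B x" for x by (simp add: B_def)
  have main: "(\<integral>\<^sup>+x. indicator (cbox (low n) (high n)) x * ennreal ((1/2) * (f x)\<^sup>2) \<partial>lborel) \<le> slab_nn B"
    if n: "n \<ge> 2" for n :: nat
  proof -
    define e where "e = 1 / real n"
    have e: "0 < e" "e \<le> 1/2" using n by (auto simp: e_def field_simps)
    have Q: "cbox (low n) (high n) \<subseteq> slab" using n by (intro slab_box_subset) auto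
    define p where "p z = (z - e) * (1 - e - z) * (1 - 2 * z)" for z
    define p' where "p' z = (1 - 2 * z)\<^sup>2 - 2 * ((z - e) * (1 - e - z))" for z
    have dp: "(p has_real_derivative p' z) (at z)" for z
      unfolding p_def[abs_def] p'_def by (auto intro!: derivative_eq_intros simp: power2_eq_square algebra_simps)
    define F where "F i = (if i = (3::3) then (\<lambda>x. p (x $ 3) * (f x * f x)) else (\<lambda>x. 0))" for i
    have pdF: "(\<Sum>i\<in>UNIV. pd i (F i) x) = p' (x $ 3) * (f x)\<^sup>2 + 2 * p (x $ 3) * f x * pd 3 f x" if "x \<in> slab" for x
      using smooth_on_differentiable[OF f that] pd_comp_coord[OF dp]
      by (simp add: F_def sum_3 pd_mult differentiable_mult power2_eq_square algebra_simps)
    have le: "(1/2) * (f x)\<^sup>2 \<le> B x + (\<Sum>i\<in>UNIV. pd i (F i) x)" if x: "x \<in> cbox (low n) (high n)" for x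
    proof -
      have xs: "x \<in> slab" using x Q by auto
      let ?z = "x $ 3" let ?P = "(?z - e) * (1 - e - ?z)"
      have z: "e \<le> ?z" "?z \<le> 1 - e" using x by (auto simp: mem_slab_box e_def)
      have P: "0 \<le> ?P" using z by simp
      have "e * e \<le> e * 1" using e by (intro mult_left_mono) auto
      then have Pd: "?P \<le> wt x" by (simp add: wt_def algebra_simps)
      have "(1 - 2 * ?z)\<^sup>2 = 1 - 4 * wt x" by (simp add: wt_def power2_eq_square algebra_simps)
      then have p': "p' ?z \<ge> 1 - 6 * wt x" using Pd unfolding p'_def by linarith
      have "\<bar>1 - 2 * ?z\<bar> \<le> 1" using xs by (auto simp: slab_def)
      then have "?P * \<bar>1 - 2 * ?z\<bar> \<le> wt x" using mult_mono[OF Pd, of "\<bar>1 - 2 * ?z\<bar>" 1] P Pd by simp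
      then have "\<bar>p ?z\<bar> \<le> wt x" by (simp only: p_def abs_mult[of ?P] abs_of_nonneg[OF P])
      then have p: "(p ?z)\<^sup>2 \<le> (wt x)\<^sup>2" by (metis abs_le_square_iff abs_ge_zero abs_of_nonneg order_trans)
      \<comment> \<open>The linear deficit 6 \<open>wt\<close> is traded for 36 \<open>wt\<close>^2,
        the power of the weight that Caccioppoli's inequality handles, at the price of 1/4. Young's
        inequality for the mixed term takes another 1/4, which leaves the factor 1/2 of f^2.\<close>
      have "0 \<le> (1/2 - 6 * wt x)\<^sup>2" by simp
      then have "6 * wt x \<le> 1/4 + 36 * (wt x)\<^sup>2" by (simp add: power2_eq_square algebra_simps)
      then have "p' ?z \<ge> 3/4 - 36 * (wt x)\<^sup>2" using p' by linarith
      then have 1: "p' ?z * (f x)\<^sup>2 \<ge> (3/4 - 36 * (wt x)\<^sup>2) * (f x)\<^sup>2" by (intro mult_right_mono) auto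
      have "0 \<le> (f x / 2 + 2 * (p ?z * pd 3 f x))\<^sup>2" by simp
      then have 2: "2 * p ?z * f x * pd 3 f x \<ge> - (1/4) * (f x)\<^sup>2 - 4 * ((p ?z)\<^sup>2 * (pd 3 f x)\<^sup>2)"
        by (simp add: power2_eq_square algebra_simps)
      have 3: "(p ?z)\<^sup>2 * (pd 3 f x)\<^sup>2 \<le> (wt x)\<^sup>2 * (pd 3 f x)\<^sup>2" using p by (intro mult_right_mono) auto
      show ?thesis unfolding pdF[OF xs] B_def using 1 2 3 by (simp add: algebra_simps)
    qed
    have "(\<integral>\<^sup>+x. indicator (cbox (low n) (high n)) x * ennreal ((1/2) * (f x)\<^sup>2) \<partial>lborel)
      \<le> (\<integral>\<^sup>+x. indicator (cbox (low n) (high n)) x * ennreal (B x) \<partial>lborel)"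
    proof (rule cbox_ineq[OF open_slab Q, where F=F])
      show "smooth_on slab (F i)" for i unfolding F_def p_def
        by (auto intro!: smooth_on_intros open_slab f)
      fix i :: 3 and x :: "real^3"
      show "F i (x + (high n $ i - x $ i) *\<^sub>R axis i 1) \<le> F i (x + (low n $ i - x $ i) *\<^sub>R axis i 1)"
        by (auto simp: F_def p_def axis_def e_def)
    qed (use le B0 in \<open>auto intro!: continuous_intros cont B\<close>)
    also have "\<dots> \<le> slab_nn B" using n B0 by (intro cbox_nn_le_slab_nn) auto
    finally show ?thesis .
  qed
  have "slab_nn (\<lambda>x. (1/2) * (f x)\<^sup>2) \<le> slab_nn B"
  proof (rule slab_nn_Fatou[where A="\<lambda>n x. (1/2) * (f x)\<^sup>2"])
  qed (rule main tendsto_const | assumption | intro continuous_intros cont)+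
  also have "slab_nn B = ennreal 36 * slab_nn (\<lambda>x. (wt x)\<^sup>2 * (f x)\<^sup>2) + ennreal 4 * slab_nn (\<lambda>x. (wt x)\<^sup>2 * (pd 3 f x)\<^sup>2)"
  proof -
    have c: "continuous_on slab (\<lambda>x. (wt x)\<^sup>2 * (f x)\<^sup>2)" "continuous_on slab (\<lambda>x. (wt x)\<^sup>2 * (pd 3 f x)\<^sup>2)"
      by (intro continuous_intros cont)+
    show ?thesis unfolding B_def[abs_def]
      by (subst slab_nn_add) (auto intro!: continuous_intros c simp: slab_nn_cmult[OF c(1)] slab_nn_cmult[OF c(2)])
  qed
  finally have "ennreal 2 * slab_nn (\<lambda>x. (1/2) * (f x)\<^sup>2) \<le> ennreal 2 * (ennreal 36 * slab_nn (\<lambda>x. (wt x)\<^sup>2 * (f x)\<^sup>2) + ennreal 4 * slab_nn (\<lambda>x. (wt x)\<^sup>2 * (pd 3 f x)\<^sup>2))"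
    by (rule mult_left_mono) simp
  also have "\<dots> = ennreal 72 * slab_nn (\<lambda>x. (wt x)\<^sup>2 * (f x)\<^sup>2) + ennreal 8 * slab_nn (\<lambda>x. (wt x)\<^sup>2 * (pd 3 f x)\<^sup>2)"
    by (simp add: distrib_left mult.assoc[symmetric] ennreal_mult[symmetric])
  also have "ennreal 2 * slab_nn (\<lambda>x. (1/2) * (f x)\<^sup>2) = slab_nn (\<lambda>x. (f x)\<^sup>2)"
    by (subst slab_nn_cmult[symmetric]) (auto intro!: continuous_intros cont)
  finally show ?thesis .
qed

text \<open>On each half of the slab the multiplier is x_3 - c with c the height of the outer face:
  this factor kills the outer face, \<open>f\<close> kills the middle one. The divergence now
  contains f^2 with coefficient 1 throughout, so no weighted term in f itself appears. The other
  factor of the weight is at least 1/2 on that half, whence |x_3 - c| \<le> 2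
  \<open>wt\<close>.\<close>

lemma Hardy_midplane:
  assumes f: "smooth_on slab f" and mid: "\<And>x. x $ 3 = 1/2 \<Longrightarrow> f x = 0"
  shows "slab_nn (\<lambda>x. (f x)\<^sup>2) \<le> ennreal 32 * slab_nn (\<lambda>x. (wt x)\<^sup>2 * (pd 3 f x)\<^sup>2)"
proof -
  note cont = smooth_on_continuous[OF f] smooth_on_continuous[OF smooth_on_pd[OF f]]
    smooth_on_continuous[OF smooth_on_wt[OF open_slab]]
  define B where "B x = 8 * ((wt x)\<^sup>2 * (pd 3 f x)\<^sup>2)" for x
  have B: "continuous_on slab B" unfolding B_def[abs_def] by (intro continuous_intros cont)
  have B0: "0 \<le> B x" for x by (simp add: B_def)
  have half: "(\<integral>\<^sup>+x. indicator (cbox a b) x * ennreal ((1/2) * (f x)\<^sup>2) \<partial>lborel) \<le> slab_nn B"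
    if ab: "cbox a b \<subseteq> slab" "(c = a $ 3 \<and> b $ 3 = 1/2) \<or> (c = b $ 3 \<and> a $ 3 = 1/2)"
      "\<And>x. x \<in> cbox a b \<Longrightarrow> (x $ 3 - c)\<^sup>2 \<le> 4 * (wt x)\<^sup>2" for a b :: "real^3" and c
  proof -
    define F where "F i = (if i = (3::3) then (\<lambda>x. (x $ 3 - c) * (f x * f x)) else (\<lambda>x. 0))" for i
    have pdF: "(\<Sum>i\<in>UNIV. pd i (F i) x) = (f x)\<^sup>2 + 2 * (x $ 3 - c) * f x * pd 3 f x" if "x \<in> slab" for x
      using smooth_on_differentiable[OF f that]
      by (simp add: F_def sum_3 pd_mult pd_diff differentiable_mult differentiable_diff power2_eq_square algebra_simps)
    have le: "(1/2) * (f x)\<^sup>2 \<le> B x + (\<Sum>i\<in>UNIV. pd i (F i) x)" if x: "x \<in> cbox a b" for x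
    proof -
      have xs: "x \<in> slab" using x ab by auto
      have "(x $ 3 - c)\<^sup>2 * (pd 3 f x)\<^sup>2 \<le> 4 * (wt x)\<^sup>2 * (pd 3 f x)\<^sup>2" using ab(3)[OF x] by (intro mult_right_mono) auto
      moreover have "0 \<le> (f x + 2 * ((x $ 3 - c) * pd 3 f x))\<^sup>2" by simp
      ultimately show ?thesis unfolding pdF[OF xs] B_def by (simp add: power2_eq_square algebra_simps)
    qed
    have "(\<integral>\<^sup>+x. indicator (cbox a b) x * ennreal ((1/2) * (f x)\<^sup>2) \<partial>lborel)
      \<le> (\<integral>\<^sup>+x. indicator (cbox a b) x * ennreal (B x) \<partial>lborel)"
    proof (rule cbox_ineq[OF open_slab ab(1), where F=F])
      show "smooth_on slab (F i)" for i unfolding F_def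
        by (auto intro!: smooth_on_intros open_slab f)
      fix i :: 3 and x :: "real^3"
      show "F i (x + (b $ i - x $ i) *\<^sub>R axis i 1) \<le> F i (x + (a $ i - x $ i) *\<^sub>R axis i 1)"
        using ab(2) by (auto simp: F_def axis_def mid)
    qed (use le B0 in \<open>auto intro!: continuous_intros cont B\<close>)
    also have "\<dots> \<le> slab_nn B" unfolding slab_nn_def using ab(1)
      by (intro nn_integral_mono) (auto split: split_indicator)
    finally show ?thesis .
  qed
  have main: "(\<integral>\<^sup>+x. indicator (cbox (low n) (high n)) x * ennreal ((1/2) * (f x)\<^sup>2) \<partial>lborel) \<le> slab_nn B + slab_nn B"
    if n: "n \<ge> 2" for n :: nat
  proof -
    define e where "e = 1 / real n"
    have e: "0 < e" "e \<le> 1/2" using n by (auto simp: e_def field_simps)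
    have Q: "cbox (low n) (high n) \<subseteq> slab" using n by (intro slab_box_subset) auto
    define m1 m2 :: "real^3" where "m1 = (\<chi> i. if i = 3 then 1/2 else low n $ i)" and "m2 = (\<chi> i. if i = 3 then 1/2 else high n $ i)"
    have mem: "x \<in> cbox (low n) m2 \<longleftrightarrow> x \<in> cbox (low n) (high n) \<and> x $ 3 \<le> 1/2" 
       "x \<in> cbox m1 (high n) \<longleftrightarrow> x \<in> cbox (low n) (high n) \<and> x $ 3 \<ge> 1/2" for x
      using e by (auto simp: mem_box_cart forall_3 m1_def m2_def e_def)
    have sq: "s\<^sup>2 \<le> 4 * w\<^sup>2" if "\<bar>s\<bar> \<le> 2 * w" for s w :: real
      using power_mono[OF that abs_ge_zero, of 2] by (simp add: power_mult_distrib)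
    have 1: "(\<integral>\<^sup>+x. indicator (cbox (low n) m2) x * ennreal ((1/2) * (f x)\<^sup>2) \<partial>lborel) \<le> slab_nn B"
    proof (rule half[where c=e])
      show "cbox (low n) m2 \<subseteq> slab" using Q mem by auto
      show "(e = low n $ 3 \<and> m2 $ 3 = 1/2) \<or> (e = m2 $ 3 \<and> low n $ 3 = 1/2)" by (simp add: e_def m2_def)
      fix x assume "x \<in> cbox (low n) m2"
      then have x: "e \<le> x $ 3" "x $ 3 \<le> 1/2" by (auto simp: mem mem_slab_box e_def)
      then have "x $ 3 * 1 \<le> x $ 3 * (2 * (1 - x $ 3))" using e by (intro mult_left_mono) auto
      then show "(x $ 3 - e)\<^sup>2 \<le> 4 * (wt x)\<^sup>2" using x e unfolding wt_def by (intro sq) linarith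
    qed
    have 2: "(\<integral>\<^sup>+x. indicator (cbox m1 (high n)) x * ennreal ((1/2) * (f x)\<^sup>2) \<partial>lborel) \<le> slab_nn B"
    proof (rule half[where c="1 - e"])
      show "cbox m1 (high n) \<subseteq> slab" using Q mem by auto
      show "(1 - e = m1 $ 3 \<and> high n $ 3 = 1/2) \<or> (1 - e = high n $ 3 \<and> m1 $ 3 = 1/2)" by (simp add: e_def m1_def)
      fix x assume "x \<in> cbox m1 (high n)"
      then have x: "1/2 \<le> x $ 3" "x $ 3 \<le> 1 - e" by (auto simp: mem mem_slab_box e_def)
      then have "(1 - x $ 3) * 1 \<le> (1 - x $ 3) * (2 * x $ 3)" using e by (intro mult_left_mono) auto
      then have "1 - x $ 3 \<le> 2 * (x $ 3 * (1 - x $ 3))" by (simp add: algebra_simps)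
      then show "(x $ 3 - (1 - e))\<^sup>2 \<le> 4 * (wt x)\<^sup>2" using x e unfolding wt_def by (intro sq) linarith
    qed
    have c: "continuous_on (cbox a b) (\<lambda>x. (1/2) * (f x)\<^sup>2)" if "cbox a b \<subseteq> slab" for a b
      by (rule continuous_on_subset[OF _ that]) (intro continuous_intros cont)
    have meas: "(\<lambda>x. indicator (cbox a b) x * ennreal ((1/2) * (f x)\<^sup>2)) \<in> borel_measurable borel" if "cbox a b \<subseteq> slab" for a b
    proof -
      have "(\<lambda>x. ennreal (indicator (cbox a b) x *\<^sub>R ((1/2) * (f x)\<^sup>2))) \<in> borel_measurable borel"
        by (intro measurable_compose[OF borel_measurable_continuous_on_indicator[OF _ c[OF that]]]) auto
      moreover have "(\<lambda>x. ennreal (indicator (cbox a b) x *\<^sub>R ((1/2) * (f x)\<^sup>2))) = (\<lambda>x. indicator (cbox a b) x * ennreal ((1/2) * (f x)\<^sup>2))"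
        by (auto split: split_indicator)
      ultimately show ?thesis by (simp only:)
    qed
    have "(\<integral>\<^sup>+x. indicator (cbox (low n) (high n)) x * ennreal ((1/2) * (f x)\<^sup>2) \<partial>lborel) \<le>
      (\<integral>\<^sup>+x. indicator (cbox (low n) m2) x * ennreal ((1/2) * (f x)\<^sup>2) + indicator (cbox m1 (high n)) x * ennreal ((1/2) * (f x)\<^sup>2) \<partial>lborel)"
      by (intro nn_integral_mono) (auto split: split_indicator simp: mem)
    also have "\<dots> \<le> slab_nn B + slab_nn B"
    proof (subst nn_integral_add)
      show "(\<lambda>x. indicator (cbox (low n) m2) x * ennreal ((1/2) * (f x)\<^sup>2)) \<in> borel_measurable lborel"
        "(\<lambda>x. indicator (cbox m1 (high n)) x * ennreal ((1/2) * (f x)\<^sup>2)) \<in> borel_measurable lborel"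
        using Q mem meas[of "low n" m2] meas[of m1 "high n"] by (simp_all add: subset_iff)
    qed (rule add_mono[OF 1 2])
    finally show ?thesis .
  qed
  have "slab_nn (\<lambda>x. (1/2) * (f x)\<^sup>2) \<le> slab_nn B + slab_nn B"
  proof (rule slab_nn_Fatou[where A="\<lambda>n x. (1/2) * (f x)\<^sup>2"])
  qed (rule main tendsto_const | assumption | intro continuous_intros cont)+
  also have "\<dots> = ennreal 16 * slab_nn (\<lambda>x. (wt x)\<^sup>2 * (pd 3 f x)\<^sup>2)"
    unfolding B_def[abs_def] by (subst (1 2) slab_nn_cmult) (auto intro!: continuous_intros cont simp: distrib_right[symmetric])
  finally have "ennreal 2 * slab_nn (\<lambda>x. (1/2) * (f x)\<^sup>2) \<le> ennreal 2 * (ennreal 16 * slab_nn (\<lambda>x. (wt x)\<^sup>2 * (pd 3 f x)\<^sup>2))"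
    by (rule mult_left_mono) simp
  also have "\<dots> = ennreal 32 * slab_nn (\<lambda>x. (wt x)\<^sup>2 * (pd 3 f x)\<^sup>2)"
    by (simp add: mult.assoc[symmetric] ennreal_mult[symmetric])
  also have "ennreal 2 * slab_nn (\<lambda>x. (1/2) * (f x)\<^sup>2) = slab_nn (\<lambda>x. (f x)\<^sup>2)"
    by (subst slab_nn_cmult[symmetric]) (auto intro!: continuous_intros cont)
  finally show ?thesis .
qed

section \<open>Induction on the number of derivatives of a harmonic function\<close>

lemma smooth_on_lap: "open U \<Longrightarrow> smooth_on U f \<Longrightarrow> smooth_on U (lap f)"
  unfolding lap_def[abs_def] by (intro smooth_on_intros smooth_on_pd)

lemma lap_pd:
  assumes f: "smooth_on slab f" and harm: "\<And>x. x \<in> slab \<Longrightarrow> lap f x = 0" and x: "x \<in> slab"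
  shows "lap (pd i f) x = 0"
proof -
  have "lap (pd i f) x = (\<Sum>j\<in>UNIV. pd i (pd j (pd j f)) x)"
    unfolding lap_def
  proof (intro sum.cong refl)
    fix j
    have "pds [j, j, i] f x = pds [i, j, j] f x" by (rule pds_perm[OF open_slab f x]) simp
    then show "pd j (pd j (pd i f)) x = pd i (pd j (pd j f)) x" by simp
  qed
  also have "\<dots> = pd i (\<lambda>x. \<Sum>j\<in>UNIV. pd j (pd j f) x) x"
    using smooth_on_differentiable[OF smooth_on_pd[OF smooth_on_pd[OF f]] x]
    by (simp add: sum_3 pd_add differentiable_add)
  also have "\<dots> = pd i (\<lambda>x. 0) x"
    by (rule pd_cong_open[OF open_slab x]) (use harm in \<open>simp add: lap_def\<close>)
  finally show ?thesis by simp
qed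

lemma lap_pds:
  assumes "smooth_on slab f" "\<And>x. x \<in> slab \<Longrightarrow> lap f x = 0" "x \<in> slab"
  shows "lap (pds is f) x = 0"
  using assms(3) by (induction "is" arbitrary: x) (auto intro: lap_pd smooth_on_pds assms)

lemma weighted_pd_le:
  assumes u: "smooth_on slab u" and harm: "\<And>x. x \<in> slab \<Longrightarrow> lap u x = 0"
  shows "slab_nn (\<lambda>x. (wt x)\<^sup>2 * (pd i u x)\<^sup>2) \<le> ennreal 3 * slab_nn (\<lambda>x. (u x)\<^sup>2)"
proof (rule order_trans[OF slab_nn_mono Caccioppoli[OF u harm]])
  fix x
  have "(pd i u x)\<^sup>2 \<le> (\<Sum>i\<in>UNIV. (pd i u x)\<^sup>2)" by (intro member_le_sum) auto
  then show "(wt x)\<^sup>2 * (pd i u x)\<^sup>2 \<le> (wt x)\<^sup>2 * (\<Sum>i\<in>UNIV. (pd i u x)\<^sup>2)" by (rule mult_left_mono) simp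
qed

text \<open>The weight in Hardy's inequality absorbs one derivative, by Caccioppoli's inequality: in the second
  term a horizontal one, since \<open>\<partial>\<^sub>3\<partial>\<^sub>i\<partial>\<^sub>hf = \<partial>\<^sub>h(\<partial>\<^sub>i\<partial>\<^sub>3f)\<close>.\<close>

lemma horizontal_step:
  assumes f: "smooth_on slab f" and harm: "\<And>x. x \<in> slab \<Longrightarrow> lap f x = 0"
  shows "slab_nn (\<lambda>x. (pd i (pd h f) x)\<^sup>2) \<le> ennreal 216 * slab_nn (\<lambda>x. (pd h f x)\<^sup>2) + ennreal 24 * slab_nn (\<lambda>x. (pd i (pd 3 f) x)\<^sup>2)"
proof -
  have "slab_nn (\<lambda>x. (wt x)\<^sup>2 * (pd i (pd h f) x)\<^sup>2) \<le> ennreal 3 * slab_nn (\<lambda>x. (pd h f x)\<^sup>2)"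
    by (rule weighted_pd_le) (auto intro: smooth_on_pd f lap_pd harm)
  moreover have "slab_nn (\<lambda>x. (wt x)\<^sup>2 * (pd h (pd i (pd 3 f)) x)\<^sup>2) \<le> ennreal 3 * slab_nn (\<lambda>x. (pd i (pd 3 f) x)\<^sup>2)"
    by (rule weighted_pd_le) (auto intro: smooth_on_pd f lap_pd harm)
  moreover have "slab_nn (\<lambda>x. (wt x)\<^sup>2 * (pd 3 (pd i (pd h f)) x)\<^sup>2) = slab_nn (\<lambda>x. (wt x)\<^sup>2 * (pd h (pd i (pd 3 f)) x)\<^sup>2)"
  proof (rule slab_nn_cong)
    fix x assume x: "x \<in> slab"
    have "pds [3, i, h] f x = pds [h, i, 3] f x" by (rule pds_perm[OF open_slab f x]) simp
    then show "(wt x)\<^sup>2 * (pd 3 (pd i (pd h f)) x)\<^sup>2 = (wt x)\<^sup>2 * (pd h (pd i (pd 3 f)) x)\<^sup>2" by simp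
  qed
  moreover note Hardy[OF smooth_on_pd[OF smooth_on_pd[OF f]], of i h]
  ultimately have "slab_nn (\<lambda>x. (pd i (pd h f) x)\<^sup>2) \<le>
      ennreal 72 * (ennreal 3 * slab_nn (\<lambda>x. (pd h f x)\<^sup>2)) + ennreal 8 * (ennreal 3 * slab_nn (\<lambda>x. (pd i (pd 3 f) x)\<^sup>2))"
    by (elim order_trans) (intro add_mono mult_left_mono; simp)
  then show ?thesis by (simp add: mult.assoc[symmetric] ennreal_mult[symmetric])
qed

text \<open>Every letter of the word costs one \<open>horizontal_step\<close>, applied to the
  harmonic function \<open>pds is f\<close>, and multiplies the bound by 216 + 24 = 240. The
  induction removes letters from the front, so vertical derivatives are needed along all suffixes of
  the word.\<close>

lemma horizontal_iterate:
  assumes f: "smooth_on slab f" and harm: "\<And>x. x \<in> slab \<Longrightarrow> lap f x = 0"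
    and base: "slab_nn (\<lambda>x. (pd h f x)\<^sup>2) \<le> T"
    and suffix: "\<And>js. (\<exists>ks. is = ks @ js) \<Longrightarrow> slab_nn (\<lambda>x. (pds js (pd 3 f) x)\<^sup>2) \<le> T"
  shows "slab_nn (\<lambda>x. (pds is (pd h f) x)\<^sup>2) \<le> ennreal (240 ^ length is) * T"
  using suffix
proof (induction "is")
  case (Cons i "is")
  have IH: "slab_nn (\<lambda>x. (pds is (pd h f) x)\<^sup>2) \<le> ennreal (240 ^ length is) * T"
    by (rule Cons.IH, rule Cons.prems) (metis append_Cons)
  have e: "pds js (pd k f) x = pd k (pds js f) x" if "x \<in> slab" for js k x
    using pds_perm[OF open_slab f that, of "js @ [k]" "k # js"] by simp
  have e2: "pds (i # js) (pd k f) x = pd i (pd k (pds js f)) x" if "x \<in> slab" for js k x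
  proof -
    have "pd i (pds js (pd k f)) x = pd i (pd k (pds js f)) x" by (rule pd_cong_open[OF open_slab that e])
    then show ?thesis by simp
  qed
  have "slab_nn (\<lambda>x. (pds (i # is) (pd h f) x)\<^sup>2) = slab_nn (\<lambda>x. (pd i (pd h (pds is f)) x)\<^sup>2)"
    by (intro slab_nn_cong) (simp only: e2)
  also have "\<dots> \<le> ennreal 216 * slab_nn (\<lambda>x. (pd h (pds is f) x)\<^sup>2) + ennreal 24 * slab_nn (\<lambda>x. (pd i (pd 3 (pds is f)) x)\<^sup>2)"
    by (rule horizontal_step) (auto intro: smooth_on_pds f lap_pds harm)
  also have "slab_nn (\<lambda>x. (pd h (pds is f) x)\<^sup>2) = slab_nn (\<lambda>x. (pds is (pd h f) x)\<^sup>2)"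
    by (intro slab_nn_cong) (simp only: e)
  also have "slab_nn (\<lambda>x. (pd i (pd 3 (pds is f)) x)\<^sup>2) = slab_nn (\<lambda>x. (pds (i # is) (pd 3 f) x)\<^sup>2)"
    by (intro slab_nn_cong) (simp only: e2)
  also have "ennreal 216 * slab_nn (\<lambda>x. (pds is (pd h f) x)\<^sup>2) + ennreal 24 * slab_nn (\<lambda>x. (pds (i # is) (pd 3 f) x)\<^sup>2)
     \<le> ennreal 216 * (ennreal (240 ^ length is) * T) + ennreal 24 * (ennreal (240 ^ length is) * T)"
  proof (intro add_mono mult_left_mono IH)
    have "slab_nn (\<lambda>x. (pds (i # is) (pd 3 f) x)\<^sup>2) \<le> 1 * T" using Cons.prems[of "i # is"] by simp
    also have "\<dots> \<le> ennreal (240 ^ length is) * T" by (intro mult_right_mono) auto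
    finally show "slab_nn (\<lambda>x. (pds (i # is) (pd 3 f) x)\<^sup>2) \<le> ennreal (240 ^ length is) * T" .
  qed auto
  also have "\<dots> = (ennreal 216 + ennreal 24) * (ennreal (240 ^ length is) * T)" by (simp only: distrib_right)
  also have "\<dots> = ennreal (240 ^ length (i # is)) * T"
    by (simp add: ennreal_mult' mult.assoc)
  finally show ?case .
qed (use base in simp)

section \<open>Weak derivatives\<close>

text \<open>The face inequality holds for the function and for its negative on a box beyond the
  support, so both signs of the integral are excluded.\<close>

lemma test_fun_lborel:
  assumes "\<psi> \<in> test_fun UNIV" shows "integrable lborel \<psi>" "(\<integral>x. pd i \<psi> x \<partial>lborel) = 0"
proof -
  obtain K where sm: "smooth_on UNIV \<psi>" and K: "compact K" "\<And>x. x \<notin> K \<Longrightarrow> \<psi> x = 0" using assms by (rule test_funE) blast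
  obtain c where c: "K \<subseteq> cbox (- c) c" using compact_imp_bounded[OF K(1)] bounded_subset_cbox_symmetric by blast
  \<comment> \<open>Enlarging by 1 in each direction puts all faces outside the box that contains
    the support.\<close>
  define a b where "a = - c - vec 1" and "b = c + vec 1"
  have out: "\<psi> x = 0" if "x \<notin> cbox (- c) c" for x using that c K(2) by auto
  have sub: "cbox (- c) c \<subseteq> cbox a b" by (auto simp: a_def b_def mem_box_cart) (smt (verit))+
  have face: "\<psi> x = 0" if "x $ i = a $ i \<or> x $ i = b $ i" for x i
    using that by (intro out) (auto simp: a_def b_def mem_box_cart intro!: exI[of _ i])
  have f: "\<psi> (x + (a $ i - x $ i) *\<^sub>R axis i 1) = 0" "\<psi> (x + (b $ i - x $ i) *\<^sub>R axis i 1) = 0" for x i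
    by (auto intro!: face[of _ i] simp: axis_def)
  have pd0: "pd i \<psi> x = 0" if "x \<notin> cbox a b" for i x
    using that sub by (intro pd_zero_outside[of "cbox (- c) c"] out) auto
  have eq: "indicator (cbox a b) x * \<psi> x = \<psi> x" for x using out sub by (auto split: split_indicator)
  show "integrable lborel \<psi>"
    using borel_integrable_compact[OF compact_cbox test_fun_continuous[OF assms], of a b] by (simp add: eq)
  have eq2: "indicator (cbox a b) x * pd i \<psi> x = pd i \<psi> x" for x using pd0 by (auto split: split_indicator)
  have "(\<integral>x. indicator (cbox a b) x * pd i \<psi> x \<partial>lborel) \<le> 0"
    using sm by (intro cbox_pd_integral_le_0)
      (auto intro: smooth_on_differentiable test_fun_continuous[OF test_fun_pd[OF assms]] simp: f)
  moreover have "(\<integral>x. indicator (cbox a b) x * pd i (\<lambda>x. 0 - \<psi> x) x \<partial>lborel) \<le> 0"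
  proof (intro cbox_pd_integral_le_0)
    have "smooth_on UNIV (\<lambda>x. 0 - \<psi> x)" using sm by (intro smooth_on_intros) auto
    then show "(\<lambda>x. 0 - \<psi> x) differentiable at x" "continuous_on (cbox a b) (pd i (\<lambda>x. 0 - \<psi> x))" for x
      using smooth_on_differentiable continuous_on_subset[OF smooth_on_continuous[OF smooth_on_pd]] by blast+
  qed (simp add: f)
  moreover have "pd i (\<lambda>x. 0 - \<psi> x) x = - pd i \<psi> x" for x
    using smooth_on_differentiable[OF sm] by (subst pd_diff) auto
  ultimately show "(\<integral>x. pd i \<psi> x \<partial>lborel) = 0" by (simp add: eq2)
qed

lemma LINT_slab_test:
  fixes f :: "real^3 \<Rightarrow> 'b::euclidean_space"
  assumes "\<psi> \<in> test_fun slab"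
  shows "(LINT x|lebesgue_on slab. \<psi> x *\<^sub>R f x) = (LINT x|lebesgue. \<psi> x *\<^sub>R f x)"
proof -
  obtain K where K: "K \<subseteq> slab" "\<And>x. x \<notin> K \<Longrightarrow> \<psi> x = 0" using assms by (rule test_funE) blast
  have "indicator slab x *\<^sub>R \<psi> x *\<^sub>R f x = \<psi> x *\<^sub>R f x" for x using K by (auto split: split_indicator)
  then have "(\<lambda>x. indicator slab x *\<^sub>R \<psi> x *\<^sub>R f x) = (\<lambda>x. \<psi> x *\<^sub>R f x)" by (rule ext)
  moreover have "(LINT x|lebesgue_on slab. \<psi> x *\<^sub>R f x) = (LINT x|lebesgue. indicator slab x *\<^sub>R \<psi> x *\<^sub>R f x)"
    by (rule integral_restrict_space) simp
  ultimately show ?thesis by (simp only:)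
qed

lemma test_fun_measurable: "\<psi> \<in> test_fun S \<Longrightarrow> \<psi> \<in> borel_measurable borel"
  by (intro borel_measurable_continuous_onI test_fun_continuous)

lemma integrable_mult_test:
  fixes f :: "real^3 \<Rightarrow> 'b::euclidean_space"
  assumes f: "loc_integrable f" and \<psi>: "\<psi> \<in> test_fun slab"
  shows "integrable lebesgue (\<lambda>x. \<psi> x *\<^sub>R f x)"
proof -
  obtain K where K: "compact K" "K \<subseteq> slab" "\<And>x. x \<notin> K \<Longrightarrow> \<psi> x = 0" using \<psi> by (rule test_funE) blast
  obtain B where B: "B \<ge> 0" "\<And>x. \<bar>\<psi> x\<bar> \<le> B" using test_fun_bounded[OF \<psi>] by blast
  have KL: "K \<in> sets lebesgue" using K(1) by (simp add: compact_imp_closed)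
  have i: "integrable lebesgue (\<lambda>x. indicator K x *\<^sub>R f x)"
    using f K(1,2) KL by (subst integrable_restrict_space[symmetric]) (auto simp: loc_integrable_def)
  have [measurable]: "\<psi> \<in> borel_measurable lebesgue" using test_fun_measurable[OF \<psi>] by (intro measurable_completion) simp
  have "integrable lebesgue (\<lambda>x. \<psi> x *\<^sub>R (indicator K x *\<^sub>R f x))"
  proof (rule Bochner_Integration.integrable_bound)
    show "integrable lebesgue (\<lambda>x. B *\<^sub>R (indicator K x *\<^sub>R f x))" using i by (intro integrable_scaleR_right)
    show "(\<lambda>x. \<psi> x *\<^sub>R indicator K x *\<^sub>R f x) \<in> borel_measurable lebesgue"
      using borel_measurable_integrable[OF i] by measurable
    show "AE x in lebesgue. norm (\<psi> x *\<^sub>R indicator K x *\<^sub>R f x) \<le> norm (B *\<^sub>R indicator K x *\<^sub>R f x)"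
      using B by (intro AE_I2) (auto split: split_indicator intro!: mult_right_mono)
  qed
  moreover have "(\<lambda>x. \<psi> x *\<^sub>R (indicator K x *\<^sub>R f x)) = (\<lambda>x. \<psi> x *\<^sub>R f x)" using K(3) by (auto split: split_indicator)
  ultimately show ?thesis by (simp only:)
qed

lemma loc_integrable_continuous:
  fixes f :: "real^3 \<Rightarrow> real"
  assumes "continuous_on slab f" shows "loc_integrable f"
  unfolding loc_integrable_def
proof (intro allI impI)
  fix K :: "(real^3) set" assume K: "compact K" "K \<subseteq> slab"
  have "integrable lborel (\<lambda>x. indicator K x *\<^sub>R f x)"
    by (rule borel_integrable_compact[OF K(1) continuous_on_subset[OF assms K(2)]])
  then have "integrable lebesgue (\<lambda>x. indicator K x *\<^sub>R f x)"
    by (subst integrable_completion) auto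
  then show "integrable (lebesgue_on K) f"
    using K(1) by (subst integrable_restrict_space) (auto simp: compact_imp_closed)
qed

text \<open>The product f \<psi>, which vanishes near the boundary of the slab, is itself a test
  function, and the integral of its derivative is 0. This is the product rule integrated.\<close>

lemma weak_by_parts:
  assumes f: "smooth_on slab f" and \<psi>: "\<psi> \<in> test_fun slab"
  shows "(LINT x|lebesgue. pd i \<psi> x * f x) = - (LINT x|lebesgue. \<psi> x * pd i f x)"
proof -
  note li = loc_integrable_continuous[OF smooth_on_continuous[OF f]] loc_integrable_continuous[OF smooth_on_continuous[OF smooth_on_pd[OF f]]]
  note i1 = integrable_mult_test[OF li(1) test_fun_pd[OF \<psi>], of i, simplified] and i2 = integrable_mult_test[OF li(2) \<psi>, of i, simplified]
  have t: "(\<lambda>x. f x * \<psi> x) \<in> test_fun slab" by (rule test_fun_mult[OF open_slab f \<psi>])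
  have tU: "(\<lambda>x. f x * \<psi> x) \<in> test_fun UNIV" using t by (rule test_fun_mono[rotated]) simp
  obtain K where K: "compact K" "K \<subseteq> slab" "\<And>x. x \<notin> K \<Longrightarrow> \<psi> x = 0" using \<psi> by (rule test_funE) blast
  obtain sm: "smooth_on UNIV \<psi>" using \<psi> by (auto simp: test_fun_def smooth_fun_iff)
  have "pd i (\<lambda>x. f x * \<psi> x) x = pd i \<psi> x * f x + \<psi> x * pd i f x" for x
  proof (cases "x \<in> slab")
    case True
    then show ?thesis using smooth_on_differentiable[OF f] smooth_on_differentiable[OF sm] by (simp add: pd_mult mult.commute)
  next
    case False
    then have x: "x \<notin> K" using K by auto
    have "closed K" using K(1) by (rule compact_imp_closed)
    then show ?thesis using pd_zero_outside[of K \<psi> x i] pd_zero_outside[of K "\<lambda>x. f x * \<psi> x" x i] K(3) x by auto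
  qed
  then have "(LINT x|lebesgue. pd i \<psi> x * f x + \<psi> x * pd i f x) = (LINT x|lebesgue. pd i (\<lambda>x. f x * \<psi> x) x)" by simp
  also have "\<dots> = 0"
    using test_fun_lborel(2)[OF tU, of i] test_fun_measurable[OF test_fun_pd[OF tU], of i] by (subst integral_completion) auto
  finally show ?thesis using i1 i2 by simp
qed

text \<open>Integration by parts peels off the outermost derivative of \<psi> first and stacks the
  letters on f in the opposite order, hence the reversal. It is harmless since derivatives
  commute.\<close>

lemma weak_by_parts_pds:
  assumes "smooth_on slab f" "\<psi> \<in> test_fun slab"
  shows "(LINT x|lebesgue. pds is \<psi> x * f x) = (- 1) ^ length is * (LINT x|lebesgue. \<psi> x * pds (rev is) f x)"
  using assms
proof (induction "is" arbitrary: f)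
  case (Cons i "is")
  have "(LINT x|lebesgue. pds (i # is) \<psi> x * f x) = - (LINT x|lebesgue. pds is \<psi> x * pd i f x)"
    using weak_by_parts[OF Cons.prems(1) test_fun_pds[OF Cons.prems(2)], of i "is"] by simp
  also have "\<dots> = - ((- 1) ^ length is * (LINT x|lebesgue. \<psi> x * pds (rev is) (pd i f) x))"
    by (subst Cons.IH) (auto intro: smooth_on_pd Cons.prems)
  finally show ?case by simp
qed simp

text \<open>The canonical word of a multi-index, in the order used by \<open>mpderiv\<close>.
  Passing to words makes the permutation lemma \<open>pds_perm\<close> available for
  multi-indices.\<close>

definition word :: "multi_index \<Rightarrow> 3 list" where
  "word \<alpha> = replicate (\<alpha> $ 1) 1 @ replicate (\<alpha> $ 2) 2 @ replicate (\<alpha> $ 3) 3"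

lemma length_word: "length (word \<alpha>) = mi_order \<alpha>"
  by (simp add: word_def mi_order_def sum_3)

lemma pds_replicate: "pds (replicate n i) f = (pd i ^^ n) f"
  by (induction n) auto

lemma mpderiv_word: "mpderiv \<alpha> f = pds (word \<alpha>) f"
  by (simp add: mpderiv_def word_def pds_replicate)

lemma has_weak_pderiv_smooth:
  assumes f: "smooth_on slab f" shows "has_weak_pderiv \<alpha> f (pds (word \<alpha>) f)"
  unfolding has_weak_pderiv_def
proof (intro conjI ballI)
  fix \<psi> assume \<psi>: "\<psi> \<in> test_fun slab"
  have "(LINT x|lebesgue. \<psi> x * pds (rev (word \<alpha>)) f x) = (LINT x|lebesgue. \<psi> x * pds (word \<alpha>) f x)"
  proof (rule arg_cong[where f="integral\<^sup>L lebesgue"], rule ext)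
    fix x
    show "\<psi> x * pds (rev (word \<alpha>)) f x = \<psi> x * pds (word \<alpha>) f x"
    proof (cases "x \<in> slab")
      case True
      then show ?thesis using pds_perm[OF open_slab f True, of "rev (word \<alpha>)" "word \<alpha>"] by simp
    next
      case False
      then have "\<psi> x = 0" using \<psi> by (metis subsetD test_funE)
      then show ?thesis by simp
    qed
  qed
  then show "(LINT x|lebesgue_on slab. mpderiv \<alpha> \<psi> x *\<^sub>R f x) = (- 1) ^ mi_order \<alpha> *\<^sub>R (LINT x|lebesgue_on slab. \<psi> x *\<^sub>R pds (word \<alpha>) f x)"
    using weak_by_parts_pds[OF f \<psi>, of "word \<alpha>"] LINT_slab_test[OF test_fun_pds[OF \<psi>], of "word \<alpha>" f] LINT_slab_test[OF \<psi>, of "pds (word \<alpha>) f"]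
    by (simp add: mpderiv_word length_word)
qed (intro loc_integrable_continuous smooth_on_continuous smooth_on_pds f)+

text \<open>The positive and the negative part of \<open>g\<close> are densities of two finite
  measures that agree on boxes, a generator of the Borel sets stable under intersection. The
  measures coincide, hence the densities almost everywhere; as one of the two parts is 0 at each
  point, so is \<open>g\<close>.\<close>

lemma AE_zero_of_box_integrals:
  fixes g :: "real^3 \<Rightarrow> real"
  assumes int: "integrable lborel g" and box: "\<And>a b. (\<integral>x. indicator (box a b) x * g x \<partial>lborel) = 0"
  shows "AE x in lborel. g x = 0"
proof -
  have [measurable]: "g \<in> borel_measurable borel" using int by auto
  have fin: "(\<integral>\<^sup>+x. ennreal (g x) \<partial>lborel) < top" "(\<integral>\<^sup>+x. ennreal (- g x) \<partial>lborel) < top"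
    using int integrable_minus[OF int] by (auto simp: real_integrable_def less_top)
  have "density lborel (\<lambda>x. ennreal (g x)) = density lborel (\<lambda>x. ennreal (- g x))"
  proof (rule measure_eqI_generator_eq)
    let ?E = "range (\<lambda>(a, b). box a b :: (real^3) set)"
    show "Int_stable ?E" by (auto simp: Int_stable_def box_Int_box)
    show "?E \<subseteq> Pow UNIV" "sets (density lborel (\<lambda>x. ennreal (g x))) = sigma_sets UNIV ?E"
      "sets (density lborel (\<lambda>x. ennreal (- g x))) = sigma_sets UNIV ?E"
      by (simp_all add: borel_eq_box)
    let ?A = "\<lambda>n::nat. box (- (real n *\<^sub>R One)) (real n *\<^sub>R One) :: (real^3) set"
    show "range ?A \<subseteq> ?E" "(\<Union>i. ?A i) = UNIV" unfolding UN_box_eq_UNIV by auto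
    have "(\<integral>\<^sup>+x. ennreal (g x) * indicator (?A i) x \<partial>lborel) < top" for i
      by (rule le_less_trans[OF nn_integral_mono fin(1)]) (auto split: split_indicator)
    then show "emeasure (density lborel (\<lambda>x. ennreal (g x))) (?A i) \<noteq> \<infinity>" for i
      by (simp add: emeasure_density less_top)
    fix X assume "X \<in> ?E"
    then obtain a b where X: "X = box a b" by auto
    have i: "integrable lborel (\<lambda>x. indicator (box a b) x * g x)"
      using integrable_mult_indicator[OF _ int, of "box a b"] by simp
    have eq: "ennreal (indicator (box a b) x * h) = ennreal h * indicator (box a b) x" for h x
      by (auto split: split_indicator)
    have eq2: "ennreal (- (indicator (box a b) x * h)) = ennreal (- h) * indicator (box a b) x" for h x
      by (auto split: split_indicator)
    have A: "(\<integral>\<^sup>+x. ennreal (g x) * indicator (box a b) x \<partial>lborel) \<le> (\<integral>\<^sup>+x. ennreal (- g x) * indicator (box a b) x \<partial>lborel)"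
      using nn_integral_pos_le_neg[OF i] box[of a b] unfolding eq eq2 by simp
    have "(\<integral>x. - (indicator (box a b) x * g x) \<partial>lborel) \<le> 0" using box[of a b] i by simp
    from nn_integral_pos_le_neg[OF integrable_minus[OF i] this]
    have B: "(\<integral>\<^sup>+x. ennreal (- g x) * indicator (box a b) x \<partial>lborel) \<le> (\<integral>\<^sup>+x. ennreal (g x) * indicator (box a b) x \<partial>lborel)"
      unfolding minus_minus eq eq2 .
    show "emeasure (density lborel (\<lambda>x. ennreal (g x))) X = emeasure (density lborel (\<lambda>x. ennreal (- g x))) X"
      using A B by (simp add: X emeasure_density)
  qed
  then have "AE x in lborel. ennreal (g x) = ennreal (- g x)"
    using fin by (subst (asm) finite_density_unique) auto
  then show ?thesis
  proof eventually_elim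
    case (elim x)
    show ?case
    proof (cases "g x \<ge> 0")
      case True
      then have "ennreal (g x) = 0" using elim ennreal_neg[of "- g x"] by simp
      then show ?thesis using True by (simp add: ennreal_eq_0_iff)
    next
      case False
      then have "ennreal (- g x) = 0" using elim ennreal_neg[of "g x"] by simp
      then show ?thesis using False by (simp add: ennreal_eq_0_iff)
    qed
  qed
qed

lemma flat_exp_tendsto:
  "(\<lambda>n. flat_exp 0 (real n * t)) \<longlonglongrightarrow> (if t > 0 then 1 else 0)"
proof (cases "t > 0")
  case True
  have "(\<lambda>n. exp (- ((1 / t) / real n))) \<longlonglongrightarrow> exp (- 0)"
    by (intro tendsto_intros lim_const_over_n)
  moreover have "exp (- ((1 / t) / real n)) = flat_exp 0 (real n * t)" if "n > 0" for n
  proof -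
    have "- ((1 / t) / real n) = - 1 / (real n * t)" by (simp add: mult.commute)
    then show ?thesis using True that by (simp add: flat_exp_def)
  qed
  then have "\<forall>\<^sub>F n in sequentially. exp (- ((1 / t) / real n)) = flat_exp 0 (real n * t)"
    using eventually_gt_at_top[of 0] by (rule eventually_mono[rotated])
  ultimately have "(\<lambda>n. flat_exp 0 (real n * t)) \<longlonglongrightarrow> exp (- 0)" by (rule Lim_transform_eventually)
  then show ?thesis using True by simp
next
  case False
  then have "real n * t \<le> 0" for n by (intro mult_nonneg_nonpos) auto
  then have "flat_exp 0 (real n * t) = 0" for n by (simp add: flat_exp_def leD)
  then show ?thesis using False by simp
qed

lemma flat_exp_0_bounds: "0 \<le> flat_exp 0 t" "flat_exp 0 t \<le> 1"
proof -
  show "0 \<le> flat_exp 0 t" by (simp add: flat_exp_def)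
  have "exp (- 1 / t) \<le> exp 0" if "t > 0" unfolding exp_le_cancel_iff using that by (intro divide_nonpos_pos) auto
  then show "flat_exp 0 t \<le> 1" unfolding flat_exp_def by (cases "t > 0") (simp_all only: if_True if_False exp_zero power_0 div_by_1 zero_le_one)
qed

text \<open>A product of factors exp(-1/(n s)), with s the signed distance to a face, is a test
  function supported in the closed box. It is bounded by 1 and converges to the indicator of the
  open box, so dominated convergence carries the hypothesis over.\<close>

lemma box_integral_zero:
  fixes f :: "real^3 \<Rightarrow> real"
  assumes f: "loc_integrable f" and zero: "\<And>\<psi>. \<psi> \<in> test_fun slab \<Longrightarrow> (LINT x|lebesgue_on slab. \<psi> x * f x) = 0"
    and ab: "cbox a b \<subseteq> slab"
  shows "(LINT x|lebesgue. indicator (box a b) x * f x) = 0"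
proof -
  define \<psi> where "\<psi> n x = (\<Prod>i\<in>UNIV. flat_exp 0 (real n * (x $ i - a $ i)) * flat_exp 0 (real n * (b $ i - x $ i)))" for n and x :: "real^3"
  have sm: "smooth_on UNIV (\<psi> n)" for n
    unfolding \<psi>_def[abs_def] UNIV_3 by (simp, intro smooth_on_intros open_UNIV)
  have out: "\<psi> n x = 0" if x: "x \<notin> cbox a b" for n x
  proof -
    obtain i where "x $ i < a $ i \<or> b $ i < x $ i" using x unfolding mem_box_cart by (auto simp: not_le)
    then have "real n * (x $ i - a $ i) \<le> 0 \<or> real n * (b $ i - x $ i) \<le> 0"
      by (auto intro: mult_nonneg_nonpos)
    then have "flat_exp 0 (real n * (x $ i - a $ i)) * flat_exp 0 (real n * (b $ i - x $ i)) = 0"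
      by (auto simp: flat_exp_def)
    then show ?thesis unfolding \<psi>_def by (intro prod_zero) auto
  qed
  have bd: "\<bar>\<psi> n x\<bar> \<le> 1" for n x
    unfolding \<psi>_def abs_prod by (intro prod_le_1 conjI) (auto simp: abs_mult flat_exp_0_bounds intro!: mult_le_one)
  have test: "\<psi> n \<in> test_fun slab" for n
    using sm compact_cbox ab out by (rule test_funI)
  have KL: "cbox a b \<in> sets lebesgue" by simp
  have i: "integrable lebesgue (\<lambda>x. indicator (cbox a b) x *\<^sub>R f x)"
    using f ab by (subst integrable_restrict_space[symmetric]) (auto simp: loc_integrable_def)
  have "(\<lambda>n. LINT x|lebesgue. \<psi> n x * (indicator (cbox a b) x *\<^sub>R f x)) \<longlonglongrightarrow> (LINT x|lebesgue. indicator (box a b) x * (indicator (cbox a b) x *\<^sub>R f x))"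
  proof (rule integral_dominated_convergence[where w="\<lambda>x. norm (indicator (cbox a b) x *\<^sub>R f x)"])
    show "(\<lambda>x. indicator (box a b) x * (indicator (cbox a b) x *\<^sub>R f x)) \<in> borel_measurable lebesgue"
      by (intro borel_measurable_times borel_measurable_integrable[OF i] borel_measurable_indicator) simp
    have [measurable]: "\<psi> n \<in> borel_measurable lebesgue" for n using test_fun_measurable[OF test] by (intro measurable_completion) simp
    show "(\<lambda>x. \<psi> n x * (indicator (cbox a b) x *\<^sub>R f x)) \<in> borel_measurable lebesgue" for n
      by (intro borel_measurable_times borel_measurable_integrable[OF i]) simp
    show "integrable lebesgue (\<lambda>x. norm (indicator (cbox a b) x *\<^sub>R f x))" using i by (rule integrable_norm)
    have "(\<lambda>n. \<psi> n x) \<longlonglongrightarrow> indicator (box a b) x" for x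
    proof -
      have "(\<lambda>n. \<psi> n x) \<longlonglongrightarrow> (\<Prod>i\<in>UNIV. (if x $ i - a $ i > 0 then 1 else 0) * (if b $ i - x $ i > 0 then 1 else 0))"
        unfolding \<psi>_def by (intro tendsto_intros flat_exp_tendsto)
      moreover have "(\<Prod>i\<in>UNIV. (if x $ i - a $ i > 0 then 1 else 0) * (if b $ i - x $ i > 0 then 1 else 0)) = (indicator (box a b) x :: real)"
        unfolding UNIV_3 by (auto simp: mem_box_cart forall_3 split: split_indicator)
      ultimately show ?thesis by simp
    qed
    then show "AE x in lebesgue. (\<lambda>n. \<psi> n x * (indicator (cbox a b) x *\<^sub>R f x)) \<longlonglongrightarrow> indicator (box a b) x * (indicator (cbox a b) x *\<^sub>R f x)"
      by (intro AE_I2 tendsto_mult_right)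
    show "AE x in lebesgue. norm (\<psi> n x * (indicator (cbox a b) x *\<^sub>R f x)) \<le> norm (indicator (cbox a b) x *\<^sub>R f x)" for n
      using bd by (intro AE_I2) (auto simp: abs_mult intro!: mult_left_le_one_le)
  qed
  moreover have "(\<lambda>x. \<psi> n x * (indicator (cbox a b) x *\<^sub>R f x)) = (\<lambda>x. \<psi> n x *\<^sub>R f x)" for n using out by (auto split: split_indicator)
  moreover have "(LINT x|lebesgue. \<psi> n x *\<^sub>R f x) = 0" for n
    using zero[OF test] LINT_slab_test[OF test, where f=f] by simp
  moreover have "(\<lambda>x. indicator (box a b) x * (indicator (cbox a b) x *\<^sub>R f x)) = (\<lambda>x. indicator (box a b) x * f x)"
    by (auto simp: indicator_def box_subset_cbox[THEN subsetD])
  ultimately show ?thesis by (simp only: LIMSEQ_const_iff)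
qed

text \<open>On each box of the exhaustion \<open>f\<close> is integrable and agrees almost
  everywhere with a Borel function; the integrals of the latter over arbitrary boxes vanish, because
  the intersection of two boxes is a box inside the slab. Countably many exceptional sets are then
  discarded.\<close>

lemma fundamental_lemma:
  fixes f :: "real^3 \<Rightarrow> real"
  assumes f: "loc_integrable f" and zero: "\<And>\<psi>. \<psi> \<in> test_fun slab \<Longrightarrow> (LINT x|lebesgue_on slab. \<psi> x * f x) = 0"
  shows "AE x in lebesgue. x \<in> slab \<longrightarrow> f x = 0"
proof -
  have "AE x in lebesgue. indicator (box (low n) (high n)) x * f x = 0" for n
  proof (cases "n \<ge> 1")
    case False
    then show ?thesis by (intro AE_I2) (auto simp: mem_box_cart forall_3 split: split_indicator)
  next
    case True
    then have Q: "cbox (low n) (high n) \<subseteq> slab" by (rule slab_box_subset)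
    have i0: "integrable lebesgue (\<lambda>x. indicator (cbox (low n) (high n)) x *\<^sub>R f x)"
      using f Q by (subst integrable_restrict_space[symmetric]) (auto simp: loc_integrable_def)
    have i: "integrable lebesgue (\<lambda>x. indicator (box (low n) (high n)) x * f x)"
    proof -
      have "integrable lebesgue (\<lambda>x. indicator (box (low n) (high n)) x *\<^sub>R (indicator (cbox (low n) (high n)) x *\<^sub>R f x))"
        by (rule integrable_mult_indicator[OF _ i0]) simp
      moreover have "(\<lambda>x. indicator (box (low n) (high n)) x *\<^sub>R (indicator (cbox (low n) (high n)) x *\<^sub>R f x)) = (\<lambda>x. indicator (box (low n) (high n)) x * f x)"
        by (auto simp: indicator_def box_subset_cbox[THEN subsetD])
      ultimately show ?thesis by (simp only:)
    qed
    obtain g where g[measurable]: "g \<in> borel_measurable lborel" and ae: "AE x in lborel. indicator (box (low n) (high n)) x * f x = g x"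
      using completion_ex_borel_measurable_real[OF borel_measurable_integrable[OF i]] by blast
    have ae': "AE x in lebesgue. indicator (box (low n) (high n)) x * f x = g x" using ae by (rule AE_completion)
    have gL[measurable]: "g \<in> borel_measurable lebesgue" using g by (rule measurable_completion)
    have "integrable lebesgue g" using i integrable_cong_AE[OF borel_measurable_integrable[OF i] gL ae'] by blast
    then have ig: "integrable lborel g" using integrable_completion[OF g] by simp
    have "AE x in lborel. g x = 0"
    proof (rule AE_zero_of_box_integrals[OF ig])
      fix a b :: "real^3"
      define c d where "c = (\<chi> i. max (a $ i) (low n $ i))" and "d = (\<chi> i. min (b $ i) (high n $ i))"
      have cd: "indicator (box a b) x * (indicator (box (low n) (high n)) x * f x) = indicator (box c d) x * f x" for x
        by (auto simp: c_def d_def mem_box_cart split: split_indicator)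
      have "cbox c d \<subseteq> cbox (low n) (high n)" by (auto simp: c_def d_def mem_box_cart)
      then have Z: "(LINT x|lebesgue. indicator (box c d) x * f x) = 0" using Q by (intro box_integral_zero f zero) auto
      have "(\<integral>x. indicator (box a b) x * g x \<partial>lborel) = (LINT x|lebesgue. indicator (box a b) x * g x)"
        by (rule integral_completion[symmetric]) measurable
      also have "\<dots> = (LINT x|lebesgue. indicator (box a b) x * (indicator (box (low n) (high n)) x * f x))"
        using ae' by (intro integral_cong_AE borel_measurable_times borel_measurable_integrable[OF i] gL borel_measurable_indicator) auto
      finally show "(\<integral>x. indicator (box a b) x * g x \<partial>lborel) = 0" using Z by (simp add: cd)
    qed
    then have "AE x in lebesgue. g x = 0" by (rule AE_completion)
    with ae' show ?thesis by eventually_elim simp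
  qed
  then have "AE x in lebesgue. \<forall>n. indicator (box (low n) (high n)) x * f x = 0" by (subst AE_all_countable) blast
  then show ?thesis
  proof eventually_elim
    case (elim x)
    show ?case
    proof
      assume x: "x \<in> slab"
      obtain n where n: "n \<ge> 1" "x \<in> cbox (low n) (high n)"
        using eventually_conj[OF eventually_ge_at_top[of 1] eventually_mem_slab_box[OF x]] eventually_sequentially by auto
      \<comment> \<open>A point of the n-th closed box is interior to the next one, and the
        vanishing is known on open boxes.\<close>
      have "1 / real (n + 1) < 1 / real n" using n(1) by (simp add: field_simps)
      then have "x \<in> box (low (n + 1)) (high (n + 1))"
        using n(2) unfolding mem_slab_box by (auto simp: mem_box_cart forall_3)
      then show "f x = 0" using elim by (metis indicator_simps(1) mult_1)
    qed
  qed
qed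

section \<open>Smoothness of weakly harmonic functions\<close>

lemma test_fun_smooth: "\<psi> \<in> test_fun S \<Longrightarrow> smooth_on UNIV \<psi>"
  by (auto simp: test_fun_def smooth_fun_iff)

lemma abs_sum_nth_le:
  fixes h p :: "real^3" shows "\<bar>\<Sum>i\<in>UNIV. h $ i * p $ i\<bar> \<le> (\<Sum>i\<in>UNIV. \<bar>p $ i\<bar>) * norm h"
proof -
  have "\<bar>\<Sum>i\<in>UNIV. h $ i * p $ i\<bar> \<le> (\<Sum>i\<in>UNIV. \<bar>p $ i\<bar> * norm h)"
  proof (intro order_trans[OF sum_abs] sum_mono)
    fix i
    show "\<bar>h $ i * p $ i\<bar> \<le> \<bar>p $ i\<bar> * norm h"
      unfolding abs_mult mult.commute[of "\<bar>h $ i\<bar>"] by (intro mult_left_mono component_le_norm_cart) simp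
  qed
  then show ?thesis by (simp add: sum_distrib_right)
qed

lemma test_fun_Lipschitz:
  assumes "\<psi> \<in> test_fun S" obtains L where "L \<ge> 0" "\<And>u v. \<bar>\<psi> u - \<psi> v\<bar> \<le> L * norm (u - v)"
proof -
  have "\<exists>B. B \<ge> 0 \<and> (\<forall>x. \<bar>pd i \<psi> x\<bar> \<le> B)" for i
    by (rule test_fun_bounded[OF test_fun_pd[OF assms, of i]]) blast
  then have "\<exists>B. \<forall>i. B i \<ge> 0 \<and> (\<forall>x. \<bar>pd i \<psi> x\<bar> \<le> B i)" by (intro choice allI)
  then obtain B where B: "\<And>i. B i \<ge> 0" "\<And>i x. \<bar>pd i \<psi> x\<bar> \<le> B i" by blast
  have "norm (\<psi> u - \<psi> v) \<le> (\<Sum>i\<in>UNIV. B i) * norm (u - v)" for u v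
  proof (rule differentiable_bound[where S=UNIV and f'="\<lambda>x h. \<Sum>i\<in>UNIV. h $ i * pd i \<psi> x"])
    fix x :: "real^3"
    show "(\<psi> has_derivative (\<lambda>h. \<Sum>i\<in>UNIV. h $ i * pd i \<psi> x)) (at x)"
      by (intro has_derivative_pd smooth_on_differentiable[OF test_fun_smooth[OF assms]]) auto
    show "onorm (\<lambda>h. \<Sum>i\<in>UNIV. h $ i * pd i \<psi> x) \<le> (\<Sum>i\<in>UNIV. B i)"
    proof (rule onorm_bound)
      fix h :: "real^3"
      have "norm (\<Sum>i\<in>UNIV. h $ i * pd i \<psi> x) \<le> (\<Sum>i\<in>UNIV. \<bar>pd i \<psi> x\<bar>) * norm h"
        using abs_sum_nth_le[of h "\<chi> i. pd i \<psi> x"] by simp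
      also have "\<dots> \<le> (\<Sum>i\<in>UNIV. B i) * norm h" by (intro mult_right_mono sum_mono B) auto
      finally show "norm (\<Sum>i\<in>UNIV. h $ i * pd i \<psi> x) \<le> (\<Sum>i\<in>UNIV. B i) * norm h" .
    qed (auto intro: sum_nonneg B)
  qed auto
  then show ?thesis using that[of "\<Sum>i\<in>UNIV. B i"] B by (auto intro: sum_nonneg)
qed

text \<open>The first derivatives are Lipschitz with global constants, so the linearisation error is
  quadratic uniformly in the base point. This uniformity is what allows differentiation under an
  integral.\<close>

lemma test_fun_taylor:
  assumes "\<psi> \<in> test_fun S"
  obtains C where "C \<ge> 0" "\<And>u h. \<bar>\<psi> (u + h) - \<psi> u - (\<Sum>i\<in>UNIV. h $ i * pd i \<psi> u)\<bar> \<le> C * (norm h)\<^sup>2"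
proof -
  have "\<exists>L. L \<ge> 0 \<and> (\<forall>u v. \<bar>pd i \<psi> u - pd i \<psi> v\<bar> \<le> L * norm (u - v))" for i
    by (rule test_fun_Lipschitz[OF test_fun_pd[OF assms, of i]]) blast
  then have "\<exists>L. \<forall>i. L i \<ge> 0 \<and> (\<forall>u v. \<bar>pd i \<psi> u - pd i \<psi> v\<bar> \<le> L i * norm (u - v))" by (intro choice allI)
  then obtain L where L: "\<And>i. L i \<ge> 0" "\<And>i u v. \<bar>pd i \<psi> u - pd i \<psi> v\<bar> \<le> L i * norm (u - v)" by blast
  have "norm (\<psi> (u + h) - \<psi> u - (\<lambda>h. \<Sum>i\<in>UNIV. h $ i * pd i \<psi> u) (u + h - u)) \<le> norm (u + h - u) * ((\<Sum>i\<in>UNIV. L i) * norm h)" for u h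
  proof (rule differentiable_bound_linearization[where S="cball u (norm h)" and f'="\<lambda>x h. \<Sum>i\<in>UNIV. h $ i * pd i \<psi> x"])
    show "u + t *\<^sub>R (u + h - u) \<in> cball u (norm h)" if "t \<in> {0..1}" for t
    proof -
      have "norm (t *\<^sub>R h) \<le> 1 * norm h" unfolding norm_scaleR using that by (intro mult_right_mono) auto
      then show ?thesis by (simp add: dist_norm)
    qed
    show "(\<psi> has_derivative (\<lambda>h. \<Sum>i\<in>UNIV. h $ i * pd i \<psi> x)) (at x within cball u (norm h))" for x
      by (rule has_derivative_at_withinI[OF has_derivative_pd[OF smooth_on_differentiable[OF test_fun_smooth[OF assms] UNIV_I]]])
    show "onorm ((\<lambda>h. \<Sum>i\<in>UNIV. h $ i * pd i \<psi> x) - (\<lambda>h. \<Sum>i\<in>UNIV. h $ i * pd i \<psi> u)) \<le> (\<Sum>i\<in>UNIV. L i) * norm h"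
      if x: "x \<in> cball u (norm h)" for x
    proof (rule onorm_bound)
      fix k :: "real^3"
      have "((\<lambda>h. \<Sum>i\<in>UNIV. h $ i * pd i \<psi> x) - (\<lambda>h. \<Sum>i\<in>UNIV. h $ i * pd i \<psi> u)) k = (\<Sum>i\<in>UNIV. k $ i * (pd i \<psi> x - pd i \<psi> u))"
        by (simp add: sum_subtractf right_diff_distrib)
      then have "norm (((\<lambda>h. \<Sum>i\<in>UNIV. h $ i * pd i \<psi> x) - (\<lambda>h. \<Sum>i\<in>UNIV. h $ i * pd i \<psi> u)) k) \<le> (\<Sum>i\<in>UNIV. \<bar>pd i \<psi> x - pd i \<psi> u\<bar>) * norm k"
        using abs_sum_nth_le[of k "\<chi> i. pd i \<psi> x - pd i \<psi> u"] by simp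
      also have "\<dots> \<le> (\<Sum>i\<in>UNIV. L i * norm h) * norm k"
      proof (intro mult_right_mono sum_mono)
        fix i
        have "norm (x - u) \<le> norm h" using x by (simp add: dist_norm norm_minus_commute)
        then show "\<bar>pd i \<psi> x - pd i \<psi> u\<bar> \<le> L i * norm h" using L(2)[of i x u] mult_left_mono[OF _ L(1)] by (meson order_trans)
      qed auto
      finally show "norm (((\<lambda>h. \<Sum>i\<in>UNIV. h $ i * pd i \<psi> x) - (\<lambda>h. \<Sum>i\<in>UNIV. h $ i * pd i \<psi> u)) k) \<le> (\<Sum>i\<in>UNIV. L i) * norm h * norm k"
        by (simp add: sum_distrib_right)
    qed (auto intro!: sum_nonneg L mult_nonneg_nonneg)
  qed auto
  then show ?thesis using that[of "\<Sum>i\<in>UNIV. L i"] L(1) by (auto intro: sum_nonneg simp: power2_eq_square mult_ac)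
qed

section \<open>Convolution of an integrable function with a test function\<close>

lemma integrable_mult_bounded:
  fixes m k :: "real^3 \<Rightarrow> real"
  assumes m: "integrable lebesgue m" and k: "k \<in> borel_measurable borel" "\<And>x. \<bar>k x\<bar> \<le> B"
  shows "integrable lebesgue (\<lambda>y. m y * k y)"
proof (rule Bochner_Integration.integrable_bound)
  show "integrable lebesgue (\<lambda>y. B * m y)" using m by (intro integrable_mult_right)
  have "k \<in> borel_measurable lebesgue" using k(1) by (intro measurable_completion) simp
  then show "(\<lambda>y. m y * k y) \<in> borel_measurable lebesgue"
    by (intro borel_measurable_times borel_measurable_integrable[OF m])
  have "\<bar>k y\<bar> \<le> \<bar>B\<bar>" for y using k(2)[of y] by linarith
  then show "AE y in lebesgue. norm (m y * k y) \<le> norm (B * m y)"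
    using mult_left_mono[of "\<bar>k _\<bar>" "\<bar>B\<bar>" "\<bar>m _\<bar>"] by (intro AE_I2) (simp only: real_norm_def abs_mult mult.commute abs_ge_zero)
qed

lemma measurable_reflect:
  assumes "k \<in> test_fun UNIV" shows "(\<lambda>y. k (x - y)) \<in> borel_measurable borel"
  by (intro borel_measurable_continuous_onI continuous_on_compose2[OF test_fun_continuous[OF assms, of UNIV]] continuous_intros) auto

lemma conv_integrable:
  assumes m: "integrable lebesgue m" and k: "k \<in> test_fun UNIV"
  shows "integrable lebesgue (\<lambda>y. m y * k (x - y))"
proof -
  obtain B where "\<And>x. \<bar>k x\<bar> \<le> B" using k by (rule test_fun_bounded) blast
  then show ?thesis by (intro integrable_mult_bounded[OF m measurable_reflect[OF k], where B=B]) auto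
qed

text \<open>Integrating the uniform Taylor bound against |m| leaves a remainder of at most C M |h|^2
  with M the integral of |m|. No dominated convergence is involved.\<close>

lemma conv_has_derivative:
  assumes m: "integrable lebesgue m" and k: "k \<in> test_fun UNIV"
  shows "((\<lambda>x. LINT y|lebesgue. m y * k (x - y)) has_derivative (\<lambda>h. \<Sum>i\<in>UNIV. h $ i * (LINT y|lebesgue. m y * pd i k (x - y)))) (at x)"
proof -
  obtain C where C: "C \<ge> 0" "\<And>u h. \<bar>k (u + h) - k u - (\<Sum>i\<in>UNIV. h $ i * pd i k u)\<bar> \<le> C * (norm h)\<^sup>2"
    using k by (rule test_fun_taylor) blast
  define F where "F x = (LINT y|lebesgue. m y * k (x - y))" for x
  define G where "G i = (LINT y|lebesgue. m y * pd i k (x - y))" for i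
  define M where "M = (LINT y|lebesgue. \<bar>m y\<bar>)"
  have bound: "\<bar>F (x + h) - F x - (\<Sum>i\<in>UNIV. h $ i * G i)\<bar> \<le> C * M * (norm h)\<^sup>2" for h
  proof -
    note i1 = conv_integrable[OF m k] and i2 = conv_integrable[OF m test_fun_pd[OF k]]
    have int: "integrable lebesgue (\<lambda>y. m y * k (x + h - y) - m y * k (x - y) - (\<Sum>i\<in>UNIV. h $ i * (m y * pd i k (x - y))))"
      by (intro Bochner_Integration.integrable_diff Bochner_Integration.integrable_sum integrable_mult_right i1 i2)
    have "F (x + h) - F x - (\<Sum>i\<in>UNIV. h $ i * G i) =
       (LINT y|lebesgue. m y * k (x + h - y) - m y * k (x - y) - (\<Sum>i\<in>UNIV. h $ i * (m y * pd i k (x - y))))"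
      unfolding F_def G_def using i1 i2
      by (simp add: Bochner_Integration.integral_diff Bochner_Integration.integral_sum Bochner_Integration.integrable_diff Bochner_Integration.integrable_sum)
    also have "norm \<dots> \<le> (LINT y|lebesgue. (C * (norm h)\<^sup>2) * \<bar>m y\<bar>)"
    proof (rule Bochner_Integration.integral_norm_bound_integral[OF int])
      fix y
      have "m y * k (x + h - y) - m y * k (x - y) - (\<Sum>i\<in>UNIV. h $ i * (m y * pd i k (x - y))) =
          m y * (k ((x - y) + h) - k (x - y) - (\<Sum>i\<in>UNIV. h $ i * pd i k (x - y)))"
        by (simp only: right_diff_distrib sum_distrib_left mult.left_commute[of "m y"] add_diff_eq diff_add_eq)
      then show "norm (m y * k (x + h - y) - m y * k (x - y) - (\<Sum>i\<in>UNIV. h $ i * (m y * pd i k (x - y)))) \<le> (C * (norm h)\<^sup>2) * \<bar>m y\<bar>"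
        using mult_left_mono[OF C(2)[of "x - y" h], of "\<bar>m y\<bar>"] by (simp only: real_norm_def abs_mult mult.commute abs_ge_zero)
    qed (intro integrable_mult_right integrable_abs m)
    finally show ?thesis by (simp add: M_def mult_ac)
  qed
  have "(F has_derivative (\<lambda>h. \<Sum>i\<in>UNIV. h $ i * G i)) (at x)"
    unfolding has_derivative_at
  proof
    show "bounded_linear (\<lambda>h. \<Sum>i\<in>UNIV. h $ i * G i)"
      by (intro bounded_linear_sum bounded_linear_mult_const bounded_linear_vec_nth)
    have "\<forall>\<^sub>F h in at 0. norm (norm (F (x + h) - F x - (\<Sum>i\<in>UNIV. h $ i * G i)) / norm h) \<le> C * M * norm h"
    proof (rule always_eventually, rule allI)
      fix h :: "real^3"
      show "norm (norm (F (x + h) - F x - (\<Sum>i\<in>UNIV. h $ i * G i)) / norm h) \<le> C * M * norm h"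
        using bound[of h] by (cases "h = 0") (simp_all add: divide_le_eq power2_eq_square mult.assoc)
    qed
    moreover have "(\<lambda>h::real^3. C * M * norm h) \<midarrow>0\<rightarrow> 0"
      using tendsto_mult_right_zero[OF tendsto_norm_zero[OF tendsto_ident_at[of 0 UNIV]], of "C * M"] .
    ultimately show "(\<lambda>h. norm (F (x + h) - F x - (\<Sum>i\<in>UNIV. h $ i * G i)) / norm h) \<midarrow>0\<rightarrow> 0"
      by (rule Lim_null_comparison)
  qed
  then show ?thesis by (simp add: F_def[abs_def] G_def)
qed

text \<open>Derivatives fall on the kernel, so the convolutions of a fixed \<open>m\<close> with
  test functions form a family closed under partial derivatives.\<close>

lemma conv_smooth:
  assumes m: "integrable lebesgue m" and k: "k \<in> test_fun UNIV"
  shows "smooth_on UNIV (\<lambda>x. LINT y|lebesgue. m y * k (x - y))"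
proof (rule smooth_on_coinduct[where X="\<lambda>F. \<exists>k\<in>test_fun UNIV. F = (\<lambda>x. LINT y|lebesgue. m y * k (x - y))"])
  fix F assume "\<exists>k\<in>test_fun UNIV. F = (\<lambda>x. LINT y|lebesgue. m y * k (x - y))"
  then obtain k where k: "k \<in> test_fun UNIV" and F: "F = (\<lambda>x. LINT y|lebesgue. m y * k (x - y))" by blast
  have 1: "F differentiable at x" for x
    unfolding F differentiable_def using conv_has_derivative[OF m k] by blast
  have "pd i F x = (\<Sum>j\<in>UNIV. axis i 1 $ j * (LINT y|lebesgue. m y * pd j k (x - y)))" for i x
    unfolding F by (rule pd_eqI[OF conv_has_derivative[OF m k]])
  then have 2: "pd i F x = (LINT y|lebesgue. m y * pd i k (x - y))" for i x
    by (simp add: axis_def if_distrib[where f="\<lambda>c. c * _"] cong: if_cong)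
  show "(\<forall>x\<in>UNIV. F differentiable at x) \<and> (\<forall>i. \<exists>g. (\<exists>k\<in>test_fun UNIV. g = (\<lambda>x. LINT y|lebesgue. m y * k (x - y))) \<and> (\<forall>x\<in>UNIV. pd i F x = g x))"
    using 1 2 test_fun_pd[OF k] by blast
qed (use k in auto)

text \<open>Fubini's theorem is applied to Lebesgue measure on Borel sets, whence the passage to a
  Borel function \<open>m'\<close> that equals \<open>m\<close> almost everywhere. The product is
  dominated by a constant times |\<psi>(x)| |m'(y)|.\<close>

lemma conv_swap:
  assumes m: "integrable lebesgue m" and k: "k \<in> test_fun UNIV" and \<psi>: "\<psi> \<in> test_fun UNIV"
  shows "(LINT x|lebesgue. \<psi> x * (LINT y|lebesgue. m y * k (x - y))) = (LINT y|lebesgue. m y * (\<integral>x. \<psi> x * k (x - y) \<partial>lborel))"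
proof -
  obtain m' where m'[measurable]: "m' \<in> borel_measurable lborel" and ae: "AE x in lborel. m x = m' x"
    using completion_ex_borel_measurable_real[OF borel_measurable_integrable[OF m]] by blast
  have aeL: "AE x in lebesgue. m x = m' x" using ae by (rule AE_completion)
  have m'L: "m' \<in> borel_measurable lebesgue" by (rule measurable_completion) measurable
  have "integrable lebesgue m'" using m integrable_cong_AE[OF borel_measurable_integrable[OF m] m'L aeL] by blast
  then have im: "integrable lborel m'" using integrable_completion[OF m'] by simp
  note ip = test_fun_lborel(1)[OF \<psi>]
  have [measurable]: "k \<in> borel_measurable borel" "\<psi> \<in> borel_measurable borel"
    using test_fun_measurable k \<psi> by blast+
  obtain B where B: "B \<ge> 0" "\<And>x. \<bar>k x\<bar> \<le> B" using k by (rule test_fun_bounded) blast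
  have pairint: "integrable (lborel \<Otimes>\<^sub>M lborel) (\<lambda>(x, y). \<psi> x * (m' y * k (x - y)))"
  proof (rule Bochner_Integration.integrable_bound)
    show "integrable (lborel \<Otimes>\<^sub>M lborel) (\<lambda>(x, y). B * \<psi> x * m' y)"
    proof (rule lborel_pair.Fubini_integrable)
      have "(\<integral>y. norm (B * \<psi> x * m' y) \<partial>lborel) = \<bar>B\<bar> * \<bar>\<psi> x\<bar> * (\<integral>y. \<bar>m' y\<bar> \<partial>lborel)" for x
        by (simp add: abs_mult)
      then show "integrable lborel (\<lambda>x. \<integral>y. norm (case (x, y) of (x, y) \<Rightarrow> B * \<psi> x * m' y) \<partial>lborel)"
        using ip by simp
    qed (use im in auto)
    show "AE xy in lborel \<Otimes>\<^sub>M lborel. norm (case xy of (x, y) \<Rightarrow> \<psi> x * (m' y * k (x - y))) \<le> norm (case xy of (x, y) \<Rightarrow> B * \<psi> x * m' y)"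
    proof (intro AE_I2, clarsimp simp: abs_mult)
      fix x y :: "real^3"
      have "\<bar>\<psi> x\<bar> * \<bar>m' y\<bar> * \<bar>k (x - y)\<bar> \<le> \<bar>\<psi> x\<bar> * \<bar>m' y\<bar> * \<bar>B\<bar>" using B by (intro mult_left_mono) auto
      then show "\<bar>\<psi> x\<bar> * (\<bar>m' y\<bar> * \<bar>k (x - y)\<bar>) \<le> \<bar>B\<bar> * \<bar>\<psi> x\<bar> * \<bar>m' y\<bar>" by (simp add: mult_ac)
    qed
  qed measurable
  have inner: "(LINT y|lebesgue. m y * k (x - y)) = (\<integral>y. m' y * k (x - y) \<partial>lborel)" for x
  proof -
    have "(LINT y|lebesgue. m y * k (x - y)) = (LINT y|lebesgue. m' y * k (x - y))"
      using aeL borel_measurable_integrable[OF conv_integrable[OF m k]] m'L measurable_completion[of "\<lambda>y. k (x - y)" lborel borel] measurable_reflect[OF k]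
      by (intro integral_cong_AE) auto
    also have "\<dots> = (\<integral>y. m' y * k (x - y) \<partial>lborel)" by (rule integral_completion) measurable
    finally show ?thesis .
  qed
  have "(LINT x|lebesgue. \<psi> x * (LINT y|lebesgue. m y * k (x - y))) = (\<integral>x. \<psi> x * (\<integral>y. m' y * k (x - y) \<partial>lborel) \<partial>lborel)"
    unfolding inner by (rule integral_completion) measurable
  also have "\<dots> = (\<integral>x. \<integral>y. \<psi> x * (m' y * k (x - y)) \<partial>lborel \<partial>lborel)" by simp
  also have "\<dots> = (\<integral>y. \<integral>x. \<psi> x * (m' y * k (x - y)) \<partial>lborel \<partial>lborel)"
    by (rule lborel_pair.Fubini_integral[symmetric, OF pairint])
  also have "\<dots> = (\<integral>y. m' y * (\<integral>x. \<psi> x * k (x - y) \<partial>lborel) \<partial>lborel)"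
    by (subst mult.left_commute) simp
  also have "\<dots> = (LINT y|lebesgue. m' y * (\<integral>x. \<psi> x * k (x - y) \<partial>lborel))"
    by (rule integral_completion[symmetric]) measurable
  also have "\<dots> = (LINT y|lebesgue. m y * (\<integral>x. \<psi> x * k (x - y) \<partial>lborel))"
  proof (rule integral_cong_AE)
    have "(\<lambda>y. \<integral>x. \<psi> x * k (x - y) \<partial>lborel) \<in> borel_measurable lborel" by measurable
    then have "(\<lambda>y. \<integral>x. \<psi> x * k (x - y) \<partial>lborel) \<in> borel_measurable lebesgue" by (rule measurable_completion)
    then show "(\<lambda>y. m y * (\<integral>x. \<psi> x * k (x - y) \<partial>lborel)) \<in> borel_measurable lebesgue"
       "(\<lambda>y. m' y * (\<integral>x. \<psi> x * k (x - y) \<partial>lborel)) \<in> borel_measurable lebesgue"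
      using borel_measurable_integrable[OF m] m'L by auto
  qed (use aeL in auto)
  finally show ?thesis .
qed

section \<open>The truncated Newtonian potential as a source of mollifiers\<close>

definition r2 :: "real^3 \<Rightarrow> real" where "r2 x = (\<Sum>i\<in>UNIV. (x $ i)\<^sup>2)"

lemma r2_norm: "r2 x = (norm x)\<^sup>2"
  by (simp add: r2_def norm_vec_def L2_set_def sum_nonneg)

lemma smooth_on_r2: "open U \<Longrightarrow> smooth_on U r2"
  unfolding r2_def[abs_def] by (intro smooth_on_intros)

lemma pd_r2: "pd i r2 x = 2 * x $ i"
  unfolding r2_def[abs_def] sum_3 power2_eq_square
  using exhaust_3[of i] by (auto simp: pd_add pd_mult differentiable_add differentiable_mult)

text \<open>The Newtonian potential \<open>1/|x|\<close>, cut off to \<open>0\<close> near the origin.\<close>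

definition newton :: "real^3 \<Rightarrow> real" where "newton x = step_fun (2 * r2 x - 1) * r2 x powr (- 1/2)"

lemma newton_small: "norm x \<le> 1/2 \<Longrightarrow> newton x = 0"
  using power_mono[of "norm x" "1/2" 2] by (simp add: newton_def step_fun_0 r2_norm power2_eq_square)

lemma newton_large: "norm x \<ge> 1 \<Longrightarrow> newton x = r2 x powr (- 1/2)"
  using power_mono[of 1 "norm x" 2] by (simp add: newton_def step_fun_1 r2_norm)

lemma smooth_on_newton: "smooth_on UNIV newton"
proof (rule smooth_on_local)
  fix x :: "real^3"
  show "\<exists>V. open V \<and> x \<in> V \<and> smooth_on V newton"
  proof (cases "x = 0")
    case True
    have "smooth_on (ball 0 (1/2)) newton"
      by (subst smooth_on_cong[where g="\<lambda>x. 0"]) (auto simp: newton_small intro: smooth_on_const)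
    then show ?thesis using True by (intro exI[of _ "ball 0 (1/2)"]) auto
  next
    case False
    have "smooth_on (- {0}) newton" unfolding newton_def[abs_def]
      by (intro smooth_on_intros smooth_on_step_fun smooth_on_powr smooth_on_r2) (auto simp: r2_norm)
    then show ?thesis using False by (intro exI[of _ "- {0}"]) auto
  qed
qed

lemma pd_r2_powr:
  assumes "x \<noteq> 0"
  shows "pd i (\<lambda>x. r2 x powr a) x = 2 * a * x $ i * r2 x powr (a - 1)" "(\<lambda>x. r2 x powr a) differentiable at x"
proof -
  have "r2 x > 0" using assms by (simp add: r2_norm)
  then have "((\<lambda>t. t powr a) has_real_derivative a * r2 x powr (a - 1)) (at (r2 x))"
    by (rule has_real_derivative_powr)
  note d = pd_comp_real[where g="\<lambda>t. t powr a" and f=r2, OF this smooth_on_differentiable[OF smooth_on_r2[OF open_UNIV] UNIV_I]]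
  show "pd i (\<lambda>x. r2 x powr a) x = 2 * a * x $ i * r2 x powr (a - 1)" using d(2)[of i] by (simp add: pd_r2)
  show "(\<lambda>x. r2 x powr a) differentiable at x" using d(1) differentiable_def by blast
qed

text \<open>Three terms -|x|^(-3) meet 3 |x|^2 |x|^(-5): the cancellation is specific to dimension
  3. It takes place where the truncation is no longer felt.\<close>

lemma pd_newton:
  assumes "norm x > 1"
  shows "pd i newton x = - (x $ i * r2 x powr (- 3/2))" and "lap newton x = 0"
proof -
  let ?U = "- cball 0 1 :: (real^3) set"
  have U: "open ?U" "y \<in> ?U \<longleftrightarrow> norm y > 1" for y by (auto simp: open_Compl)
  have 1: "pd i newton y = - 1 * (y $ i * r2 y powr (- 3/2))" if "norm y > 1" for i y
  proof -
    have "pd i newton y = pd i (\<lambda>y. r2 y powr (- 1/2)) y"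
      using that by (intro pd_cong_open[of ?U]) (auto simp: U newton_large)
    also have "\<dots> = - 1 * (y $ i * r2 y powr (- 3/2))" using that pd_r2_powr(1)[of y i "-1/2"] by (cases "y = 0") auto
    finally show ?thesis .
  qed
  then show "pd i newton x = - (x $ i * r2 x powr (- 3/2))" using assms by simp
  have x0: "x \<noteq> 0" using assms by auto
  have p: "pd j (pd j newton) x = - 1 * (r2 x powr (- 3/2) - 3 * ((x $ j)\<^sup>2 * r2 x powr (- 5/2)))" for j
  proof -
    have "pd j (pd j newton) x = pd j (\<lambda>y. - 1 * (y $ j * r2 y powr (- 3/2))) x"
      by (rule pd_cong_open[of ?U]) (use assms U 1 in auto)
    also have "\<dots> = - 1 * (x $ j * (- 3 * x $ j * r2 x powr (- 5/2)) + r2 x powr (- 3/2))"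
      using pd_r2_powr(1)[OF x0, of j "- 3/2"] pd_r2_powr(2)[OF x0, of "- 3/2"] by (subst pd_mult) (auto simp: pd_mult differentiable_mult)
    finally show ?thesis by (simp add: power2_eq_square algebra_simps)
  qed
  have "lap newton x = - 3 * (r2 x powr (- 3/2) - (\<Sum>j\<in>UNIV. (x $ j)\<^sup>2) * r2 x powr (- 5/2))"
    unfolding lap_def sum_3 p by (simp add: algebra_simps)
  also have "(\<Sum>j\<in>UNIV. (x $ j)\<^sup>2) = r2 x powr 1" using x0 by (simp add: r2_norm flip: r2_def)
  also have "r2 x powr 1 * r2 x powr (- 5/2) = r2 x powr (1 + - 5/2)" by (simp only: powr_add)
  finally show "lap newton x = 0" by simp
qed

lemma integrable_compact_support:
  assumes "smooth_on UNIV f" "\<And>x. norm x > R \<Longrightarrow> f x = 0"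
  shows "f \<in> test_fun UNIV"
  using assms by (intro test_funI[where K="cball 0 R"]) (auto simp: dist_norm not_le)

lemma lap_newton_test: "lap newton \<in> test_fun UNIV"
  by (rule integrable_compact_support[where R=1]) (auto intro: smooth_on_lap smooth_on_newton pd_newton)

text \<open>The flux of \<open>\<nabla>(1/|x|)\<close> through the boundary of a cube is negative: on the face
  \<open>x $ i = 2\<close> its normal component is \<open>-2/|x|\<^sup>3\<close> with \<open>|x|\<^sup>2 \<le> 12\<close>.\<close>

lemma lap_newton_integral_neg: "(\<integral>x. lap newton x \<partial>lborel) < 0"
proof -
  define a b :: "real^3" where "a = (\<chi> i. -2)" and "b = (\<chi> i. 2)"
  define \<kappa> :: real where "\<kappa> = 12 powr (- 3/2)"
  have \<kappa>: "\<kappa> > 0" by (simp add: \<kappa>_def)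
  let ?I = "indicator (cbox a b) :: real^3 \<Rightarrow> real"
  \<comment> \<open>On the faces the normal derivative is at least 2\<kappa> in size, because |x|^2
    \<le> 12 and \<kappa> = 12^(-3/2). The linear term can therefore be added without violating the
    face inequality. It raises the divergence by 3\<kappa>, and subtracting this again turns a
    nonpositive integral into a strictly negative one.\<close>
  define F where "F i x = pd i newton x + \<kappa> * x $ i" for i x
  have smF: "smooth_on UNIV (F i)" for i
    unfolding F_def[abs_def] by (intro smooth_on_intros smooth_on_pd smooth_on_newton open_UNIV)
  have pdF: "pd i (F i) x = pd i (pd i newton) x + \<kappa>" for i x
    unfolding F_def[abs_def] using smooth_on_differentiable[OF smooth_on_pd[OF smooth_on_newton] UNIV_I]
    by (simp add: pd_add pd_mult differentiable_mult)
  have int: "integrable lborel (\<lambda>x. ?I x * pd i (F i) x)" and le: "(\<integral>x. ?I x * pd i (F i) x \<partial>lborel) \<le> 0" for i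
  proof -
    have 1: "F i (x + (b $ i - x $ i) *\<^sub>R axis i 1) \<le> F i (x + (a $ i - x $ i) *\<^sub>R axis i 1)" if x: "x \<in> cbox a b" for x
    proof -
      define y z where "y = x + (b $ i - x $ i) *\<^sub>R axis i 1" and "z = x + (a $ i - x $ i) *\<^sub>R axis i 1"
      have yi: "y $ i = 2" "z $ i = -2" by (auto simp: y_def z_def a_def b_def axis_def)
      have yj: "j \<noteq> i \<Longrightarrow> y $ j = x $ j \<and> z $ j = x $ j" for j by (auto simp: y_def z_def axis_def)
      have "(y $ j)\<^sup>2 \<le> 4 \<and> (z $ j)\<^sup>2 = (y $ j)\<^sup>2" for j
      proof (cases "j = i")
        case False
        have "\<bar>x $ j\<bar> \<le> 2" using x by (auto simp: mem_box_cart a_def b_def abs_le_iff minus_le_iff)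
        then have "(x $ j)\<^sup>2 \<le> 2\<^sup>2" using abs_le_square_iff[of "x $ j" 2] by simp
        then show ?thesis using yj[OF False] by simp
      qed (simp add: yi)
      then have yz: "(y $ j)\<^sup>2 \<le> 4" "(z $ j)\<^sup>2 = (y $ j)\<^sup>2" for j by blast+
      have r: "r2 y \<le> 12" "r2 z = r2 y" unfolding r2_def sum_3 using yz(1)[of 1] yz(1)[of 2] yz(1)[of 3] by (simp_all add: yz(2))
      have "2 \<le> norm y" "2 \<le> norm z" using component_le_norm_cart[of y i] component_le_norm_cart[of z i] yi by auto
      then have n: "norm y > 1" "norm z > 1" by auto
      then have "r2 y > 0" by (auto simp: r2_norm)
      then have "\<kappa> \<le> r2 y powr (- 3/2)" unfolding \<kappa>_def using r by (intro powr_mono2') auto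
      then show ?thesis unfolding y_def[symmetric] z_def[symmetric] F_def
        using n by (simp add: pd_newton yi r)
    qed
    have 2: "continuous_on (cbox a b) (pd i (F i))"
      by (rule continuous_on_subset[OF smooth_on_continuous[OF smooth_on_pd[OF smF]]]) auto
    show "integrable lborel (\<lambda>x. ?I x * pd i (F i) x)" "(\<integral>x. ?I x * pd i (F i) x \<partial>lborel) \<le> 0"
      using cbox_pd_integral_le_0[OF smooth_on_differentiable[OF smF UNIV_I] 2 1] by auto
  qed
  have I: "integrable lborel (\<lambda>x. ?I x)"
    by (rule integrable_real_indicator) (simp, rule emeasure_bounded_finite[OF bounded_cbox])
  have M: "(\<integral>x. ?I x \<partial>lborel) > 0"
    by (simp add: a_def b_def content_cbox_cart interval_ne_empty_cart)
  have eq: "lap newton x = (\<Sum>i\<in>UNIV. ?I x * pd i (F i) x) - 3 * \<kappa> * ?I x" for x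
  proof (cases "x \<in> cbox a b")
    case True
    then show ?thesis by (simp add: lap_def pdF sum.distrib sum_3)
  next
    case False
    then obtain i where "x $ i < - 2 \<or> 2 < x $ i" by (auto simp: mem_box_cart a_def b_def not_le)
    then have "norm x > 1" using component_le_norm_cart[of x i] by auto
    then show ?thesis using False by (simp add: pd_newton)
  qed
  have "(\<integral>x. lap newton x \<partial>lborel) = (\<Sum>i\<in>UNIV. \<integral>x. ?I x * pd i (F i) x \<partial>lborel) - 3 * \<kappa> * (\<integral>x. ?I x \<partial>lborel)"
    unfolding eq Bochner_Integration.integral_diff[OF Bochner_Integration.integrable_sum[OF int] integrable_mult_right[OF I]]
      Bochner_Integration.integral_sum[OF int] by simp
  moreover have "(\<Sum>i\<in>UNIV. \<integral>x. ?I x * pd i (F i) x \<partial>lborel) \<le> 0" by (intro sum_nonpos le)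
  moreover have "0 < 3 * \<kappa> * (\<integral>x. ?I x \<partial>lborel)" using \<kappa> M by (intro mult_pos_pos) auto
  ultimately show ?thesis by linarith
qed

text \<open>The dilation that preserves 1/|x|: all these functions coincide with 1/|x| outside the
  ball of radius e and differ only in where they are truncated.\<close>

definition newton_sc :: "real \<Rightarrow> real^3 \<Rightarrow> real" where "newton_sc e x = (1 / e) * newton (\<chi> i. (1 / e) * x $ i)"

lemma norm_scale: "e > 0 \<Longrightarrow> norm (\<chi> i. (1 / e) * x $ i) = norm (x :: real^3) / e"
proof -
  assume e: "e > 0"
  have "(\<chi> i. (1 / e) * x $ i) = (1 / e) *\<^sub>R x" by (simp add: vec_eq_iff)
  then show ?thesis using e by simp
qed

lemma newton_sc_smooth:
  assumes e: "e > 0"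
  shows "smooth_on UNIV (newton_sc e)" "lap (newton_sc e) x = lap newton (\<chi> i. (1 / e) * x $ i) / e ^ 3"
proof -
  define S where "S x = (\<chi> i. (1 / e) * x $ i)" for x :: "real^3"
  have aff: "smooth_on UNIV (\<lambda>x. f (S x)) \<and> pd i (\<lambda>x. f (S x)) x = (1 / e) * pd i f (S x)" if "smooth_on UNIV f" for f i x
    using smooth_on_affine[OF open_UNIV that, of "\<chi> i. 1 / e" 0] by (simp add: S_def)
  have ns: "newton_sc e = (\<lambda>x. (1 / e) * newton (S x))" by (auto simp: newton_sc_def S_def)
  show "smooth_on UNIV (newton_sc e)" unfolding ns
    using aff[OF smooth_on_newton] by (intro smooth_on_intros open_UNIV) auto
  have c: "pd i (\<lambda>x. c * g x) x = c * pd i g x" if "smooth_on UNIV g" for i g c x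
    using smooth_on_differentiable[OF that UNIV_I] by (simp add: pd_mult)
  have 1: "pd i (newton_sc e) = (\<lambda>x. (1 / e\<^sup>2) * pd i newton (S x))" for i
  proof
    fix x
    have "pd i (newton_sc e) x = (1 / e) * ((1 / e) * pd i newton (S x))"
      unfolding ns c[OF conjunct1[OF aff[OF smooth_on_newton]]]
      using aff[OF smooth_on_newton] by (simp only:)
    then show "pd i (newton_sc e) x = (1 / e\<^sup>2) * pd i newton (S x)" by (simp add: power2_eq_square)
  qed
  have "pd i (pd i (newton_sc e)) x = (1 / e ^ 3) * pd i (pd i newton) (S x)" for i x
  proof -
    have "pd i (pd i (newton_sc e)) x = (1 / e\<^sup>2) * ((1 / e) * pd i (pd i newton) (S x))"
      unfolding 1 c[OF conjunct1[OF aff[OF smooth_on_pd[OF smooth_on_newton]]]]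
      using aff[OF smooth_on_pd[OF smooth_on_newton]] by (simp only:)
    then show ?thesis by (simp add: power2_eq_square power3_eq_cube)
  qed
  then show "lap (newton_sc e) x = lap newton (\<chi> i. (1 / e) * x $ i) / e ^ 3"
    by (simp add: lap_def S_def sum_divide_distrib)
qed

lemma newton_sc_large:
  assumes "e > 0" "norm x \<ge> e" shows "newton_sc e x = r2 x powr (- 1/2)"
proof -
  have n: "norm (\<chi> i. (1 / e) * x $ i) \<ge> 1" using assms by (subst norm_scale) auto
  have "r2 (\<chi> i. (1 / e) * x $ i) = r2 x / e\<^sup>2" unfolding r2_norm norm_scale[OF assms(1)] by (simp add: power_divide)
  then have "newton_sc e x = (1 / e) * (r2 x powr (- 1/2) / (e\<^sup>2) powr (- 1/2))"
    unfolding newton_sc_def newton_large[OF n] using assms by (simp add: powr_divide r2_norm)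
  also have "(e\<^sup>2) powr (- 1/2) = 1 / e" using assms by (simp add: powr_powr powr_minus_divide flip: powr_numeral)
  finally show ?thesis using assms by simp
qed

text \<open>An approximate identity up to a factor: concentrated in the ball of radius e, with an
  integral that does not depend on e and is nonzero. Its form as a Laplacian is what makes
  mollifications of harmonic functions independent of e.\<close>

definition mollifier :: "real \<Rightarrow> real^3 \<Rightarrow> real" where "mollifier e = lap (newton_sc e)"

lemma mollifier_zero: "e > 0 \<Longrightarrow> norm x > e \<Longrightarrow> mollifier e x = 0"
proof -
  assume e: "e > 0" "norm x > e"
  then have "norm (\<chi> i. (1 / e) * x $ i) > 1" by (subst norm_scale) auto
  from pd_newton(2)[OF this] show ?thesis unfolding mollifier_def newton_sc_smooth(2)[OF e(1)] by simp
qed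

lemma mollifier_test: "e > 0 \<Longrightarrow> mollifier e \<in> test_fun UNIV"
  unfolding mollifier_def using mollifier_zero
  by (intro integrable_compact_support[where R=e] smooth_on_lap newton_sc_smooth) (auto simp: mollifier_def)

text \<open>Beyond the larger of the two radii both functions are 1/|x| and cancel.\<close>

lemma newton_sc_diff_test:
  assumes "e > 0" "e' > 0"
  shows "(\<lambda>x. newton_sc e x - newton_sc e' x) \<in> test_fun UNIV"
    and "lap (\<lambda>x. newton_sc e x - newton_sc e' x) x = mollifier e x - mollifier e' x"
proof -
  show "(\<lambda>x. newton_sc e x - newton_sc e' x) \<in> test_fun UNIV"
    using assms by (intro integrable_compact_support[where R="max e e'"] smooth_on_intros newton_sc_smooth) (auto simp: newton_sc_large)
  have "pd i (\<lambda>x. f x - g x) x = pd i f x - pd i g x" if "smooth_on UNIV f" "smooth_on UNIV g" for f g i x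
    using that smooth_on_differentiable by (intro pd_diff) auto
  then have d: "pd i (\<lambda>x. f x - g x) = (\<lambda>x. pd i f x - pd i g x)" if "smooth_on UNIV f" "smooth_on UNIV g" for f g i
    using that by blast
  note s = newton_sc_smooth(1)[OF assms(1)] newton_sc_smooth(1)[OF assms(2)]
  show "lap (\<lambda>x. newton_sc e x - newton_sc e' x) x = mollifier e x - mollifier e' x"
    unfolding mollifier_def lap_def d[OF s] d[OF smooth_on_pd[OF s(1)] smooth_on_pd[OF s(2)]] by (simp add: sum_subtractf)
qed

text \<open>Comparison with e = 1: the difference is the Laplacian of a test function, and
  derivatives of test functions integrate to 0.\<close>

lemma mollifier_integral:
  assumes "e > 0" shows "(\<integral>x. mollifier e x \<partial>lborel) = (\<integral>x. lap newton x \<partial>lborel)"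
proof -
  have m1: "mollifier 1 = lap newton" using newton_sc_smooth(2)[of 1] by (auto simp: mollifier_def)
  let ?d = "\<lambda>x. newton_sc e x - newton_sc 1 x"
  have t: "?d \<in> test_fun UNIV" using newton_sc_diff_test(1)[OF assms, of 1] by simp
  have "(\<integral>x. mollifier e x - mollifier 1 x \<partial>lborel) = (\<integral>x. (\<Sum>i\<in>UNIV. pd i (pd i ?d) x) \<partial>lborel)"
    using newton_sc_diff_test(2)[OF assms, of 1] by (simp add: lap_def)
  also have "\<dots> = (\<Sum>i\<in>UNIV. \<integral>x. pd i (pd i ?d) x \<partial>lborel)"
    by (intro Bochner_Integration.integral_sum test_fun_lborel(1) test_fun_pd t)
  also have "\<dots> = 0" using test_fun_lborel(2)[OF test_fun_pd[OF t]] by simp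
  finally show ?thesis
    unfolding m1 Bochner_Integration.integral_diff[OF test_fun_lborel(1)[OF mollifier_test[OF assms]] test_fun_lborel(1)[OF lap_newton_test]] by simp
qed

text \<open>No sign is established for the mollifier, so the integral of its absolute value needs
  its own bound. The supremum scales like e^(-3) and is multiplied by the volume 8 e^3 of a
  cube.\<close>

lemma mollifier_L1_bound:
  obtains B where "B \<ge> 0" "\<And>e. e > 0 \<Longrightarrow> (\<integral>x. \<bar>mollifier e x\<bar> \<partial>lborel) \<le> B"
proof -
  obtain B where B: "B \<ge> 0" "\<And>x. \<bar>lap newton x\<bar> \<le> B" using lap_newton_test by (rule test_fun_bounded) blast
  have "(\<integral>x. \<bar>mollifier e x\<bar> \<partial>lborel) \<le> 8 * B" if e: "e > 0" for e
  proof -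
    define a b :: "real^3" where "a = (\<chi> i. -e)" and "b = (\<chi> i. e)"
    have "(\<integral>x. \<bar>mollifier e x\<bar> \<partial>lborel) \<le> (\<integral>x. B / e ^ 3 * indicator (cbox a b) x \<partial>lborel)"
    proof (rule integral_mono)
      show "integrable lborel (\<lambda>x. \<bar>mollifier e x\<bar>)" using test_fun_lborel(1)[OF mollifier_test[OF e]] by simp
      show "integrable lborel (\<lambda>x. B / e ^ 3 * indicator (cbox a b) x)"
        by (intro integrable_mult_right integrable_real_indicator) (simp, rule emeasure_bounded_finite[OF bounded_cbox])
      fix x :: "real^3"
      show "\<bar>mollifier e x\<bar> \<le> B / e ^ 3 * indicator (cbox a b) x"
      proof (cases "x \<in> cbox a b")
        case True
        then show ?thesis using B(2) e by (simp add: mollifier_def newton_sc_smooth(2) abs_divide divide_right_mono)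
      next
        case False
        then obtain i where "x $ i < - e \<or> e < x $ i" by (auto simp: mem_box_cart a_def b_def not_le)
        then have "norm x > e" using component_le_norm_cart[of x i] by auto
        then show ?thesis using mollifier_zero[OF e] False by simp
      qed
    qed
    also have "\<dots> = 8 * B" using e by (simp add: a_def b_def content_cbox_cart interval_ne_empty_cart power3_eq_cube field_simps)
    finally show ?thesis .
  qed
  then show ?thesis using that[of "8 * B"] B(1) by simp
qed

section \<open>Weyl's lemma\<close>

definition depth :: "real^3 \<Rightarrow> real" where "depth x = min (x $ 3) (1 - x $ 3)"

lemma depth_pos: "x \<in> slab \<longleftrightarrow> depth x > 0"
  by (auto simp: depth_def slab_def)

lemma depth_Lipschitz: "\<bar>depth x - depth y\<bar> \<le> norm (x - y)"
  using component_le_norm_cart[of "x - y" 3] by (auto simp: depth_def min_def)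

lemma cball_subset_slab: "r < depth x \<Longrightarrow> cball x r \<subseteq> slab"
  using depth_Lipschitz[of x] by (auto simp: depth_pos dist_norm) (smt (verit))

lemma compact_slab_depth:
  assumes "compact K" "K \<subseteq> slab" obtains d where "d > 0" "\<And>x. x \<in> K \<Longrightarrow> d < depth x"
proof (cases "K = {}")
  case False
  have "continuous_on K depth" unfolding depth_def by (intro continuous_intros)
  then obtain y where y: "y \<in> K" "\<forall>x\<in>K. depth y \<le> depth x" using continuous_attains_inf[OF assms(1) False] by blast
  then have "depth y > 0" using assms(2) depth_pos by blast
  then show ?thesis using that[of "depth y / 2"] y by force
qed (use that[of 1] in auto)

text \<open>A kernel centred at x is an admissible test function of y as soon as the ball of its
  radius fits into the domain. The two signs of the reflection cancel in the Laplacian.\<close>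

lemma reflect_test:
  assumes "k \<in> test_fun UNIV" "\<And>z. norm z > r \<Longrightarrow> k z = 0" "cball x r \<subseteq> S"
  shows "(\<lambda>y. k (x - y)) \<in> test_fun S" "pd i (\<lambda>y. k (x - y)) y = - pd i k (x - y)" "lap (\<lambda>y. k (x - y)) y = lap k (x - y)"
proof -
  have eq: "(\<chi> i. vec (- 1) $ i * y $ i + x $ i) = x - y" for y :: "real^3" by (simp add: vec_eq_iff)
  note A = smooth_on_affine[OF open_UNIV, where a="vec (-1)" and c=x, unfolded eq]
  note sm = test_fun_smooth[OF assms(1)]
  show "(\<lambda>y. k (x - y)) \<in> test_fun S"
  proof (rule test_funI[where K="cball x r"])
    show "smooth_on UNIV (\<lambda>y. k (x - y))" by (rule A(1)[OF sm]) auto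
    show "k (x - y) = 0" if "y \<notin> cball x r" for y using that assms(2)[of "x - y"] by (simp add: dist_norm)
  qed (use assms(3) in auto)
  have 1: "pd i (\<lambda>y. f (x - y)) y = - pd i f (x - y)" if "smooth_on UNIV f" for f i y
    using A(2)[OF that] by simp
  then show "pd i (\<lambda>y. k (x - y)) y = - pd i k (x - y)" using sm by blast
  have "pd i (pd i (\<lambda>y. k (x - y))) y = pd i (pd i k) (x - y)" for i y
  proof -
    have e: "pd i (\<lambda>y. k (x - y)) = (\<lambda>y. (-1) * pd i k (x - y))" using 1[OF sm] by auto
    have "smooth_on UNIV (\<lambda>y. pd i k (x - y))" by (rule A(1)[OF smooth_on_pd[OF sm]]) auto
    then have "(\<lambda>y. pd i k (x - y)) differentiable at y" by (rule smooth_on_differentiable) simp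
    then have "pd i (\<lambda>y. (-1) * pd i k (x - y)) y = (-1) * pd i (\<lambda>y. pd i k (x - y)) y"
      by (subst pd_mult) auto
    then show ?thesis unfolding e using 1[OF smooth_on_pd[OF sm]] by simp
  qed
  then show "lap (\<lambda>y. k (x - y)) y = lap k (x - y)" by (simp add: lap_def)
qed

text \<open>Weyl's lemma: \<open>m\<^sub>e - m\<^sub>e'\<close> is the Laplacian of a test function, so that the mollifications \<open>\<phi> * m\<^sub>e\<close>
  do not depend on \<open>e\<close>.\<close>

theorem Weyl:
  fixes \<phi> :: "real^3 \<Rightarrow> real"
  assumes li: "loc_integrable \<phi>" and harm: "\<And>\<psi>. \<psi> \<in> test_fun slab \<Longrightarrow> (LINT x|lebesgue. lap \<psi> x * \<phi> x) = 0"
  obtains f where "smooth_on slab f" "AE x in lebesgue. x \<in> slab \<longrightarrow> f x = \<phi> x"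
proof -
  define c where "c = (\<integral>x. lap newton x \<partial>lborel)"
  have c: "c < 0" unfolding c_def by (rule lap_newton_integral_neg)
  define P where "P e x = (LINT y|lebesgue. mollifier e (x - y) * \<phi> y) / c" for e x
  \<comment> \<open>The radius varies with the point, as it must near the boundary. By the
    independence proved next, it may be frozen locally, which gives smoothness.\<close>
  define f where "f x = P (depth x / 2) x" for x
  have indep: "P e x = P e' x" if e: "0 < e" "0 < e'" "e < depth x" "e' < depth x" for e e' x
  proof -
    let ?k = "\<lambda>x. newton_sc e x - newton_sc e' x"
    have kt: "?k \<in> test_fun UNIV" by (rule newton_sc_diff_test(1)[OF e(1,2)])
    have k0: "?k z = 0" if "norm z > max e e'" for z using that e by (simp add: newton_sc_large)
    have cb: "cball x (max e e') \<subseteq> slab" using e by (intro cball_subset_slab) auto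
    note R = reflect_test[OF kt k0 cb]
    have "(LINT y|lebesgue. lap (\<lambda>y. ?k (x - y)) y * \<phi> y) = 0" by (rule harm[OF R(1)])
    moreover have "lap (\<lambda>y. ?k (x - y)) y * \<phi> y = mollifier e (x - y) * \<phi> y - mollifier e' (x - y) * \<phi> y" for y
      using R(3)[of y] newton_sc_diff_test(2)[OF e(1,2), of "x - y"] by (simp only: left_diff_distrib)
    ultimately have "(LINT y|lebesgue. mollifier e (x - y) * \<phi> y - mollifier e' (x - y) * \<phi> y) = 0"
      by (simp only:)
    moreover have "integrable lebesgue (\<lambda>y. mollifier s (x - y) * \<phi> y)" if "0 < s" "s < depth x" for s
      using integrable_mult_test[OF li reflect_test(1)[OF mollifier_test[OF that(1)] mollifier_zero[OF that(1)] cball_subset_slab[OF that(2)]]]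
      by simp
    ultimately show ?thesis unfolding P_def using e by simp
  qed
  have restr: "P e x = (LINT y|lebesgue. (indicator K y * \<phi> y) * (mollifier e (x - y))) / c" if "0 < e" "cball x e \<subseteq> K" for e x K
  proof -
    have "(\<lambda>y. mollifier e (x - y) * \<phi> y) = (\<lambda>y. (indicator K y * \<phi> y) * (mollifier e (x - y)))"
    proof
      fix y show "mollifier e (x - y) * \<phi> y = (indicator K y * \<phi> y) * (mollifier e (x - y))"
    proof (cases "y \<in> K")
      case False
      then have "mollifier e (x - y) = 0" using that by (intro mollifier_zero) (auto simp: dist_norm subset_iff not_le)
      then show ?thesis by simp
    qed simp
    qed
    then show ?thesis unfolding P_def by (simp only:)
  qed
  have Kint: "integrable lebesgue (\<lambda>y. indicator K y * \<phi> y)" if "compact K" "K \<subseteq> slab" for K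
  proof -
    have 1: "integrable (lebesgue_on K) \<phi>" using li that by (simp add: loc_integrable_def)
    have "K \<inter> space lebesgue \<in> sets lebesgue" using compact_imp_closed[OF that(1)] by simp
    from integrable_restrict_space[OF this, of \<phi>] 1 show ?thesis by simp
  qed
  have Psm: "smooth_on UNIV (\<lambda>x. (LINT y|lebesgue. (indicator K y * \<phi> y) * (mollifier e (x - y))) / c)" if "compact K" "K \<subseteq> slab" "0 < e" for K e
    unfolding divide_inverse by (intro smooth_on_intros open_UNIV conv_smooth Kint mollifier_test that)
  have fP: "f x = P e x" if "0 < e" "e < depth x" for e x
    unfolding f_def using that by (intro indep) auto
  have smf: "smooth_on slab f"
  proof (rule smooth_on_local)
    fix x0 assume "x0 \<in> slab"
    then have d: "depth x0 > 0" by (simp add: depth_pos)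
    \<comment> \<open>Radius depth/4 for the kernel and depth/4 for the neighbourhood of
      \<open>x0\<close> add up to the ball \<open>K\<close>, which lies in the slab. On
      \<open>K\<close> the function \<phi> is integrable and the convolution lemmas apply.\<close>
    define K where "K = cball x0 (depth x0 / 2)"
    have K: "compact K" "K \<subseteq> slab" using d by (auto simp: K_def intro!: cball_subset_slab)
    have "f x = (LINT y|lebesgue. (indicator K y * \<phi> y) * (mollifier (depth x0 / 4) (x - y))) / c" if x: "x \<in> ball x0 (depth x0 / 4)" for x
    proof -
      have n: "norm (x0 - x) < depth x0 / 4" using x by (simp add: dist_norm)
      have "depth x0 / 4 < depth x" using depth_Lipschitz[of x0 x] n d by linarith
      then have "f x = P (depth x0 / 4) x" using d by (intro fP) auto
      also have "cball x (depth x0 / 4) \<subseteq> K"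
      proof
        fix y assume "y \<in> cball x (depth x0 / 4)"
        then have "dist x y \<le> depth x0 / 4" by simp
        then have "dist x0 y \<le> depth x0 / 2" using dist_triangle[of x0 y x] x d by (simp add: dist_commute)
        then show "y \<in> K" by (simp add: K_def)
      qed
      then have "P (depth x0 / 4) x = (LINT y|lebesgue. (indicator K y * \<phi> y) * (mollifier (depth x0 / 4) (x - y))) / c"
        using d by (intro restr) auto
      finally show ?thesis .
    qed
    then have "smooth_on (ball x0 (depth x0 / 4)) f"
      using smooth_on_subset[OF Psm[OF K, of "depth x0 / 4"]] d by (subst smooth_on_cong) auto
    then show "\<exists>V. open V \<and> x0 \<in> V \<and> smooth_on V f" using d by (intro exI[of _ "ball x0 (depth x0 / 4)"]) auto
  qed
  obtain B where B: "B \<ge> 0" "\<And>e. e > 0 \<Longrightarrow> (\<integral>x. \<bar>mollifier e x\<bar> \<partial>lborel) \<le> B" using mollifier_L1_bound by metis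
  have weak: "(LINT x|lebesgue. \<psi> x * f x) = (LINT x|lebesgue. \<psi> x * \<phi> x)" if \<psi>: "\<psi> \<in> test_fun slab" for \<psi>
  proof -
    have \<psi>U: "\<psi> \<in> test_fun UNIV" using \<psi> by (rule test_fun_mono[rotated]) simp
    obtain K0 where K0: "compact K0" "K0 \<subseteq> slab" "\<And>x. x \<notin> K0 \<Longrightarrow> \<psi> x = 0" using \<psi> by (rule test_funE) blast
    obtain d where d: "d > 0" "\<And>x. x \<in> K0 \<Longrightarrow> d < depth x" using compact_slab_depth[OF K0(1,2)] by blast
    \<comment> \<open>The closed d-neighbourhood of the support of \<psi>: mollification at points
      of the support with radius below d sees \<phi> only on this compact subset of the
      slab.\<close>
    define K where "K = {x + y | x y. x \<in> K0 \<and> y \<in> cball 0 d}"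
    have "compact K" unfolding K_def by (intro compact_sums K0 compact_cball)
    moreover have "K \<subseteq> slab"
    proof
      fix z assume "z \<in> K"
      then obtain x y where "z = x + y" "x \<in> K0" "norm y \<le> d" by (auto simp: K_def)
      then have "depth z > 0" using depth_Lipschitz[of x z] d(2)[of x] by (auto simp: norm_minus_commute)
      then show "z \<in> slab" by (simp add: depth_pos)
    qed
    ultimately have K: "compact K" "K \<subseteq> slab" .
    have cK: "cball x e \<subseteq> K" if "x \<in> K0" "e \<le> d" for x e
    proof
      fix y assume "y \<in> cball x e"
      then have "y = x + (y - x) \<and> x \<in> K0 \<and> y - x \<in> cball 0 d" using that by (auto simp: dist_norm norm_minus_commute)
      then show "y \<in> K" unfolding K_def by blast
    qed
    define m where "m y = indicator K y * \<phi> y" for y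
    have m: "integrable lebesgue m" using Kint[OF K] by (simp add: m_def[abs_def])
    obtain L where L: "L \<ge> 0" "\<And>u v. \<bar>\<psi> u - \<psi> v\<bar> \<le> L * norm (u - v)" using \<psi> by (rule test_fun_Lipschitz) blast
    \<comment> \<open>The mollifier is moved from \<phi> to the Lipschitz function \<psi>. Since its
      total mass is c, the smeared \<psi> differs from c \<psi> by at most L e times the bound B for
      the integral of its absolute value.\<close>
    have close: "\<bar>(\<integral>x. \<psi> x * mollifier e (x - y) \<partial>lborel) - c * \<psi> y\<bar> \<le> L * e * B" if e: "e > 0" for e y
    proof -
      let ?m = "\<lambda>x. mollifier e (x - y)"
      have tr: "distr lborel borel ((+) y) = (lborel :: (real^3) measure)" by (rule lborel_distr_plus)
      have mm: "mollifier e \<in> borel_measurable borel" by (rule test_fun_measurable[OF mollifier_test[OF e]])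
      have mm': "?m \<in> borel_measurable borel" using mm by measurable
      have shift: "(\<integral>x. g (x - y) \<partial>lborel) = (\<integral>x. g x \<partial>lborel)" "integrable lborel g \<Longrightarrow> integrable lborel (\<lambda>x. g (x - y))" if [measurable]: "g \<in> borel_measurable borel" for g :: "real^3 \<Rightarrow> real"
      proof -
        have "(\<integral>x. g (x - y) \<partial>lborel) = (\<integral>x. g (x - y) \<partial>distr lborel borel ((+) y))" by (simp add: tr)
        also have "\<dots> = (\<integral>x. g x \<partial>lborel)" by (subst integral_distr) auto
        finally show "(\<integral>x. g (x - y) \<partial>lborel) = (\<integral>x. g x \<partial>lborel)" .
        have "integrable (distr lborel borel ((+) y)) (\<lambda>x. g (x - y)) = integrable lborel (\<lambda>x. g x)" by (subst integrable_distr_eq) auto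
        then show "integrable lborel g \<Longrightarrow> integrable lborel (\<lambda>x. g (x - y))" by (simp add: tr)
      qed
      have i1: "integrable lborel ?m" by (rule shift(2)[OF mm test_fun_lborel(1)[OF mollifier_test[OF e]]])
      obtain M where M: "\<And>x. \<bar>mollifier e x\<bar> \<le> M" using mollifier_test[OF e] by (rule test_fun_bounded) blast
      have "integrable lborel (\<lambda>x. M * \<psi> x)" using test_fun_lborel(1)[OF \<psi>U] by simp
      then have i2: "integrable lborel (\<lambda>x. \<psi> x * ?m x)"
      proof (rule Bochner_Integration.integrable_bound)
        show "(\<lambda>x. \<psi> x * ?m x) \<in> borel_measurable lborel" using mm' test_fun_measurable[OF \<psi>] by measurable
        have "\<bar>\<psi> x\<bar> * \<bar>?m x\<bar> \<le> \<bar>\<psi> x\<bar> * \<bar>M\<bar>" for x using M[of "x - y"] by (intro mult_left_mono) auto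
        then show "AE x in lborel. norm (\<psi> x * ?m x) \<le> norm (M * \<psi> x)" by (intro AE_I2) (simp add: abs_mult mult.commute)
      qed
      have "c = (\<integral>x. ?m x \<partial>lborel)" unfolding c_def shift(1)[OF mm] by (rule mollifier_integral[OF e, symmetric])
      then have "(\<integral>x. \<psi> x * ?m x \<partial>lborel) - c * \<psi> y = (\<integral>x. \<psi> x * ?m x - ?m x * \<psi> y \<partial>lborel)"
        using i1 i2 by simp
      also have "norm \<dots> \<le> (\<integral>x. (L * e) * \<bar>?m x\<bar> \<partial>lborel)"
      proof (rule Bochner_Integration.integral_norm_bound_integral)
        fix x
        have "\<bar>\<psi> x - \<psi> y\<bar> * \<bar>?m x\<bar> \<le> (L * e) * \<bar>?m x\<bar>"
        proof (cases "norm (x - y) \<le> e")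
          case True
          then have "\<bar>\<psi> x - \<psi> y\<bar> \<le> L * e" using L(2)[of x y] mult_left_mono[OF True L(1)] by linarith
          then show ?thesis by (intro mult_right_mono) auto
        next
          case False
          then have "?m x = 0" using e by (intro mollifier_zero) auto
          then show ?thesis by simp
        qed
        moreover have "\<psi> x * ?m x - ?m x * \<psi> y = (\<psi> x - \<psi> y) * ?m x" by (simp add: algebra_simps)
        ultimately show "norm (\<psi> x * ?m x - ?m x * \<psi> y) \<le> L * e * \<bar>?m x\<bar>" by (simp add: abs_mult)
      qed (use i1 i2 in auto)
      also have "\<dots> = (L * e) * (\<integral>x. \<bar>mollifier e x\<bar> \<partial>lborel)"
        using shift(1)[of "\<lambda>x. \<bar>mollifier e x\<bar>"] mm by simp
      also have "\<dots> \<le> L * e * B" using B(2)[OF e] L(1) e by (intro mult_left_mono) auto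
      finally show ?thesis by (simp only: real_norm_def)
    qed
    have bound: "\<bar>c * (LINT x|lebesgue. \<psi> x * f x) - c * (LINT x|lebesgue. \<psi> x * \<phi> x)\<bar> \<le> e * (L * B * (LINT y|lebesgue. \<bar>m y\<bar>))" if e: "0 < e" "e < d" for e
    proof -
      have mt: "mollifier e \<in> test_fun UNIV" by (rule mollifier_test[OF e(1)])
      have "\<psi> x * f x = \<psi> x * ((LINT y|lebesgue. m y * mollifier e (x - y)) / c)" for x
      proof (cases "x \<in> K0")
        case True
        then have "f x = P e x" using d(2)[OF True] e by (intro fP) auto
        also have "\<dots> = (LINT y|lebesgue. m y * mollifier e (x - y)) / c"
          unfolding m_def using restr[OF e(1) cK[OF True]] e by simp
        finally show ?thesis by simp
      qed (simp add: K0(3))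
      then have "c * (LINT x|lebesgue. \<psi> x * f x) = (LINT x|lebesgue. \<psi> x * (LINT y|lebesgue. m y * mollifier e (x - y)))"
        using c by simp
      also have "\<dots> = (LINT y|lebesgue. m y * (\<integral>x. \<psi> x * mollifier e (x - y) \<partial>lborel))"
        by (rule conv_swap[OF m mt \<psi>U])
      finally have 1: "c * (LINT x|lebesgue. \<psi> x * f x) = (LINT y|lebesgue. m y * (\<integral>x. \<psi> x * mollifier e (x - y) \<partial>lborel))" .
      have "\<psi> y * \<phi> y = m y * \<psi> y" for y
      proof (cases "y \<in> K0")
        case True
        then have "y \<in> K" using cK[OF True, of 0] d(1) by auto
        then show ?thesis by (simp add: m_def)
      qed (simp add: K0(3))
      then have "(LINT x|lebesgue. \<psi> x * \<phi> x) = (LINT y|lebesgue. m y * \<psi> y)" by (intro Bochner_Integration.integral_cong) simp_all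
      then have 2: "c * (LINT x|lebesgue. \<psi> x * \<phi> x) = (LINT y|lebesgue. m y * (c * \<psi> y))" by (simp add: mult.left_commute)
      obtain B\<psi> where B\<psi>: "\<And>x. \<bar>\<psi> x\<bar> \<le> B\<psi>" using \<psi> by (rule test_fun_bounded) blast
      have i2: "integrable lebesgue (\<lambda>y. m y * (c * \<psi> y))"
      proof (rule integrable_mult_bounded[OF m])
        show "(\<lambda>y. c * \<psi> y) \<in> borel_measurable borel" using test_fun_measurable[OF \<psi>] by measurable
        show "\<bar>c * \<psi> y\<bar> \<le> \<bar>c\<bar> * B\<psi>" for y using B\<psi>[of y] by (simp add: abs_mult mult_left_mono)
      qed
      have meas: "(\<lambda>y. \<integral>x. \<psi> x * mollifier e (x - y) \<partial>lborel) \<in> borel_measurable borel"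
      proof -
        have [measurable]: "mollifier e \<in> borel_measurable borel" "\<psi> \<in> borel_measurable borel"
          using test_fun_measurable mt \<psi> by blast+
        have "(\<lambda>y. \<integral>x. \<psi> x * mollifier e (x - y) \<partial>lborel) \<in> borel_measurable lborel" by measurable
        then show ?thesis by simp
      qed
      have i1: "integrable lebesgue (\<lambda>y. m y * (\<integral>x. \<psi> x * mollifier e (x - y) \<partial>lborel))"
      proof (rule integrable_mult_bounded[OF m meas])
        fix y
        have "\<bar>c * \<psi> y\<bar> \<le> \<bar>c\<bar> * B\<psi>" using B\<psi>[of y] by (simp add: abs_mult mult_left_mono)
        then show "\<bar>\<integral>x. \<psi> x * mollifier e (x - y) \<partial>lborel\<bar> \<le> L * e * B + \<bar>c\<bar> * B\<psi>" using close[OF e(1), of y] by linarith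
      qed
      have "c * (LINT x|lebesgue. \<psi> x * f x) - c * (LINT x|lebesgue. \<psi> x * \<phi> x) =
        (LINT y|lebesgue. m y * (\<integral>x. \<psi> x * mollifier e (x - y) \<partial>lborel) - m y * (c * \<psi> y))"
        unfolding 1 2 Bochner_Integration.integral_diff[OF i1 i2] ..
      also have "norm \<dots> \<le> (LINT y|lebesgue. (L * e * B) * \<bar>m y\<bar>)"
      proof (rule Bochner_Integration.integral_norm_bound_integral[OF Bochner_Integration.integrable_diff[OF i1 i2]])
        show "integrable lebesgue (\<lambda>y. L * e * B * \<bar>m y\<bar>)" using m by simp
        fix y
        show "norm (m y * (\<integral>x. \<psi> x * mollifier e (x - y) \<partial>lborel) - m y * (c * \<psi> y)) \<le> L * e * B * \<bar>m y\<bar>"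
          unfolding right_diff_distrib[symmetric] real_norm_def abs_mult mult.commute[of "\<bar>m y\<bar>"]
          by (intro mult_right_mono close e) simp
      qed
      finally show ?thesis by (simp add: mult_ac)
    qed
    let ?X = "\<bar>c * (LINT x|lebesgue. \<psi> x * f x) - c * (LINT x|lebesgue. \<psi> x * \<phi> x)\<bar>"
    \<comment> \<open>The left-hand side of the bound no longer depends on e, so e may tend to
      0.\<close>
    have "((\<lambda>e. e * (L * B * (LINT y|lebesgue. \<bar>m y\<bar>))) \<longlongrightarrow> 0 * (L * B * (LINT y|lebesgue. \<bar>m y\<bar>))) (at_right 0)"
      by (intro tendsto_intros)
    then have "?X \<le> 0 * (L * B * (LINT y|lebesgue. \<bar>m y\<bar>))"
      by (rule tendsto_lowerbound) (use eventually_at_right_real[OF d(1)] in \<open>auto elim!: eventually_mono intro: bound\<close>)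
    then show ?thesis using c by simp
  qed
  have lf: "loc_integrable f" by (rule loc_integrable_continuous[OF smooth_on_continuous[OF smf]])
  have "AE x in lebesgue. x \<in> slab \<longrightarrow> f x - \<phi> x = 0"
  proof (rule fundamental_lemma)
    show "loc_integrable (\<lambda>x. f x - \<phi> x)" using lf li by (auto simp: loc_integrable_def)
    fix \<psi> assume \<psi>: "\<psi> \<in> test_fun slab"
    have "(LINT x|lebesgue_on slab. \<psi> x * (f x - \<phi> x)) = (LINT x|lebesgue. \<psi> x * f x - \<psi> x * \<phi> x)"
      using LINT_slab_test[OF \<psi>, of "\<lambda>x. f x - \<phi> x"] by (simp add: right_diff_distrib)
    also have "\<dots> = 0" using weak[OF \<psi>] integrable_mult_test[OF lf \<psi>] integrable_mult_test[OF li \<psi>] by simp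
    finally show "(LINT x|lebesgue_on slab. \<psi> x * (f x - \<phi> x)) = 0" .
  qed
  then have "AE x in lebesgue. x \<in> slab \<longrightarrow> f x = \<phi> x" by eventually_elim simp
  with smf show ?thesis by (rule that)
qed

section \<open>The first horizontal derivatives\<close>

definition slab_int :: "(real^3 \<Rightarrow> real) \<Rightarrow> real" where
  "slab_int g = (\<integral>x. indicator slab x * g x \<partial>lborel)"

abbreviation slab_integrable :: "(real^3 \<Rightarrow> real) \<Rightarrow> bool" where
  "slab_integrable g \<equiv> integrable lborel (\<lambda>x. indicator slab x * g x)"

lemma slab_integrable_nonneg:
  assumes "continuous_on slab g" "\<And>x. x \<in> slab \<Longrightarrow> 0 \<le> g x" "slab_nn g < top"
  shows "slab_integrable g" "ennreal (slab_int g) = slab_nn g"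
proof -
  have m: "(\<lambda>x. indicator slab x * g x) \<in> borel_measurable borel"
    using borel_measurable_continuous_on_indicator[OF slab_measurable assms(1)] by simp
  have e: "(\<integral>\<^sup>+x. ennreal (indicator slab x * g x) \<partial>lborel) = slab_nn g"
    unfolding slab_nn_def by (intro nn_integral_cong) (auto split: split_indicator)
  show i: "slab_integrable g"
    using assms m by (intro integrableI_nonneg) (auto split: split_indicator simp: e[symmetric])
  then show "ennreal (slab_int g) = slab_nn g"
    unfolding slab_int_def e[symmetric] using assms(2) by (intro nn_integral_eq_integral[symmetric]) (auto split: split_indicator)
qed

lemma slab_nn_eq:
  assumes "slab_integrable g" "\<And>x. x \<in> slab \<Longrightarrow> 0 \<le> g x" shows "slab_nn g = ennreal (slab_int g)"
proof -
  have e: "(\<integral>\<^sup>+x. ennreal (indicator slab x * g x) \<partial>lborel) = slab_nn g"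
    unfolding slab_nn_def by (intro nn_integral_cong) (auto split: split_indicator)
  show ?thesis unfolding slab_int_def e[symmetric] using assms by (intro nn_integral_eq_integral) (auto split: split_indicator)
qed

lemma slab_integrable_bound:
  assumes "slab_integrable g" "continuous_on slab h" "\<And>x. x \<in> slab \<Longrightarrow> \<bar>h x\<bar> \<le> g x"
  shows "slab_integrable h"
proof (rule Bochner_Integration.integrable_bound[OF assms(1)])
  show "(\<lambda>x. indicator slab x * h x) \<in> borel_measurable lborel"
    using borel_measurable_continuous_on_indicator[OF slab_measurable assms(2)] by simp
  have "norm (indicator slab x * h x) \<le> norm (indicator slab x * g x)" for x
    using assms(3)[of x] by (auto split: split_indicator)
  then show "AE x in lborel. norm (indicator slab x * h x) \<le> norm (indicator slab x * g x)" by simp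
qed

lemma slab_int_mono: "slab_integrable g \<Longrightarrow> slab_integrable h \<Longrightarrow> (\<And>x. x \<in> slab \<Longrightarrow> g x \<le> h x) \<Longrightarrow> slab_int g \<le> slab_int h"
  unfolding slab_int_def by (intro integral_mono) (auto split: split_indicator)

lemma slab_int_nonneg: "(\<And>x. x \<in> slab \<Longrightarrow> 0 \<le> g x) \<Longrightarrow> 0 \<le> slab_int g"
  unfolding slab_int_def by (intro integral_nonneg_AE AE_I2) (auto split: split_indicator)

lemma slab_int_add:
  assumes "slab_integrable g" "slab_integrable h"
  shows "slab_integrable (\<lambda>x. g x + h x)" "slab_int (\<lambda>x. g x + h x) = slab_int g + slab_int h"
  using Bochner_Integration.integrable_add[OF assms] Bochner_Integration.integral_add[OF assms]
  by (simp_all add: slab_int_def distrib_left)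

lemma slab_int_cmult:
  assumes "slab_integrable g"
  shows "slab_integrable (\<lambda>x. c * g x)" "slab_int (\<lambda>x. c * g x) = c * slab_int g"
  using integrable_mult_right[OF assms, of c] Bochner_Integration.integral_mult_right_zero[of lborel c "\<lambda>x. indicator slab x * g x"]
  by (simp_all add: slab_int_def mult.left_commute)

lemma slab_int_tendsto:
  assumes cont: "\<And>n. continuous_on slab (g n)" "continuous_on slab g'" and dom: "slab_integrable w"
    and le: "\<And>n x. x \<in> slab \<Longrightarrow> \<bar>g n x\<bar> \<le> w x" and lim: "\<And>x. x \<in> slab \<Longrightarrow> (\<lambda>n. g n x) \<longlonglongrightarrow> g' x"
  shows "(\<lambda>n. slab_int (g n)) \<longlonglongrightarrow> slab_int g'"
  unfolding slab_int_def
proof (rule integral_dominated_convergence[OF _ _ dom])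
  show "(\<lambda>x. indicator slab x * g' x) \<in> borel_measurable lborel" "(\<lambda>x. indicator slab x * g n x) \<in> borel_measurable lborel" for n
    using borel_measurable_continuous_on_indicator[OF slab_measurable cont(1)[of n]]
      borel_measurable_continuous_on_indicator[OF slab_measurable cont(2)] by simp_all
  show "AE x in lborel. (\<lambda>n. indicator slab x * g n x) \<longlonglongrightarrow> indicator slab x * g' x"
    using lim by (intro AE_I2) (auto split: split_indicator)
  show "AE x in lborel. norm (indicator slab x * g n x) \<le> indicator slab x * w x" for n
    using le by (intro AE_I2) (auto split: split_indicator)
qed

text \<open>As for \<open>Hardy_midplane\<close>, without weight: the box is cut along the
  hyperplane where \<open>f\<close> vanishes, and on each part the multiplier x_i - e is zero on the
  outer face. Its size is at most the side length L; the two parts contribute 2 L^2 each, and the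
  factor 1/2 in front of f^2 doubles the sum to 8 L^2.\<close>

lemma box_Poincare_anchored:
  fixes a b :: "real^3"
  assumes f: "smooth_on UNIV f" and zero: "\<And>x. x $ i = c \<Longrightarrow> f x = 0" and c: "a $ i \<le> c" "c \<le> b $ i"
  shows "(\<integral>\<^sup>+x. indicator (cbox a b) x * ennreal ((f x)\<^sup>2) \<partial>lborel) \<le>
    ennreal (8 * (b $ i - a $ i)\<^sup>2) * (\<integral>\<^sup>+x. indicator (cbox a b) x * ennreal ((pd i f x)\<^sup>2) \<partial>lborel)"
proof -
  define L where "L = b $ i - a $ i"
  note cont = continuous_on_subset[OF smooth_on_continuous[OF f] subset_UNIV] continuous_on_subset[OF smooth_on_continuous[OF smooth_on_pd[OF f]] subset_UNIV]
  define I where "I = (\<integral>\<^sup>+x. indicator (cbox a b) x * ennreal (2 * L\<^sup>2 * (pd i f x)\<^sup>2) \<partial>lborel)"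
  have meas: "(\<lambda>x. indicator (cbox u v) x * ennreal (g x)) \<in> borel_measurable borel" if "continuous_on UNIV g" for u v :: "real^3" and g
    using borel_measurable_continuous_onI[OF that] by measurable
  have half: "(\<integral>\<^sup>+x. indicator (cbox u v) x * ennreal ((1/2) * (f x)\<^sup>2) \<partial>lborel) \<le> I"
    if uv: "cbox u v \<subseteq> cbox a b" "(e = u $ i \<and> v $ i = c) \<or> (e = v $ i \<and> u $ i = c)"
      "\<And>x. x \<in> cbox u v \<Longrightarrow> \<bar>x $ i - e\<bar> \<le> L" for u v :: "real^3" and e
  proof -
    define F where "F j = (if j = i then (\<lambda>x. (x $ i - e) * (f x * f x)) else (\<lambda>x. 0))" for j
    have pdF: "(\<Sum>j\<in>UNIV. pd j (F j) x) = (f x)\<^sup>2 + 2 * (x $ i - e) * f x * pd i f x" for x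
    proof -
      have "pd j (F j) x = (if j = i then pd i (\<lambda>x. (x $ i - e) * (f x * f x)) x else 0)" for j by (simp add: F_def)
      moreover have "pd i (\<lambda>x. (x $ i - e) * (f x * f x)) x = (f x)\<^sup>2 + 2 * (x $ i - e) * f x * pd i f x"
        using smooth_on_differentiable[OF f UNIV_I]
        by (simp add: pd_mult pd_diff differentiable_mult differentiable_diff power2_eq_square algebra_simps)
      ultimately show ?thesis by simp
    qed
    have le: "(1/2) * (f x)\<^sup>2 \<le> 2 * L\<^sup>2 * (pd i f x)\<^sup>2 + (\<Sum>j\<in>UNIV. pd j (F j) x)" if x: "x \<in> cbox u v" for x
    proof -
      have "(x $ i - e)\<^sup>2 \<le> L\<^sup>2" using power_mono[OF uv(3)[OF x], of 2] by simp
      then have "(x $ i - e)\<^sup>2 * (pd i f x)\<^sup>2 \<le> L\<^sup>2 * (pd i f x)\<^sup>2" by (intro mult_right_mono) auto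
      moreover have "0 \<le> (f x + 2 * ((x $ i - e) * pd i f x))\<^sup>2" by simp
      ultimately show ?thesis unfolding pdF by (simp add: power2_eq_square algebra_simps)
    qed
    have "(\<integral>\<^sup>+x. indicator (cbox u v) x * ennreal ((1/2) * (f x)\<^sup>2) \<partial>lborel)
      \<le> (\<integral>\<^sup>+x. indicator (cbox u v) x * ennreal (2 * L\<^sup>2 * (pd i f x)\<^sup>2) \<partial>lborel)"
    proof (rule cbox_ineq[OF open_UNIV subset_UNIV, where F=F])
      show "smooth_on UNIV (F j)" for j unfolding F_def
        by (auto intro!: smooth_on_intros f)
      fix j :: 3 and x :: "real^3"
      show "F j (x + (v $ j - x $ j) *\<^sub>R axis j 1) \<le> F j (x + (u $ j - x $ j) *\<^sub>R axis j 1)"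
        using uv(2) by (auto simp: F_def axis_def zero)
    qed (use le in \<open>auto intro!: continuous_intros cont\<close>)
    also have "\<dots> \<le> I" unfolding I_def using uv(1)
      by (intro nn_integral_mono) (auto split: split_indicator)
    finally show ?thesis .
  qed
  define m1 m2 :: "real^3" where "m1 = (\<chi> j. if j = i then c else a $ j)" and "m2 = (\<chi> j. if j = i then c else b $ j)"
  have mem: "x \<in> cbox a m2 \<longleftrightarrow> x \<in> cbox a b \<and> x $ i \<le> c" "x \<in> cbox m1 b \<longleftrightarrow> x \<in> cbox a b \<and> c \<le> x $ i" for x
  proof -
    have "(\<forall>j. x $ j \<le> (if j = i then c else b $ j)) \<longleftrightarrow> (\<forall>j. x $ j \<le> b $ j) \<and> x $ i \<le> c"
    proof (intro iffI conjI allI)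
      fix j assume h: "\<forall>j. x $ j \<le> (if j = i then c else b $ j)"
      show "x $ j \<le> b $ j" using spec[OF h, of j] c(2) by (cases "j = i") simp_all
      show "x $ i \<le> c" using spec[OF h, of i] by simp
    qed auto
    moreover have "(\<forall>j. (if j = i then c else a $ j) \<le> x $ j) \<longleftrightarrow> (\<forall>j. a $ j \<le> x $ j) \<and> c \<le> x $ i"
    proof (intro iffI conjI allI)
      fix j assume h: "\<forall>j. (if j = i then c else a $ j) \<le> x $ j"
      show "a $ j \<le> x $ j" using spec[OF h, of j] c(1) by (cases "j = i") simp_all
      show "c \<le> x $ i" using spec[OF h, of i] by simp
    qed auto
    ultimately show "x \<in> cbox a m2 \<longleftrightarrow> x \<in> cbox a b \<and> x $ i \<le> c" "x \<in> cbox m1 b \<longleftrightarrow> x \<in> cbox a b \<and> c \<le> x $ i"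
      unfolding mem_box_cart m1_def m2_def vec_lambda_beta all_conj_distrib by blast+
  qed
  have 1: "(\<integral>\<^sup>+x. indicator (cbox a m2) x * ennreal ((1/2) * (f x)\<^sup>2) \<partial>lborel) \<le> I"
  proof (rule half[where e="a $ i"])
    fix x assume "x \<in> cbox a m2"
    then have "a $ i \<le> x $ i" "x $ i \<le> b $ i" unfolding mem by (auto simp: mem_box_cart)
    then show "\<bar>x $ i - a $ i\<bar> \<le> L" by (simp add: L_def)
  next
    show "cbox a m2 \<subseteq> cbox a b" using mem(1) by blast
    show "(a $ i = a $ i \<and> m2 $ i = c) \<or> (a $ i = m2 $ i \<and> a $ i = c)" by (simp add: m2_def)
  qed
  have 2: "(\<integral>\<^sup>+x. indicator (cbox m1 b) x * ennreal ((1/2) * (f x)\<^sup>2) \<partial>lborel) \<le> I"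
  proof (rule half[where e="b $ i"])
    fix x assume "x \<in> cbox m1 b"
    then have "a $ i \<le> x $ i" "x $ i \<le> b $ i" unfolding mem by (auto simp: mem_box_cart)
    then show "\<bar>x $ i - b $ i\<bar> \<le> L" by (simp add: L_def)
  next
    show "cbox m1 b \<subseteq> cbox a b" using mem(2) by blast
    show "(b $ i = m1 $ i \<and> b $ i = c) \<or> (b $ i = b $ i \<and> m1 $ i = c)" by (simp add: m1_def)
  qed
  have contf: "continuous_on UNIV (\<lambda>x. (1/2) * (f x)\<^sup>2)" "continuous_on UNIV (\<lambda>x. (f x)\<^sup>2)" "continuous_on UNIV (\<lambda>x. (pd i f x)\<^sup>2)"
    by (intro continuous_intros cont)+
  have "(\<integral>\<^sup>+x. indicator (cbox a b) x * ennreal ((1/2) * (f x)\<^sup>2) \<partial>lborel) \<le>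
      (\<integral>\<^sup>+x. indicator (cbox a m2) x * ennreal ((1/2) * (f x)\<^sup>2) + indicator (cbox m1 b) x * ennreal ((1/2) * (f x)\<^sup>2) \<partial>lborel)"
    by (intro nn_integral_mono) (auto split: split_indicator simp: mem)
  also have "\<dots> \<le> I + I"
    by (subst nn_integral_add) (simp_all only: measurable_lborel2 meas[OF contf(1)] add_mono[OF 1 2])
  also have "I = ennreal (2 * L\<^sup>2) * (\<integral>\<^sup>+x. indicator (cbox a b) x * ennreal ((pd i f x)\<^sup>2) \<partial>lborel)"
  proof -
    have "I = (\<integral>\<^sup>+x. ennreal (2 * L\<^sup>2) * (indicator (cbox a b) x * ennreal ((pd i f x)\<^sup>2)) \<partial>lborel)"
      unfolding I_def by (intro nn_integral_cong) (auto split: split_indicator simp: ennreal_mult')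
    then show ?thesis using meas[OF contf(3)] by (simp add: nn_integral_cmult)
  qed
  finally have "ennreal 2 * (\<integral>\<^sup>+x. indicator (cbox a b) x * ennreal ((1/2) * (f x)\<^sup>2) \<partial>lborel) \<le>
     ennreal 2 * (ennreal (2 * L\<^sup>2) * (\<integral>\<^sup>+x. indicator (cbox a b) x * ennreal ((pd i f x)\<^sup>2) \<partial>lborel) + ennreal (2 * L\<^sup>2) * (\<integral>\<^sup>+x. indicator (cbox a b) x * ennreal ((pd i f x)\<^sup>2) \<partial>lborel))"
    by (rule mult_left_mono) simp
  also have "\<dots> = (ennreal 2 * (ennreal (2 * L\<^sup>2) + ennreal (2 * L\<^sup>2))) * (\<integral>\<^sup>+x. indicator (cbox a b) x * ennreal ((pd i f x)\<^sup>2) \<partial>lborel)"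
    by (simp only: distrib_right mult.assoc)
  also have "ennreal 2 * (ennreal (2 * L\<^sup>2) + ennreal (2 * L\<^sup>2)) = ennreal (8 * L\<^sup>2)"
  proof -
    have "ennreal (2 * L\<^sup>2) + ennreal (2 * L\<^sup>2) = ennreal (2 * L\<^sup>2 + 2 * L\<^sup>2)" by (rule ennreal_plus[symmetric]) auto
    then show ?thesis by (simp only:) (subst ennreal_mult'[symmetric], auto)
  qed
  also have "ennreal 2 * (\<integral>\<^sup>+x. indicator (cbox a b) x * ennreal ((1/2) * (f x)\<^sup>2) \<partial>lborel) = (\<integral>\<^sup>+x. indicator (cbox a b) x * ennreal ((f x)\<^sup>2) \<partial>lborel)"
  proof -
    have "ennreal 2 * (indicator (cbox a b) x * ennreal ((1/2) * (f x)\<^sup>2)) = indicator (cbox a b) x * ennreal ((f x)\<^sup>2)" for x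
      by (cases "x \<in> cbox a b") (simp_all add: ennreal_mult'[symmetric] del: ennreal_numeral)
    then show ?thesis by (subst nn_integral_cmult[symmetric]) (simp_all only: measurable_lborel2 meas[OF contf(1)])
  qed
  finally show ?thesis by (simp add: L_def)
qed

text \<open>Averaging: if all slices were worse, integration over |t| \<le> N would make the total
  exceed itself by \<tau>, which is absurd as it is finite. A slice is measured by freezing the
  first coordinate at t and still integrating over \<open>Q\<close>, which gives 2N times the slice
  integral. The slack \<tau> avoids any question of whether the mean is attained.\<close>

lemma good_slice:
  fixes g :: "real^3 \<Rightarrow> real" and N :: real
  assumes g: "continuous_on UNIV g" and N: "N > 0" and \<tau>: "\<tau> > 0"
    and Q: "Q = {x::real^3. \<bar>x $ 1\<bar> \<le> N \<and> \<bar>x $ 2\<bar> \<le> N \<and> x \<in> slab}"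
    and fin: "(\<integral>\<^sup>+x. indicator Q x * ennreal (g x) \<partial>lborel) < top"
  obtains t where "\<bar>t\<bar> \<le> N"
    "(\<integral>\<^sup>+x. indicator Q x * ennreal (g (x + (t - x $ 1) *\<^sub>R axis 1 1)) \<partial>lborel) \<le> (\<integral>\<^sup>+x. indicator Q x * ennreal (g x) \<partial>lborel) + ennreal \<tau>"
proof -
  have coord: "(\<lambda>y::real^3. y $ i) \<in> borel_measurable borel" for i
    by (intro borel_measurable_continuous_onI continuous_intros)
  note [measurable] = coord
  have [measurable]: "g \<in> borel_measurable borel" by (rule borel_measurable_continuous_onI[OF g])
  have QB[measurable]: "Q \<in> sets borel" unfolding Q by measurable
  let ?R = "{x::real^3. \<bar>x $ 2\<bar> \<le> N \<and> x \<in> slab}"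
  define k where "k t = (\<integral>\<^sup>+y. indicator {0<..<1} (y $ 1) * (indicator ?R y * ennreal (g (y + (t - y $ 1) *\<^sub>R axis 1 1))) \<partial>lborel)" for t
  let ?m = "\<integral>\<^sup>+x. indicator Q x * ennreal (g x) \<partial>lborel"
  have slab1: "y + s *\<^sub>R axis 1 1 \<in> slab \<longleftrightarrow> y \<in> slab" "(y + s *\<^sub>R axis 1 1) $ 2 = y $ 2" "(y + s *\<^sub>R axis 1 1) $ 1 = y $ 1 + s" for y s
    by (auto simp: slab_def axis_def)
  have Qi: "indicator Q (y + (t - y $ 1) *\<^sub>R axis 1 1) = (indicator {-N..N} t * indicator ?R y :: ennreal)" for y t
  proof -
    have "y + (t - y $ 1) *\<^sub>R axis 1 1 \<in> Q \<longleftrightarrow> t \<in> {-N..N} \<and> y \<in> ?R"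
      unfolding Q mem_Collect_eq slab1 by (auto simp: abs_le_iff)
    then show ?thesis by (simp add: indicator_def)
  qed
  have m1: "(\<lambda>x. indicator Q x * ennreal (g x)) \<in> borel_measurable borel" by measurable
  have m: "?m = (\<integral>\<^sup>+t. indicator {-N..N} t * k t \<partial>lborel)"
    unfolding nn_integral_slice(2)[OF m1, of 1] k_def Qi
    by (intro nn_integral_cong, subst nn_integral_cmult[symmetric]) (auto simp: mult_ac)
  have m2: "(\<lambda>x. indicator Q x * ennreal (g (x + (t - x $ 1) *\<^sub>R axis 1 1))) \<in> borel_measurable borel" for t by measurable
  have kt: "(\<integral>\<^sup>+x. indicator Q x * ennreal (g (x + (t - x $ 1) *\<^sub>R axis 1 1)) \<partial>lborel) = ennreal (2 * N) * k t" for t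
  proof -
    have e: "y + (s - y $ 1) *\<^sub>R axis 1 1 + (t - (y + (s - y $ 1) *\<^sub>R axis 1 1) $ 1) *\<^sub>R axis 1 1 = y + (t - y $ 1) *\<^sub>R axis 1 1" for y :: "real^3" and s
      by (simp add: slab1 scaleR_diff_left)
    have "(\<integral>\<^sup>+x. indicator Q x * ennreal (g (x + (t - x $ 1) *\<^sub>R axis 1 1)) \<partial>lborel) =
      (\<integral>\<^sup>+s. indicator {-N..N} s * k t \<partial>lborel)"
      unfolding nn_integral_slice(2)[OF m2[of t], of 1] k_def Qi e
      by (intro nn_integral_cong, subst nn_integral_cmult[symmetric]) (auto simp: mult_ac)
    also have "\<dots> = ennreal (2 * N) * k t" using N by (simp add: nn_integral_multc)
    finally show ?thesis .
  qed
  have "\<exists>t. \<bar>t\<bar> \<le> N \<and> ennreal (2 * N) * k t \<le> ?m + ennreal \<tau>"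
  proof (rule ccontr)
    assume c: "\<not> ?thesis"
    have [measurable]: "k \<in> borel_measurable borel" unfolding k_def by measurable
    have "ennreal (2 * N) * ?m = (\<integral>\<^sup>+t. indicator {-N..N} t * (ennreal (2 * N) * k t) \<partial>lborel)"
      unfolding m by (subst nn_integral_cmult[symmetric]) (auto simp: mult_ac)
    also have "\<dots> \<ge> (\<integral>\<^sup>+t. indicator {-N..N} t * (?m + ennreal \<tau>) \<partial>lborel)"
    proof (intro nn_integral_mono)
      fix t
      have "?m + ennreal \<tau> \<le> ennreal (2 * N) * k t" if "\<bar>t\<bar> \<le> N" using c that by (meson linear)
      then show "indicator {-N..N} t * (?m + ennreal \<tau>) \<le> indicator {-N..N} t * (ennreal (2 * N) * k t)"
        by (auto split: split_indicator simp: abs_le_iff)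
    qed
    also have "(\<integral>\<^sup>+t. indicator {-N..N} t * (?m + ennreal \<tau>) \<partial>lborel) = ennreal (2 * N) * (?m + ennreal \<tau>)"
      using N by (simp add: nn_integral_multc)
    finally have "?m + ennreal \<tau> \<le> ?m" using N by (subst (asm) ennreal_mult_le_mult_iff) auto
    then show False using fin \<tau> by (cases ?m rule: ennreal_cases) (auto simp flip: ennreal_plus)
  qed
  then obtain t where "\<bar>t\<bar> \<le> N" "ennreal (2 * N) * k t \<le> ?m + ennreal \<tau>" by blast
  then show ?thesis using that[of t] kt[of t] by simp
qed

text \<open>Lets closed boxes and pieces of the open slab be exchanged under the integral.\<close>

lemma AE_coord_neq: "AE x::real^3 in lborel. x $ i \<noteq> c"
proof -
  have "negligible {x::real^3. x \<bullet> axis i 1 = c}" by (rule negligible_standard_hyperplane) (simp add: axis_in_Basis_iff)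
  then have "negligible {x::real^3. x $ i = c}" by (simp add: inner_axis)
  then have "AE x in lebesgue. x \<notin> {x::real^3. x $ i = c}" by (intro AE_not_in) (simp add: negligible_iff_null_sets)
  then show ?thesis unfolding AE_completion_iff by simp
qed

text \<open>The difference \<Phi> - c is split at the line x_1 = t. The part \<Phi>(x_1, x_2) -
  \<Phi>(t, x_2) vanishes on x_1 = t and needs the first derivative; \<Phi>(t, x_2) - \<Phi>(t, 0)
  vanishes on x_2 = 0 and needs the second derivative on the line only, which is why t is taken from
  \<open>good_slice\<close>. The side length is 2N, so the parts give 32 and, with the slack S, 64;
  doubling the sum gives 192.\<close>

lemma Poincare:
  assumes \<Phi>: "smooth_on UNIV \<Phi>" and hor: "\<And>x y. x $ 1 = y $ 1 \<Longrightarrow> x $ 2 = y $ 2 \<Longrightarrow> \<Phi> x = \<Phi> y"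
    and N: "N > 0" and S: "S > 0" "\<And>i. i \<in> {1,2} \<Longrightarrow> slab_nn (\<lambda>x. (pd i \<Phi> x)\<^sup>2) \<le> ennreal S"
    and Q: "Q = {x::real^3. \<bar>x $ 1\<bar> \<le> N \<and> \<bar>x $ 2\<bar> \<le> N \<and> x \<in> slab}"
  obtains c where "(\<integral>\<^sup>+x. indicator Q x * ennreal ((\<Phi> x - c)\<^sup>2) \<partial>lborel) \<le> ennreal (192 * N\<^sup>2 * S)"
proof -
  define a b :: "real^3" where "a = (\<chi> i. if i = 3 then 0 else -N)" and "b = (\<chi> i. if i = 3 then 1 else N)"
  have ab [simp]: "a $ 1 = -N" "a $ 2 = -N" "a $ 3 = 0" "b $ 1 = N" "b $ 2 = N" "b $ 3 = 1" by (auto simp: a_def b_def)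
  have box: "(\<integral>\<^sup>+x. indicator (cbox a b) x * ennreal (g x) \<partial>lborel) = (\<integral>\<^sup>+x. indicator Q x * ennreal (g x) \<partial>lborel)" for g
  proof (rule nn_integral_cong_AE)
    show "AE x in lborel. indicator (cbox a b) x * ennreal (g x) = indicator Q x * ennreal (g x)"
      using AE_coord_neq[of 3 0] AE_coord_neq[of 3 1]
    proof eventually_elim
      case (elim x)
      then have "x \<in> cbox a b \<longleftrightarrow> x \<in> Q" by (auto simp: Q mem_box_cart forall_3 slab_def abs_le_iff)
      then show ?case by (simp add: indicator_def)
    qed
  qed
  have Qle: "(\<integral>\<^sup>+x. indicator Q x * ennreal ((pd i \<Phi> x)\<^sup>2) \<partial>lborel) \<le> ennreal S" if "i \<in> {1,2}" for i
  proof (rule order_trans[OF _ S(2)[OF that]])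
    show "(\<integral>\<^sup>+x. indicator Q x * ennreal ((pd i \<Phi> x)\<^sup>2) \<partial>lborel) \<le> slab_nn (\<lambda>x. (pd i \<Phi> x)\<^sup>2)"
      unfolding slab_nn_def by (intro nn_integral_mono) (auto simp: Q split: split_indicator)
  qed
  have c2: "continuous_on UNIV (\<lambda>x. (pd i \<Phi> x)\<^sup>2)" for i by (intro continuous_intros smooth_on_continuous smooth_on_pd \<Phi>)
  have fin: "(\<integral>\<^sup>+x. indicator Q x * ennreal ((pd 2 \<Phi> x)\<^sup>2) \<partial>lborel) < top" using Qle[of 2] by (auto simp: top.not_eq_extremum[symmetric] top_unique)
  obtain t where t: "\<bar>t\<bar> \<le> N"
    "(\<integral>\<^sup>+x. indicator Q x * ennreal ((pd 2 \<Phi> (x + (t - x $ 1) *\<^sub>R axis 1 1))\<^sup>2) \<partial>lborel) \<le> (\<integral>\<^sup>+x. indicator Q x * ennreal ((pd 2 \<Phi> x)\<^sup>2) \<partial>lborel) + ennreal S"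
    using good_slice[OF c2 N S(1) Q fin] by blast
  define u v :: "real^3 \<Rightarrow> real^3" where "u x = (\<chi> i. (\<chi> i. if i = 1 then 0 else 1) $ i * x $ i + (\<chi> i. if i = 1 then t else 0) $ i)"
    and "v x = (\<chi> i. (\<chi> i. if i = 3 then 1 else 0) $ i * x $ i + (\<chi> i. if i = 1 then t else 0) $ i)" for x
  have ueq: "x + (t - x $ 1) *\<^sub>R axis 1 1 = u x" for x by (auto simp: u_def vec_eq_iff axis_def)
  have smu: "smooth_on UNIV (\<lambda>x. \<Phi> (u x))" "pd i (\<lambda>x. \<Phi> (u x)) x = (if i = 1 then 0 else pd i \<Phi> (u x))" for i x
    using smooth_on_affine[OF open_UNIV \<Phi>, of "\<chi> i. if i = 1 then 0 else 1" "\<chi> i. if i = 1 then t else 0"] by (auto simp: u_def)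
  have smv: "smooth_on UNIV (\<lambda>x. \<Phi> (v x))" "pd 2 (\<lambda>x. \<Phi> (v x)) x = 0" for x
    using smooth_on_affine[OF open_UNIV \<Phi>, of "\<chi> i. if i = 3 then 1 else 0" "\<chi> i. if i = 1 then t else 0"] by (auto simp: v_def)
  define c where "c = \<Phi> (v 0)"
  have cv: "\<Phi> (v x) = c" for x unfolding c_def by (rule hor) (auto simp: v_def)
  define F1 F2 where "F1 x = \<Phi> x - \<Phi> (u x)" and "F2 x = \<Phi> (u x) - \<Phi> (v x)" for x
  have sF: "smooth_on UNIV F1" "smooth_on UNIV F2"
    unfolding F1_def[abs_def] F2_def[abs_def] by (intro smooth_on_intros open_UNIV \<Phi> smu smv)+
  note d = smooth_on_differentiable[OF \<Phi> UNIV_I] smooth_on_differentiable[OF smu(1) UNIV_I] smooth_on_differentiable[OF smv(1) UNIV_I]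
  have p1: "pd 1 F1 x = pd 1 \<Phi> x" for x unfolding F1_def[abs_def] by (subst pd_diff) (simp_all add: d smu(2))
  have p2: "pd 2 F2 x = pd 2 \<Phi> (u x)" for x unfolding F2_def[abs_def] by (subst pd_diff) (simp_all add: d smu(2) smv(2))
  have "(\<integral>\<^sup>+x. indicator (cbox a b) x * ennreal ((F1 x)\<^sup>2) \<partial>lborel) \<le> ennreal (8 * (b $ 1 - a $ 1)\<^sup>2) * (\<integral>\<^sup>+x. indicator (cbox a b) x * ennreal ((pd 1 F1 x)\<^sup>2) \<partial>lborel)"
  proof (rule box_Poincare_anchored[OF sF(1), where c=t])
    fix x :: "real^3" assume "x $ 1 = t"
    then have "u x = x" by (auto simp: u_def vec_eq_iff)
    then show "F1 x = 0" by (simp add: F1_def)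
  qed (use t in \<open>auto simp: abs_le_iff\<close>)
  also have "\<dots> \<le> ennreal (8 * (b $ 1 - a $ 1)\<^sup>2) * ennreal S" unfolding box p1 by (intro mult_left_mono Qle) auto
  also have "\<dots> = ennreal (32 * N\<^sup>2 * S)" using S by (simp add: ennreal_mult'[symmetric] power2_eq_square algebra_simps)
  finally have B1: "(\<integral>\<^sup>+x. indicator Q x * ennreal ((F1 x)\<^sup>2) \<partial>lborel) \<le> ennreal (32 * N\<^sup>2 * S)" unfolding box .
  have "(\<integral>\<^sup>+x. indicator (cbox a b) x * ennreal ((F2 x)\<^sup>2) \<partial>lborel) \<le> ennreal (8 * (b $ 2 - a $ 2)\<^sup>2) * (\<integral>\<^sup>+x. indicator (cbox a b) x * ennreal ((pd 2 F2 x)\<^sup>2) \<partial>lborel)"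
  proof (rule box_Poincare_anchored[OF sF(2), where c=0])
    fix x :: "real^3" assume "x $ 2 = 0"
    then have "u x = v x" by (auto simp: u_def v_def vec_eq_iff forall_3)
    then show "F2 x = 0" by (simp add: F2_def)
  qed (use N in auto)
  also have "\<dots> \<le> ennreal (8 * (b $ 2 - a $ 2)\<^sup>2) * (ennreal S + ennreal S)"
    unfolding box p2 ueq[symmetric] by (intro mult_left_mono order_trans[OF t(2)] add_mono Qle) auto
  also have "\<dots> = ennreal (64 * N\<^sup>2 * S)" using S by (simp add: ennreal_plus[symmetric] ennreal_mult'[symmetric] power2_eq_square algebra_simps del: ennreal_plus)
  finally have B2: "(\<integral>\<^sup>+x. indicator Q x * ennreal ((F2 x)\<^sup>2) \<partial>lborel) \<le> ennreal (64 * N\<^sup>2 * S)" unfolding box .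
  have coord [measurable]: "(\<lambda>y::real^3. y $ i) \<in> borel_measurable borel" for i
    by (intro borel_measurable_continuous_onI continuous_intros)
  have [measurable]: "Q \<in> sets borel" unfolding Q by measurable
  have [measurable]: "F1 \<in> borel_measurable borel" "F2 \<in> borel_measurable borel"
    using sF by (auto intro!: borel_measurable_continuous_onI smooth_on_continuous)
  have "(\<integral>\<^sup>+x. indicator Q x * ennreal ((\<Phi> x - c)\<^sup>2) \<partial>lborel) \<le>
      (\<integral>\<^sup>+x. 2 * (indicator Q x * ennreal ((F1 x)\<^sup>2)) + 2 * (indicator Q x * ennreal ((F2 x)\<^sup>2)) \<partial>lborel)"
  proof (intro nn_integral_mono)
    fix x
    have "\<Phi> x - c = F1 x + F2 x" by (simp add: F1_def F2_def cv)
    moreover have "(p + q)\<^sup>2 \<le> 2 * p\<^sup>2 + 2 * q\<^sup>2" for p q :: real using zero_le_power2[of "p - q"] by (simp add: power2_eq_square algebra_simps)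
    ultimately have "ennreal ((\<Phi> x - c)\<^sup>2) \<le> ennreal (2 * (F1 x)\<^sup>2 + 2 * (F2 x)\<^sup>2)" by (intro ennreal_leI) simp
    then show "indicator Q x * ennreal ((\<Phi> x - c)\<^sup>2) \<le> 2 * (indicator Q x * ennreal ((F1 x)\<^sup>2)) + 2 * (indicator Q x * ennreal ((F2 x)\<^sup>2))"
      by (auto split: split_indicator simp: ennreal_mult')
  qed
  also have "\<dots> = 2 * (\<integral>\<^sup>+x. indicator Q x * ennreal ((F1 x)\<^sup>2) \<partial>lborel) + 2 * (\<integral>\<^sup>+x. indicator Q x * ennreal ((F2 x)\<^sup>2) \<partial>lborel)"
    by (simp add: nn_integral_add nn_integral_cmult)
  also have "\<dots> \<le> ennreal 2 * ennreal (32 * N\<^sup>2 * S) + ennreal 2 * ennreal (64 * N\<^sup>2 * S)"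
    using B1 B2 by (intro add_mono) (auto intro!: mult_left_mono)
  also have "\<dots> = ennreal (192 * N\<^sup>2 * S)"
    using S by (simp add: ennreal_mult'[symmetric] ennreal_plus[symmetric] del: ennreal_plus ennreal_numeral)
  finally show ?thesis by (rule that)
qed

section \<open>Cut-off functions in the horizontal variables\<close>

definition plateau :: "real \<Rightarrow> real" where "plateau t = step_fun (2 - t) * step_fun (2 + t)"

lemma plateau_bounds: "0 \<le> plateau t" "plateau t \<le> 1" "\<bar>t\<bar> \<le> 1 \<Longrightarrow> plateau t = 1" "2 \<le> \<bar>t\<bar> \<Longrightarrow> plateau t = 0"
proof -
  show "0 \<le> plateau t" "plateau t \<le> 1" unfolding plateau_def using step_fun_bounds by (simp_all add: mult_le_one)
  show "\<bar>t\<bar> \<le> 1 \<Longrightarrow> plateau t = 1" by (simp add: plateau_def step_fun_1 abs_le_iff)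
  show "2 \<le> \<bar>t\<bar> \<Longrightarrow> plateau t = 0" by (cases "t \<ge> 0") (simp_all add: plateau_def step_fun_0)
qed

lemma DERIV_zero_locally_const:
  assumes "(f has_real_derivative D) (at t)" "open S" "t \<in> S" "\<And>s. s \<in> S \<Longrightarrow> f s = k"
  shows "D = 0"
proof -
  have "((\<lambda>s. k) has_real_derivative 0) (at t)" by simp
  then have "(f has_real_derivative 0) (at t)"
    by (rule has_field_derivative_transform_within_open) (use assms in auto)
  then show ?thesis using assms(1) DERIV_unique by blast
qed

lemma bounded_compact_support_real:
  fixes D :: "real \<Rightarrow> real"
  assumes "continuous_on UNIV D" "\<And>t. t \<notin> {a..b} \<Longrightarrow> D t = 0"
  obtains B where "B > 0" "\<And>t. \<bar>D t\<bar> \<le> B"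
proof -
  have "bounded (D ` {a..b})"
    by (intro compact_imp_bounded compact_continuous_image continuous_on_subset[OF assms(1)]) auto
  then obtain B where "\<forall>y\<in>D ` {a..b}. norm y \<le> B" unfolding bounded_iff by blast
  then have B: "\<And>t. t \<in> {a..b} \<Longrightarrow> \<bar>D t\<bar> \<le> B" by simp
  have "\<bar>D t\<bar> \<le> \<bar>B\<bar> + 1" for t using B[of t] assms(2)[of t] by (cases "t \<in> {a..b}") force+
  then show ?thesis using that[of "\<bar>B\<bar> + 1"] by auto
qed

lemma plateau_deriv:
  obtains p' B where "B > 0" "\<And>t. (plateau has_real_derivative p' t) (at t)" "\<And>t. \<bar>p' t\<bar> \<le> B"
    "\<And>t. \<bar>t\<bar> < 1 \<or> 2 < \<bar>t\<bar> \<Longrightarrow> p' t = 0"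
proof -
  obtain D where D: "continuous_on UNIV D" "\<And>t. (step_fun has_real_derivative D t) (at t)" using step_fun_deriv by blast
  define p' where "p' t = D (2 - t) * (- 1) * step_fun (2 + t) + D (2 + t) * 1 * step_fun (2 - t)" for t
  have d1: "((\<lambda>t. step_fun (2 - t)) has_real_derivative D (2 - t) * (- 1)) (at t)" for t
    by (rule DERIV_chain2[OF D(2)]) (auto intro!: derivative_eq_intros)
  have d2: "((\<lambda>t. step_fun (2 + t)) has_real_derivative D (2 + t) * 1) (at t)" for t
    by (rule DERIV_chain2[OF D(2)]) (auto intro!: derivative_eq_intros)
  have p: "(plateau has_real_derivative p' t) (at t)" for t
    using DERIV_mult[OF d1 d2] by (simp add: plateau_def[abs_def] p'_def)
  have 0: "p' t = 0" if "\<bar>t\<bar> < 1 \<or> 2 < \<bar>t\<bar>" for t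
    using that
  proof
    assume "\<bar>t\<bar> < 1"
    then show ?thesis by (intro DERIV_zero_locally_const[OF p, of "{-1<..<1}" _ 1]) (auto simp: plateau_bounds)
  next
    assume "2 < \<bar>t\<bar>"
    then show ?thesis by (intro DERIV_zero_locally_const[OF p, of "- {-2..2}" _ 0]) (auto simp: plateau_bounds intro!: plateau_bounds(4))
  qed
  have cs: "continuous_on UNIV step_fun" using D(2) by (intro DERIV_continuous_on) blast
  have "continuous_on UNIV p'" unfolding p'_def[abs_def]
    by (intro continuous_intros continuous_on_compose2[OF D(1)] continuous_on_compose2[OF cs]) auto
  then obtain B where "B > 0" "\<And>t. \<bar>p' t\<bar> \<le> B"
    using bounded_compact_support_real[of p' "-2" 2] 0 by (metis abs_le_iff atLeastAtMost_iff minus_le_iff not_le)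
  then show ?thesis using that p 0 by blast
qed

definition cutoff :: "real \<Rightarrow> real^3 \<Rightarrow> real" where "cutoff n x = plateau (x $ 1 / n) * plateau (x $ 2 / n)"

lemma smooth_on_cutoff: "smooth_on UNIV (cutoff n)"
  unfolding cutoff_def[abs_def] plateau_def divide_inverse
  by (intro smooth_on_intros smooth_on_step_fun open_UNIV)

lemma cutoff_bounds: "0 \<le> cutoff n x" "cutoff n x \<le> 1"
  unfolding cutoff_def using plateau_bounds by (simp_all add: mult_le_one)

lemma cutoff_eq_0: "n > 0 \<Longrightarrow> 2 * n \<le> \<bar>x $ 1\<bar> \<or> 2 * n \<le> \<bar>x $ 2\<bar> \<Longrightarrow> cutoff n x = 0"
  unfolding cutoff_def by (auto simp: plateau_bounds(4) le_divide_eq)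

lemma cutoff_eq_1: "n > 0 \<Longrightarrow> \<bar>x $ 1\<bar> \<le> n \<Longrightarrow> \<bar>x $ 2\<bar> \<le> n \<Longrightarrow> cutoff n x = 1"
  unfolding cutoff_def by (simp add: plateau_bounds(3) divide_le_eq)

text \<open>The constant is uniform in n by scaling. The last clause says that derivatives live
  where \<open>cutoff (n / 2)\<close> has already dropped to 0, a region that moves to infinity with
  n.\<close>

lemma cutoff_pd:
  obtains B where "B > 0" "\<And>n i x. n > 0 \<Longrightarrow> \<bar>pd i (cutoff n) x\<bar> \<le> B / n"
    "\<And>n i x. n > 0 \<Longrightarrow> \<bar>x $ 1\<bar> > 2 * n \<or> \<bar>x $ 2\<bar> > 2 * n \<Longrightarrow> pd i (cutoff n) x = 0"
    "\<And>n i x. n > 0 \<Longrightarrow> \<bar>x $ 1\<bar> < n \<Longrightarrow> \<bar>x $ 2\<bar> < n \<Longrightarrow> pd i (cutoff n) x = 0"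
proof -
  obtain p' B where B: "B > 0" "\<And>t. (plateau has_real_derivative p' t) (at t)" "\<And>t. \<bar>p' t\<bar> \<le> B"
    "\<And>t. \<bar>t\<bar> < 1 \<or> 2 < \<bar>t\<bar> \<Longrightarrow> p' t = 0" by (rule plateau_deriv) blast
  have ch: "((\<lambda>t. plateau (t / n)) has_real_derivative p' (t / n) * (1 / n)) (at t)" if "n > 0" for n t
    by (rule DERIV_chain2[OF B(2) DERIV_cdivide[OF DERIV_ident]])
  have one: "((\<lambda>t. 1) has_real_derivative 0) (at t)" for t :: real by simp
  have co: "cutoff n = (\<lambda>x. plateau (x $ 1 / n) * plateau (x $ 2 / n) * 1)" for n by (simp add: cutoff_def[abs_def])
  have f: "pd 1 (cutoff n) x = p' (x $ 1 / n) * (1 / n) * plateau (x $ 2 / n)" "pd 2 (cutoff n) x = plateau (x $ 1 / n) * (p' (x $ 2 / n) * (1 / n))" "pd 3 (cutoff n) x = 0" if "n > 0" for n x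
    unfolding co pd_prod_coords[OF ch[OF that] ch[OF that] one] by simp_all
  have c: "\<bar>p' s * (1 / n)\<bar> * \<bar>plateau t\<bar> \<le> B / n" if "n > 0" for s t n
  proof -
    have "\<bar>p' s * (1 / n)\<bar> * \<bar>plateau t\<bar> \<le> \<bar>p' s * (1 / n)\<bar> * 1" using plateau_bounds[of t] by (intro mult_left_mono) auto
    also have "\<dots> \<le> B / n" using B(3)[of s] that by (simp add: abs_mult divide_right_mono)
    finally show ?thesis .
  qed
  show ?thesis
  proof (rule that[OF B(1)])
    fix n :: real and i :: 3 and x :: "real^3" assume n: "n > 0"
    show "\<bar>pd i (cutoff n) x\<bar> \<le> B / n"
      using exhaust_3[of i] c[OF n, of "x $ 1 / n" "x $ 2 / n"] c[OF n, of "x $ 2 / n" "x $ 1 / n"] B(1) n by (auto simp: f[OF n] abs_mult mult_ac)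
    show "pd i (cutoff n) x = 0" if "\<bar>x $ 1\<bar> > 2 * n \<or> \<bar>x $ 2\<bar> > 2 * n"
    proof -
      have "2 < \<bar>x $ 1 / n\<bar> \<or> 2 < \<bar>x $ 2 / n\<bar>" using that n by (simp add: less_divide_eq)
      then show ?thesis using exhaust_3[of i] by (auto simp: f[OF n] B(4) plateau_bounds(4))
    qed
    show "pd i (cutoff n) x = 0" if "\<bar>x $ 1\<bar> < n" "\<bar>x $ 2\<bar> < n"
    proof -
      have "\<bar>x $ 1 / n\<bar> < 1" "\<bar>x $ 2 / n\<bar> < 1" using that n by (simp_all add: divide_less_eq)
      then show ?thesis using exhaust_3[of i] by (auto simp: f[OF n] B(4))
    qed
  qed
qed

text \<open>Functions of two variables, encoded as functions on the space that ignore the third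
  coordinate. They are not \<open>test_fun\<close> in general, since their support is unbounded
  vertically.\<close>

definition horiz_test :: "(real^3 \<Rightarrow> real) \<Rightarrow> bool" where
  "horiz_test \<zeta> \<longleftrightarrow> smooth_on UNIV \<zeta> \<and> (\<forall>x y. x $ 1 = y $ 1 \<longrightarrow> x $ 2 = y $ 2 \<longrightarrow> \<zeta> x = \<zeta> y) \<and>
     (\<exists>R. \<forall>x. \<bar>x $ 1\<bar> > R \<or> \<bar>x $ 2\<bar> > R \<longrightarrow> \<zeta> x = 0)"

lemma horiz_test_pd_3:
  assumes "horiz_test \<zeta>" shows "pd 3 \<zeta> x = 0"
proof -
  have sm: "smooth_on UNIV \<zeta>" and hor: "\<And>x y. x $ 1 = y $ 1 \<Longrightarrow> x $ 2 = y $ 2 \<Longrightarrow> \<zeta> x = \<zeta> y"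
    using assms unfolding horiz_test_def by blast+
  have "((\<lambda>t. \<zeta> (x + t *\<^sub>R axis 3 1)) has_real_derivative pd 3 \<zeta> (x + 0 *\<^sub>R axis 3 1)) (at 0)"
    by (intro has_real_derivative_line smooth_on_differentiable[OF sm]) auto
  moreover have "\<zeta> (x + t *\<^sub>R axis 3 1) = \<zeta> x" for t by (rule hor) (auto simp: axis_def)
  ultimately show ?thesis using DERIV_unique[OF _ DERIV_const] by fastforce
qed

text \<open>The horizontal gradient is compared with its trace \<open>G\<close> on the plane \<open>x $ 3 = 1/2\<close>. The difference is
  controlled by \<open>\<partial>\<^sub>3f\<close> (Hardy and Caccioppoli); \<open>G = \<nabla>\<Phi>\<close> itself is tested with \<open>\<nabla>(\<chi>\<^sub>n(\<Phi> - c\<^sub>n))\<close>, where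
  the Poincare inequality bounds the terms with \<open>\<nabla>\<chi>\<^sub>n\<close>.\<close>

lemma midplane_trace_estimate:
  assumes C0: "C0 \<ge> 0"
  obtains K where "K \<ge> 0"
    "\<And>f M2 h. \<lbrakk>smooth_on slab f; \<And>x. x \<in> slab \<Longrightarrow> lap f x = 0; \<And>i. slab_nn (\<lambda>x. (pd i f x)\<^sup>2) < top; M2 \<ge> 0;
       \<And>\<zeta> \<kappa>. horiz_test \<zeta> \<Longrightarrow> \<kappa> > 0 \<Longrightarrow> slab_int (\<lambda>x. pd 1 f x * pd 1 \<zeta> x + pd 2 f x * pd 2 \<zeta> x) \<le>
          \<kappa> * M2 + C0 / \<kappa> * slab_int (\<lambda>x. (pd 1 \<zeta> x)\<^sup>2 + (pd 2 \<zeta> x)\<^sup>2); h \<in> {1,2}\<rbrakk>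
     \<Longrightarrow> slab_nn (\<lambda>x. (pd h f x)\<^sup>2) \<le> ennreal K * (slab_nn (\<lambda>x. (pd 3 f x)\<^sup>2) + ennreal M2)"
proof -
  obtain B where B: "B > 0" "\<And>n i x. n > 0 \<Longrightarrow> \<bar>pd i (cutoff n) x\<bar> \<le> B / n"
    "\<And>n i x. n > 0 \<Longrightarrow> \<bar>x $ 1\<bar> > 2 * n \<or> \<bar>x $ 2\<bar> > 2 * n \<Longrightarrow> pd i (cutoff n) x = 0"
    "\<And>n i x. n > 0 \<Longrightarrow> \<bar>x $ 1\<bar> < n \<Longrightarrow> \<bar>x $ 2\<bar> < n \<Longrightarrow> pd i (cutoff n) x = 0"
    by (rule cutoff_pd) blast
  \<comment> \<open>768 = 192 * 4 is the Poincare constant on the square of half-width 2n after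
    multiplication by (B/n)^2. With S the energy of the trace, \<open>C1 * S\<close> bounds the
    energy of the test function: 2 S plus 2 E1 S for each of two directions. The weights \<kappa>
    and \<mu> are chosen such that each of the two error terms containing S is at most S /
    4.\<close>
  define E1 where "E1 = 768 * B\<^sup>2"
  define C1 where "C1 = 2 + 4 * E1"
  define \<kappa> where "\<kappa> = 4 * (C0 + 1) * C1"
  define \<mu> where "\<mu> = 1 / (8 * E1 + 1)"
  have E1: "E1 \<ge> 0" by (simp add: E1_def)
  then have C1: "C1 \<ge> 2" by (simp add: C1_def)
  have \<kappa>: "\<kappa> > 0" unfolding \<kappa>_def using C0 C1 by simp
  have \<kappa>2: "(C0 + 1) / \<kappa> * C1 = 1/4" 
  proof -
    have "(C0 + 1) * C1 \<noteq> 0" using C0 C1 by simp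
    moreover have "(C0 + 1) / \<kappa> * C1 = ((C0 + 1) * C1) / (4 * ((C0 + 1) * C1))" by (simp only: \<kappa>_def times_divide_eq_left mult.assoc)
    ultimately show ?thesis by simp
  qed
  have \<mu>: "\<mu> > 0" "\<mu> * (2 * E1) \<le> 1/4" unfolding \<mu>_def using E1 by (simp_all add: field_simps)
  \<comment> \<open>From 2 S + 2 EF with S \<le> 2 \<kappa> (M2 + EF), where EF, the energy of the
    deviation from the trace in both directions, is at most 2 * 96 times that of the vertical
    derivative.\<close>
  define K where "K = (4 * \<kappa> + 2) * 192"
  have main: "slab_nn (\<lambda>x. (pd h f x)\<^sup>2) \<le> ennreal K * (slab_nn (\<lambda>x. (pd 3 f x)\<^sup>2) + ennreal M2)"
    if f: "smooth_on slab f" and harm: "\<And>x. x \<in> slab \<Longrightarrow> lap f x = 0"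
      and fin: "\<And>i. slab_nn (\<lambda>x. (pd i f x)\<^sup>2) < top" and M2: "M2 \<ge> 0"
      and HZ: "\<And>\<zeta> \<kappa>. horiz_test \<zeta> \<Longrightarrow> \<kappa> > 0 \<Longrightarrow> slab_int (\<lambda>x. pd 1 f x * pd 1 \<zeta> x + pd 2 f x * pd 2 \<zeta> x) \<le>
          \<kappa> * M2 + C0 / \<kappa> * slab_int (\<lambda>x. (pd 1 \<zeta> x)\<^sup>2 + (pd 2 \<zeta> x)\<^sup>2)"
      and h: "h \<in> {1,2}" for f M2 and h :: 3
  proof -
    define mid :: "real^3 \<Rightarrow> real^3" where "mid x = (\<chi> i. (\<chi> i. if i = 3 then 0 else 1) $ i * x $ i + (\<chi> i. if i = 3 then 1/2 else 0) $ i)" for x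
    have mid_slab: "mid x \<in> slab" for x by (simp add: mid_def slab_def)
    have aff: "smooth_on UNIV (\<lambda>x. g (mid x))" "pd i (\<lambda>x. g (mid x)) x = (if i = 3 then 0 else pd i g (mid x))" if "smooth_on slab g" for g i x
      using smooth_on_affine[OF open_UNIV that, of "\<chi> i. if i = 3 then 0 else 1" "\<chi> i. if i = 3 then 1/2 else 0"] mid_slab
      unfolding mid_def by auto
    define \<Phi> where "\<Phi> x = f (mid x)" for x
    have sm\<Phi>: "smooth_on UNIV \<Phi>" unfolding \<Phi>_def[abs_def] by (rule aff(1)[OF f])
    have pd\<Phi>: "pd i \<Phi> x = (if i = 3 then 0 else pd i f (mid x))" for i x unfolding \<Phi>_def[abs_def] by (rule aff(2)[OF f])
    have hor: "\<Phi> x = \<Phi> y" if "x $ 1 = y $ 1" "x $ 2 = y $ 2" for x y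
    proof -
      have "mid x = mid y" using that by (auto simp: mid_def vec_eq_iff forall_3)
      then show ?thesis by (simp add: \<Phi>_def)
    qed
    define F where "F j x = pd j f x - pd j f (mid x)" for j x
    have smG: "smooth_on UNIV (\<lambda>x. pd j f (mid x))" for j by (rule aff(1)[OF smooth_on_pd[OF f]])
    have smF: "smooth_on slab (F j)" for j unfolding F_def[abs_def]
      by (intro smooth_on_intros open_slab smooth_on_pd f smooth_on_subset[OF smG]) auto
    have F3: "pd 3 (F j) x = pd 3 (pd j f) x" if "x \<in> slab" for j x
      unfolding F_def[abs_def] using smooth_on_differentiable[OF smooth_on_pd[OF f] that] smooth_on_differentiable[OF smG]
      by (subst pd_diff) (auto simp: aff(2)[OF smooth_on_pd[OF f]])
    \<comment> \<open>The factor 32 is from Hardy's inequality anchored at the middle plane. The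
      weighted derivative there equals \<open>\<partial>\<^sub>j\<partial>\<^sub>3f\<close>, as the
      trace does not depend on the height, and Caccioppoli's inequality for
      \<open>\<partial>\<^sub>3f\<close> gives the factor 3.\<close>
    have Fnn: "slab_nn (\<lambda>x. (F j x)\<^sup>2) \<le> ennreal 96 * slab_nn (\<lambda>x. (pd 3 f x)\<^sup>2)" for j
    proof -
      have "slab_nn (\<lambda>x. (F j x)\<^sup>2) \<le> ennreal 32 * slab_nn (\<lambda>x. (wt x)\<^sup>2 * (pd 3 (F j) x)\<^sup>2)"
      proof (rule Hardy_midplane[OF smF])
        fix x :: "real^3" assume "x $ 3 = 1/2"
        then have "mid x = x" by (auto simp: mid_def vec_eq_iff)
        then show "F j x = 0" by (simp add: F_def)
      qed
      also have "slab_nn (\<lambda>x. (wt x)\<^sup>2 * (pd 3 (F j) x)\<^sup>2) = slab_nn (\<lambda>x. (wt x)\<^sup>2 * (pd j (pd 3 f) x)\<^sup>2)"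
      proof (rule slab_nn_cong)
        fix x assume x: "x \<in> slab"
        show "(wt x)\<^sup>2 * (pd 3 (F j) x)\<^sup>2 = (wt x)\<^sup>2 * (pd j (pd 3 f) x)\<^sup>2"
          using F3[OF x] pd_commute[OF open_slab f x, of 3 j] by simp
      qed
      also have "ennreal 32 * slab_nn (\<lambda>x. (wt x)\<^sup>2 * (pd j (pd 3 f) x)\<^sup>2) \<le> ennreal 32 * (ennreal 3 * slab_nn (\<lambda>x. (pd 3 f x)\<^sup>2))"
        by (intro mult_left_mono weighted_pd_le smooth_on_pd f lap_pd harm) auto
      also have "\<dots> = ennreal 96 * slab_nn (\<lambda>x. (pd 3 f x)\<^sup>2)" by (simp add: mult.assoc[symmetric] ennreal_mult'[symmetric])
      finally show ?thesis .
    qed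
    note cf = smooth_on_continuous[OF smooth_on_pd[OF f]] and cF = smooth_on_continuous[OF smF]
    have c\<Phi>: "continuous_on slab (pd j \<Phi>)" "continuous_on slab \<Phi>" for j
      by (rule continuous_on_subset[OF smooth_on_continuous[OF smooth_on_pd[OF sm\<Phi>]] subset_UNIV], rule continuous_on_subset[OF smooth_on_continuous[OF sm\<Phi>] subset_UNIV])
    have Ffin: "slab_nn (\<lambda>x. (F j x)\<^sup>2) < top" for j
      using Fnn[of j] fin[of 3] by (elim le_less_trans) (simp add: ennreal_mult_less_top)
    have iF: "slab_integrable (\<lambda>x. (F j x)\<^sup>2)" "slab_nn (\<lambda>x. (F j x)\<^sup>2) = ennreal (slab_int (\<lambda>x. (F j x)\<^sup>2))" for j
    proof -
      have "continuous_on slab (\<lambda>x. (F j x)\<^sup>2)" by (intro continuous_intros cF)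
      from slab_integrable_nonneg[OF this zero_le_power2 Ffin]
      show "slab_integrable (\<lambda>x. (F j x)\<^sup>2)" "slab_nn (\<lambda>x. (F j x)\<^sup>2) = ennreal (slab_int (\<lambda>x. (F j x)\<^sup>2))" by simp_all
    qed
    have if': "slab_integrable (\<lambda>x. (pd j f x)\<^sup>2)" "slab_nn (\<lambda>x. (pd j f x)\<^sup>2) = ennreal (slab_int (\<lambda>x. (pd j f x)\<^sup>2))" for j
    proof -
      have "continuous_on slab (\<lambda>x. (pd j f x)\<^sup>2)" by (intro continuous_intros cf)
      from slab_integrable_nonneg[OF this zero_le_power2 fin]
      show "slab_integrable (\<lambda>x. (pd j f x)\<^sup>2)" "slab_nn (\<lambda>x. (pd j f x)\<^sup>2) = ennreal (slab_int (\<lambda>x. (pd j f x)\<^sup>2))" by simp_all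
    qed
    have split: "pd j f x = pd j \<Phi> x + F j x" if "j \<in> {1,2}" for j x
      using that by (auto simp: F_def pd\<Phi>)
    have sq: "(p + q)\<^sup>2 \<le> 2 * p\<^sup>2 + 2 * q\<^sup>2" "(p - q)\<^sup>2 \<le> 2 * p\<^sup>2 + 2 * q\<^sup>2" for p q :: real
      using zero_le_power2[of "p - q"] zero_le_power2[of "p + q"] by (simp_all add: power2_eq_square algebra_simps)
    have iG: "slab_integrable (\<lambda>x. (pd j \<Phi> x)\<^sup>2)" if j: "j \<in> {1,2}" for j
    proof (rule slab_integrable_bound[OF slab_int_add(1)[OF slab_int_cmult(1)[OF if'(1), of 2 j] slab_int_cmult(1)[OF iF(1), of 2 j]]])
      show "\<bar>(pd j \<Phi> x)\<^sup>2\<bar> \<le> 2 * (pd j f x)\<^sup>2 + 2 * (F j x)\<^sup>2" for x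
        using sq(2)[of "pd j f x" "F j x"] split[OF j, of x] by simp
    qed (intro continuous_intros c\<Phi>)
    define S where "S = slab_int (\<lambda>x. (pd 1 \<Phi> x)\<^sup>2) + slab_int (\<lambda>x. (pd 2 \<Phi> x)\<^sup>2)"
    define EF where "EF = slab_int (\<lambda>x. (F 1 x)\<^sup>2) + slab_int (\<lambda>x. (F 2 x)\<^sup>2)"
    define E3 where "E3 = slab_int (\<lambda>x. (pd 3 f x)\<^sup>2)"
    have E3: "E3 \<ge> 0" unfolding E3_def by (intro slab_int_nonneg) simp
    have EF0: "EF \<ge> 0" unfolding EF_def by (intro add_nonneg_nonneg slab_int_nonneg) simp_all
    have "slab_int (\<lambda>x. (F j x)\<^sup>2) \<le> 96 * E3" for j
      using Fnn[of j] E3 unfolding iF(2) if'(2) E3_def[symmetric] by (simp add: ennreal_mult'[symmetric] del: ennreal_numeral)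
    then have EF: "EF \<le> 192 * E3" unfolding EF_def using add_mono[of "slab_int (\<lambda>x. (F 1 x)\<^sup>2)" "96 * E3" "slab_int (\<lambda>x. (F 2 x)\<^sup>2)" "96 * E3"] by simp
    have S0: "slab_int (\<lambda>x. (pd j \<Phi> x)\<^sup>2) \<ge> 0" for j by (intro slab_int_nonneg) simp
    \<comment> \<open>S is finite, being the energy of a difference of square integrable functions,
      so half of it can be absorbed. The case S = 0 is separate because the Poincare inequality uses
      S also as a positive slack.\<close>
    have Sle: "S \<le> 2 * \<kappa> * (M2 + EF)"
    proof (cases "S > 0")
      case False
      have "0 \<le> 2 * \<kappa> * (M2 + EF)" using \<kappa> M2 EF0 by (intro mult_nonneg_nonneg add_nonneg_nonneg) auto
      then show ?thesis using False by linarith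
    next
      case S: True
      have SS: "slab_nn (\<lambda>x. (pd i \<Phi> x)\<^sup>2) \<le> ennreal S" if "i \<in> {1,2}" for i
        unfolding slab_nn_eq[OF iG[OF that] zero_le_power2] S_def using that S0[of 1] S0[of 2] by (auto intro!: ennreal_leI)
      define Q where "Q n = {x::real^3. \<bar>x $ 1\<bar> \<le> 2 * n \<and> \<bar>x $ 2\<bar> \<le> 2 * n \<and> x \<in> slab}" for n :: real
      have key: "slab_int (\<lambda>x. cutoff n x * ((pd 1 \<Phi> x)\<^sup>2 + (pd 2 \<Phi> x)\<^sup>2)) \<le>
          \<kappa> * (M2 + EF) + S / 2 + 1 / (4 * \<mu>) * slab_int (\<lambda>x. (1 - cutoff (n / 2) x) * ((pd 1 \<Phi> x)\<^sup>2 + (pd 2 \<Phi> x)\<^sup>2))" if n: "n > 0" for n :: real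
      proof -
        have n2: "2 * n > 0" using n by simp
        obtain c where c: "(\<integral>\<^sup>+x. indicator (Q n) x * ennreal ((\<Phi> x - c)\<^sup>2) \<partial>lborel) \<le> ennreal (192 * (2 * n)\<^sup>2 * S)"
          by (rule Poincare[OF sm\<Phi> hor n2 S SS Q_def[of n]])
        define \<zeta> where "\<zeta> x = cutoff n x * (\<Phi> x - c)" for x
        have sm\<zeta>: "smooth_on UNIV \<zeta>" unfolding \<zeta>_def[abs_def] by (intro smooth_on_intros open_UNIV smooth_on_cutoff sm\<Phi>)
        have pd\<zeta>: "pd j \<zeta> x = cutoff n x * pd j \<Phi> x + pd j (cutoff n) x * (\<Phi> x - c)" for j x
          unfolding \<zeta>_def[abs_def] using smooth_on_differentiable[OF sm\<Phi> UNIV_I] smooth_on_differentiable[OF smooth_on_cutoff UNIV_I]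
          by (simp add: pd_mult pd_diff differentiable_diff)
        have ht: "horiz_test \<zeta>"
          unfolding horiz_test_def
        proof (intro conjI allI impI exI[of _ "2 * n"] sm\<zeta>)
          fix x y :: "real^3" assume xy: "x $ 1 = y $ 1" "x $ 2 = y $ 2"
          have "cutoff n x = cutoff n y" using xy by (simp add: cutoff_def)
          then show "\<zeta> x = \<zeta> y" using hor[OF xy] by (simp add: \<zeta>_def)
        next
          fix x :: "real^3" assume "2 * n < \<bar>x $ 1\<bar> \<or> 2 * n < \<bar>x $ 2\<bar>"
          then have "cutoff n x = 0" using n by (intro cutoff_eq_0) auto
          then show "\<zeta> x = 0" by (simp add: \<zeta>_def)
        qed
        have cc: "continuous_on slab (cutoff m)" "continuous_on slab (pd j (cutoff m))" for j m
          using continuous_on_subset[OF smooth_on_continuous[OF smooth_on_cutoff] subset_UNIV]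
            continuous_on_subset[OF smooth_on_continuous[OF smooth_on_pd[OF smooth_on_cutoff]] subset_UNIV] by auto
        have c\<zeta>: "continuous_on slab (pd j \<zeta>)" for j
          by (rule continuous_on_subset[OF smooth_on_continuous[OF smooth_on_pd[OF sm\<zeta>]] subset_UNIV])
        define e where "e j x = (pd j (cutoff n) x)\<^sup>2 * (\<Phi> x - c)\<^sup>2" for j x
        have ce: "continuous_on slab (e j)" for j unfolding e_def[abs_def] by (intro continuous_intros cc c\<Phi>)
        have enn: "slab_nn (e j) \<le> ennreal (E1 * S)" for j
        proof -
          have "slab_nn (e j) \<le> (\<integral>\<^sup>+x. ennreal ((B / n)\<^sup>2) * (indicator (Q n) x * ennreal ((\<Phi> x - c)\<^sup>2)) \<partial>lborel)"
            unfolding slab_nn_def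
          proof (intro nn_integral_mono)
            fix x :: "real^3"
            have "(pd j (cutoff n) x)\<^sup>2 \<le> (B / n)\<^sup>2" using power_mono[OF B(2)[OF n, of j x] abs_ge_zero, of 2] by simp
            then have 1: "ennreal (e j x) \<le> ennreal ((B / n)\<^sup>2) * ennreal ((\<Phi> x - c)\<^sup>2)"
              unfolding e_def by (subst ennreal_mult'[symmetric]) (auto intro!: ennreal_leI mult_right_mono)
            show "indicator slab x * ennreal (e j x) \<le> ennreal ((B / n)\<^sup>2) * (indicator (Q n) x * ennreal ((\<Phi> x - c)\<^sup>2))"
            proof (cases "x \<in> slab \<and> x \<notin> Q n")
              case True
              then have "pd j (cutoff n) x = 0" by (intro B(3)[OF n]) (auto simp: Q_def)
              then show ?thesis by (simp add: e_def)
            next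
              case False
              then show ?thesis using 1 by (auto split: split_indicator simp: Q_def)
            qed
          qed
          also have "\<dots> = ennreal ((B / n)\<^sup>2) * (\<integral>\<^sup>+x. indicator (Q n) x * ennreal ((\<Phi> x - c)\<^sup>2) \<partial>lborel)"
          proof (rule nn_integral_cmult)
            have [measurable]: "(\<lambda>y::real^3. y $ i) \<in> borel_measurable borel" for i
              by (intro borel_measurable_continuous_onI continuous_intros)
            have [measurable]: "Q n \<in> sets borel" unfolding Q_def by measurable
            have [measurable]: "\<Phi> \<in> borel_measurable borel" by (intro borel_measurable_continuous_onI smooth_on_continuous sm\<Phi>)
            show "(\<lambda>x. indicator (Q n) x * ennreal ((\<Phi> x - c)\<^sup>2)) \<in> borel_measurable lborel" by measurable
          qed
          also have "\<dots> \<le> ennreal ((B / n)\<^sup>2) * ennreal (192 * (2 * n)\<^sup>2 * S)" by (intro mult_left_mono c) simp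
          also have "\<dots> = ennreal (E1 * S)" using n S by (simp add: ennreal_mult'[symmetric] E1_def power_divide power_mult_distrib field_simps)
          finally show ?thesis .
        qed
        have e0: "0 \<le> e j x" for j x by (simp add: e_def)
        have ie: "slab_integrable (e j)" and ele: "slab_int (e j) \<le> E1 * S" for j
        proof -
          have "slab_nn (e j) < top" by (rule le_less_trans[OF enn]) simp
          note this' = slab_integrable_nonneg[OF ce e0 this]
          show "slab_integrable (e j)" by (rule this'(1))
          have "E1 * S \<ge> 0" using E1 S by simp
          then show "slab_int (e j) \<le> E1 * S" using enn[of j] unfolding this'(2)[symmetric] by (simp only: ennreal_le_iff)
        qed
        have cut2: "(cutoff m x)\<^sup>2 \<le> 1" for m x using cutoff_bounds by (simp add: power_le_one)
        have z2: "(pd j \<zeta> x)\<^sup>2 \<le> 2 * (pd j \<Phi> x)\<^sup>2 + 2 * e j x" for j x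
        proof -
          have "(pd j \<zeta> x)\<^sup>2 \<le> 2 * (cutoff n x * pd j \<Phi> x)\<^sup>2 + 2 * (pd j (cutoff n) x * (\<Phi> x - c))\<^sup>2" unfolding pd\<zeta> by (rule sq)
          moreover have "(cutoff n x)\<^sup>2 * (pd j \<Phi> x)\<^sup>2 \<le> 1 * (pd j \<Phi> x)\<^sup>2" by (intro mult_right_mono cut2) simp
          ultimately show ?thesis by (simp add: e_def power_mult_distrib)
        qed
        have j12: "(1::3) \<in> {1,2}" "(2::3) \<in> {1,2}" by auto
        have i2: "slab_integrable (\<lambda>x. 2 * (pd j \<Phi> x)\<^sup>2 + 2 * e j x)" "slab_int (\<lambda>x. 2 * (pd j \<Phi> x)\<^sup>2 + 2 * e j x) = 2 * slab_int (\<lambda>x. (pd j \<Phi> x)\<^sup>2) + 2 * slab_int (e j)" if "j \<in> {1,2}" for j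
          using slab_int_add[OF slab_int_cmult(1)[OF iG[OF that], of 2] slab_int_cmult(1)[OF ie, of 2 j]] slab_int_cmult(2)[OF iG[OF that], of 2] slab_int_cmult(2)[OF ie, of 2 j] by simp_all
        have i\<zeta>: "slab_integrable (\<lambda>x. (pd j \<zeta> x)\<^sup>2)" if "j \<in> {1,2}" for j
          by (rule slab_integrable_bound[OF i2(1)[OF that]]) (use z2 in \<open>auto intro!: continuous_intros c\<zeta>\<close>)
        define D where "D = slab_int (\<lambda>x. (pd 1 \<zeta> x)\<^sup>2 + (pd 2 \<zeta> x)\<^sup>2)"
        have Dsum: "D = slab_int (\<lambda>x. (pd 1 \<zeta> x)\<^sup>2) + slab_int (\<lambda>x. (pd 2 \<zeta> x)\<^sup>2)"
          unfolding D_def by (rule slab_int_add(2)[OF i\<zeta>[OF j12(1)] i\<zeta>[OF j12(2)]])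
        have "slab_int (\<lambda>x. (pd j \<zeta> x)\<^sup>2) \<le> 2 * slab_int (\<lambda>x. (pd j \<Phi> x)\<^sup>2) + 2 * (E1 * S)" if "j \<in> {1,2}" for j
          using slab_int_mono[OF i\<zeta>[OF that] i2(1)[OF that] z2] i2(2)[OF that] ele[of j] by simp
        from this[OF j12(1)] this[OF j12(2)] have D: "D \<le> C1 * S" unfolding Dsum C1_def S_def by (simp add: algebra_simps)
        define W where "W x = (pd 1 f x)\<^sup>2 + (pd 2 f x)\<^sup>2 + (pd 1 \<zeta> x)\<^sup>2 + (pd 2 \<zeta> x)\<^sup>2" for x
        have iff: "slab_integrable (\<lambda>x. pd 1 f x * pd 1 \<zeta> x + pd 2 f x * pd 2 \<zeta> x)"
        proof (rule slab_integrable_bound)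
          show "slab_integrable W" unfolding W_def[abs_def] by (intro slab_int_add(1) if'(1) i\<zeta> j12)
          fix x
          have "\<bar>p * q\<bar> \<le> p\<^sup>2 + q\<^sup>2" for p q :: real
          proof -
            have "(\<bar>p\<bar> - \<bar>q\<bar>)\<^sup>2 = p\<^sup>2 + q\<^sup>2 - 2 * \<bar>p * q\<bar>" by (simp add: power2_diff abs_mult)
            then show ?thesis using zero_le_power2[of "\<bar>p\<bar> - \<bar>q\<bar>"] abs_ge_zero[of "p * q"] by linarith
          qed
          from this[of "pd 1 f x" "pd 1 \<zeta> x"] this[of "pd 2 f x" "pd 2 \<zeta> x"]
          show "\<bar>pd 1 f x * pd 1 \<zeta> x + pd 2 f x * pd 2 \<zeta> x\<bar> \<le> W x" unfolding W_def by linarith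
        qed (intro continuous_intros cf c\<zeta>)
        \<comment> \<open>The density cut-off times |\<nabla>\<Phi>|^2 equals \<nabla>f .
          \<nabla>\<zeta> minus F . \<nabla>\<zeta> minus the product of \<Phi> - c, the gradient of
          the cut-off and \<nabla>\<Phi>, all in the horizontal variables. \<open>R\<close> is the
          outcome of Young's inequality with weight \<kappa> for the second and \<mu> for the third
          term.\<close>
        define R where "R x = (pd 1 f x * pd 1 \<zeta> x + pd 2 f x * pd 2 \<zeta> x) + (\<kappa> * ((F 1 x)\<^sup>2 + (F 2 x)\<^sup>2) + 1 / \<kappa> * ((pd 1 \<zeta> x)\<^sup>2 + (pd 2 \<zeta> x)\<^sup>2))
           + (\<mu> * (e 1 x + e 2 x) + 1 / (4 * \<mu>) * ((1 - cutoff (n / 2) x) * ((pd 1 \<Phi> x)\<^sup>2 + (pd 2 \<Phi> x)\<^sup>2)))" for x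
        have iGG: "slab_integrable (\<lambda>x. (pd 1 \<Phi> x)\<^sup>2 + (pd 2 \<Phi> x)\<^sup>2)" by (intro slab_int_add(1) iG j12)
        have iL: "slab_integrable (\<lambda>x. cutoff n x * ((pd 1 \<Phi> x)\<^sup>2 + (pd 2 \<Phi> x)\<^sup>2))"
          by (rule slab_integrable_bound[OF iGG]) (use cutoff_bounds in \<open>auto intro!: continuous_intros cc c\<Phi> mult_left_le_one_le simp: abs_mult\<close>)
        have iT: "slab_integrable (\<lambda>x. (1 - cutoff (n / 2) x) * ((pd 1 \<Phi> x)\<^sup>2 + (pd 2 \<Phi> x)\<^sup>2))"
          by (rule slab_integrable_bound[OF iGG]) (use cutoff_bounds in \<open>auto intro!: continuous_intros cc c\<Phi> mult_left_le_one_le simp: abs_mult\<close>)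
        note iFF = slab_int_add[OF iF(1)[of 1] iF(1)[of 2]] and i\<zeta>\<zeta> = slab_int_add[OF i\<zeta>[OF j12(1)] i\<zeta>[OF j12(2)]] and iee = slab_int_add[OF ie[of 1] ie[of 2]]
        note s1 = slab_int_add[OF slab_int_cmult(1)[OF iFF(1), of \<kappa>] slab_int_cmult(1)[OF i\<zeta>\<zeta>(1), of "1 / \<kappa>"]]
        note s2 = slab_int_add[OF slab_int_cmult(1)[OF iee(1), of \<mu>] slab_int_cmult(1)[OF iT, of "1 / (4 * \<mu>)"]]
        note s3 = slab_int_add[OF iff s1(1)] 
        note s4 = slab_int_add[OF s3(1) s2(1)]
        have "slab_int (\<lambda>x. cutoff n x * ((pd 1 \<Phi> x)\<^sup>2 + (pd 2 \<Phi> x)\<^sup>2)) \<le> slab_int R"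
        proof (rule slab_int_mono[OF iL])
          show "slab_integrable R" unfolding R_def[abs_def] by (rule s4(1))
          fix x assume "x \<in> slab"
          \<comment> \<open>\<open>T\<close> equals 1 wherever the gradient of the cut-off is
            nonzero, so inserting it costs nothing. Its purpose is that the integral of T
            |\<nabla>\<Phi>|^2 tends to 0 by dominated convergence; the large factor 1 / (4\<mu>) is
            then harmless.\<close>
          define T where "T = 1 - cutoff (n / 2) x"
          have T: "0 \<le> T" "T \<le> 1" unfolding T_def using cutoff_bounds[of "n / 2" x] by auto
          have T1: "T = 1 \<or> pd j (cutoff n) x = 0" for j
          proof (cases "\<bar>x $ 1\<bar> < n \<and> \<bar>x $ 2\<bar> < n")
            case True
            then show ?thesis using B(4)[OF n] by blast
          next
            case False
            then have "cutoff (n / 2) x = 0" using n by (intro cutoff_eq_0) auto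
            then show ?thesis by (simp add: T_def)
          qed
          have yA: "- (p * q) \<le> \<kappa> * p\<^sup>2 + 1 / \<kappa> * q\<^sup>2" for p q
          proof -
            have "0 \<le> \<kappa> * (p + q / (2 * \<kappa>))\<^sup>2" using \<kappa> by simp
            also have "\<dots> = \<kappa> * p\<^sup>2 + p * q + q\<^sup>2 / (4 * \<kappa>)" using \<kappa> by (simp add: power2_eq_square field_simps)
            finally have "- (p * q) \<le> \<kappa> * p\<^sup>2 + q\<^sup>2 / (4 * \<kappa>)" by linarith
            moreover have "q\<^sup>2 / (4 * \<kappa>) \<le> 1 / \<kappa> * q\<^sup>2" using \<kappa> by (simp add: field_simps)
            ultimately show ?thesis by linarith
          qed
          have yB: "- (pd j (cutoff n) x * (\<Phi> x - c) * pd j \<Phi> x) \<le> \<mu> * e j x + 1 / (4 * \<mu>) * (T * (pd j \<Phi> x)\<^sup>2)" for j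
            using T1[of j]
          proof
            assume T1: "T = 1"
            let ?p = "pd j (cutoff n) x * (\<Phi> x - c)" let ?q = "pd j \<Phi> x"
            have "0 \<le> \<mu> * (?p + ?q / (2 * \<mu>))\<^sup>2" using \<mu> by simp
            also have "\<dots> = \<mu> * ?p\<^sup>2 + ?p * ?q + 1 / (4 * \<mu>) * ?q\<^sup>2" using \<mu> by (simp add: power2_eq_square field_simps)
            finally show ?thesis unfolding T1 by (simp add: e_def power_mult_distrib)
          next
            assume z: "pd j (cutoff n) x = 0"
            show ?thesis using \<mu> T e0[of j x] by (simp add: z)
          qed
          have "cutoff n x * ((pd 1 \<Phi> x)\<^sup>2 + (pd 2 \<Phi> x)\<^sup>2) = (pd 1 f x * pd 1 \<zeta> x + pd 2 f x * pd 2 \<zeta> x) - F 1 x * pd 1 \<zeta> x - F 2 x * pd 2 \<zeta> x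
             - pd 1 (cutoff n) x * (\<Phi> x - c) * pd 1 \<Phi> x - pd 2 (cutoff n) x * (\<Phi> x - c) * pd 2 \<Phi> x"
            unfolding split[OF j12(1)] split[OF j12(2)] by (simp add: pd\<zeta> power2_eq_square algebra_simps)
          also have "\<dots> \<le> R x"
            using yA[of "F 1 x" "pd 1 \<zeta> x"] yA[of "F 2 x" "pd 2 \<zeta> x"] yB[of 1] yB[of 2]
            unfolding R_def T_def[symmetric] distrib_left by linarith
          finally show "cutoff n x * ((pd 1 \<Phi> x)\<^sup>2 + (pd 2 \<Phi> x)\<^sup>2) \<le> R x" .
        qed
        also have "slab_int R = slab_int (\<lambda>x. pd 1 f x * pd 1 \<zeta> x + pd 2 f x * pd 2 \<zeta> x) + (\<kappa> * EF + 1 / \<kappa> * D) + (\<mu> * (slab_int (e 1) + slab_int (e 2)) + 1 / (4 * \<mu>) * slab_int (\<lambda>x. (1 - cutoff (n / 2) x) * ((pd 1 \<Phi> x)\<^sup>2 + (pd 2 \<Phi> x)\<^sup>2)))"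
          unfolding R_def[abs_def] s4(2) s3(2) s2(2) s1(2) slab_int_cmult(2)[OF iFF(1)] slab_int_cmult(2)[OF i\<zeta>\<zeta>(1)] slab_int_cmult(2)[OF iee(1)] slab_int_cmult(2)[OF iT] iFF(2) i\<zeta>\<zeta>(2) iee(2) EF_def Dsum ..
        also have "\<dots> \<le> (\<kappa> * M2 + C0 / \<kappa> * D) + (\<kappa> * EF + 1 / \<kappa> * D) + (\<mu> * (E1 * S + E1 * S) + 1 / (4 * \<mu>) * slab_int (\<lambda>x. (1 - cutoff (n / 2) x) * ((pd 1 \<Phi> x)\<^sup>2 + (pd 2 \<Phi> x)\<^sup>2)))"
          using \<mu> by (intro add_mono mult_left_mono ele order_refl HZ[OF ht \<kappa>, folded D_def]) auto
        also have "(C0 / \<kappa> * D) + 1 / \<kappa> * D \<le> S / 4"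
        proof -
          have "(C0 / \<kappa> * D) + 1 / \<kappa> * D = (C0 + 1) / \<kappa> * D" by (simp add: add_divide_distrib distrib_right)
          also have "\<dots> \<le> (C0 + 1) / \<kappa> * (C1 * S)" using C0 \<kappa> by (intro mult_left_mono D) auto
          also have "\<dots> = S / 4" using \<kappa>2 by (metis mult.assoc mult.commute mult_1 times_divide_eq_right)
          finally show ?thesis .
        qed
        then have "(\<kappa> * M2 + C0 / \<kappa> * D) + (\<kappa> * EF + 1 / \<kappa> * D) \<le> \<kappa> * (M2 + EF) + S / 4" by (simp add: distrib_left)
        moreover have "\<mu> * (E1 * S + E1 * S) \<le> S / 4"
          using mult_right_mono[OF \<mu>(2), of S] S by (simp add: algebra_simps)
        ultimately show ?thesis by linarith
      qed
      have iGG: "slab_integrable (\<lambda>x. (pd 1 \<Phi> x)\<^sup>2 + (pd 2 \<Phi> x)\<^sup>2)" by (intro slab_int_add(1) iG) auto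
      have SGG: "slab_int (\<lambda>x. (pd 1 \<Phi> x)\<^sup>2 + (pd 2 \<Phi> x)\<^sup>2) = S" unfolding S_def by (intro slab_int_add(2) iG) auto
      have cc: "continuous_on slab (cutoff m)" for m by (rule continuous_on_subset[OF smooth_on_continuous[OF smooth_on_cutoff] subset_UNIV])
      have ev: "\<forall>\<^sub>F n in sequentially. cutoff (s * real n) x = 1" if "s > 0" for s x
      proof -
        have "\<forall>\<^sub>F n in sequentially. max 1 (max \<bar>x $ 1\<bar> \<bar>x $ 2\<bar> / s) \<le> real n"
          using filterlim_real_sequentially unfolding filterlim_at_top by blast
        then show ?thesis
        proof eventually_elim
          case (elim n)
          then have n: "real n \<ge> 1" "max \<bar>x $ 1\<bar> \<bar>x $ 2\<bar> \<le> s * real n" using that by (auto simp: pos_divide_le_eq mult.commute)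
          then show ?case using that by (intro cutoff_eq_1) auto
        qed
      qed
      have lim1: "(\<lambda>n. slab_int (\<lambda>x. cutoff (real n) x * ((pd 1 \<Phi> x)\<^sup>2 + (pd 2 \<Phi> x)\<^sup>2))) \<longlonglongrightarrow> slab_int (\<lambda>x. (pd 1 \<Phi> x)\<^sup>2 + (pd 2 \<Phi> x)\<^sup>2)"
      proof (rule slab_int_tendsto[OF _ _ iGG])
        show "(\<lambda>n. cutoff (real n) x * ((pd 1 \<Phi> x)\<^sup>2 + (pd 2 \<Phi> x)\<^sup>2)) \<longlonglongrightarrow> (pd 1 \<Phi> x)\<^sup>2 + (pd 2 \<Phi> x)\<^sup>2" for x
          by (rule tendsto_eventually) (use ev[of 1 x] in \<open>auto elim: eventually_mono\<close>)
      qed (use cutoff_bounds in \<open>auto intro!: continuous_intros cc c\<Phi> mult_left_le_one_le simp: abs_mult\<close>)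
      have lim2: "(\<lambda>n. slab_int (\<lambda>x. (1 - cutoff (real n / 2) x) * ((pd 1 \<Phi> x)\<^sup>2 + (pd 2 \<Phi> x)\<^sup>2))) \<longlonglongrightarrow> slab_int (\<lambda>x. 0)"
      proof (rule slab_int_tendsto[OF _ _ iGG])
        show "(\<lambda>n. (1 - cutoff (real n / 2) x) * ((pd 1 \<Phi> x)\<^sup>2 + (pd 2 \<Phi> x)\<^sup>2)) \<longlonglongrightarrow> 0" for x
          by (rule tendsto_eventually) (use ev[of "1/2" x] in \<open>auto elim: eventually_mono\<close>)
      qed (use cutoff_bounds in \<open>auto intro!: continuous_intros cc c\<Phi> mult_left_le_one_le simp: abs_mult\<close>)
      \<comment> \<open>In the limit the tail term disappears and half of S can be moved to the
        left.\<close>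
      have "S \<le> \<kappa> * (M2 + EF) + S / 2 + 1 / (4 * \<mu>) * slab_int (\<lambda>x. 0)"
        unfolding SGG[symmetric]
      proof (rule LIMSEQ_le[OF lim1])
        show "(\<lambda>n. \<kappa> * (M2 + EF) + slab_int (\<lambda>x. (pd 1 \<Phi> x)\<^sup>2 + (pd 2 \<Phi> x)\<^sup>2) / 2 + 1 / (4 * \<mu>) * slab_int (\<lambda>x. (1 - cutoff (real n / 2) x) * ((pd 1 \<Phi> x)\<^sup>2 + (pd 2 \<Phi> x)\<^sup>2)))
          \<longlonglongrightarrow> \<kappa> * (M2 + EF) + slab_int (\<lambda>x. (pd 1 \<Phi> x)\<^sup>2 + (pd 2 \<Phi> x)\<^sup>2) / 2 + 1 / (4 * \<mu>) * slab_int (\<lambda>x. 0)"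
          by (intro tendsto_intros lim2)
        show "\<exists>N. \<forall>n\<ge>N. slab_int (\<lambda>x. cutoff (real n) x * ((pd 1 \<Phi> x)\<^sup>2 + (pd 2 \<Phi> x)\<^sup>2)) \<le>
          \<kappa> * (M2 + EF) + slab_int (\<lambda>x. (pd 1 \<Phi> x)\<^sup>2 + (pd 2 \<Phi> x)\<^sup>2) / 2 + 1 / (4 * \<mu>) * slab_int (\<lambda>x. (1 - cutoff (real n / 2) x) * ((pd 1 \<Phi> x)\<^sup>2 + (pd 2 \<Phi> x)\<^sup>2))"
          unfolding SGG using key by (intro exI[of _ 1]) auto
      qed
      then show ?thesis by (simp add: slab_int_def)
    qed
    have "slab_int (\<lambda>x. (pd h f x)\<^sup>2) \<le> slab_int (\<lambda>x. 2 * (pd h \<Phi> x)\<^sup>2 + 2 * (F h x)\<^sup>2)"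
      using sq(1) split[OF h] by (intro slab_int_mono if'(1) slab_int_add(1) slab_int_cmult(1) iG[OF h] iF(1)) auto
    also have "\<dots> = 2 * slab_int (\<lambda>x. (pd h \<Phi> x)\<^sup>2) + 2 * slab_int (\<lambda>x. (F h x)\<^sup>2)"
      using slab_int_add(2)[OF slab_int_cmult(1)[OF iG[OF h], of 2] slab_int_cmult(1)[OF iF(1), of 2 h]] slab_int_cmult(2)[OF iG[OF h], of 2] slab_int_cmult(2)[OF iF(1), of 2 h] by simp
    also have "\<dots> \<le> 2 * S + 2 * EF"
    proof -
      have "slab_int (\<lambda>x. (F j x)\<^sup>2) \<ge> 0" for j by (intro slab_int_nonneg) simp
      note this[of 1] this[of 2]
      then show ?thesis using S0[of 1] S0[of 2] h unfolding S_def EF_def by auto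
    qed
    also have "\<dots> \<le> 2 * (2 * \<kappa> * (M2 + EF)) + 2 * EF" using Sle by simp
    also have "\<dots> = 4 * \<kappa> * M2 + (4 * \<kappa> + 2) * EF" by (simp add: algebra_simps)
    also have "\<dots> \<le> K * M2 + (4 * \<kappa> + 2) * (192 * E3)"
      using \<kappa> M2 by (intro add_mono mult_right_mono mult_left_mono EF) (auto simp: K_def)
    also have "\<dots> = K * (E3 + M2)" by (simp add: K_def algebra_simps)
    finally have "ennreal (slab_int (\<lambda>x. (pd h f x)\<^sup>2)) \<le> ennreal (K * (E3 + M2))" by (rule ennreal_leI)
    then show ?thesis unfolding if'(2) E3_def[symmetric] using E3 M2 \<kappa> by (simp add: ennreal_mult' K_def)
  qed
  show ?thesis
  proof (rule that[of K])
    show "K \<ge> 0" using \<kappa> by (simp add: K_def)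
  qed (rule main)
qed

section \<open>Sobolev norms of representatives\<close>

abbreviation AE_slab :: "(real^3 \<Rightarrow> bool) \<Rightarrow> bool" where
  "AE_slab P \<equiv> (AE x in lebesgue. x \<in> slab \<longrightarrow> P x)"

abbreviation LS :: "(real^3 \<Rightarrow> real) \<Rightarrow> real" where
  "LS g \<equiv> (LINT x|lebesgue_on slab. g x)"

lemma AE_slab_iff: "AE_slab P \<longleftrightarrow> (AE x in lebesgue_on slab. P x)"
  by (subst AE_restrict_space_iff) auto

text \<open>By completeness of Lebesgue measure: a preimage changes only by a subset of a null
  set.\<close>

lemma borel_measurable_AE_lebesgue:
  fixes f g :: "real^3 \<Rightarrow> 'b::euclidean_space"
  assumes f: "f \<in> borel_measurable lebesgue" and ae: "AE x in lebesgue. f x = g x"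
  shows "g \<in> borel_measurable lebesgue"
proof (rule measurableI)
  fix A :: "'b set" assume A: "A \<in> sets borel"
  define N where "N = {x. f x \<noteq> g x}"
  have N: "N \<in> null_sets lebesgue" using ae by (simp add: N_def completion.AE_iff_null_sets)
  have 1: "g -` A \<inter> N \<in> null_sets lebesgue" by (rule completion.complete2[OF _ N]) auto
  have 2: "f -` A \<in> sets lebesgue" using measurable_sets[OF f A] by simp
  have "g -` A = (f -` A - N) \<union> (g -` A \<inter> N)" by (auto simp: N_def)
  moreover have "\<dots> \<in> sets lebesgue" using 1 2 N by (intro sets.Un sets.Diff) (auto dest: null_setsD2)
  ultimately show "g -` A \<inter> space lebesgue \<in> sets lebesgue" by simp
qed simp

lemma borel_measurable_AE_slab:
  fixes f g :: "real^3 \<Rightarrow> 'b::euclidean_space"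
  assumes f: "f \<in> borel_measurable (lebesgue_on slab)" and ae: "AE_slab (\<lambda>x. f x = g x)"
  shows "g \<in> borel_measurable (lebesgue_on slab)"
proof -
  have "(\<lambda>x. indicator slab x *\<^sub>R f x) \<in> borel_measurable lebesgue"
    using f by (subst borel_measurable_restrict_space_iff[symmetric]) auto
  moreover have "AE x in lebesgue. indicator slab x *\<^sub>R f x = indicator slab x *\<^sub>R g x"
    using ae by eventually_elim (auto split: split_indicator)
  ultimately have "(\<lambda>x. indicator slab x *\<^sub>R g x) \<in> borel_measurable lebesgue" by (rule borel_measurable_AE_lebesgue)
  then show ?thesis by (subst borel_measurable_restrict_space_iff) auto
qed

lemma continuous_measurable_slab:
  fixes q :: "real^3 \<Rightarrow> real"
  assumes "continuous_on slab q" shows "q \<in> borel_measurable (lebesgue_on slab)"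
proof -
  have "(\<lambda>x. indicator slab x *\<^sub>R q x) \<in> borel_measurable lborel"
    using borel_measurable_continuous_on_indicator[OF slab_measurable assms] by simp
  then have "(\<lambda>x. indicator slab x *\<^sub>R q x) \<in> borel_measurable lebesgue" by (rule measurable_completion)
  then show ?thesis by (subst borel_measurable_restrict_space_iff) auto
qed

lemma LS_continuous:
  assumes "continuous_on slab q"
  shows "integrable (lebesgue_on slab) q \<longleftrightarrow> slab_integrable q" "LS q = slab_int q"
proof -
  have m: "(\<lambda>x. indicator slab x *\<^sub>R q x) \<in> borel_measurable lborel"
    using borel_measurable_continuous_on_indicator[OF slab_measurable assms] by simp
  have S: "slab \<inter> space lebesgue \<in> sets lebesgue" by simp
  show "integrable (lebesgue_on slab) q \<longleftrightarrow> slab_integrable q"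
    using integrable_restrict_space[OF S, of q] integrable_completion[OF m] by simp
  show "LS q = slab_int q" unfolding slab_int_def
    using integral_restrict_space[OF S, of q] integral_completion[OF m] by simp
qed

text \<open>The norms are defined through arbitrarily chosen representatives of weak derivatives,
  the estimates through a continuous function. This is the bridge between the two, including the
  case of an infinite integral.\<close>

lemma L2_slab_AE_iff:
  fixes F q :: "real^3 \<Rightarrow> real"
  assumes q: "continuous_on slab q" and ae: "AE_slab (\<lambda>x. F x = q x)"
  shows "F \<in> L2_slab \<longleftrightarrow> slab_nn (\<lambda>x. (q x)\<^sup>2) < top"
    and "F \<in> L2_slab \<Longrightarrow> ennreal (LS (\<lambda>x. (norm (F x))\<^sup>2)) = slab_nn (\<lambda>x. (q x)\<^sup>2)"
proof -
  have q2: "continuous_on slab (\<lambda>x. (q x)\<^sup>2)" by (intro continuous_intros q)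
  have "AE_slab (\<lambda>x. q x = F x)" using ae by eventually_elim simp
  then have mF: "F \<in> borel_measurable (lebesgue_on slab)" by (rule borel_measurable_AE_slab[OF continuous_measurable_slab[OF q]])
  have mF2: "(\<lambda>x. (norm (F x))\<^sup>2) \<in> borel_measurable (lebesgue_on slab)" using mF by measurable
  have ae2: "AE x in lebesgue_on slab. (norm (F x))\<^sup>2 = (q x)\<^sup>2"
    using ae unfolding AE_slab_iff by eventually_elim simp
  have i: "integrable (lebesgue_on slab) (\<lambda>x. (norm (F x))\<^sup>2) \<longleftrightarrow> slab_integrable (\<lambda>x. (q x)\<^sup>2)"
    using integrable_cong_AE[OF mF2 continuous_measurable_slab[OF q2] ae2] LS_continuous(1)[OF q2] by simp
  have L: "LS (\<lambda>x. (norm (F x))\<^sup>2) = slab_int (\<lambda>x. (q x)\<^sup>2)"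
    using integral_cong_AE[OF mF2 continuous_measurable_slab[OF q2] ae2] LS_continuous(2)[OF q2] by simp
  have "slab_integrable (\<lambda>x. (q x)\<^sup>2) \<Longrightarrow> slab_nn (\<lambda>x. (q x)\<^sup>2) < top"
    using slab_nn_eq[of "\<lambda>x. (q x)\<^sup>2"] by simp
  then show "F \<in> L2_slab \<longleftrightarrow> slab_nn (\<lambda>x. (q x)\<^sup>2) < top"
    using mF i slab_integrable_nonneg(1)[OF q2] by (auto simp: L2_slab_def)
  show "F \<in> L2_slab \<Longrightarrow> ennreal (LS (\<lambda>x. (norm (F x))\<^sup>2)) = slab_nn (\<lambda>x. (q x)\<^sup>2)"
    using i L slab_nn_eq[of "\<lambda>x. (q x)\<^sup>2"] by (simp add: L2_slab_def)
qed

lemma has_weak_pderiv_test: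
  fixes f g :: "real^3 \<Rightarrow> real"
  assumes "has_weak_pderiv \<alpha> f g" "\<psi> \<in> test_fun slab"
  shows "(LINT x|lebesgue. pds (word \<alpha>) \<psi> x * f x) = (- 1) ^ mi_order \<alpha> * (LINT x|lebesgue. \<psi> x * g x)"
proof -
  have "(LINT x|lebesgue_on slab. mpderiv \<alpha> \<psi> x *\<^sub>R f x) = (- 1) ^ mi_order \<alpha> *\<^sub>R (LINT x|lebesgue_on slab. \<psi> x *\<^sub>R g x)"
    using assms unfolding has_weak_pderiv_def by blast
  then show ?thesis unfolding mpderiv_word LINT_slab_test[OF test_fun_pds[OF assms(2)]] LINT_slab_test[OF assms(2)] by simp
qed

lemma weak_pderiv_unique:
  fixes f :: "real^3 \<Rightarrow> real"
  assumes "has_weak_pderiv \<alpha> f g" "has_weak_pderiv \<alpha> f g'"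
  shows "AE_slab (\<lambda>x. g x = g' x)"
proof -
  have li: "loc_integrable g" "loc_integrable g'" using assms by (auto simp: has_weak_pderiv_def)
  have "AE_slab (\<lambda>x. g x - g' x = 0)"
  proof (rule fundamental_lemma)
    show "loc_integrable (\<lambda>x. g x - g' x)" using li by (auto simp: loc_integrable_def)
    fix \<psi> assume \<psi>: "\<psi> \<in> test_fun slab"
    have "(LINT x|lebesgue. \<psi> x * g x) = (LINT x|lebesgue. \<psi> x * g' x)"
      using has_weak_pderiv_test[OF assms(1) \<psi>] has_weak_pderiv_test[OF assms(2) \<psi>] by simp
    moreover have "LS (\<lambda>x. \<psi> x * (g x - g' x)) = (LINT x|lebesgue. \<psi> x * g x - \<psi> x * g' x)"
      using LINT_slab_test[OF \<psi>, of "\<lambda>x. g x - g' x"] by (simp add: right_diff_distrib)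
    ultimately show "LS (\<lambda>x. \<psi> x * (g x - g' x)) = 0"
      using integrable_mult_test[OF li(1) \<psi>] integrable_mult_test[OF li(2) \<psi>] by simp
  qed
  then show ?thesis by eventually_elim simp
qed

text \<open>Weak derivatives are selected for \<phi> itself, which agrees with its harmonic
  representative only almost everywhere. The classical derivatives of the representative have to be
  recognised as weak derivatives of \<phi>.\<close>

lemma has_weak_pderiv_cong:
  fixes f f' g :: "real^3 \<Rightarrow> real"
  assumes w: "has_weak_pderiv \<alpha> f g" and li: "loc_integrable f'" and ae: "AE_slab (\<lambda>x. f x = f' x)"
  shows "has_weak_pderiv \<alpha> f' g"
  unfolding has_weak_pderiv_def
proof (intro conjI ballI li)
  show "loc_integrable g" using w by (simp add: has_weak_pderiv_def)
  fix \<psi> assume \<psi>: "\<psi> \<in> test_fun slab"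
  have lf: "loc_integrable f" using w by (simp add: has_weak_pderiv_def)
  have t: "pds (word \<alpha>) \<psi> \<in> test_fun slab" by (rule test_fun_pds[OF \<psi>])
  have "(LINT x|lebesgue. pds (word \<alpha>) \<psi> x *\<^sub>R f' x) = (LINT x|lebesgue. pds (word \<alpha>) \<psi> x *\<^sub>R f x)"
  proof (rule integral_cong_AE)
    show "AE x in lebesgue. pds (word \<alpha>) \<psi> x *\<^sub>R f' x = pds (word \<alpha>) \<psi> x *\<^sub>R f x"
      using ae
    proof eventually_elim
      case (elim x)
      show ?case
      proof (cases "x \<in> slab")
        case False
        then have "pds (word \<alpha>) \<psi> x = 0" using t by (metis subsetD test_funE)
        then show ?thesis by simp
      qed (use elim in simp)
    qed
  qed (rule borel_measurable_integrable[OF integrable_mult_test[OF li t]] borel_measurable_integrable[OF integrable_mult_test[OF lf t]])+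
  then show "(LINT x|lebesgue_on slab. mpderiv \<alpha> \<psi> x *\<^sub>R f' x) = (- 1) ^ mi_order \<alpha> *\<^sub>R (LINT x|lebesgue_on slab. \<psi> x *\<^sub>R g x)"
    using w \<psi> LINT_slab_test[OF t, of f] LINT_slab_test[OF t, of f'] unfolding has_weak_pderiv_def mpderiv_word by simp
qed

lemma weak_pderiv_spec: "has_weak_pderiv \<alpha> f g \<Longrightarrow> has_weak_pderiv \<alpha> f (weak_pderiv \<alpha> f)"
  unfolding weak_pderiv_def by (rule someI[of "has_weak_pderiv \<alpha> f"])

lemma weak_pderiv_smooth:
  fixes F q :: "real^3 \<Rightarrow> real"
  assumes q: "smooth_on slab q" and li: "loc_integrable F" and ae: "AE_slab (\<lambda>x. F x = q x)"
  shows "has_weak_pderiv \<alpha> F (pds (word \<alpha>) q)" "has_weak_pderiv \<alpha> F (weak_pderiv \<alpha> F)"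
    "loc_integrable (weak_pderiv \<alpha> F)" "AE_slab (\<lambda>x. weak_pderiv \<alpha> F x = pds (word \<alpha>) q x)"
proof -
  have ae': "AE_slab (\<lambda>x. q x = F x)" using ae by eventually_elim simp
  show 1: "has_weak_pderiv \<alpha> F (pds (word \<alpha>) q)" by (rule has_weak_pderiv_cong[OF has_weak_pderiv_smooth[OF q] li ae'])
  show 2: "has_weak_pderiv \<alpha> F (weak_pderiv \<alpha> F)" by (rule weak_pderiv_spec[OF 1])
  then show "loc_integrable (weak_pderiv \<alpha> F)" by (simp add: has_weak_pderiv_def)
  show "AE_slab (\<lambda>x. weak_pderiv \<alpha> F x = pds (word \<alpha>) q x)" by (rule weak_pderiv_unique[OF 2 1])
qed

lemma finite_mi_order: "finite {\<alpha>. mi_order \<alpha> \<le> k}"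
proof (rule finite_imageD)
  let ?g = "\<lambda>\<alpha>::multi_index. (\<alpha> $ 1, \<alpha> $ 2, \<alpha> $ 3)"
  show "finite (?g ` {\<alpha>. mi_order \<alpha> \<le> k})"
    by (rule finite_subset[of _ "{..k} \<times> {..k} \<times> {..k}"]) (auto simp: mi_order_def sum_3)
  show "inj_on ?g {\<alpha>. mi_order \<alpha> \<le> k}" by (auto simp: inj_on_def vec_eq_iff forall_3)
qed

lemma horizontal_indices_mi_order: "\<alpha> \<in> horizontal_indices l \<longleftrightarrow> \<alpha> $ 3 = 0 \<and> mi_order \<alpha> \<le> l"
  by (auto simp: horizontal_indices_def mi_order_def sum_3)

lemma finite_horizontal_indices: "finite (horizontal_indices l)"
  by (rule finite_subset[OF _ finite_mi_order[of l]]) (auto simp: horizontal_indices_mi_order)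

lemma word_0 [simp]: "word 0 = []" by (simp add: word_def)

lemma mi_order_0 [simp]: "mi_order 0 = 0" by (simp add: mi_order_def)

text \<open>Membership in the Sobolev space amounts to finiteness of every summand. If one summand
  is infinite, both sides are, so the identity needs no regularity assumption up to the
  boundary.\<close>

lemma Sobolev_norm_smooth:
  fixes F q :: "real^3 \<Rightarrow> real"
  assumes q: "smooth_on slab q" and li: "loc_integrable F" and ae: "AE_slab (\<lambda>x. F x = q x)"
  shows "(Sobolev_norm k F)\<^sup>2 = (\<Sum>\<beta> | mi_order \<beta> \<le> k. slab_nn (\<lambda>x. (pds (word \<beta>) q x)\<^sup>2))"
proof -
  let ?B = "{\<beta>. mi_order \<beta> \<le> k}"
  note cq = smooth_on_continuous[OF smooth_on_pds[OF q]]
  note wp = weak_pderiv_smooth[OF q li ae]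
  have mem: "F \<in> Sobolev_space k \<longleftrightarrow> (\<forall>\<beta>\<in>?B. slab_nn (\<lambda>x. (pds (word \<beta>) q x)\<^sup>2) < top)"
  proof
    assume S: "F \<in> Sobolev_space k"
    show "\<forall>\<beta>\<in>?B. slab_nn (\<lambda>x. (pds (word \<beta>) q x)\<^sup>2) < top"
    proof
      fix \<beta> assume "\<beta> \<in> ?B"
      then obtain g where "g \<in> L2_slab" "has_weak_pderiv \<beta> F g" using S by (auto simp: Sobolev_space_def)
      then show "slab_nn (\<lambda>x. (pds (word \<beta>) q x)\<^sup>2) < top"
        using L2_slab_AE_iff(1)[OF cq weak_pderiv_unique[OF _ wp(1)]] by blast
    qed
  next
    assume fin: "\<forall>\<beta>\<in>?B. slab_nn (\<lambda>x. (pds (word \<beta>) q x)\<^sup>2) < top"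
    have "slab_nn (\<lambda>x. (pds (word 0) q x)\<^sup>2) < top" using bspec[OF fin, of 0] by simp
    then have "F \<in> L2_slab" using L2_slab_AE_iff(1)[OF smooth_on_continuous[OF q] ae] by simp
    moreover have "pds (word \<beta>) q \<in> L2_slab" if "\<beta> \<in> ?B" for \<beta>
      using fin that L2_slab_AE_iff(1)[OF smooth_on_continuous[OF smooth_on_pds[OF q, of "word \<beta>"]], of "pds (word \<beta>) q"] by simp
    ultimately show "F \<in> Sobolev_space k" using wp(1) by (auto simp: Sobolev_space_def)
  qed
  show ?thesis
  proof (cases "F \<in> Sobolev_space k")
    case True
    have nn: "0 \<le> LS (\<lambda>x. (norm (weak_pderiv \<beta> F x))\<^sup>2)" for \<beta> by (intro integral_nonneg_AE) simp
    have eq: "ennreal (LS (\<lambda>x. (norm (weak_pderiv \<beta> F x))\<^sup>2)) = slab_nn (\<lambda>x. (pds (word \<beta>) q x)\<^sup>2)" if "\<beta> \<in> ?B" for \<beta>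
      using L2_slab_AE_iff[OF smooth_on_continuous[OF smooth_on_pds[OF q]] wp(4)[of \<beta>]] mem True that by blast
    have "(Sobolev_norm k F)\<^sup>2 = ennreal (\<Sum>\<beta>\<in>?B. LS (\<lambda>x. (norm (weak_pderiv \<beta> F x))\<^sup>2))"
      using True nn by (simp add: Sobolev_norm_def ennreal_power sum_nonneg)
    also have "\<dots> = (\<Sum>\<beta>\<in>?B. slab_nn (\<lambda>x. (pds (word \<beta>) q x)\<^sup>2))"
      unfolding sum_ennreal[OF nn, symmetric] by (intro sum.cong refl eq)
    finally show ?thesis .
  next
    case False
    then obtain \<beta> where \<beta>: "\<beta> \<in> ?B" "\<not> slab_nn (\<lambda>x. (pds (word \<beta>) q x)\<^sup>2) < top" using mem by blast
    then have \<beta>': "slab_nn (\<lambda>x. (pds (word \<beta>) q x)\<^sup>2) = top" by (simp add: less_top[symmetric])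
    have "(\<Sum>\<beta>\<in>?B. slab_nn (\<lambda>x. (pds (word \<beta>) q x)\<^sup>2)) = top"
      using member_le_sum[OF \<beta>(1) zero_le, of "\<lambda>\<beta>. slab_nn (\<lambda>x. (pds (word \<beta>) q x)\<^sup>2)"] finite_mi_order \<beta>' by (simp add: top_unique)
    then show ?thesis using False by (simp add: Sobolev_norm_def power2_eq_square ennreal_mult_top)
  qed
qed

lemma aniso_norm_sq_smooth:
  fixes F q :: "real^3 \<Rightarrow> real"
  assumes q: "smooth_on slab q" and li: "loc_integrable F" and ae: "AE_slab (\<lambda>x. F x = q x)"
  shows "aniso_norm_sq k l F = (\<Sum>\<alpha>\<in>horizontal_indices l. \<Sum>\<beta> | mi_order \<beta> \<le> k. slab_nn (\<lambda>x. (pds (word \<beta> @ word \<alpha>) q x)\<^sup>2))"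
proof -
  note wp = weak_pderiv_smooth[OF q li ae]
  have "\<forall>\<alpha>\<in>horizontal_indices l. \<exists>g. has_weak_pderiv \<alpha> F g" using wp(1) by blast
  then have "aniso_norm_sq k l F = (\<Sum>\<alpha>\<in>horizontal_indices l. (Sobolev_norm k (weak_pderiv \<alpha> F))\<^sup>2)"
    by (simp add: aniso_norm_sq_def)
  also have "\<dots> = (\<Sum>\<alpha>\<in>horizontal_indices l. \<Sum>\<beta> | mi_order \<beta> \<le> k. slab_nn (\<lambda>x. (pds (word \<beta>) (pds (word \<alpha>) q) x)\<^sup>2))"
    by (intro sum.cong refl Sobolev_norm_smooth smooth_on_pds q wp)
  finally show ?thesis by simp
qed

lemma mi_order_axis [simp]: "mi_order (axis i 1) = 1"
  by (simp add: mi_order_def axis_def)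

lemma word_axis [simp]: "word (axis i 1) = [i]"
  using exhaust_3[of i] by (auto simp: word_def axis_def)

text \<open>For words of horizontal letters the front of \<open>word \<beta> @ word \<alpha>\<close> can be dropped without leaving the
  index set; a vertical letter turns \<open>\<partial>\<^sub>h\<close> into \<open>\<partial>\<^sub>3\<close> by permuting derivatives.\<close>

lemma word_suffix:
  assumes "\<beta> $ 3 = 0" "word \<beta> = ks @ js"
  obtains \<beta>' where "\<beta>' $ 3 = 0" "mi_order \<beta>' \<le> mi_order \<beta>" "word \<beta>' = js"
proof -
  define m where "m = length ks"
  have js: "js = drop m (word \<beta>)" using assms(2) by (simp add: m_def)
  \<comment> \<open>Dropping m letters first exhausts the 1s and then takes the remaining
    \<open>m - \<beta> $ 1\<close> letters from the 2s; truncated subtraction covers both cases at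
    once.\<close>
  define \<beta>' :: multi_index where "\<beta>' = (\<chi> i. if i = 1 then \<beta> $ 1 - m else if i = 2 then \<beta> $ 2 - (m - \<beta> $ 1) else 0)"
  have "word \<beta>' = js" unfolding js word_def \<beta>'_def using assms(1) by simp
  moreover have "mi_order \<beta>' \<le> mi_order \<beta>" by (simp add: mi_order_def sum_3 \<beta>'_def)
  ultimately show ?thesis using that[of \<beta>'] by (simp add: \<beta>'_def)
qed

lemma horizontal_estimate:
  assumes f: "smooth_on slab f" and harm: "\<And>x. x \<in> slab \<Longrightarrow> lap f x = 0"
    and base: "slab_nn (\<lambda>x. (pd h f x)\<^sup>2) \<le> T"
    and hyp: "\<And>\<alpha> \<beta>. \<alpha> \<in> horizontal_indices l \<Longrightarrow> mi_order \<beta> \<le> k \<Longrightarrow> slab_nn (\<lambda>x. (pds (word \<beta> @ word \<alpha>) (pd 3 f) x)\<^sup>2) \<le> T"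
    and \<alpha>: "\<alpha> \<in> horizontal_indices l" and \<beta>: "mi_order \<beta> \<le> k" and kl: "k + l \<le> N"
  shows "slab_nn (\<lambda>x. (pds (word \<beta> @ word \<alpha>) (pd h f) x)\<^sup>2) \<le> ennreal (240 ^ N) * T"
proof -
  have one: "1 \<le> ennreal (240 ^ N)" by simp
  show ?thesis
  proof (cases "\<beta> $ 3 = 0")
    case True
    have "slab_nn (\<lambda>x. (pds (word \<beta> @ word \<alpha>) (pd h f) x)\<^sup>2) \<le> ennreal (240 ^ length (word \<beta> @ word \<alpha>)) * T"
    proof (rule horizontal_iterate[OF f harm base])
      fix js assume "\<exists>ks. word \<beta> @ word \<alpha> = ks @ js"
      then obtain ks where "word \<beta> @ word \<alpha> = ks @ js" by blast
      then consider us where "word \<beta> = ks @ us" "js = us @ word \<alpha>" | us where "word \<alpha> = us @ js"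
        by (auto simp: append_eq_append_conv2)
      then show "slab_nn (\<lambda>x. (pds js (pd 3 f) x)\<^sup>2) \<le> T"
      proof cases
        case 1
        obtain \<beta>' where "mi_order \<beta>' \<le> mi_order \<beta>" "word \<beta>' = us" by (rule word_suffix[OF True 1(1)])
        then show ?thesis using hyp[OF \<alpha>, of \<beta>'] \<beta> 1(2) by simp
      next
        case 2
        have "\<alpha> $ 3 = 0" using \<alpha> by (simp add: horizontal_indices_mi_order)
        then obtain \<alpha>' where "\<alpha>' $ 3 = 0" "mi_order \<alpha>' \<le> mi_order \<alpha>" "word \<alpha>' = js" by (rule word_suffix[OF _ 2])
        then show ?thesis using hyp[of \<alpha>' 0] \<alpha> by (simp add: horizontal_indices_mi_order)
      qed
    qed
    also have "\<dots> \<le> ennreal (240 ^ N) * T"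
    proof (intro mult_right_mono ennreal_leI power_increasing)
      show "length (word \<beta> @ word \<alpha>) \<le> N" using \<alpha> \<beta> kl by (simp add: length_word horizontal_indices_mi_order)
    qed auto
    finally show ?thesis .
  next
    case False
    define \<beta>' :: multi_index where "\<beta>' = (\<chi> i. if i = 3 then \<beta> $ 3 - 1 else if i = h then \<beta> $ i + 1 else \<beta> $ i)"
    show ?thesis
    proof (cases "h = 3")
      case True
      have "slab_nn (\<lambda>x. (pds (word \<beta> @ word \<alpha>) (pd h f) x)\<^sup>2) \<le> 1 * T" using hyp[OF \<alpha> \<beta>] True by simp
      also have "\<dots> \<le> ennreal (240 ^ N) * T" using one by (intro mult_right_mono) auto
      finally show ?thesis .
    next
      case h: False
      have ord: "mi_order \<beta>' = mi_order \<beta>" using False h exhaust_3[of h] by (auto simp: \<beta>'_def mi_order_def sum_3)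
      have ms: "mset ((word \<beta> @ word \<alpha>) @ [h]) = mset ((word \<beta>' @ word \<alpha>) @ [3])"
        using False h exhaust_3[of h] by (cases "\<beta> $ 3") (auto simp: word_def \<beta>'_def)
      have "slab_nn (\<lambda>x. (pds (word \<beta> @ word \<alpha>) (pd h f) x)\<^sup>2) = slab_nn (\<lambda>x. (pds (word \<beta>' @ word \<alpha>) (pd 3 f) x)\<^sup>2)"
      proof (rule slab_nn_cong)
        fix x assume "x \<in> slab"
        from pds_perm[OF open_slab f this ms] show "(pds (word \<beta> @ word \<alpha>) (pd h f) x)\<^sup>2 = (pds (word \<beta>' @ word \<alpha>) (pd 3 f) x)\<^sup>2" by simp
      qed
      also have "\<dots> \<le> 1 * T" using hyp[OF \<alpha>, of \<beta>'] \<beta> ord by simp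
      also have "\<dots> \<le> ennreal (240 ^ N) * T" using one by (intro mult_right_mono) auto
      finally show ?thesis .
    qed
  qed
qed

section \<open>The curl and its boundary values\<close>

lemma L2_mult_integrable:
  fixes u v :: "real^3 \<Rightarrow> real"
  assumes "u \<in> L2_slab" "v \<in> L2_slab" shows "integrable (lebesgue_on slab) (\<lambda>x. u x * v x)"
proof (rule Bochner_Integration.integrable_bound)
  have m: "u \<in> borel_measurable (lebesgue_on slab)" "v \<in> borel_measurable (lebesgue_on slab)"
    and i: "integrable (lebesgue_on slab) (\<lambda>x. (norm (u x))\<^sup>2)" "integrable (lebesgue_on slab) (\<lambda>x. (norm (v x))\<^sup>2)"
    using assms by (auto simp: L2_slab_def)
  show "integrable (lebesgue_on slab) (\<lambda>x. (norm (u x))\<^sup>2 + (norm (v x))\<^sup>2)" by (intro Bochner_Integration.integrable_add i)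
  show "(\<lambda>x. u x * v x) \<in> borel_measurable (lebesgue_on slab)" using m by measurable
  have "\<bar>p * q\<bar> \<le> p\<^sup>2 + q\<^sup>2" for p q :: real
  proof -
    have "(\<bar>p\<bar> - \<bar>q\<bar>)\<^sup>2 = p\<^sup>2 + q\<^sup>2 - 2 * \<bar>p * q\<bar>" by (simp add: power2_diff abs_mult)
    then show ?thesis using zero_le_power2[of "\<bar>p\<bar> - \<bar>q\<bar>"] abs_ge_zero[of "p * q"] by linarith
  qed
  then show "AE x in lebesgue_on slab. norm (u x * v x) \<le> norm ((norm (u x))\<^sup>2 + (norm (v x))\<^sup>2)"
    by (intro AE_I2) simp
qed

lemma L2_Young:
  fixes u v :: "real^3 \<Rightarrow> real"
  assumes "u \<in> L2_slab" "v \<in> L2_slab" "t > 0"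
  shows "LS (\<lambda>x. u x * v x) \<le> t * LS (\<lambda>x. (u x)\<^sup>2) + 1 / t * LS (\<lambda>x. (v x)\<^sup>2)"
proof -
  have i: "integrable (lebesgue_on slab) (\<lambda>x. (u x)\<^sup>2)" "integrable (lebesgue_on slab) (\<lambda>x. (v x)\<^sup>2)"
    using assms by (auto simp: L2_slab_def)
  have "LS (\<lambda>x. u x * v x) \<le> LS (\<lambda>x. t * (u x)\<^sup>2 + 1 / t * (v x)\<^sup>2)"
  proof (rule integral_mono[OF L2_mult_integrable[OF assms(1,2)]])
    show "integrable (lebesgue_on slab) (\<lambda>x. t * (u x)\<^sup>2 + 1 / t * (v x)\<^sup>2)"
      by (intro Bochner_Integration.integrable_add integrable_mult_right i)
    fix x
    have "0 \<le> t * (u x - v x / (2 * t))\<^sup>2" using assms(3) by simp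
    also have "\<dots> = t * (u x)\<^sup>2 - u x * v x + (v x)\<^sup>2 / (4 * t)" using assms(3) by (simp add: power2_eq_square field_simps)
    finally have "u x * v x \<le> t * (u x)\<^sup>2 + (v x)\<^sup>2 / (4 * t)" by linarith
    moreover have "(v x)\<^sup>2 / (4 * t) \<le> 1 / t * (v x)\<^sup>2" using assms(3) by (simp add: field_simps)
    ultimately show "u x * v x \<le> t * (u x)\<^sup>2 + 1 / t * (v x)\<^sup>2" by linarith
  qed
  also have "\<dots> = t * LS (\<lambda>x. (u x)\<^sup>2) + 1 / t * LS (\<lambda>x. (v x)\<^sup>2)"
    by (subst Bochner_Integration.integral_add) (auto intro!: integrable_mult_right i simp del: integrable_mult_right_iff)
  finally show ?thesis .
qed

lemma L2_component:
  fixes f :: "real^3 \<Rightarrow> real^3"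
  assumes "f \<in> L2_slab" shows "(\<lambda>x. f x $ j) \<in> L2_slab" "LS (\<lambda>x. (f x $ j)\<^sup>2) \<le> LS (\<lambda>x. (norm (f x))\<^sup>2)"
proof -
  have m: "f \<in> borel_measurable (lebesgue_on slab)" and i: "integrable (lebesgue_on slab) (\<lambda>x. (norm (f x))\<^sup>2)"
    using assms by (auto simp: L2_slab_def)
  have "(\<lambda>v::real^3. v $ j) \<in> borel_measurable borel" by (intro borel_measurable_continuous_onI continuous_intros)
  then have mj: "(\<lambda>x. f x $ j) \<in> borel_measurable (lebesgue_on slab)" by (rule measurable_compose[OF m])
  have le: "(f x $ j)\<^sup>2 \<le> (norm (f x))\<^sup>2" for x
    using power_mono[OF component_le_norm_cart[of "f x" j], of 2] by simp
  have ij: "integrable (lebesgue_on slab) (\<lambda>x. (f x $ j)\<^sup>2)"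
    by (rule Bochner_Integration.integrable_bound[OF i]) (use mj le in auto)
  then show "(\<lambda>x. f x $ j) \<in> L2_slab" using mj by (simp add: L2_slab_def)
  show "LS (\<lambda>x. (f x $ j)\<^sup>2) \<le> LS (\<lambda>x. (norm (f x))\<^sup>2)" using ij i le by (intro integral_mono) auto
qed

lemma L2_add_diff:
  fixes u v :: "real^3 \<Rightarrow> real"
  assumes "u \<in> L2_slab" "v \<in> L2_slab"
  shows "(\<lambda>x. u x - v x) \<in> L2_slab" "LS (\<lambda>x. (u x - v x)\<^sup>2) \<le> 2 * LS (\<lambda>x. (u x)\<^sup>2) + 2 * LS (\<lambda>x. (v x)\<^sup>2)"
proof -
  have m: "(\<lambda>x. u x - v x) \<in> borel_measurable (lebesgue_on slab)"
    and i: "integrable (lebesgue_on slab) (\<lambda>x. (u x)\<^sup>2)" "integrable (lebesgue_on slab) (\<lambda>x. (v x)\<^sup>2)"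
    using assms by (auto simp: L2_slab_def)
  have i2: "integrable (lebesgue_on slab) (\<lambda>x. 2 * (u x)\<^sup>2 + 2 * (v x)\<^sup>2)"
    by (intro Bochner_Integration.integrable_add integrable_mult_right i)
  have le: "(p - q)\<^sup>2 \<le> 2 * p\<^sup>2 + 2 * q\<^sup>2" for p q :: real
    using zero_le_power2[of "p + q"] by (simp add: power2_eq_square algebra_simps)
  have ij: "integrable (lebesgue_on slab) (\<lambda>x. (u x - v x)\<^sup>2)"
    by (rule Bochner_Integration.integrable_bound[OF i2]) (use m le in auto)
  then show "(\<lambda>x. u x - v x) \<in> L2_slab" using m by (simp add: L2_slab_def)
  have "LS (\<lambda>x. (u x - v x)\<^sup>2) \<le> LS (\<lambda>x. 2 * (u x)\<^sup>2 + 2 * (v x)\<^sup>2)" using ij i2 le by (intro integral_mono) auto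
  also have "\<dots> = 2 * LS (\<lambda>x. (u x)\<^sup>2) + 2 * LS (\<lambda>x. (v x)\<^sup>2)"
    by (subst Bochner_Integration.integral_add) (auto intro!: integrable_mult_right i simp del: integrable_mult_right_iff)
  finally show "LS (\<lambda>x. (u x - v x)\<^sup>2) \<le> 2 * LS (\<lambda>x. (u x)\<^sup>2) + 2 * LS (\<lambda>x. (v x)\<^sup>2)" .
qed

lemma L2_continuous_iff:
  "continuous_on slab q \<Longrightarrow> q \<in> L2_slab \<longleftrightarrow> slab_nn (\<lambda>x. (q x)\<^sup>2) < top" for q :: "real^3 \<Rightarrow> real"
  using L2_slab_AE_iff(1)[of q q] by simp

lemma L2_test:
  assumes "\<psi> \<in> test_fun UNIV" shows "\<psi> \<in> L2_slab"
proof -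
  have c: "continuous_on slab \<psi>" by (rule test_fun_continuous[OF assms])
  have "(\<lambda>x. \<psi> x * \<psi> x) \<in> test_fun UNIV" by (rule test_fun_mult[OF open_UNIV test_fun_smooth[OF assms] assms])
  from test_fun_lborel(1)[OF this] have i: "integrable lborel (\<lambda>x. (\<psi> x)\<^sup>2)" by (simp add: power2_eq_square)
  have "slab_integrable (\<lambda>x. (\<psi> x)\<^sup>2)" using integrable_mult_indicator[OF _ i, of slab] by simp
  then have "slab_nn (\<lambda>x. (\<psi> x)\<^sup>2) < top" using slab_nn_eq[of "\<lambda>x. (\<psi> x)\<^sup>2"] by simp
  then show ?thesis using L2_continuous_iff[OF c] by simp
qed

text \<open>The Sobolev hypothesis concerns the vector field as a whole, whereas
  \<open>weak_curl\<close> differentiates its scalar components.\<close>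

lemma has_weak_pderiv_component:
  fixes f g :: "real^3 \<Rightarrow> real^3"
  assumes "has_weak_pderiv \<alpha> f g" shows "has_weak_pderiv \<alpha> (\<lambda>x. f x $ j) (\<lambda>x. g x $ j)"
proof -
  have li: "loc_integrable f" "loc_integrable g" using assms by (auto simp: has_weak_pderiv_def)
  have lij: "loc_integrable (\<lambda>x. F x $ j)" if "loc_integrable F" for F :: "real^3 \<Rightarrow> real^3"
    using that unfolding loc_integrable_def by (auto intro!: integrable_bounded_linear[OF bounded_linear_vec_nth])
  have comp: "(LINT x|lebesgue_on slab. \<psi> x *\<^sub>R F x $ j) = (LINT x|lebesgue_on slab. \<psi> x *\<^sub>R F x) $ j"
    if "loc_integrable F" "\<psi> \<in> test_fun slab" for F :: "real^3 \<Rightarrow> real^3" and \<psi>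
    using integral_bounded_linear[OF bounded_linear_vec_nth integrable_mult_test[OF that], of j]
    unfolding LINT_slab_test[OF that(2)] by simp
  show ?thesis
    unfolding has_weak_pderiv_def
  proof (intro conjI ballI lij li)
    fix \<psi> assume \<psi>: "\<psi> \<in> test_fun slab"
    have t: "mpderiv \<alpha> \<psi> \<in> test_fun slab" unfolding mpderiv_word by (rule test_fun_pds[OF \<psi>])
    show "(LINT x|lebesgue_on slab. mpderiv \<alpha> \<psi> x *\<^sub>R f x $ j) = (- 1) ^ mi_order \<alpha> *\<^sub>R (LINT x|lebesgue_on slab. \<psi> x *\<^sub>R g x $ j)"
      using assms \<psi> unfolding comp[OF li(1) t] comp[OF li(2) \<psi>] has_weak_pderiv_def by simp
  qed
qed

lemma L2_AE:
  fixes f g :: "real^3 \<Rightarrow> real"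
  assumes "f \<in> L2_slab" "AE_slab (\<lambda>x. f x = g x)"
  shows "g \<in> L2_slab" "LS (\<lambda>x. (g x)\<^sup>2) = LS (\<lambda>x. (f x)\<^sup>2)"
proof -
  have m: "f \<in> borel_measurable (lebesgue_on slab)" "g \<in> borel_measurable (lebesgue_on slab)"
    using assms borel_measurable_AE_slab by (auto simp: L2_slab_def)
  have ae: "AE x in lebesgue_on slab. (f x)\<^sup>2 = (g x)\<^sup>2" using assms(2) unfolding AE_slab_iff by eventually_elim simp
  have i: "integrable (lebesgue_on slab) (\<lambda>x. (f x)\<^sup>2)" using assms by (auto simp: L2_slab_def)
  have m2: "(\<lambda>x. (f x)\<^sup>2) \<in> borel_measurable (lebesgue_on slab)" "(\<lambda>x. (g x)\<^sup>2) \<in> borel_measurable (lebesgue_on slab)"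
    using m by measurable
  show "g \<in> L2_slab" using m(2) integrable_cong_AE[OF m2 ae] i by (simp add: L2_slab_def)
  show "LS (\<lambda>x. (g x)\<^sup>2) = LS (\<lambda>x. (f x)\<^sup>2)" using integral_cong_AE[OF m2 ae] by simp
qed

text \<open>The weak derivatives of \<open>w\<close> and those of its components are selected
  independently of each other. Uniqueness almost everywhere identifies them, and each is then
  dominated by one summand of the squared norm.\<close>

lemma curl_data:
  fixes w :: "real^3 \<Rightarrow> real^3"
  assumes w: "w \<in> Sobolev_space N" and N: "N \<ge> 1"
  obtains b0 b1 where "0 \<le> b0" "b0 \<le> b1" "Sobolev_norm 0 w = ennreal b0" "Sobolev_norm 1 w = ennreal b1"
    "\<And>j. (\<lambda>x. w x $ j) \<in> L2_slab" "\<And>j. LS (\<lambda>x. (w x $ j)\<^sup>2) \<le> b0\<^sup>2"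
    "\<And>i j. weak_partial i (\<lambda>x. w x $ j) \<in> L2_slab" "\<And>i j. LS (\<lambda>x. (weak_partial i (\<lambda>x. w x $ j) x)\<^sup>2) \<le> b1\<^sup>2"
    "\<And>i j. has_weak_pderiv (axis i 1) (\<lambda>x. w x $ j) (weak_partial i (\<lambda>x. w x $ j))"
proof -
  let ?D = "\<lambda>\<alpha>. LS (\<lambda>x. (norm (weak_pderiv \<alpha> w x))\<^sup>2)"
  have nn: "0 \<le> ?D \<alpha>" for \<alpha> by (intro integral_nonneg_AE) simp
  have "\<exists>g\<in>L2_slab. has_weak_pderiv \<alpha> w g" if "mi_order \<alpha> \<le> N" for \<alpha> using w that by (auto simp: Sobolev_space_def)
  then have sp: "\<exists>g\<in>L2_slab. has_weak_pderiv \<alpha> w g" if "mi_order \<alpha> \<le> 1" for \<alpha> using that N by (meson order_trans)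
  have wS: "w \<in> Sobolev_space k" if "k \<le> 1" for k using w sp that by (auto simp: Sobolev_space_def)
  have main: "(\<lambda>x. weak_pderiv \<alpha> (\<lambda>y. w y $ j) x) \<in> L2_slab \<and> LS (\<lambda>x. (weak_pderiv \<alpha> (\<lambda>y. w y $ j) x)\<^sup>2) \<le> ?D \<alpha> \<and>
      has_weak_pderiv \<alpha> (\<lambda>y. w y $ j) (weak_pderiv \<alpha> (\<lambda>y. w y $ j))" if \<alpha>: "mi_order \<alpha> \<le> 1" for \<alpha> j
  proof -
    obtain g where g: "g \<in> L2_slab" "has_weak_pderiv \<alpha> w g" using sp[OF \<alpha>] by blast
    note ws = weak_pderiv_spec[OF g(2)]
    have ae: "AE_slab (\<lambda>x. g x $ i = weak_pderiv \<alpha> w x $ i)" for i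
      by (rule weak_pderiv_unique[OF has_weak_pderiv_component[OF g(2)] has_weak_pderiv_component[OF ws]])
    have "AE_slab (\<lambda>x. g x = weak_pderiv \<alpha> w x)"
      using ae[of 1] ae[of 2] ae[of 3] by eventually_elim (auto simp: vec_eq_iff forall_3)
    then have aen: "AE x in lebesgue_on slab. (norm (g x))\<^sup>2 = (norm (weak_pderiv \<alpha> w x))\<^sup>2" 
      and mD: "weak_pderiv \<alpha> w \<in> borel_measurable (lebesgue_on slab)"
      using borel_measurable_AE_slab g(1) unfolding AE_slab_iff L2_slab_def by (auto elim: eventually_mono)
    have mg: "g \<in> borel_measurable (lebesgue_on slab)" using g(1) by (simp add: L2_slab_def)
    have nm: "(\<lambda>x. (norm (G x))\<^sup>2) \<in> borel_measurable (lebesgue_on slab)"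
      if G: "G \<in> borel_measurable (lebesgue_on slab)" for G :: "real^3 \<Rightarrow> real^3"
      using G by measurable
    have Dg: "LS (\<lambda>x. (norm (g x))\<^sup>2) = ?D \<alpha>"
      by (rule integral_cong_AE[OF nm[OF mg] nm[OF mD] aen])
    have hj: "has_weak_pderiv \<alpha> (\<lambda>y. w y $ j) (weak_pderiv \<alpha> (\<lambda>y. w y $ j))"
      by (rule weak_pderiv_spec[OF has_weak_pderiv_component[OF g(2)]])
    have "AE_slab (\<lambda>x. g x $ j = weak_pderiv \<alpha> (\<lambda>y. w y $ j) x)"
      by (rule weak_pderiv_unique[OF has_weak_pderiv_component[OF g(2)] hj])
    from L2_AE[OF L2_component(1)[OF g(1)] this] L2_component(2)[OF g(1), of j] show ?thesis
      using Dg hj by simp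
  qed
  define b where "b k = sqrt (\<Sum>\<alpha> | mi_order \<alpha> \<le> k. ?D \<alpha>)" for k :: nat
  have norm: "Sobolev_norm k w = ennreal (b k)" if "k \<le> 1" for k using wS[OF that] by (simp add: Sobolev_norm_def b_def)
  have b2: "(b k)\<^sup>2 = (\<Sum>\<alpha> | mi_order \<alpha> \<le> k. ?D \<alpha>)" for k unfolding b_def using nn by (simp add: sum_nonneg)
  have Dle: "?D \<alpha> \<le> (b k)\<^sup>2" if "mi_order \<alpha> \<le> k" for \<alpha> k
    unfolding b2 using that finite_mi_order nn by (intro member_le_sum) auto
  \<comment> \<open>The weak derivative of order 0 is again only some representative; that the
    component itself is one makes the norm of order 0 a bound for it.\<close>
  have w0: "has_weak_pderiv 0 (\<lambda>y. w y $ j) (\<lambda>y. w y $ j)" for j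
    using main[of 0 j] by (simp add: has_weak_pderiv_def mpderiv_word)
  have ae0: "AE_slab (\<lambda>x. weak_pderiv 0 (\<lambda>y. w y $ j) x = w x $ j)" for j
    using main[of 0 j] w0 by (intro weak_pderiv_unique[of 0]) auto
  have L0: "(\<lambda>x. w x $ j) \<in> L2_slab" "LS (\<lambda>x. (w x $ j)\<^sup>2) \<le> (b 0)\<^sup>2" for j
    using L2_AE[OF _ ae0[of j]] main[of 0 j] Dle[of 0 0] by auto
  show ?thesis
  proof (rule that[of "b 0" "b 1"])
    show "0 \<le> b 0" unfolding b_def by (simp add: sum_nonneg nn)
    show "b 0 \<le> b 1" unfolding b_def by (intro real_sqrt_le_mono sum_mono2 finite_mi_order) (auto intro: nn)
    show "weak_partial i (\<lambda>x. w x $ j) \<in> L2_slab" "LS (\<lambda>x. (weak_partial i (\<lambda>x. w x $ j) x)\<^sup>2) \<le> (b 1)\<^sup>2"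
      "has_weak_pderiv (axis i 1) (\<lambda>x. w x $ j) (weak_partial i (\<lambda>x. w x $ j))" for i j
      using main[of "axis i 1" j] Dle[of "axis i 1" 1] by (auto simp del: One_nat_def)
  qed (use L0 norm in auto)
qed

section \<open>Vertical cut-off functions and boundary layers\<close>

lemma step_deriv_bounded:
  obtains D B where "B > 0" "\<And>t. (step_fun has_real_derivative D t) (at t)" "\<And>t. \<bar>D t\<bar> \<le> B"
    "\<And>t. t < 0 \<or> 1 < t \<Longrightarrow> D t = 0"
proof -
  obtain D where D: "continuous_on UNIV D" "\<And>t. (step_fun has_real_derivative D t) (at t)" using step_fun_deriv by blast
  have 0: "D t = 0" if "t < 0 \<or> 1 < t" for t
    using that
  proof
    assume "t < 0"
    then show ?thesis by (intro DERIV_zero_locally_const[OF D(2), of "{..<0}" _ 0]) (auto simp: step_fun_0)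
  next
    assume "1 < t"
    then show ?thesis by (intro DERIV_zero_locally_const[OF D(2), of "{1<..}" _ 1]) (auto simp: step_fun_1)
  qed
  have z: "\<And>t. t \<notin> {0..1} \<Longrightarrow> D t = 0" using 0 by auto
  obtain B where "B > 0" "\<And>t. \<bar>D t\<bar> \<le> B" by (rule bounded_compact_support_real[of D 0 1, OF D(1) z]) blast+
  then show ?thesis using that[of B D] D(2) 0 by blast
qed

text \<open>No smallness of \<delta> is required: once \<delta> is at least 1/4 the layer is the
  whole interval, and the statements below remain correct. This matters because \<delta> will be a
  quotient of norms.\<close>

definition vcut :: "real \<Rightarrow> real^3 \<Rightarrow> real" where
  "vcut \<delta> x = step_fun ((x $ 3 - \<delta>) / \<delta>) * step_fun ((1 - \<delta> - x $ 3) / \<delta>)"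

definition layer :: "real \<Rightarrow> real set" where "layer \<delta> = {t. 0 < t \<and> t < 1 \<and> (t \<le> 2 * \<delta> \<or> 1 - 2 * \<delta> \<le> t)}"

lemma smooth_on_vcut: "smooth_on UNIV (vcut \<delta>)"
  unfolding vcut_def[abs_def] divide_inverse by (intro smooth_on_intros smooth_on_step_fun open_UNIV)

lemma vcut_props:
  assumes "\<delta> > 0"
  shows "0 \<le> vcut \<delta> x" "vcut \<delta> x \<le> 1" "x $ 3 \<notin> {\<delta>..1 - \<delta>} \<Longrightarrow> vcut \<delta> x = 0"
    "x \<in> slab \<Longrightarrow> x $ 3 \<notin> layer \<delta> \<Longrightarrow> vcut \<delta> x = 1" "x $ 3 = y $ 3 \<Longrightarrow> vcut \<delta> x = vcut \<delta> y"
proof -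
  show "0 \<le> vcut \<delta> x" "vcut \<delta> x \<le> 1" unfolding vcut_def using step_fun_bounds by (simp_all add: mult_le_one)
  show "x $ 3 \<notin> {\<delta>..1 - \<delta>} \<Longrightarrow> vcut \<delta> x = 0" using assms by (auto simp: vcut_def step_fun_0 divide_le_0_iff)
  show "vcut \<delta> x = 1" if "x \<in> slab" "x $ 3 \<notin> layer \<delta>"
  proof -
    have "2 * \<delta> < x $ 3" "x $ 3 < 1 - 2 * \<delta>" using that by (auto simp: layer_def slab_def)
    then have "1 \<le> (x $ 3 - \<delta>) / \<delta>" "1 \<le> (1 - \<delta> - x $ 3) / \<delta>" using assms by (simp_all add: le_divide_eq)
    then show ?thesis by (simp add: vcut_def step_fun_1)
  qed
  show "x $ 3 = y $ 3 \<Longrightarrow> vcut \<delta> x = vcut \<delta> y" by (simp add: vcut_def)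
qed

lemma vcut_pd:
  obtains B where "B > 0" "\<And>\<delta> i x. \<delta> > 0 \<Longrightarrow> i \<noteq> 3 \<Longrightarrow> pd i (vcut \<delta>) x = 0" "\<And>\<delta> x. \<delta> > 0 \<Longrightarrow> \<bar>pd 3 (vcut \<delta>) x\<bar> \<le> B / \<delta>"
    "\<And>\<delta> x. \<delta> > 0 \<Longrightarrow> x \<in> slab \<Longrightarrow> x $ 3 \<notin> layer \<delta> \<Longrightarrow> pd 3 (vcut \<delta>) x = 0"
proof -
  obtain D B where B: "B > 0" "\<And>t. (step_fun has_real_derivative D t) (at t)" "\<And>t. \<bar>D t\<bar> \<le> B"
    "\<And>t. t < 0 \<or> 1 < t \<Longrightarrow> D t = 0" by (rule step_deriv_bounded) blast
  define E where "E \<delta> t = (D ((t - \<delta>) / \<delta>) * (1 / \<delta>)) * step_fun ((1 - \<delta> - t) / \<delta>) + (D ((1 - \<delta> - t) / \<delta>) * (- 1 / \<delta>)) * step_fun ((t - \<delta>) / \<delta>)" for \<delta> t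
  have d1: "((\<lambda>t. step_fun ((t - \<delta>) / \<delta>)) has_real_derivative D ((t - \<delta>) / \<delta>) * (1 / \<delta>)) (at t)" for \<delta> t
    by (rule DERIV_chain2[OF B(2)], rule DERIV_cdivide) (auto intro!: derivative_eq_intros)
  have d2: "((\<lambda>t. step_fun ((1 - \<delta> - t) / \<delta>)) has_real_derivative D ((1 - \<delta> - t) / \<delta>) * (- 1 / \<delta>)) (at t)" for \<delta> t
    by (rule DERIV_chain2[OF B(2)], rule DERIV_cdivide) (auto intro!: derivative_eq_intros)
  have dE: "((\<lambda>t. step_fun ((t - \<delta>) / \<delta>) * step_fun ((1 - \<delta> - t) / \<delta>)) has_real_derivative E \<delta> t) (at t)" for \<delta> t
    unfolding E_def by (rule DERIV_mult[OF d1 d2])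
  have f: "pd i (vcut \<delta>) x = (if i = 3 then E \<delta> (x $ 3) else 0)" for i \<delta> x
    unfolding vcut_def[abs_def] by (rule pd_comp_coord(1)[OF dE])
  have s: "\<bar>D p * (c / \<delta>) * step_fun q\<bar> \<le> B / \<delta>" if "\<delta> > 0" "\<bar>c\<bar> = 1" for p q c \<delta>
  proof -
    have "\<bar>D p * (c / \<delta>) * step_fun q\<bar> = \<bar>D p\<bar> / \<delta> * step_fun q" using that step_fun_bounds[of q] by (simp add: abs_mult)
    also have "\<dots> \<le> \<bar>D p\<bar> / \<delta> * 1" using that step_fun_bounds[of q] by (intro mult_left_mono) auto
    also have "\<dots> \<le> B / \<delta>" using B(3)[of p] that by (simp add: divide_right_mono)
    finally show ?thesis .
  qed
  show ?thesis
  proof (rule that[of "2 * B"])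
    show "2 * B > 0" using B(1) by simp
    fix \<delta> :: real and x :: "real^3" assume \<delta>: "\<delta> > 0"
    show "pd i (vcut \<delta>) x = 0" if "i \<noteq> 3" for i using that by (simp add: f)
    have "2 * B / \<delta> = B / \<delta> + B / \<delta>" by simp
    then show "\<bar>pd 3 (vcut \<delta>) x\<bar> \<le> 2 * B / \<delta>"
      unfolding f E_def if_P[OF refl] by (simp only:) (rule order_trans[OF abs_triangle_ineq add_mono[OF s[OF \<delta>] s[OF \<delta>]]]; simp)
    assume "x \<in> slab" "x $ 3 \<notin> layer \<delta>"
    then have "2 * \<delta> < x $ 3" "x $ 3 < 1 - 2 * \<delta>" by (auto simp: layer_def slab_def)
    then have "1 < (x $ 3 - \<delta>) / \<delta>" "1 < (1 - \<delta> - x $ 3) / \<delta>" using \<delta> by (simp_all add: less_divide_eq)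
    then show "pd 3 (vcut \<delta>) x = 0" by (simp add: f E_def B(4))
  qed
qed

text \<open>The majorant depends on the horizontal variables only, so slicing in the vertical
  direction separates the integral into the length of the layer, at most 4 \<delta>, and an integral
  over the slab, whose height is 1.\<close>

lemma slab_nn_layer:
  assumes q: "continuous_on UNIV q" "\<And>x y. x $ 1 = y $ 1 \<Longrightarrow> x $ 2 = y $ 2 \<Longrightarrow> q x = q y" "\<And>x. 0 \<le> q x"
    and c: "c \<ge> 0" and \<delta>: "\<delta> > 0"
    and g: "\<And>x. x \<in> slab \<Longrightarrow> x $ 3 \<in> layer \<delta> \<Longrightarrow> g x \<le> c * q x" "\<And>x. x \<in> slab \<Longrightarrow> x $ 3 \<notin> layer \<delta> \<Longrightarrow> g x = 0"
  shows "slab_nn g \<le> ennreal (4 * \<delta> * c) * slab_nn q"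
proof -
  have coord[measurable]: "(\<lambda>y::real^3. y $ i) \<in> borel_measurable borel" for i
    by (intro borel_measurable_continuous_onI continuous_intros)
  have [measurable]: "q \<in> borel_measurable borel" by (rule borel_measurable_continuous_onI[OF q(1)])
  have lay[measurable]: "layer \<delta> \<in> sets borel" unfolding layer_def by measurable
  let ?H = "\<lambda>x::real^3. indicator (layer \<delta>) (x $ 3) * (ennreal c * ennreal (q x))"
  have "slab_nn g \<le> (\<integral>\<^sup>+x. ?H x \<partial>lborel)" unfolding slab_nn_def
  proof (intro nn_integral_mono)
    fix x
    show "indicator slab x * ennreal (g x) \<le> ?H x"
    proof (cases "x \<in> slab \<and> x $ 3 \<in> layer \<delta>")
      case True
      then have "ennreal (g x) \<le> ennreal (c * q x)" using g(1) by (intro ennreal_leI) auto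
      then show ?thesis using True c by (simp add: ennreal_mult')
    next
      case False
      then show ?thesis using g(2)[of x] by (cases "x \<in> slab") auto
    qed
  qed
  also have "\<dots> = (\<integral>\<^sup>+t. \<integral>\<^sup>+y. indicator {0<..<1} (y $ 3) * ?H (y + (t - y $ 3) *\<^sub>R axis 3 1) \<partial>lborel \<partial>lborel)"
    by (rule nn_integral_slice(2)) measurable
  also have "\<dots> = (\<integral>\<^sup>+t. \<integral>\<^sup>+y. (indicator (layer \<delta>) t * ennreal c) * (indicator slab y * ennreal (q y)) \<partial>lborel \<partial>lborel)"
  proof (intro nn_integral_cong)
    fix t and y :: "real^3"
    have "q (y + (t - y $ 3) *\<^sub>R axis 3 1) = q y" by (rule q(2)) (auto simp: axis_def)
    moreover have "(y + (t - y $ 3) *\<^sub>R axis 3 1) $ 3 = t" by (simp add: axis_def)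
    moreover have "indicator {0<..<1} (y $ 3) = (indicator slab y :: ennreal)" by (auto simp: slab_def split: split_indicator)
    ultimately show "indicator {0<..<1} (y $ 3) * ?H (y + (t - y $ 3) *\<^sub>R axis 3 1) = (indicator (layer \<delta>) t * ennreal c) * (indicator slab y * ennreal (q y))"
      by (simp only: mult_ac)
  qed
  also have "\<dots> = (\<integral>\<^sup>+t. indicator (layer \<delta>) t * (ennreal c * slab_nn q) \<partial>lborel)"
    unfolding slab_nn_def by (intro nn_integral_cong) (simp add: nn_integral_cmult mult.assoc)
  also have "\<dots> = emeasure lborel (layer \<delta>) * (ennreal c * slab_nn q)" by (simp add: nn_integral_multc)
  also have "\<dots> \<le> ennreal (4 * \<delta>) * (ennreal c * slab_nn q)"
  proof (rule mult_right_mono)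
    have "emeasure lborel (layer \<delta>) \<le> emeasure lborel ({0..2 * \<delta>} \<union> {1 - 2 * \<delta>..1})"
      by (rule emeasure_mono) (auto simp: layer_def)
    also have "\<dots> \<le> emeasure lborel {0..2 * \<delta>} + emeasure lborel {1 - 2 * \<delta>..1}" by (rule emeasure_subadditive) auto
    also have "\<dots> = ennreal (2 * \<delta>) + ennreal (2 * \<delta>)" using \<delta> by simp
    also have "\<dots> = ennreal (4 * \<delta>)" using \<delta> by (subst ennreal_plus[symmetric]) auto
    finally show "emeasure lborel (layer \<delta>) \<le> ennreal (4 * \<delta>)" .
  qed simp
  also have "\<dots> = ennreal (4 * \<delta> * c) * slab_nn q" using \<delta> c by (simp add: ennreal_mult' mult.assoc)
  finally show ?thesis .
qed

section \<open>Integration by parts for the curl\<close>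

lemma weak_partial_test:
  fixes u v :: "real^3 \<Rightarrow> real"
  assumes "has_weak_pderiv (axis i 1) u v" "\<psi> \<in> test_fun slab"
  shows "LS (\<lambda>x. v x * \<psi> x) = - LS (\<lambda>x. u x * pd i \<psi> x)"
  using has_weak_pderiv_test[OF assms] LINT_slab_test[OF assms(2), of v] LINT_slab_test[OF test_fun_pd[OF assms(2)], of i u]
  by (simp add: mult.commute del: One_nat_def)

lemma inner_3: "(a::real^3) \<bullet> b = a $ 1 * b $ 1 + a $ 2 * b $ 2 + a $ 3 * b $ 3"
  by (simp add: inner_vec_def sum_3)

lemma weak_curl_nth:
  "weak_curl w x $ 1 = weak_partial 2 (\<lambda>y. w y $ 3) x - weak_partial 3 (\<lambda>y. w y $ 2) x"
  "weak_curl w x $ 2 = weak_partial 3 (\<lambda>y. w y $ 1) x - weak_partial 1 (\<lambda>y. w y $ 3) x"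
  "weak_curl w x $ 3 = weak_partial 1 (\<lambda>y. w y $ 2) x - weak_partial 2 (\<lambda>y. w y $ 1) x"
  by (simp_all add: weak_curl_def vector_3)

lemma grad_nth: "grad \<psi> x $ i = pd i \<psi> x"
  by (simp add: grad_def)

context
  fixes w :: "real^3 \<Rightarrow> real^3" and b0 b1 :: real
  assumes wL2: "\<And>j. (\<lambda>x. w x $ j) \<in> L2_slab" and w0: "\<And>j. LS (\<lambda>x. (w x $ j)\<^sup>2) \<le> b0\<^sup>2"
    and PL2: "\<And>i j. weak_partial i (\<lambda>x. w x $ j) \<in> L2_slab"
    and P1: "\<And>i j. LS (\<lambda>x. (weak_partial i (\<lambda>x. w x $ j) x)\<^sup>2) \<le> b1\<^sup>2"
    and hw: "\<And>i j. has_weak_pderiv (axis i 1) (\<lambda>x. w x $ j) (weak_partial i (\<lambda>x. w x $ j))"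
    and b01: "0 \<le> b0" "b0 \<le> b1"
begin

abbreviation "wpd i j \<equiv> weak_partial i (\<lambda>x. w x $ j)"

lemma curl_L2: "(\<lambda>x. weak_curl w x $ i) \<in> L2_slab" "LS (\<lambda>x. (weak_curl w x $ i)\<^sup>2) \<le> 4 * b1\<^sup>2"
proof -
  have "(\<lambda>x. wpd j k x - wpd j' k' x) \<in> L2_slab \<and> LS (\<lambda>x. (wpd j k x - wpd j' k' x)\<^sup>2) \<le> 4 * b1\<^sup>2" for j k j' k'
    using L2_add_diff[OF PL2 PL2, of j k j' k'] P1[of j k] P1[of j' k'] by auto
  then show "(\<lambda>x. weak_curl w x $ i) \<in> L2_slab" "LS (\<lambda>x. (weak_curl w x $ i)\<^sup>2) \<le> 4 * b1\<^sup>2"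
    using exhaust_3[of i] by (auto simp: weak_curl_nth)
qed

text \<open>After integration by parts every component of \<open>w\<close> is paired with a
  commutator of second derivatives of \<psi>, which vanishes.\<close>

lemma curl_div_free:
  assumes \<psi>: "\<psi> \<in> test_fun slab" shows "LS (\<lambda>x. weak_curl w x \<bullet> grad \<psi> x) = 0"
proof -
  have t: "pd j \<psi> \<in> test_fun slab" "pd j \<psi> \<in> L2_slab" for j
    using test_fun_pd[OF \<psi>] L2_test[OF test_fun_mono[OF subset_UNIV test_fun_pd[OF \<psi>]]] by auto
  have comm: "pd i (pd j \<psi>) = pd j (pd i \<psi>)" for i j
    using pd_commute[OF open_UNIV test_fun_smooth[OF \<psi>]] by auto
  have i: "integrable (lebesgue_on slab) (\<lambda>x. wpd i j x * pd k \<psi> x)" for i j k by (rule L2_mult_integrable[OF PL2 t(2)])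
  have v: "LS (\<lambda>x. wpd i j x * pd k \<psi> x) = - LS (\<lambda>x. w x $ j * pd i (pd k \<psi>) x)" for i j k
    by (rule weak_partial_test[OF hw t(1)])
  have "LS (\<lambda>x. weak_curl w x \<bullet> grad \<psi> x) = LS (\<lambda>x. (wpd 2 3 x * pd 1 \<psi> x - wpd 3 2 x * pd 1 \<psi> x) + (wpd 3 1 x * pd 2 \<psi> x - wpd 1 3 x * pd 2 \<psi> x) + (wpd 1 2 x * pd 3 \<psi> x - wpd 2 1 x * pd 3 \<psi> x))"
    by (simp add: inner_3 weak_curl_nth grad_nth left_diff_distrib)
  also have "\<dots> = (LS (\<lambda>x. wpd 2 3 x * pd 1 \<psi> x) - LS (\<lambda>x. wpd 3 2 x * pd 1 \<psi> x)) + (LS (\<lambda>x. wpd 3 1 x * pd 2 \<psi> x) - LS (\<lambda>x. wpd 1 3 x * pd 2 \<psi> x)) + (LS (\<lambda>x. wpd 1 2 x * pd 3 \<psi> x) - LS (\<lambda>x. wpd 2 1 x * pd 3 \<psi> x))"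
    using i by simp
  also have "\<dots> = 0" unfolding v comm[of 2 1] comm[of 3 1] comm[of 3 2] by simp
  finally show ?thesis .
qed

text \<open>The second derivatives \<open>\<partial>\<^sub>1\<partial>\<^sub>2\<zeta>\<close> paired with \<open>w\<^sub>3\<close> cancel, so only the derivative of the vertical cut-off survives.\<close>

lemma curl_horizontal_pairing:
  assumes \<zeta>: "horiz_test \<zeta>" and \<delta>: "\<delta> > 0"
  shows "LS (\<lambda>x. weak_curl w x $ 1 * (vcut \<delta> x * pd 1 \<zeta> x) + weak_curl w x $ 2 * (vcut \<delta> x * pd 2 \<zeta> x)) =
    LS (\<lambda>x. w x $ 2 * (pd 3 (vcut \<delta>) x * pd 1 \<zeta> x)) - LS (\<lambda>x. w x $ 1 * (pd 3 (vcut \<delta>) x * pd 2 \<zeta> x))"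
proof -
  obtain R where sm: "smooth_on UNIV \<zeta>" and hor: "\<And>x y. x $ 1 = y $ 1 \<Longrightarrow> x $ 2 = y $ 2 \<Longrightarrow> \<zeta> x = \<zeta> y"
    and supp: "\<And>x. \<bar>x $ 1\<bar> > R \<or> \<bar>x $ 2\<bar> > R \<Longrightarrow> \<zeta> x = 0" using \<zeta> unfolding horiz_test_def by blast
  define K :: "(real^3) set" where "K = cbox (\<chi> i. if i = 3 then \<delta> else - R) (\<chi> i. if i = 3 then 1 - \<delta> else R)"
  have K: "compact K" "K \<subseteq> slab" using \<delta> by (auto simp: K_def mem_box_cart slab_def forall_3)
  have closedH: "closed {x::real^3. \<bar>x $ 1\<bar> \<le> R \<and> \<bar>x $ 2\<bar> \<le> R}"
    by (intro closed_Collect_conj closed_Collect_le continuous_intros)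
  have pd0: "pd i \<zeta> x = 0" if "\<bar>x $ 1\<bar> > R \<or> \<bar>x $ 2\<bar> > R" for i x
    by (rule pd_zero_outside[OF closedH]) (use that supp in auto)
  have pd3: "pd 3 (pd j \<zeta>) x = 0" for j x
  proof -
    have "pd 3 \<zeta> = (\<lambda>y. 0)" using horiz_test_pd_3[OF \<zeta>] by auto
    then have "pd j (pd 3 \<zeta>) x = 0" by simp
    then show ?thesis using pd_commute[OF open_UNIV sm, of x 3 j] by simp
  qed
  have t: "(\<lambda>x. vcut \<delta> x * pd j \<zeta> x) \<in> test_fun slab" for j
  proof (rule test_funI[OF _ K])
    show "smooth_on UNIV (\<lambda>x. vcut \<delta> x * pd j \<zeta> x)" by (intro smooth_on_intros open_UNIV smooth_on_vcut smooth_on_pd sm)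
    fix x assume "x \<notin> K"
    then have "x $ 3 \<notin> {\<delta>..1 - \<delta>} \<or> \<bar>x $ 1\<bar> > R \<or> \<bar>x $ 2\<bar> > R" by (auto simp: K_def mem_box_cart forall_3 abs_le_iff not_le)
    then show "vcut \<delta> x * pd j \<zeta> x = 0" using vcut_props(3)[OF \<delta>, of x] pd0[of x j] by auto
  qed
  have tL: "(\<lambda>x. vcut \<delta> x * pd j \<zeta> x) \<in> L2_slab" for j by (rule L2_test[OF test_fun_mono[OF subset_UNIV t]])
  have pdt: "pd i (\<lambda>x. vcut \<delta> x * pd j \<zeta> x) x = (if i = 3 then pd 3 (vcut \<delta>) x * pd j \<zeta> x else vcut \<delta> x * pd i (pd j \<zeta>) x)" for i j x
  proof -
    have "pd i (\<lambda>x. vcut \<delta> x * pd j \<zeta> x) x = vcut \<delta> x * pd i (pd j \<zeta>) x + pd i (vcut \<delta>) x * pd j \<zeta> x"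
      by (intro pd_mult smooth_on_differentiable[OF smooth_on_vcut] smooth_on_differentiable[OF smooth_on_pd[OF sm]]) auto
    moreover have "pd i (vcut \<delta>) x = 0" if "i \<noteq> 3" by (rule vcut_pd) (use \<delta> that in blast)
    ultimately show ?thesis using pd3 by auto
  qed
  have v: "LS (\<lambda>x. wpd i k x * (vcut \<delta> x * pd j \<zeta> x)) = - LS (\<lambda>x. w x $ k * (if i = 3 then pd 3 (vcut \<delta>) x * pd j \<zeta> x else vcut \<delta> x * pd i (pd j \<zeta>) x))" for i j k
    using weak_partial_test[OF hw[of i k] t[of j]] unfolding pdt .
  have i: "integrable (lebesgue_on slab) (\<lambda>x. wpd i k x * (vcut \<delta> x * pd j \<zeta> x))" for i j k by (rule L2_mult_integrable[OF PL2 tL])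
  have "pd 2 (pd 1 \<zeta>) = pd 1 (pd 2 \<zeta>)" using pd_commute[OF open_UNIV sm] by auto
  then have c: "LS (\<lambda>x. wpd 2 3 x * (vcut \<delta> x * pd 1 \<zeta> x)) = LS (\<lambda>x. wpd 1 3 x * (vcut \<delta> x * pd 2 \<zeta> x))" unfolding v by simp
  have "LS (\<lambda>x. weak_curl w x $ 1 * (vcut \<delta> x * pd 1 \<zeta> x) + weak_curl w x $ 2 * (vcut \<delta> x * pd 2 \<zeta> x)) =
    LS (\<lambda>x. (wpd 2 3 x * (vcut \<delta> x * pd 1 \<zeta> x) - wpd 3 2 x * (vcut \<delta> x * pd 1 \<zeta> x)) + (wpd 3 1 x * (vcut \<delta> x * pd 2 \<zeta> x) - wpd 1 3 x * (vcut \<delta> x * pd 2 \<zeta> x)))"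
    by (simp add: weak_curl_nth left_diff_distrib)
  also have "\<dots> = (LS (\<lambda>x. wpd 2 3 x * (vcut \<delta> x * pd 1 \<zeta> x)) - LS (\<lambda>x. wpd 3 2 x * (vcut \<delta> x * pd 1 \<zeta> x))) + (LS (\<lambda>x. wpd 3 1 x * (vcut \<delta> x * pd 2 \<zeta> x)) - LS (\<lambda>x. wpd 1 3 x * (vcut \<delta> x * pd 2 \<zeta> x)))"
    using i by simp
  also have "\<dots> = LS (\<lambda>x. wpd 3 1 x * (vcut \<delta> x * pd 2 \<zeta> x)) - LS (\<lambda>x. wpd 3 2 x * (vcut \<delta> x * pd 1 \<zeta> x))" using c by simp
  finally show ?thesis unfolding v by simp
qed

end

text \<open>On the layer of width \<open>\<delta>\<close> next to the boundary the curl is estimated directly; on the rest one integrates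
  by parts, which costs a factor \<open>1 / \<delta>\<close>. The choice \<open>\<delta> = b0 / b1\<close> balances the two contributions.\<close>

lemma curl_estimate:
  obtains C0 where "C0 \<ge> 0"
    "\<And>w b0 b1 \<zeta> \<kappa>. \<lbrakk>\<And>j. (\<lambda>x. w x $ j) \<in> L2_slab; \<And>j. LS (\<lambda>x. (w x $ j)\<^sup>2) \<le> b0\<^sup>2;
      \<And>i j. weak_partial i (\<lambda>x. w x $ j) \<in> L2_slab; \<And>i j. LS (\<lambda>x. (weak_partial i (\<lambda>x. w x $ j) x)\<^sup>2) \<le> b1\<^sup>2;
      \<And>i j. has_weak_pderiv (axis i 1) (\<lambda>x. w x $ j) (weak_partial i (\<lambda>x. w x $ j)); 0 \<le> b0; b0 \<le> b1;
      horiz_test \<zeta>; \<And>j. pd j \<zeta> \<in> L2_slab; \<kappa> > 0\<rbrakk> \<Longrightarrow>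
      LS (\<lambda>x. weak_curl w x $ 1 * pd 1 \<zeta> x + weak_curl w x $ 2 * pd 2 \<zeta> x) \<le>
        \<kappa> * (b0 * b1) + C0 / \<kappa> * slab_int (\<lambda>x. (pd 1 \<zeta> x)\<^sup>2 + (pd 2 \<zeta> x)\<^sup>2)"
proof -
  obtain B where B: "B > 0" "\<And>\<delta> i x. \<delta> > 0 \<Longrightarrow> i \<noteq> 3 \<Longrightarrow> pd i (vcut \<delta>) x = 0" "\<And>\<delta> x. \<delta> > 0 \<Longrightarrow> \<bar>pd 3 (vcut \<delta>) x\<bar> \<le> B / \<delta>"
    "\<And>\<delta> x. \<delta> > 0 \<Longrightarrow> x \<in> slab \<Longrightarrow> x $ 3 \<notin> layer \<delta> \<Longrightarrow> pd 3 (vcut \<delta>) x = 0" by (rule vcut_pd) blast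
  \<comment> \<open>The 4 is from the boundary layer of measure 4 \<delta>, the 4 B^2 from the
    derivative of the cut-off, of size B / \<delta> on the same layer.\<close>
  define C where "C = 4 + 4 * B\<^sup>2"
  have C: "C \<ge> 0" by (simp add: C_def)
  have main: "LS (\<lambda>x. weak_curl w x $ 1 * pd 1 \<zeta> x + weak_curl w x $ 2 * pd 2 \<zeta> x) \<le>
        \<kappa> * (b0 * b1) + (10 * C) / \<kappa> * slab_int (\<lambda>x. (pd 1 \<zeta> x)\<^sup>2 + (pd 2 \<zeta> x)\<^sup>2)"
    if wL2: "\<And>j. (\<lambda>x. w x $ j) \<in> L2_slab" and w0: "\<And>j. LS (\<lambda>x. (w x $ j)\<^sup>2) \<le> b0\<^sup>2"
      and PL2: "\<And>i j. weak_partial i (\<lambda>x. w x $ j) \<in> L2_slab"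
      and P1: "\<And>i j. LS (\<lambda>x. (weak_partial i (\<lambda>x. w x $ j) x)\<^sup>2) \<le> b1\<^sup>2"
      and hw: "\<And>i j. has_weak_pderiv (axis i 1) (\<lambda>x. w x $ j) (weak_partial i (\<lambda>x. w x $ j))"
      and b01: "0 \<le> b0" "b0 \<le> b1"
      and \<zeta>: "horiz_test \<zeta>" and \<zeta>L: "\<And>j. pd j \<zeta> \<in> L2_slab" and \<kappa>: "\<kappa> > 0"
    for w :: "real^3 \<Rightarrow> real^3" and b0 b1 \<kappa> :: real and \<zeta>
  proof -
    have sm: "smooth_on UNIV \<zeta>" and hor: "\<And>x y. x $ 1 = y $ 1 \<Longrightarrow> x $ 2 = y $ 2 \<Longrightarrow> \<zeta> x = \<zeta> y"
      using \<zeta> unfolding horiz_test_def by blast+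
    \<comment> \<open>The translation by y - x is vertical and leaves \<zeta> unchanged, hence also
      its derivatives.\<close>
    have pdhor: "pd j \<zeta> x = pd j \<zeta> y" if "x $ 1 = y $ 1" "x $ 2 = y $ 2" for j x y
    proof -
      define c where "c = y - x"
      have "pd j (\<lambda>z. \<zeta> (z + c)) x = pd j \<zeta> (x + c)"
        using smooth_on_affine(2)[OF open_UNIV sm, of "\<chi> i. 1" c x j] by (simp add: plus_vec_def)
      moreover have "(\<lambda>z. \<zeta> (z + c)) = \<zeta>" by (rule ext, rule hor) (use that in \<open>auto simp: c_def\<close>)
      ultimately show ?thesis by (simp add: c_def)
    qed
    note W = curl_L2[OF wL2 w0 PL2 P1 hw b01]
    define D where "D = slab_int (\<lambda>x. (pd 1 \<zeta> x)\<^sup>2 + (pd 2 \<zeta> x)\<^sup>2)"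
    have cpd: "continuous_on UNIV (pd j \<zeta>)" for j by (rule smooth_on_continuous[OF smooth_on_pd[OF sm]])
    have cpds: "continuous_on slab (pd j \<zeta>)" for j by (rule continuous_on_subset[OF cpd]) simp
    have fin: "slab_nn (\<lambda>x. (pd j \<zeta> x)\<^sup>2) < top" for j using \<zeta>L[of j] L2_continuous_iff[OF cpds] by simp
    have ip: "slab_integrable (\<lambda>x. (pd j \<zeta> x)\<^sup>2)" for j
      by (rule slab_integrable_nonneg(1)[OF _ zero_le_power2 fin]) (intro continuous_intros cpds)
    define d where "d j = slab_int (\<lambda>x. (pd j \<zeta> x)\<^sup>2)" for j
    have D: "D = d 1 + d 2" unfolding D_def d_def by (rule slab_int_add(2)[OF ip ip])
    have d0: "d j \<ge> 0" for j unfolding d_def by (intro slab_int_nonneg) simp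
    have nd: "slab_nn (\<lambda>x. (pd j \<zeta> x)\<^sup>2) = ennreal (d j)" for j unfolding d_def by (rule slab_nn_eq[OF ip]) simp
    have step: "LS (\<lambda>x. weak_curl w x $ 1 * pd 1 \<zeta> x + weak_curl w x $ 2 * pd 2 \<zeta> x) \<le> \<kappa>' * (8 * \<delta> * b1\<^sup>2 + 2 * b0\<^sup>2 / \<delta>) + C / \<kappa>' * D"
      if \<delta>: "\<delta> > 0" and \<kappa>': "\<kappa>' > 0" for \<delta> \<kappa>'
    proof -
      define u where "u j x = (1 - vcut \<delta> x) * pd j \<zeta> x" for j x
      define v where "v j x = pd 3 (vcut \<delta>) x * pd j \<zeta> x" for j x
      have cv: "continuous_on slab (vcut \<delta>)" "continuous_on slab (pd 3 (vcut \<delta>))"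
        by (rule continuous_on_subset[OF smooth_on_continuous[OF smooth_on_vcut] subset_UNIV], rule continuous_on_subset[OF smooth_on_continuous[OF smooth_on_pd[OF smooth_on_vcut]] subset_UNIV])
      have cu: "continuous_on slab (u j)" "continuous_on slab (v j)" for j
        unfolding u_def[abs_def] v_def[abs_def] by (intro continuous_intros cv cpds)+
      have q: "continuous_on UNIV (\<lambda>x. (pd j \<zeta> x)\<^sup>2)" "\<And>x y. x $ 1 = y $ 1 \<Longrightarrow> x $ 2 = y $ 2 \<Longrightarrow> (pd j \<zeta> x)\<^sup>2 = (pd j \<zeta> y)\<^sup>2" for j
        by (intro continuous_intros cpd) (rule arg_cong[where f="\<lambda>r. r\<^sup>2"], rule pdhor)
      have nu: "slab_nn (\<lambda>x. (u j x)\<^sup>2) \<le> ennreal (4 * \<delta> * 1) * slab_nn (\<lambda>x. (pd j \<zeta> x)\<^sup>2)" for j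
      proof (rule slab_nn_layer[OF q zero_le_power2 _ \<delta>])
        fix x assume x: "x \<in> slab"
        have "(1 - vcut \<delta> x)\<^sup>2 \<le> 1" using vcut_props(1,2)[OF \<delta>, of x] by (simp add: power_le_one)
        from mult_right_mono[OF this zero_le_power2[of "pd j \<zeta> x"]] show "(u j x)\<^sup>2 \<le> 1 * (pd j \<zeta> x)\<^sup>2" by (simp add: u_def power_mult_distrib)
        show "(u j x)\<^sup>2 = 0" if "x $ 3 \<notin> layer \<delta>" using vcut_props(4)[OF \<delta> x that] by (simp add: u_def)
      qed simp_all
      have nv: "slab_nn (\<lambda>x. (v j x)\<^sup>2) \<le> ennreal (4 * \<delta> * (B / \<delta>)\<^sup>2) * slab_nn (\<lambda>x. (pd j \<zeta> x)\<^sup>2)" for j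
      proof (rule slab_nn_layer[OF q zero_le_power2 _ \<delta>])
        fix x assume x: "x \<in> slab"
        have "(pd 3 (vcut \<delta>) x)\<^sup>2 \<le> (B / \<delta>)\<^sup>2" using power_mono[OF B(3)[OF \<delta>, of x] abs_ge_zero, of 2] by simp
        from mult_right_mono[OF this zero_le_power2[of "pd j \<zeta> x"]] show "(v j x)\<^sup>2 \<le> (B / \<delta>)\<^sup>2 * (pd j \<zeta> x)\<^sup>2" by (simp add: v_def power_mult_distrib)
        show "(v j x)\<^sup>2 = 0" if "x $ 3 \<notin> layer \<delta>" using B(4)[OF \<delta> x that] by (simp add: v_def)
      qed simp_all
      have L2q: "p \<in> L2_slab \<and> LS (\<lambda>x. (p x)\<^sup>2) \<le> c" if cp: "continuous_on slab p" and le: "slab_nn (\<lambda>x. (p x)\<^sup>2) \<le> ennreal c" and c: "c \<ge> 0" for p c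
      proof -
        have f: "slab_nn (\<lambda>x. (p x)\<^sup>2) < top" by (rule le_less_trans[OF le]) simp
        have cp2: "continuous_on slab (\<lambda>x. (p x)\<^sup>2)" by (intro continuous_intros cp)
        have "ennreal (slab_int (\<lambda>x. (p x)\<^sup>2)) \<le> ennreal c" using slab_integrable_nonneg(2)[OF cp2 zero_le_power2 f] le by simp
        then show ?thesis using c f L2_continuous_iff[OF cp] LS_continuous(2)[OF cp2] by (simp add: ennreal_le_iff)
      qed
      have uL: "u j \<in> L2_slab" "LS (\<lambda>x. (u j x)\<^sup>2) \<le> 4 * \<delta> * d j" for j
      proof -
        have "slab_nn (\<lambda>x. (u j x)\<^sup>2) \<le> ennreal (4 * \<delta> * d j)" using nu[of j] \<delta> unfolding nd by (subst ennreal_mult') simp_all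
        from L2q[OF cu(1) this] show "u j \<in> L2_slab" "LS (\<lambda>x. (u j x)\<^sup>2) \<le> 4 * \<delta> * d j" using \<delta> d0[of j] by simp_all
      qed
      have vL: "v j \<in> L2_slab" "LS (\<lambda>x. (v j x)\<^sup>2) \<le> 4 * B\<^sup>2 / \<delta> * d j" for j
      proof -
        have e: "4 * \<delta> * (B / \<delta>)\<^sup>2 = 4 * B\<^sup>2 / \<delta>" using \<delta> by (simp add: power2_eq_square)
        have "slab_nn (\<lambda>x. (v j x)\<^sup>2) \<le> ennreal (4 * B\<^sup>2 / \<delta> * d j)" using nv[of j] \<delta> unfolding nd e by (subst ennreal_mult') simp_all
        from L2q[OF cu(2) this] show "v j \<in> L2_slab" "LS (\<lambda>x. (v j x)\<^sup>2) \<le> 4 * B\<^sup>2 / \<delta> * d j" using \<delta> d0[of j] by simp_all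
      qed
      have vL': "(\<lambda>x. - v j x) \<in> L2_slab" for j using vL(1)[of j] by (auto simp: L2_slab_def)
      have eL: "(\<lambda>x. vcut \<delta> x * pd j \<zeta> x) \<in> L2_slab" for j
      proof -
        have "(\<lambda>x. pd j \<zeta> x - u j x) \<in> L2_slab" by (rule L2_add_diff(1)[OF \<zeta>L uL(1)])
        then show ?thesis by (simp add: u_def algebra_simps)
      qed
      let ?W = "\<lambda>i x. weak_curl w x $ i"
      have i1: "integrable (lebesgue_on slab) (\<lambda>x. ?W i x * (vcut \<delta> x * pd j \<zeta> x))" for i j by (rule L2_mult_integrable[OF W(1) eL])
      have i2: "integrable (lebesgue_on slab) (\<lambda>x. ?W i x * u j x)" for i j by (rule L2_mult_integrable[OF W(1) uL(1)])
      have "LS (\<lambda>x. ?W 1 x * pd 1 \<zeta> x + ?W 2 x * pd 2 \<zeta> x) =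
        LS (\<lambda>x. (?W 1 x * (vcut \<delta> x * pd 1 \<zeta> x) + ?W 2 x * (vcut \<delta> x * pd 2 \<zeta> x)) + (?W 1 x * u 1 x + ?W 2 x * u 2 x))"
        by (rule arg_cong[where f=LS]) (auto simp: u_def algebra_simps)
      also have "\<dots> = LS (\<lambda>x. ?W 1 x * (vcut \<delta> x * pd 1 \<zeta> x) + ?W 2 x * (vcut \<delta> x * pd 2 \<zeta> x)) + (LS (\<lambda>x. ?W 1 x * u 1 x) + LS (\<lambda>x. ?W 2 x * u 2 x))"
        using i1 i2 by simp
      also have "LS (\<lambda>x. ?W 1 x * (vcut \<delta> x * pd 1 \<zeta> x) + ?W 2 x * (vcut \<delta> x * pd 2 \<zeta> x)) = LS (\<lambda>x. w x $ 2 * v 1 x) + LS (\<lambda>x. w x $ 1 * (- v 2 x))"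
        unfolding curl_horizontal_pairing[OF wL2 w0 PL2 P1 hw b01 \<zeta> \<delta>] by (simp add: v_def)
      \<comment> \<open>Young's inequality with weight \<kappa>'/\<delta> here and \<kappa>'
        \<delta> for the layer terms: the powers of \<delta> then cancel in front of the energy of
        \<zeta> and remain only with the norms of \<open>w\<close>.\<close>
      also have "LS (\<lambda>x. w x $ 2 * v 1 x) \<le> (\<kappa>' / \<delta>) * b0\<^sup>2 + 1 / (\<kappa>' / \<delta>) * (4 * B\<^sup>2 / \<delta> * d 1)"
        by (rule order_trans[OF L2_Young[OF wL2 vL(1), of "\<kappa>' / \<delta>"]]) (use \<kappa>' \<delta> in \<open>auto intro!: add_mono mult_left_mono divide_right_mono w0 vL(2) simp del: divide_divide_eq_right times_divide_eq_left times_divide_eq_right\<close>)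
      also have "LS (\<lambda>x. w x $ 1 * (- v 2 x)) \<le> (\<kappa>' / \<delta>) * b0\<^sup>2 + 1 / (\<kappa>' / \<delta>) * (4 * B\<^sup>2 / \<delta> * d 2)"
        by (rule order_trans[OF L2_Young[OF wL2 vL', of "\<kappa>' / \<delta>"]]) (use \<kappa>' \<delta> vL(2)[of 2] in \<open>auto intro!: add_mono mult_left_mono divide_right_mono w0 simp del: divide_divide_eq_right times_divide_eq_left times_divide_eq_right\<close>)
      also have "LS (\<lambda>x. ?W 1 x * u 1 x) \<le> (\<kappa>' * \<delta>) * (4 * b1\<^sup>2) + 1 / (\<kappa>' * \<delta>) * (4 * \<delta> * d 1)"
        by (rule order_trans[OF L2_Young[OF W(1) uL(1), of "\<kappa>' * \<delta>"]]) (use \<kappa>' \<delta> in \<open>auto intro!: add_mono mult_left_mono divide_right_mono W(2) uL(2) simp del: divide_divide_eq_right times_divide_eq_left times_divide_eq_right\<close>)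
      also have "LS (\<lambda>x. ?W 2 x * u 2 x) \<le> (\<kappa>' * \<delta>) * (4 * b1\<^sup>2) + 1 / (\<kappa>' * \<delta>) * (4 * \<delta> * d 2)"
        by (rule order_trans[OF L2_Young[OF W(1) uL(1), of "\<kappa>' * \<delta>"]]) (use \<kappa>' \<delta> in \<open>auto intro!: add_mono mult_left_mono divide_right_mono W(2) uL(2) simp del: divide_divide_eq_right times_divide_eq_left times_divide_eq_right\<close>)
      finally have "LS (\<lambda>x. ?W 1 x * pd 1 \<zeta> x + ?W 2 x * pd 2 \<zeta> x) \<le>
        ((\<kappa>' / \<delta>) * b0\<^sup>2 + 1 / (\<kappa>' / \<delta>) * (4 * B\<^sup>2 / \<delta> * d 1) + ((\<kappa>' / \<delta>) * b0\<^sup>2 + 1 / (\<kappa>' / \<delta>) * (4 * B\<^sup>2 / \<delta> * d 2))) +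
        ((\<kappa>' * \<delta>) * (4 * b1\<^sup>2) + 1 / (\<kappa>' * \<delta>) * (4 * \<delta> * d 1) + ((\<kappa>' * \<delta>) * (4 * b1\<^sup>2) + 1 / (\<kappa>' * \<delta>) * (4 * \<delta> * d 2)))" by simp
      also have "\<dots> = \<kappa>' * (8 * \<delta> * b1\<^sup>2 + 2 * b0\<^sup>2 / \<delta>) + C / \<kappa>' * D"
        using \<delta> \<kappa>' unfolding D C_def by (simp add: field_simps)
      finally show ?thesis .
    qed
    \<comment> \<open>For \<delta> = b0/b1 the two norm terms become 8 b0 b1 and 2 b0 b1, hence the
      factor 10.\<close>
    define \<kappa>' where "\<kappa>' = \<kappa> / 10"
    have \<kappa>': "\<kappa>' > 0" using \<kappa> by (simp add: \<kappa>'_def)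
    have eqC: "C / \<kappa>' * D = (10 * C) / \<kappa> * D" by (simp add: \<kappa>'_def)
    show ?thesis unfolding D_def[symmetric] eqC[symmetric]
    proof (cases "b0 = 0")
      case False
      then have b: "b0 > 0" "b1 > 0" using b01 by auto
      have "\<kappa>' * (8 * (b0 / b1) * b1\<^sup>2 + 2 * b0\<^sup>2 / (b0 / b1)) = \<kappa> * (b0 * b1)"
        using b by (simp add: \<kappa>'_def power2_eq_square field_simps)
      then show "LS (\<lambda>x. weak_curl w x $ 1 * pd 1 \<zeta> x + weak_curl w x $ 2 * pd 2 \<zeta> x) \<le> \<kappa> * (b0 * b1) + C / \<kappa>' * D"
        using step[of "b0 / b1" \<kappa>'] b \<kappa>' by simp
    next
      case True
      \<comment> \<open>For b0 = 0 the quotient b0/b1 is not admissible as a width. Then only the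
        layer term is left, and it is made smaller than any e > 0 by shrinking \<delta>.\<close>
      have "LS (\<lambda>x. weak_curl w x $ 1 * pd 1 \<zeta> x + weak_curl w x $ 2 * pd 2 \<zeta> x) \<le> C / \<kappa>' * D + e" if e: "e > 0" for e
      proof -
        define \<delta> where "\<delta> = e / (\<kappa>' * (8 * b1\<^sup>2 + 1))"
        have p: "\<kappa>' * (8 * b1\<^sup>2 + 1) > 0" using \<kappa>' by (intro mult_pos_pos) (auto intro: add_nonneg_pos)
        have \<delta>: "\<delta> > 0" unfolding \<delta>_def using e p by simp
        have le: "\<kappa>' * (8 * \<delta> * b1\<^sup>2) \<le> \<delta> * (\<kappa>' * (8 * b1\<^sup>2 + 1))" using \<delta> \<kappa>' by (simp add: algebra_simps)
        have "e / r * r = e" if "r > 0" for r :: real using that by simp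
        then have "\<delta> * (\<kappa>' * (8 * b1\<^sup>2 + 1)) = e" unfolding \<delta>_def using p by blast
        with le show ?thesis using step[OF \<delta> \<kappa>'] True by simp
      qed
      then have "LS (\<lambda>x. weak_curl w x $ 1 * pd 1 \<zeta> x + weak_curl w x $ 2 * pd 2 \<zeta> x) \<le> C / \<kappa>' * D" by (rule field_le_epsilon)
      then show "LS (\<lambda>x. weak_curl w x $ 1 * pd 1 \<zeta> x + weak_curl w x $ 2 * pd 2 \<zeta> x) \<le> \<kappa> * (b0 * b1) + C / \<kappa>' * D" using True by simp
    qed
  qed
  show ?thesis by (rule that[of "10 * C"]) (use C in simp, rule main)
qed

section \<open>The potential of the gradient part\<close>

lemma LINT_slab_test_real:
  fixes f :: "real^3 \<Rightarrow> real"
  assumes "\<psi> \<in> test_fun slab"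
  shows "LS (\<lambda>x. f x * \<psi> x) = (LINT x|lebesgue. \<psi> x * f x)"
  using LINT_slab_test[OF assms, of f] by (simp add: mult.commute)

text \<open>Orthogonality to gradients of test functions says that \<phi> is weakly harmonic, so
  Weyl's lemma applies. Moving the Laplacian back onto the smooth representative shows it to be
  harmonic almost everywhere, and by continuity everywhere; uniqueness of weak derivatives
  identifies its gradient.\<close>

lemma harmonic_representative:
  fixes \<phi> :: "real^3 \<Rightarrow> real" and g :: "3 \<Rightarrow> real^3 \<Rightarrow> real"
  assumes weak: "\<And>i. has_weak_pderiv (axis i 1) \<phi> (g i)" and gL: "\<And>i. g i \<in> L2_slab"
    and orth: "\<And>\<psi>. \<psi> \<in> test_fun slab \<Longrightarrow> LS (\<lambda>x. \<Sum>i\<in>UNIV. g i x * pd i \<psi> x) = 0"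
  obtains f where "smooth_on slab f" "AE_slab (\<lambda>x. \<phi> x = f x)" "\<And>x. x \<in> slab \<Longrightarrow> lap f x = 0"
    "\<And>i. AE_slab (\<lambda>x. g i x = pd i f x)"
proof -
  have li: "loc_integrable \<phi>" using weak[of 1] by (simp add: has_weak_pderiv_def)
  have split: "(LINT x|lebesgue. lap \<psi> x * F x) = (\<Sum>i\<in>UNIV. LINT x|lebesgue. pd i (pd i \<psi>) x * F x)"
    if F: "loc_integrable F" and \<psi>: "\<psi> \<in> test_fun slab" for F \<psi>
    unfolding lap_def sum_distrib_right
    by (rule Bochner_Integration.integral_sum)
      (use integrable_mult_test[OF F test_fun_pd[OF test_fun_pd[OF \<psi>]]] in simp)
  have harm: "(LINT x|lebesgue. lap \<psi> x * \<phi> x) = 0" if \<psi>: "\<psi> \<in> test_fun slab" for \<psi>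
  proof -
    have one: "(LINT x|lebesgue. pd i (pd i \<psi>) x * \<phi> x) = - LS (\<lambda>x. g i x * pd i \<psi> x)" for i
      using has_weak_pderiv_test[OF weak[of i] test_fun_pd[OF \<psi>, of i]] LINT_slab_test_real[OF test_fun_pd[OF \<psi>, of i], of "g i"]
      by (simp del: One_nat_def)
    have "integrable (lebesgue_on slab) (\<lambda>x. g i x * pd i \<psi> x)" for i
      by (rule L2_mult_integrable[OF gL L2_test[OF test_fun_mono[OF subset_UNIV test_fun_pd[OF \<psi>]]]])
    then have "LS (\<lambda>x. \<Sum>i\<in>UNIV. g i x * pd i \<psi> x) = (\<Sum>i\<in>UNIV. LS (\<lambda>x. g i x * pd i \<psi> x))"
      by (rule Bochner_Integration.integral_sum)
    then show ?thesis unfolding split[OF li \<psi>] one using orth[OF \<psi>] by (simp add: sum_negf)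
  qed
  obtain f where f: "smooth_on slab f" "AE_slab (\<lambda>x. f x = \<phi> x)" by (rule Weyl[OF li harm])
  have ae: "AE_slab (\<lambda>x. \<phi> x = f x)" using f(2) by eventually_elim simp
  have lif: "loc_integrable f" by (rule loc_integrable_continuous[OF smooth_on_continuous[OF f(1)]])
  have cl: "continuous_on slab (lap f)" by (rule smooth_on_continuous[OF smooth_on_lap[OF open_slab f(1)]])
  have "LS (\<lambda>x. \<psi> x * lap f x) = 0" if \<psi>: "\<psi> \<in> test_fun slab" for \<psi>
  proof -
    have lp: "lap \<psi> \<in> test_fun slab"
    proof -
      obtain M where M: "smooth_on UNIV \<psi>" "compact M" "M \<subseteq> slab" "\<And>x. x \<notin> M \<Longrightarrow> \<psi> x = 0" using \<psi> by (rule test_funE) blast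
      have z: "pd i \<psi> x = 0" if "x \<notin> M" for i x
        by (rule pd_zero_outside[OF compact_imp_closed[OF M(2)]]) (use that M in auto)
      have "pd i (pd i \<psi>) x = 0" if "x \<notin> M" for i x
        by (rule pd_zero_outside[OF compact_imp_closed[OF M(2)]]) (use that z in auto)
      then show ?thesis by (intro test_funI[OF smooth_on_lap[OF open_UNIV M(1)] M(2,3)]) (simp add: lap_def)
    qed
    have li2: "loc_integrable (pd i (pd i f))" for i
      by (rule loc_integrable_continuous[OF smooth_on_continuous[OF smooth_on_pd[OF smooth_on_pd[OF f(1)]]]])
    have "LS (\<lambda>x. \<psi> x * lap f x) = (LINT x|lebesgue. (\<Sum>i\<in>UNIV. \<psi> x * pd i (pd i f) x))"
      using LINT_slab_test[OF \<psi>, of "lap f"] by (simp add: lap_def sum_distrib_left)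
    also have "\<dots> = (\<Sum>i\<in>UNIV. LINT x|lebesgue. \<psi> x * pd i (pd i f) x)"
      by (rule Bochner_Integration.integral_sum) (use integrable_mult_test[OF li2 \<psi>] in simp)
    also have "\<dots> = (\<Sum>i\<in>UNIV. LINT x|lebesgue. pd i (pd i \<psi>) x * f x)"
      using weak_by_parts_pds[OF f(1) \<psi>, of "[i, i]" for i] by simp
    also have "\<dots> = (LINT x|lebesgue. lap \<psi> x * f x)" by (rule split[OF lif \<psi>, symmetric])
    also have "\<dots> = (LINT x|lebesgue. lap \<psi> x * \<phi> x)"
    proof (rule integral_cong_AE)
      show "(\<lambda>x. lap \<psi> x * f x) \<in> borel_measurable lebesgue" "(\<lambda>x. lap \<psi> x * \<phi> x) \<in> borel_measurable lebesgue"
        using borel_measurable_integrable[OF integrable_mult_test[OF lif lp]] borel_measurable_integrable[OF integrable_mult_test[OF li lp]] by auto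
      have "lap \<psi> x = 0" if "x \<notin> slab" for x by (rule test_funE[OF lp]) (use that in blast)
      then show "AE x in lebesgue. lap \<psi> x * f x = lap \<psi> x * \<phi> x" using f(2) by (elim eventually_mono) (metis mult_zero_left)
    qed
    finally show ?thesis using harm[OF \<psi>] by simp
  qed
  from fundamental_lemma[OF loc_integrable_continuous[OF cl] this] have ael: "AE_slab (\<lambda>x. lap f x = 0)" .
  \<comment> \<open>The set where the continuous Laplacian is nonzero is open and null, hence
    empty.\<close>
  have "open {x \<in> slab. lap f x \<in> - {0}}" using continuous_open_preimage[OF cl open_slab open_Compl[OF closed_singleton[of 0]]] by (simp add: vimage_def Int_def)
  moreover have "AE x \<in> {x \<in> slab. lap f x \<in> - {0}} in lebesgue. x \<in> {}" using ael by eventually_elim simp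
  ultimately have lap0: "lap f x = 0" if "x \<in> slab" for x
    using mem_closed_if_AE_lebesgue_open[OF _ closed_empty, of "{x \<in> slab. lap f x \<in> - {0}}" x] that by auto
  have "AE_slab (\<lambda>x. g i x = pd i f x)" for i
    using weak_pderiv_unique[OF weak[of i] weak_pderiv_smooth(1)[OF f(1) li ae, of "axis i 1"]] by (simp del: One_nat_def)
  then show ?thesis using that[OF f(1) ae lap0] by blast
qed

text \<open>A field with vanishing normal trace is also orthogonal to gradients of functions of the horizontal
  variables, as these agree on the slab with compactly supported ones.\<close>

lemma horiz_test_localise:
  assumes \<zeta>: "horiz_test \<zeta>"
  obtains \<psi> where "\<psi> \<in> test_fun UNIV" "\<And>i x. x \<in> slab \<Longrightarrow> pd i \<psi> x = pd i \<zeta> x"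
proof -
  obtain R where sm: "smooth_on UNIV \<zeta>" and supp: "\<And>x. \<bar>x $ 1\<bar> > R \<or> \<bar>x $ 2\<bar> > R \<Longrightarrow> \<zeta> x = 0" using \<zeta> unfolding horiz_test_def by blast
  define \<psi> where "\<psi> x = \<zeta> x * plateau (x $ 3)" for x
  define M :: "(real^3) set" where "M = cbox (\<chi> i. if i = 3 then - 2 else - R) (\<chi> i. if i = 3 then 2 else R)"
  have "\<psi> \<in> test_fun UNIV"
  proof (rule test_funI)
    show "smooth_on UNIV \<psi>" unfolding \<psi>_def[abs_def] plateau_def
      by (intro smooth_on_intros smooth_on_step_fun open_UNIV sm)
    show "compact M" by (simp add: M_def compact_cbox)
    fix x assume "x \<notin> M"
    then have "2 \<le> \<bar>x $ 3\<bar> \<or> \<bar>x $ 1\<bar> > R \<or> \<bar>x $ 2\<bar> > R" by (auto simp: M_def mem_box_cart forall_3 abs_le_iff not_le)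
    then show "\<psi> x = 0" using supp[of x] plateau_bounds(4) by (auto simp: \<psi>_def)
  qed simp
  moreover have "pd i \<psi> x = pd i \<zeta> x" if "x \<in> slab" for i x
    by (rule pd_cong_open[OF open_slab that]) (auto simp: \<psi>_def slab_def plateau_bounds(3))
  ultimately show ?thesis by (rule that)
qed

text \<open>The bilinear bound required by \<open>midplane_trace_estimate\<close> is supplied by
  \<open>curl_estimate\<close>, with \<open>M2\<close> the product of the two norms of
  \<open>w\<close>. The constant C0 of the latter has to be fixed first, as K is built from
  it.\<close>

lemma gradient_part_estimate:
  fixes n :: nat
  assumes n: "n \<ge> 1"
  obtains K where "K \<ge> 0"
    "\<And>w PW \<phi> h. \<lbrakk>w \<in> Sobolev_space (2 * n); Helmholtz_decomposition (weak_curl w) PW \<phi>; h \<in> {1,2}\<rbrakk> \<Longrightarrow>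
      \<exists>f. smooth_on slab f \<and> (\<forall>x\<in>slab. lap f x = 0) \<and> loc_integrable \<phi> \<and> AE_slab (\<lambda>x. \<phi> x = f x) \<and>
        slab_nn (\<lambda>x. (pd h f x)\<^sup>2) \<le> ennreal K * (slab_nn (\<lambda>x. (pd 3 f x)\<^sup>2) + Sobolev_norm 0 w * Sobolev_norm 1 w)"
proof -
  obtain C0 where C0: "C0 \<ge> 0"
    "\<And>w b0 b1 \<zeta> \<kappa>. \<lbrakk>\<And>j. (\<lambda>x. w x $ j) \<in> L2_slab; \<And>j. LS (\<lambda>x. (w x $ j)\<^sup>2) \<le> b0\<^sup>2;
      \<And>i j. weak_partial i (\<lambda>x. w x $ j) \<in> L2_slab; \<And>i j. LS (\<lambda>x. (weak_partial i (\<lambda>x. w x $ j) x)\<^sup>2) \<le> b1\<^sup>2;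
      \<And>i j. has_weak_pderiv (axis i 1) (\<lambda>x. w x $ j) (weak_partial i (\<lambda>x. w x $ j)); 0 \<le> b0; b0 \<le> b1;
      horiz_test \<zeta>; \<And>j. pd j \<zeta> \<in> L2_slab; \<kappa> > 0\<rbrakk> \<Longrightarrow>
      LS (\<lambda>x. weak_curl w x $ 1 * pd 1 \<zeta> x + weak_curl w x $ 2 * pd 2 \<zeta> x) \<le>
        \<kappa> * (b0 * b1) + C0 / \<kappa> * slab_int (\<lambda>x. (pd 1 \<zeta> x)\<^sup>2 + (pd 2 \<zeta> x)\<^sup>2)"
    by (rule curl_estimate) blast
  obtain K where K: "K \<ge> 0"
    "\<And>f M2 h. \<lbrakk>smooth_on slab f; \<And>x. x \<in> slab \<Longrightarrow> lap f x = 0; \<And>i. slab_nn (\<lambda>x. (pd i f x)\<^sup>2) < top; M2 \<ge> 0;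
       \<And>\<zeta> \<kappa>. horiz_test \<zeta> \<Longrightarrow> \<kappa> > 0 \<Longrightarrow> slab_int (\<lambda>x. pd 1 f x * pd 1 \<zeta> x + pd 2 f x * pd 2 \<zeta> x) \<le>
          \<kappa> * M2 + C0 / \<kappa> * slab_int (\<lambda>x. (pd 1 \<zeta> x)\<^sup>2 + (pd 2 \<zeta> x)\<^sup>2); h \<in> {1,2}\<rbrakk>
     \<Longrightarrow> slab_nn (\<lambda>x. (pd h f x)\<^sup>2) \<le> ennreal K * (slab_nn (\<lambda>x. (pd 3 f x)\<^sup>2) + ennreal M2)"
    by (rule midplane_trace_estimate[OF C0(1)]) blast
  show ?thesis
  proof (rule that[OF K(1)])
    fix w :: "real^3 \<Rightarrow> real^3" and PW \<phi> and h :: 3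
    assume w: "w \<in> Sobolev_space (2 * n)" and H: "Helmholtz_decomposition (weak_curl w) PW \<phi>" and h: "h \<in> {1, 2}"
    have n2: "2 * n \<ge> 1" using n by simp
    obtain b0 b1 where b: "0 \<le> b0" "b0 \<le> b1" "Sobolev_norm 0 w = ennreal b0" "Sobolev_norm 1 w = ennreal b1"
      "\<And>j. (\<lambda>x. w x $ j) \<in> L2_slab" "\<And>j. LS (\<lambda>x. (w x $ j)\<^sup>2) \<le> b0\<^sup>2"
      "\<And>i j. weak_partial i (\<lambda>x. w x $ j) \<in> L2_slab" "\<And>i j. LS (\<lambda>x. (weak_partial i (\<lambda>x. w x $ j) x)\<^sup>2) \<le> b1\<^sup>2"
      "\<And>i j. has_weak_pderiv (axis i 1) (\<lambda>x. w x $ j) (weak_partial i (\<lambda>x. w x $ j))"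
      by (rule curl_data[OF w n2]) blast
    let ?W = "weak_curl w"
    note W = curl_L2[OF b(5-9) b(1,2)] and Wdiv = curl_div_free[OF b(5-9) b(1,2)]
    define g where "g i x = (?W x - PW x) $ i" for i x
    have weak: "has_weak_pderiv (axis i 1) \<phi> (g i)" for i
      using H unfolding Helmholtz_decomposition_def g_def by blast
    have PW: "PW \<in> L2_slab" "weakly_div_free PW" "zero_normal_trace PW"
      using H unfolding Helmholtz_decomposition_def is_Helmholtz_projection_def solenoidal_def by auto
    note PL = L2_component(1)[OF PW(1)]
    have gL: "g i \<in> L2_slab" for i
      using L2_add_diff(1)[OF W(1) PL, of i i] by (simp add: g_def[abs_def])
    have gs: "LS (\<lambda>x. \<Sum>i\<in>UNIV. g i x * pd i \<psi> x) = LS (\<lambda>x. ?W x \<bullet> grad \<psi> x) - LS (\<lambda>x. PW x \<bullet> grad \<psi> x)"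
      if \<psi>: "\<psi> \<in> test_fun UNIV" for \<psi>
    proof -
      note t = L2_test[OF test_fun_pd[OF \<psi>]]
      have "integrable (lebesgue_on slab) (\<lambda>x. ?W x \<bullet> grad \<psi> x)" "integrable (lebesgue_on slab) (\<lambda>x. PW x \<bullet> grad \<psi> x)"
        unfolding inner_3 grad_nth by (intro Bochner_Integration.integrable_add L2_mult_integrable W(1) PL t)+
      from Bochner_Integration.integral_diff[OF this] show ?thesis
        by (simp add: inner_3 grad_nth g_def sum_3 algebra_simps)
    qed
    \<comment> \<open>Both parts of the difference are weakly divergence free: the curl by commuting
      derivatives, the projection by definition of \<open>solenoidal\<close>.\<close>
    have "LS (\<lambda>x. \<Sum>i\<in>UNIV. g i x * pd i \<psi> x) = 0" if \<psi>: "\<psi> \<in> test_fun slab" for \<psi>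
      using gs[OF test_fun_mono[OF subset_UNIV \<psi>]] Wdiv[OF \<psi>] PW(2) \<psi> unfolding weakly_div_free_def by simp
    from harmonic_representative[OF weak gL this] obtain f where f: "smooth_on slab f" "AE_slab (\<lambda>x. \<phi> x = f x)"
      "\<And>x. x \<in> slab \<Longrightarrow> lap f x = 0" "\<And>i. AE_slab (\<lambda>x. g i x = pd i f x)" by blast
    have cf: "continuous_on slab (pd i f)" for i by (rule smooth_on_continuous[OF smooth_on_pd[OF f(1)]])
    have fin: "slab_nn (\<lambda>x. (pd i f x)\<^sup>2) < top" for i using L2_slab_AE_iff(1)[OF cf f(4)] gL by blast
    have test: "slab_int (\<lambda>x. pd 1 f x * pd 1 \<zeta> x + pd 2 f x * pd 2 \<zeta> x) \<le>
        \<kappa> * (b0 * b1) + C0 / \<kappa> * slab_int (\<lambda>x. (pd 1 \<zeta> x)\<^sup>2 + (pd 2 \<zeta> x)\<^sup>2)" if \<zeta>: "horiz_test \<zeta>" and \<kappa>: "\<kappa> > 0" for \<zeta> \<kappa>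
    proof -
      obtain \<psi> where \<psi>: "\<psi> \<in> test_fun UNIV" "\<And>i x. x \<in> slab \<Longrightarrow> pd i \<psi> x = pd i \<zeta> x"
        using \<zeta> by (rule horiz_test_localise) blast
      have c\<zeta>: "continuous_on slab (pd i \<zeta>)" for i
        using \<zeta> by (auto simp: horiz_test_def intro!: smooth_on_continuous[OF smooth_on_pd] smooth_on_subset[of UNIV \<zeta> slab])
      have \<psi>L: "pd i \<zeta> \<in> L2_slab" for i
        by (rule L2_AE(1)[OF L2_test[OF test_fun_pd[OF \<psi>(1)]]]) (auto simp: \<psi>(2))
      have sp: "space (lebesgue_on slab) = slab" by simp
      have "slab_int (\<lambda>x. pd 1 f x * pd 1 \<zeta> x + pd 2 f x * pd 2 \<zeta> x) = LS (\<lambda>x. pd 1 f x * pd 1 \<zeta> x + pd 2 f x * pd 2 \<zeta> x)"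
        by (rule LS_continuous(2)[symmetric]) (intro continuous_intros cf c\<zeta>)
      also have "\<dots> = LS (\<lambda>x. \<Sum>i\<in>UNIV. g i x * pd i \<psi> x)"
      proof (rule integral_cong_AE)
        show "(\<lambda>x. pd 1 f x * pd 1 \<zeta> x + pd 2 f x * pd 2 \<zeta> x) \<in> borel_measurable (lebesgue_on slab)"
          by (intro continuous_measurable_slab continuous_intros cf c\<zeta>)
        show "(\<lambda>x. \<Sum>i\<in>UNIV. g i x * pd i \<psi> x) \<in> borel_measurable (lebesgue_on slab)"
          by (intro borel_measurable_sum borel_measurable_integrable L2_mult_integrable gL L2_test[OF test_fun_pd[OF \<psi>(1)]])
        have "AE_slab (\<lambda>x. pd 1 f x * pd 1 \<zeta> x + pd 2 f x * pd 2 \<zeta> x = (\<Sum>i\<in>UNIV. g i x * pd i \<psi> x))"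
          using f(4)[of 1] f(4)[of 2] by eventually_elim (auto simp: sum_3 \<psi>(2) horiz_test_pd_3[OF \<zeta>])
        then show "AE x in lebesgue_on slab. pd 1 f x * pd 1 \<zeta> x + pd 2 f x * pd 2 \<zeta> x = (\<Sum>i\<in>UNIV. g i x * pd i \<psi> x)"
          unfolding AE_slab_iff .
      qed
      \<comment> \<open>Here \<psi> need not vanish on the boundary; the projection drops out
        because its normal trace is zero, which removes it from the pairing.\<close>
      also have "\<dots> = LS (\<lambda>x. ?W x \<bullet> grad \<psi> x)"
        using gs[OF \<psi>(1)] PW(3) \<psi>(1) unfolding zero_normal_trace_def by simp
      also have "\<dots> = LS (\<lambda>x. ?W x $ 1 * pd 1 \<zeta> x + ?W x $ 2 * pd 2 \<zeta> x)"
        by (rule Bochner_Integration.integral_cong) (simp_all add: sp inner_3 grad_nth \<psi>(2) horiz_test_pd_3[OF \<zeta>])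
      also have "\<dots> \<le> \<kappa> * (b0 * b1) + C0 / \<kappa> * slab_int (\<lambda>x. (pd 1 \<zeta> x)\<^sup>2 + (pd 2 \<zeta> x)\<^sup>2)"
        by (rule C0(2)[OF b(5-9) b(1,2) \<zeta> \<psi>L \<kappa>])
      finally show ?thesis .
    qed
    have "slab_nn (\<lambda>x. (pd h f x)\<^sup>2) \<le> ennreal K * (slab_nn (\<lambda>x. (pd 3 f x)\<^sup>2) + ennreal (b0 * b1))"
      by (rule K(2)[OF f(1,3) fin _ test h]) (use b(1,2) in auto)
    moreover have "ennreal (b0 * b1) = Sobolev_norm 0 w * Sobolev_norm 1 w"
      unfolding b(3,4) using b(1) by (rule ennreal_mult')
    moreover have "loc_integrable \<phi>" using weak[of 1] by (simp add: has_weak_pderiv_def)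
    ultimately show "\<exists>f. smooth_on slab f \<and> (\<forall>x\<in>slab. lap f x = 0) \<and> loc_integrable \<phi> \<and> AE_slab (\<lambda>x. \<phi> x = f x) \<and>
        slab_nn (\<lambda>x. (pd h f x)\<^sup>2) \<le> ennreal K * (slab_nn (\<lambda>x. (pd 3 f x)\<^sup>2) + Sobolev_norm 0 w * Sobolev_norm 1 w)"
      using f(1-3) by (intro exI[of _ f]) simp
  qed
qed

theorem lemma3p2:
  fixes n :: nat
  assumes "n \<ge> 3"
  shows "\<exists>C::real. C > 0 \<and>
    (\<forall>(w :: real^3 \<Rightarrow> real^3) (W :: real^3 \<Rightarrow> real^3) (PW :: real^3 \<Rightarrow> real^3)
      (\<phi> :: real^3 \<Rightarrow> real) (h :: 3) (\<sigma> :: real).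
      w \<in> Sobolev_space (2 * n) \<longrightarrow> W = weak_curl w \<longrightarrow> Helmholtz_decomposition W PW \<phi> \<longrightarrow>
      h \<in> {1, 2} \<longrightarrow> \<sigma> > 0 \<longrightarrow>
        aniso_norm_sq 0 (2 * n - 1) (weak_partial h \<phi>)
          \<le> ennreal C * (aniso_norm_sq 0 (2 * n - 1) (weak_partial 3 \<phi>)
                + ennreal \<sigma> * aniso_norm_sq 0 (2 * n - 1) W
                + Sobolev_norm 0 w * Sobolev_norm 1 w) \<and>
        (\<forall>k l. k \<le> 2 * n - 1 \<longrightarrow> l \<le> 2 * n - k - 1 \<longrightarrow>
          aniso_norm_sq k l (weak_partial h \<phi>)
            \<le> ennreal C * (aniso_norm_sq k l (weak_partial 3 \<phi>)
                + ennreal \<sigma> * aniso_norm_sq 0 (k + l) W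
                + Sobolev_norm 0 w * Sobolev_norm 1 w)))"
proof -
  have n1: "n \<ge> 1" using assms by simp
  obtain K where K: "K \<ge> 0"
    "\<And>w PW \<phi> h. \<lbrakk>w \<in> Sobolev_space (2 * n); Helmholtz_decomposition (weak_curl w) PW \<phi>; h \<in> {1,2}\<rbrakk> \<Longrightarrow>
      \<exists>f. smooth_on slab f \<and> (\<forall>x\<in>slab. lap f x = 0) \<and> loc_integrable \<phi> \<and> AE_slab (\<lambda>x. \<phi> x = f x) \<and>
        slab_nn (\<lambda>x. (pd h f x)\<^sup>2) \<le> ennreal K * (slab_nn (\<lambda>x. (pd 3 f x)\<^sup>2) + Sobolev_norm 0 w * Sobolev_norm 1 w)"
    using n1 by (rule gradient_part_estimate) blast
  \<comment> \<open>m bounds the number of horizontal indices as well as the number of full indices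
    for all admissible k and l, so that one constant serves all pairs. With 240^(2n) every number of
    derivatives up to 2n is covered.\<close>
  define m where "m = card {\<alpha>. mi_order \<alpha> \<le> 2 * n}"
  define C where "C = real m * (real m * (240 ^ (2 * n) * (K + 1)))"
  have "{\<alpha>. mi_order \<alpha> \<le> 2 * n} \<noteq> {}" using mi_order_0 by (auto intro!: exI[of _ 0])
  then have m: "m > 0" unfolding m_def using finite_mi_order by (simp add: card_gt_0_iff)
  have Cpos: "C > 0" unfolding C_def using m K(1) by (intro mult_pos_pos) auto
  \<comment> \<open>Both claims are instances of this bound for k + l \<le> 2n, the first one with k
    = 0 and l = 2n - 1.\<close>
  have main: "aniso_norm_sq k l (weak_partial h \<phi>) \<le> ennreal C * (aniso_norm_sq k l (weak_partial 3 \<phi>)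
                + ennreal \<sigma> * aniso_norm_sq 0 (k + l) W + Sobolev_norm 0 w * Sobolev_norm 1 w)"
    if w: "w \<in> Sobolev_space (2 * n)" and W: "W = weak_curl w" and H: "Helmholtz_decomposition W PW \<phi>"
      and h: "h \<in> {1, 2}" and kl: "k + l \<le> 2 * n" for w W PW \<phi> h \<sigma> k l
  proof -
    let ?H = "horizontal_indices l" and ?B = "{\<beta>. mi_order \<beta> \<le> k}"
    let ?S = "Sobolev_norm 0 w * Sobolev_norm 1 w"
    obtain f where f: "smooth_on slab f" "\<And>x. x \<in> slab \<Longrightarrow> lap f x = 0" "loc_integrable \<phi>" "AE_slab (\<lambda>x. \<phi> x = f x)"
      "slab_nn (\<lambda>x. (pd h f x)\<^sup>2) \<le> ennreal K * (slab_nn (\<lambda>x. (pd 3 f x)\<^sup>2) + ?S)"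
      using K(2)[OF w H[unfolded W] h] by blast
    have part: "loc_integrable (weak_partial i \<phi>)" "AE_slab (\<lambda>x. weak_partial i \<phi> x = pd i f x)" for i
      using weak_pderiv_smooth(3,4)[OF f(1,3,4), of "axis i 1"] by (simp_all del: One_nat_def)
    note an = aniso_norm_sq_smooth[OF smooth_on_pd[OF f(1)] part]
    let ?q = "\<lambda>i \<alpha> \<beta>. slab_nn (\<lambda>x. (pds (word \<beta> @ word \<alpha>) (pd i f) x)\<^sup>2)"
    define A where "A = aniso_norm_sq k l (weak_partial 3 \<phi>)"
    \<comment> \<open>With K + 1 in place of K, \<open>T\<close> dominates both the vertical
      derivatives, bounded by \<open>A\<close>, and the undifferentiated horizontal one, as the
      induction over derivatives requires a common bound.\<close>
    define T where "T = ennreal (K + 1) * (A + ?S)"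
    have le_A: "?q 3 \<alpha> \<beta> \<le> A" if "\<alpha> \<in> ?H" "\<beta> \<in> ?B" for \<alpha> \<beta>
    proof -
      have "?q 3 \<alpha> \<beta> \<le> (\<Sum>\<beta>\<in>?B. ?q 3 \<alpha> \<beta>)" using that finite_mi_order by (intro member_le_sum) auto
      also have "\<dots> \<le> (\<Sum>\<alpha>\<in>?H. \<Sum>\<beta>\<in>?B. ?q 3 \<alpha> \<beta>)" using that finite_horizontal_indices by (intro member_le_sum) auto
      finally show ?thesis unfolding A_def an .
    qed
    have A_T: "A + ?S \<le> T" "A \<le> T" 
    proof -
      have "1 * (A + ?S) \<le> T" unfolding T_def using K(1) by (intro mult_right_mono) auto
      then show "A + ?S \<le> T" by simp
      moreover have "A \<le> A + ?S" by simp
      ultimately show "A \<le> T" by (rule order_trans[rotated])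
    qed
    have "slab_nn (\<lambda>x. (pd 3 f x)\<^sup>2) \<le> A" using le_A[of 0 0] by (simp add: horizontal_indices_mi_order)
    then have base: "slab_nn (\<lambda>x. (pd h f x)\<^sup>2) \<le> T"
      unfolding T_def using K(1) by (intro order_trans[OF f(5)] mult_mono add_right_mono ennreal_leI) auto
    have "?q h \<alpha> \<beta> \<le> ennreal (240 ^ (2 * n)) * T" if "\<alpha> \<in> ?H" "\<beta> \<in> ?B" for \<alpha> \<beta>
      using that by (intro horizontal_estimate[OF f(1,2) base order_trans[OF le_A A_T(2)] _ _ kl]) auto
    then have "aniso_norm_sq k l (weak_partial h \<phi>) \<le> (\<Sum>\<alpha>\<in>?H. \<Sum>\<beta>\<in>?B. ennreal (240 ^ (2 * n)) * T)"
      unfolding an by (intro sum_mono) auto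
    also have "\<dots> = of_nat (card ?H) * (of_nat (card ?B) * (ennreal (240 ^ (2 * n)) * T))" by simp
    also have "\<dots> \<le> of_nat m * (of_nat m * (ennreal (240 ^ (2 * n)) * T))"
    proof -
      have "card ?H \<le> m" "card ?B \<le> m" unfolding m_def
        using kl finite_mi_order by (auto intro!: card_mono simp: horizontal_indices_mi_order)
      then show ?thesis by (intro mult_mono) auto
    qed
    also have "\<dots> = ennreal C * (A + ?S)"
      unfolding T_def C_def using K(1) by (simp add: ennreal_mult ennreal_of_nat_eq_real_of_nat mult.assoc)
    also have "\<dots> \<le> ennreal C * (A + ennreal \<sigma> * aniso_norm_sq 0 (k + l) W + ?S)"
      by (intro mult_left_mono add_mono) auto
    finally show ?thesis unfolding A_def .
  qed
  show ?thesis
  proof (intro exI[of _ C] conjI Cpos allI impI)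
    fix w W PW :: "real^3 \<Rightarrow> real^3" and \<phi> :: "real^3 \<Rightarrow> real" and h :: 3 and \<sigma> :: real
    assume a: "w \<in> Sobolev_space (2 * n)" "W = weak_curl w" "Helmholtz_decomposition W PW \<phi>" "h \<in> {1, 2}"
    show "aniso_norm_sq 0 (2 * n - 1) (weak_partial h \<phi>)
          \<le> ennreal C * (aniso_norm_sq 0 (2 * n - 1) (weak_partial 3 \<phi>)
                + ennreal \<sigma> * aniso_norm_sq 0 (2 * n - 1) W + Sobolev_norm 0 w * Sobolev_norm 1 w)"
      using main[OF a, of 0 "2 * n - 1" \<sigma>] by simp
    fix k l assume "k \<le> 2 * n - 1" "l \<le> 2 * n - k - 1"
    then show "aniso_norm_sq k l (weak_partial h \<phi>) \<le> ennreal C * (aniso_norm_sq k l (weak_partial 3 \<phi>)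
        + ennreal \<sigma> * aniso_norm_sq 0 (k + l) W + Sobolev_norm 0 w * Sobolev_norm 1 w)"
      using assms by (intro main[OF a]) linarith
  qed
qed

end
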